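(* Let $\Omega=\mathbb{R}^3\setminus\overline{B(0,1)}$. The problem $$\begin{cases}\partial_t^2u-\Delta u+u^3=0,& (t,x)\in I\times\Omega,\\ u(0,x)=u_0(x),\ \ \partial_tu(0,x)=u_1(x),& x\in\Omega,\\ u(t,x)=0,& x\in\partial\Omega,\end{cases}$$ with radial (real-valued) data $(u_0,u_1)$ is locally well-posed in $\dot H^{1/2}_D(\Omega)\times\dot H^{-1/2}_D(\Omega)$ on some interval $I=(-T,T)$. Moreover, the regularity of the initial data is enough to give a lower bound on the time of well-posedness: for any $\frac12<s<\frac32$, if the data also belong to $\dot H^s_D(\Omega)\times\dot H^{s-1}_D(\Omega)$, one can take a positive lifespan $T=T\big(\|(u_0,u_1)\|_{\dot H^s_D(\Omega)\times\dot H^{s-1}_D(\Omega)}\big)>0$ depending only on (s and) this norm.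
   Context: $-\Delta_\Omega$ denotes the Dirichlet Laplacian on $\Omega$ with domain $H^2(\Omega)\cap H^1_0(\Omega)$, a positive self-adjoint operator on $L^2(\Omega)$; functions of $\sqrt{-\Delta_\Omega}$ are defined by the spectral functional calculus. For radial $f$ it is given by $m(\sqrt{-\Delta_\Omega})f=\mathcal{F}_D^{-1}(m\,\mathcal{F}_Df)$, where $\mathcal{F}_Df(\lambda)=\sqrt{2/\pi}\int_1^\infty\frac{\sin\lambda(r-1)}{r}f(r)\,r^2\,dr$ for $\lambda>0$ is the distorted Fourier transform, an isometry from $L^2([1,\infty),r^2dr)$ onto $L^2([0,\infty),d\lambda)$. For $\sigma\in\mathbb{R}$, $\dot H^\sigma_D(\Omega)$ is the completion of (the functions of finite norm in) $C_c^\infty(\Omega)$ under the norm $\|f\|_{\dot H^\sigma_D}=\|(-\Delta_\Omega)^{\sigma/2}f\|_{L^2(\Omega)}$. Solutions are understood in the sense of Duhamel's formula $$u(t)=\cos(t\sqrt{-\Delta_\Omega})u_0+\tfrac{\sin(t\sqrt{-\Delta_\Omega})}{\sqrt{-\Delta_\Omega}}u_1-\int_0^t\tfrac{\sin((t-\tau)\sqrt{-\Delta_\Omega})}{\sqrt{-\Delta_\Omega}}u^3(\tau)\,d\tau.$$ The equation is said to be locally well-posed in $\dot H^\sigma_D(\Omega)\times\dot H^{\sigma-1}_D(\Omega)$ if there is an open interval $I\subset\mathbb{R}$ containing $0$ such that (1) there is a unique solution in $\dot H^\sigma_D(\Omega)\times\dot H^{\sigma-1}_D(\Omega)$; (2)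 the solution is continuous in time, i.e. $(u,\partial_tu)\in C(I;\dot H^\sigma_D(\Omega)\times\dot H^{\sigma-1}_D(\Omega))$; (3) the solution depends continuously on the initial data. *)

theory Defs
  imports "HOL-Analysis.Analysis"
begin

definition Omega :: "(real ^ 3) set" where
  "Omega = - cball 0 1"

fun iterated_dderiv :: "'a::euclidean_space list \<Rightarrow> ('a \<Rightarrow> real) \<Rightarrow> 'a \<Rightarrow> real" where
  "iterated_dderiv [] f = f"
| "iterated_dderiv (v # vs) f = (\<lambda>x. frechet_derivative (iterated_dderiv vs f) (at x) v)"

definition Cc_infinity :: "'a::euclidean_space set \<Rightarrow> ('a \<Rightarrow> real) set" where
  "Cc_infinity S = {f. (\<forall>vs x. iterated_dderiv vs f differentiable (at x)) \<and>
                       (\<exists>K. compact K \<and> K \<subseteq> S \<and> (\<forall>x. x \<notin> K \<longrightarrow> f x = 0))}"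

text \<open>A radial function on the exterior domain is given by its profile
  \<open>f\<close>, i.e. it is \<open>x \<mapsto> f (norm x)\<close> for \<open>norm x > 1\<close>.\<close>

definition radial_test :: "(real \<Rightarrow> real) set" where
  "radial_test = {\<phi>. (\<lambda>x :: real ^ 3. \<phi> (norm x)) \<in> Cc_infinity Omega}"

definition FD :: "(real \<Rightarrow> real) \<Rightarrow> real \<Rightarrow> real" where
  "FD f l = sqrt (2 / pi) *
     (LINT r:{1..}|lborel. sin (l * (r - 1)) / r * f r * r\<^sup>2)"

text \<open>From here on a radial element of a homogeneous Dirichlet Sobolev space is represented by its
  distorted Fourier transform \<open>g\<close>, a function on \<open>(0, \<infinity>)\<close> modulo null sets; the operator
  \<open>m(sqrt(-Delta))\<close> is then multiplication of \<open>g\<close> by \<open>m\<close>.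

  \<open>Hdot_sq \<sigma> g\<close> is the square of the norm of \<open>(-Delta)^(\<sigma>/2) f\<close> in \<open>L^2(Omega)\<close>, where
  \<open>g = FD f\<close>: \<open>FD\<close> is an isometry from \<open>L^2([1,\<infinity>), r^2 dr)\<close> onto \<open>L^2([0,\<infinity>), dl)\<close>, and the
  factor \<open>4 pi\<close> (the area of the unit sphere) turns \<open>r^2 dr\<close> into Lebesgue measure on \<open>Omega\<close>.
  It is extended-valued so that infinite norms are not confused with zero.\<close>

definition Hdot_sq :: "real \<Rightarrow> (real \<Rightarrow> real) \<Rightarrow> ennreal" where
  "Hdot_sq \<sigma> g = ennreal (4 * pi) *
     (\<integral>\<^sup>+ l\<in>{0<..}. ennreal ((l powr \<sigma> * g l)\<^sup>2) \<partial>lborel)"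

definition Hdot_norm :: "real \<Rightarrow> (real \<Rightarrow> real) \<Rightarrow> real" where
  "Hdot_norm \<sigma> g = sqrt (enn2real (Hdot_sq \<sigma> g))"

text \<open>The map \<open>FD\<close> embeds the radial test functions of finite norm isometrically into the complete
  space \<open>L^2((0,\<infinity>), 4 pi l^(2 \<sigma>) dl)\<close>. Their completion is realised as the closure of the image.\<close>

definition Hdot_D :: "real \<Rightarrow> (real \<Rightarrow> real) set" where
  "Hdot_D \<sigma> = {g. set_borel_measurable lborel {0<..} g \<and> Hdot_sq \<sigma> g < \<infinity> \<and>
     (\<exists>\<phi> :: nat \<Rightarrow> real \<Rightarrow> real.
        (\<forall>n. \<phi> n \<in> radial_test \<and> Hdot_sq \<sigma> (FD (\<phi> n)) < \<infinity>) \<and>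
        (\<lambda>n. Hdot_sq \<sigma> (\<lambda>l. FD (\<phi> n) l - g l)) \<longlonglongrightarrow> 0)}"

definition Hdot_pair_norm :: "real \<Rightarrow> (real \<Rightarrow> real) \<Rightarrow> (real \<Rightarrow> real) \<Rightarrow> real" where
  "Hdot_pair_norm \<sigma> g h = Hdot_norm \<sigma> g + Hdot_norm (\<sigma> - 1) h"

text \<open>The profile \<open>f\<close> is the function on \<open>Omega\<close> that the element \<open>g\<close> of the completion stands for:
  test functions converging to \<open>g\<close> in the completion converge to \<open>f\<close> in \<open>L^1\<close> on bounded sets.
  This is what gives a meaning to the pointwise cube of an element of the completion.\<close>

definition represents_function :: "real \<Rightarrow> (real \<Rightarrow> real) \<Rightarrow> (real \<Rightarrow> real) \<Rightarrow> bool" where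
  "represents_function \<sigma> g f \<longleftrightarrow> set_borel_measurable lborel {1..} f \<and>
     (\<exists>\<phi> :: nat \<Rightarrow> real \<Rightarrow> real.
        (\<forall>n. \<phi> n \<in> radial_test \<and> Hdot_sq \<sigma> (FD (\<phi> n)) < \<infinity>) \<and>
        (\<lambda>n. Hdot_sq \<sigma> (\<lambda>l. FD (\<phi> n) l - g l)) \<longlonglongrightarrow> 0 \<and>
        (\<forall>R. (\<lambda>n. \<integral>\<^sup>+ r\<in>{1..R}. ennreal (\<bar>\<phi> n r - f r\<bar> * r\<^sup>2) \<partial>lborel) \<longlonglongrightarrow> 0))"

text \<open>\<open>u t\<close> and \<open>ut t\<close> are the distorted Fourier transforms of the solution and of its time derivative
  at time \<open>t\<close>, and \<open>U t\<close> is the profile of the solution in physical space. The last clause is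
  Duhamel's formula after applying \<open>FD\<close>. The two integrability clauses only say that its integrals
  converge, which the Lebesgue integral of the library, being total, would not enforce.\<close>

definition nlw_solution ::
  "real \<Rightarrow> real set \<Rightarrow> (real \<Rightarrow> real) \<Rightarrow> (real \<Rightarrow> real) \<Rightarrow>
   (real \<Rightarrow> real \<Rightarrow> real) \<Rightarrow> (real \<Rightarrow> real \<Rightarrow> real) \<Rightarrow> bool" where
  "nlw_solution \<sigma> I u0 u1 u ut \<longleftrightarrow>
     (\<forall>t\<in>I. u t \<in> Hdot_D \<sigma> \<and> ut t \<in> Hdot_D (\<sigma> - 1)) \<and>
     (\<forall>t\<in>I. ((\<lambda>\<tau>. Hdot_sq \<sigma> (\<lambda>l. u \<tau> l - u t l)) \<longlongrightarrow> 0) (at t within I)) \<and>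
     (\<forall>t\<in>I. ((\<lambda>\<tau>. Hdot_sq (\<sigma> - 1) (\<lambda>l. ut \<tau> l - ut t l)) \<longlongrightarrow> 0) (at t within I)) \<and>
     (\<forall>t\<in>I. ((\<lambda>\<tau>. Hdot_sq (\<sigma> - 1) (\<lambda>l. (u \<tau> l - u t l) / (\<tau> - t) - ut t l)) \<longlongrightarrow> 0)
               (at t within I)) \<and>
     (\<exists>U :: real \<Rightarrow> real \<Rightarrow> real.
        (\<forall>t\<in>I. represents_function \<sigma> (u t) (U t) \<and>
                set_integrable lborel {1..} (\<lambda>r. U t r ^ 3 * r)) \<and>
        (\<forall>t\<in>I. AE l in lborel. l > 0 \<longrightarrow>
           interval_lebesgue_integrable lborel (ereal 0) (ereal t)
             (\<lambda>\<tau>. sin ((t - \<tau>) * l) / l * FD (\<lambda>r. U \<tau> r ^ 3) l) \<and>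
           u t l = cos (t * l) * u0 l + sin (t * l) / l * u1 l
             - (LBINT \<tau>=ereal 0..ereal t. sin ((t - \<tau>) * l) / l * FD (\<lambda>r. U \<tau> r ^ 3) l)))"

text \<open>The lifespan depends on the data, so well-posedness on \<open>I\<close> is a property of the data
  \<open>(u0, u1)\<close>. Continuous dependence: on any interval compactly contained in \<open>I\<close>, solutions exist for
  all data close to \<open>(u0, u1)\<close> and are uniformly close to the given one.\<close>

definition well_posed_at ::
  "real \<Rightarrow> real set \<Rightarrow> (real \<Rightarrow> real) \<Rightarrow> (real \<Rightarrow> real) \<Rightarrow> bool" where
  "well_posed_at \<sigma> I u0 u1 \<longleftrightarrow>
     (\<exists>u ut. nlw_solution \<sigma> I u0 u1 u ut \<and>
        (\<forall>w wt. nlw_solution \<sigma> I u0 u1 w wt \<longrightarrow>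
           (\<forall>t\<in>I. AE l in lborel. l > 0 \<longrightarrow> w t l = u t l \<and> wt t l = ut t l)) \<and>
        (\<forall>a b. a < 0 \<and> 0 < b \<and> {a..b} \<subseteq> I \<longrightarrow>
           (\<forall>\<epsilon>>0. \<exists>\<delta>>0. \<forall>w0 \<in> Hdot_D \<sigma>. \<forall>w1 \<in> Hdot_D (\<sigma> - 1).
              Hdot_pair_norm \<sigma> (\<lambda>l. w0 l - u0 l) (\<lambda>l. w1 l - u1 l) < \<delta> \<longrightarrow>
                (\<exists>w wt. nlw_solution \<sigma> {a<..<b} w0 w1 w wt) \<and>
                (\<forall>w wt. nlw_solution \<sigma> {a<..<b} w0 w1 w wt \<longrightarrow>
                   (\<forall>t\<in>{a<..<b}.
                      Hdot_pair_norm \<sigma> (\<lambda>l. w t l - u t l) (\<lambda>l. wt t l - ut t l) < \<epsilon>)))))"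

end

theory Submission
  imports Defs "HOL-Probability.Probability" "HOL-Real_Asymp.Real_Asymp"
begin

text \<open>A radial profile \<open>f\<close> on the exterior domain becomes \<open>v x = (1 + x) * f (1 + x)\<close> on the half line, where the distorted
  Fourier transform is the sine transform and the equation reads \<open>v_tt - v_xx + v^3 / (1 + x)^2 = 0\<close> with \<open>v 0 = 0\<close>.
  The embedding of the critical space into \<open>L^4(dx / x)\<close> is a radial Hardy--Littlewood inequality, and by duality the cubic
  term is locally Lipschitz from that space, without any Strichartz estimate, into the dual space, so that Picard iteration
  solves the equation after a Lipschitz truncation of the nonlinearity. In the subcritical case the data give the bound
  \<open>|v x| <= M * x powr (s - 1/2)\<close> for the linear evolution; the truncation is placed at twice this bound, and d'Alembert's
  formula on the half line shows that it stays inactive for a time that depends only on \<open>M\<close>.\<close>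

text \<open>The lifespan in the second claim may depend on the higher norm only, and that norm does
  not control the critical one: a homogeneous norm of larger order says little about low
  frequencies. A Lipschitz constant on the critical space therefore cannot set the time, and a bound
  on the profile that is pointwise in \<open>x\<close> takes its place. Existence, uniqueness and
  dependence are nevertheless proved in the critical space, so each truncation has to be globally
  Lipschitz there and be seen to be inactive afterwards: a radial cut in the norm for the local
  theory, a clamp of the values for the lifespan.

  A second obstacle is that a profile exists only as an almost everywhere class for each single
  time. The evolution is therefore carried out on the Fourier side, where at a fixed frequency the
  forcing is continuous in time; profiles enter where the nonlinearity is evaluated and where
  pointwise bounds are proved.

  Finally, the spaces of the statement are closures of test functions. They coincide with the full
  weighted \<open>L^2\<close> spaces, because the transforms of truncated Gaussian sums are dense
  for both weights.\<close>

abbreviation lims :: "(nat => 'a::topological_space) => 'a => bool" ("((_)/ ----> (_))" [60, 60] 60) where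
 "X ----> L == X \<longlonglongrightarrow> L"

abbreviation BM :: "('a::topological_space => 'b::topological_space) set" where "BM == borel_measurable borel"

section \<open>The half line and Bessel's inequality\<close>

text \<open>The half line is a density on the whole line instead of a restricted space, so functions
  stay total Borel functions on \<open>UNIV\<close> and product measures need no set restrictions.
  Values at arguments <= 0 carry no mass.\<close>

definition hl :: "real measure" where "hl = density lborel (%x. ennreal (indicator {0<..} x))"

lemma sets_hl[measurable_cong]: "sets hl = sets borel" and space_hl[simp]: "space hl = UNIV"
 by (simp_all add: hl_def)

lemma sigma_finite_hl: "sigma_finite_measure hl"
 unfolding hl_def by (subst sigma_finite_measure.sigma_finite_iff_density_finite[OF sigma_finite_lborel]) auto

interpretation hl: sigma_finite_measure hl by (rule sigma_finite_hl)
interpretation hl2: pair_sigma_finite hl hl by unfold_locales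

abbreviation nnI :: "(real => ennreal) => ennreal" (binder "NN " 10) where "nnI == nn_integral hl"

abbreviation lebI :: "(real => real) => real" (binder "LI " 10) where "lebI == integral\<^sup>L hl"

lemma AE_hl: "(AE x in hl. P x) \<longleftrightarrow> (AE x in lborel. 0 < x --> P x)"
 unfolding hl_def by (subst AE_density) (auto simp: indicator_def)

lemma AE_hlI: "(!!x. 0 < x ==> P x) ==> AE x in hl. P x"
 by (simp add: AE_hl)

lemma nn_integral_hl: "f \<in> BM ==> (NN x. f x) = (\<integral>\<^sup>+x\<in>{0<..}. f x \<partial>lborel)"
 unfolding hl_def by (subst nn_integral_density) (auto simp: ac_simps ennreal_indicator)

lemma integral_hl: "f \<in> BM ==> (LI x. f x) = (LINT x:{0<..}|lborel. f x)" for f :: "real => real"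
 unfolding hl_def set_lebesgue_integral_def by (rule integral_density) auto

lemma integrable_hl: "f \<in> BM ==> integrable hl f \<longleftrightarrow> set_integrable lborel {0<..} f" for f :: "real => real"
 unfolding hl_def set_integrable_def by (rule integrable_density) auto

lemma integrable_hl_einterval: "f \<in> BM ==> integrable hl f \<longleftrightarrow> set_integrable lborel (einterval 0 \<infinity>) f" for f :: "real => real"
 by (simp add: integrable_hl zero_ereal_def greaterThan_def einterval_def)

lemma integral_hl_einterval: "f \<in> BM ==> (LI x. f x) = (LBINT x=0..\<infinity>. f x)" for f :: "real => real"
 by (simp add: integral_hl interval_lebesgue_integral_def einterval_def zero_ereal_def greaterThan_def)

lemma nn_integral_hl_mono: "(!!x. 0 < x ==> f x <= g x) ==> (NN x. f x) <= (NN x. g x)"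
 by (rule nn_integral_mono_AE) (simp add: AE_hlI)

lemma nn_integral_hl_cong: "(!!x. 0 < x ==> f x = g x) ==> (NN x. f x) = (NN x. g x)"
 by (rule nn_integral_cong_AE) (simp add: AE_hlI)

lemma integral_hl_cong:
 fixes f :: "real => real"
 assumes "!!x. 0 < x ==> f x = g x" "f \<in> BM" "g \<in> BM"
 shows "(LI x. f x) = (LI x. g x)"
 using assms by (intro integral_cong_AE AE_hlI) auto

lemma integrable_hl_bound:
 fixes f g :: "real => real"
 assumes "integrable hl g" "f \<in> BM" "!!x. 0 < x ==> \<bar>f x\<bar> <= \<bar>g x\<bar>"
 shows "integrable hl f"
 by (rule Bochner_Integration.integrable_bound[OF assms(1)]) (use assms in "auto intro!: AE_hlI")

lemma integral_hl_mono:
 fixes f g :: "real => real"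
 shows "integrable hl f ==> integrable hl g ==> (!!x. 0 < x ==> f x <= g x) ==> (LI x. f x) <= (LI x. g x)"
 by (rule integral_mono_AE) (simp_all add: AE_hlI)

text \<open>Since \<open>K\<close> is bounded, the double integrand is dominated by
  \<open>C * \<bar>f x\<bar> * \<bar>g y\<bar>\<close>, which is integrable on the product.
  Oscillating kernels such as \<open>sin (x * y)\<close>, without decay of their own, are swapped in
  this way.\<close>

lemma (in pair_sigma_finite) bounded_kernel_Fubini:
 fixes f :: "'a => real" and g :: "'b => real" and K :: "'a \<times> 'b => real"
 assumes f: "integrable M1 f" and g: "integrable M2 g" and K[measurable]: "K \<in> borel_measurable (M1 \<Otimes>\<^sub>M M2)"
  and bd: "!!x y. x \<in> space M1 ==> y \<in> space M2 ==> \<bar>K (x, y)\<bar> <= C"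
 shows "(\<integral>x. f x * (\<integral>y. K (x, y) * g y \<partial>M2) \<partial>M1) = (\<integral>y. g y * (\<integral>x. K (x, y) * f x \<partial>M1) \<partial>M2)"
proof -
 have fm[measurable]: "f \<in> borel_measurable M1" and gm[measurable]: "g \<in> borel_measurable M2" using f g by auto
 have ig: "integrable M2 (%y. f x * (K (x, y) * g y))" if "x \<in> space M1" for x
 proof (rule Bochner_Integration.integrable_bound)
  show "integrable M2 (%y. \<bar>f x\<bar> * (\<bar>C\<bar> * \<bar>g y\<bar>))" using g by auto
  show "(%y. f x * (K (x, y) * g y)) \<in> borel_measurable M2" using that by measurable
  show "AE y in M2. norm (f x * (K (x, y) * g y)) <= norm (\<bar>f x\<bar> * (\<bar>C\<bar> * \<bar>g y\<bar>))"
   using order_trans[OF bd[OF that] abs_ge_self] by (intro AE_I2) (auto simp: abs_mult intro!: mult_left_mono mult_right_mono)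
 qed
 have I: "integrable (M1 \<Otimes>\<^sub>M M2) (%(x, y). f x * (K (x, y) * g y))"
 proof (rule Fubini_integrable)
  show "(%(x, y). f x * (K (x, y) * g y)) \<in> borel_measurable (M1 \<Otimes>\<^sub>M M2)" by measurable
  show "AE x in M1. integrable M2 (%y. case (x, y) of (x, y) => f x * (K (x, y) * g y))"
   using ig by (intro AE_I2) simp
  show "integrable M1 (%x. \<integral>y. norm (case (x, y) of (x, y) => f x * (K (x, y) * g y)) \<partial>M2)"
  proof (rule Bochner_Integration.integrable_bound)
   show "integrable M1 (%x. \<bar>f x\<bar> * (\<integral>y. \<bar>C\<bar> * \<bar>g y\<bar> \<partial>M2))" using f by auto
   show "(%x. \<integral>y. norm (case (x, y) of (x, y) => f x * (K (x, y) * g y)) \<partial>M2) \<in> borel_measurable M1" by measurable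
   show "AE x in M1. norm (\<integral>y. norm (case (x, y) of (x, y) => f x * (K (x, y) * g y)) \<partial>M2)
     \<le> norm (\<bar>f x\<bar> * (\<integral>y. \<bar>C\<bar> * \<bar>g y\<bar> \<partial>M2))"
   proof (rule AE_I2)
    fix x assume x: "x \<in> space M1"
    have "(\<integral>y. norm (f x * (K (x, y) * g y)) \<partial>M2) <= (\<integral>y. \<bar>f x\<bar> * (\<bar>C\<bar> * \<bar>g y\<bar>) \<partial>M2)"
    proof (rule integral_mono)
     show "integrable M2 (%y. norm (f x * (K (x, y) * g y)))" using ig[OF x] by (rule integrable_norm)
     show "integrable M2 (%y. \<bar>f x\<bar> * (\<bar>C\<bar> * \<bar>g y\<bar>))" using g by auto
    qed (use order_trans[OF bd[OF x] abs_ge_self] in "auto simp: abs_mult intro!: mult_left_mono mult_right_mono")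
    then show "norm (\<integral>y. norm (case (x, y) of (x, y) => f x * (K (x, y) * g y)) \<partial>M2)
     \<le> norm (\<bar>f x\<bar> * (\<integral>y. \<bar>C\<bar> * \<bar>g y\<bar> \<partial>M2))"
     by (simp add: abs_mult)
   qed
  qed
 qed
 have "(\<integral>x. f x * (\<integral>y. K (x, y) * g y \<partial>M2) \<partial>M1) = (\<integral>x. (\<integral>y. f x * (K (x, y) * g y) \<partial>M2) \<partial>M1)" by simp
 also have "... = (\<integral>y. (\<integral>x. f x * (K (x, y) * g y) \<partial>M1) \<partial>M2)"
  using Fubini_integral[of "%x y. f x * (K (x, y) * g y)"] I by simp
 also have "... = (\<integral>y. g y * (\<integral>x. K (x, y) * f x \<partial>M1) \<partial>M2)"
  by (simp add: ac_simps flip: integral_mult_right_zero)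
 finally show ?thesis .
qed

text \<open>Fatou's lemma in the form in which it recurs: a uniform bound on integrals survives an
  almost everywhere limit.\<close>

lemma nn_integral_le_of_tendsto:
 fixes f :: "nat => 'a => real" and g :: "'a => real"
 assumes m: "!!n. f n \<in> borel_measurable M" and lim: "AE x in M. (%n. f n x) ----> g x"
  and le: "!!n. (\<integral>\<^sup>+x. ennreal (f n x) \<partial>M) <= C"
 shows "(\<integral>\<^sup>+x. ennreal (g x) \<partial>M) <= C"
proof -
 have "(\<integral>\<^sup>+x. ennreal (g x) \<partial>M) = (\<integral>\<^sup>+x. liminf (%n. ennreal (f n x)) \<partial>M)"
 proof (rule nn_integral_cong_AE)
  show "AE x in M. ennreal (g x) = liminf (%n. ennreal (f n x))"
   using lim by eventually_elim (metis lim_imp_Liminf tendsto_ennrealI trivial_limit_sequentially)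
 qed
 also have "... <= liminf (%n. \<integral>\<^sup>+x. ennreal (f n x) \<partial>M)"
  using m by (intro nn_integral_liminf) auto
 also have "... <= C" by (rule Liminf_le) (use le in auto)
 finally show ?thesis .
qed

section \<open>Damped trigonometric integrals and Bessel's inequality\<close>

definition abelP :: "real => real => real" where "abelP e z = e / (e^2 + z^2)"

lemma abelP_measurable[measurable]: "abelP e \<in> BM"
 unfolding abelP_def by measurable

lemma abelP_nonneg: "0 <= e ==> 0 <= abelP e z" by (simp add: abelP_def)

lemma integrable_exp_hl:
 assumes "0 < e" shows "integrable hl (%x. exp (- (e * x)))"
proof (subst integrable_hl_einterval, measurable, rule interval_integral_FTC_nonneg(1))
 show "!!x. DERIV (%x. - exp (- (e * x)) / e) x :> exp (- (e * x))"
  using assms by (auto intro!: derivative_eq_intros)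
 show "(((%x. - exp (- (e * x)) / e) \<circ> real_of_ereal) \<longlongrightarrow> - 1 / e) (at_right 0)"
  unfolding zero_ereal_def ereal_tendsto_simps by (intro tendsto_eq_intros | simp | use assms in force)+
 show "(((%x. - exp (- (e * x)) / e) \<circ> real_of_ereal) \<longlongrightarrow> 0) (at_left \<infinity>)"
  unfolding ereal_tendsto_simps using assms by real_asymp
qed auto

lemma integrable_exp_bounded:
 fixes k :: "real => real"
 assumes "0 < e" and [measurable]: "k \<in> borel_measurable hl" and "!!x. 0 < x ==> \<bar>k x\<bar> <= C"
 shows "integrable hl (%x. exp (- (e * x)) * k x)"
proof (rule integrable_hl_bound)
 show "integrable hl (%x. C * exp (- (e * x)))" using integrable_exp_hl[OF assms(1)] by auto
 show "\<bar>exp (- (e * x)) * k x\<bar> <= \<bar>C * exp (- (e * x))\<bar>" if "0 < x" for x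
  using order_trans[OF assms(3)[OF that] abs_ge_self] by (auto simp: abs_mult mult.commute intro!: mult_right_mono)
qed measurable

text \<open>The damped cosine integral is the Poisson kernel up to the factor \<open>1 / pi\<close>.
  \<open>F\<close> is the elementary antiderivative, and its value at 0 is the only boundary
  contribution.\<close>

lemma integral_exp_cos:
 assumes e: "0 < e" shows "(LI x. exp (- (e * x)) * cos (b * x)) = abelP e b"
proof -
 define F where "F x = exp (- (e * x)) * (b * sin (b * x) - e * cos (b * x)) / (e^2 + b^2)" for x
 have nz: "e^2 + b^2 > 0" using e by (simp add: add_pos_nonneg)
 have "(LBINT x=0..\<infinity>. exp (- (e * x)) * cos (b * x)) = 0 - (- e / (e^2 + b^2))"
 proof (rule interval_integral_FTC_integrable)
  fix x :: real
  have "DERIV F x :> (exp (- (e * x)) * (- e) * (b * sin (b * x) - e * cos (b * x))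
    + exp (- (e * x)) * (b * (b * cos (b * x)) + e * (b * sin (b * x)))) / (e^2 + b^2)"
   unfolding F_def by (rule DERIV_cdivide) (auto intro!: derivative_eq_intros simp: algebra_simps)
  also have "(exp (- (e * x)) * (- e) * (b * sin (b * x) - e * cos (b * x))
    + exp (- (e * x)) * (b * (b * cos (b * x)) + e * (b * sin (b * x)))) / (e^2 + b^2)
    = exp (- (e * x)) * cos (b * x)"
   by (rule nonzero_divide_eq_eq[THEN iffD2]) (use nz in "auto simp: algebra_simps power2_eq_square")
  finally show "(F has_vector_derivative exp (- (e * x)) * cos (b * x)) (at x)"
   by (simp add: has_real_derivative_iff_has_vector_derivative)
 next
  show "set_integrable lborel (einterval 0 \<infinity>) (%x. exp (- (e * x)) * cos (b * x))"
   by (subst integrable_hl_einterval[symmetric]) (auto intro!: integrable_exp_bounded[OF e, where C=1])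
  have "isCont F 0" unfolding F_def using nz by (intro continuous_intros) auto
  then have "(F \<longlongrightarrow> F 0) (at_right 0)" by (simp add: isCont_def filterlim_at_split)
  then show "((F \<circ> real_of_ereal) \<longlongrightarrow> - e / (e^2 + b^2)) (at_right 0)"
   unfolding zero_ereal_def ereal_tendsto_simps by (simp add: F_def)
  have "(F \<longlongrightarrow> 0) at_top"
  proof (rule Lim_null_comparison)
   show "((%x. exp (- (e * x)) * ((\<bar>b\<bar> + e) / (e^2 + b^2))) \<longlongrightarrow> 0) at_top" using e by real_asymp
   show "\<forall>\<^sub>F x in at_top. norm (F x) <= exp (- (e * x)) * ((\<bar>b\<bar> + e) / (e^2 + b^2))"
   proof (rule always_eventually, rule allI)
    fix x
    have "\<bar>b * sin (b * x) - e * cos (b * x)\<bar> <= \<bar>b * sin (b * x)\<bar> + \<bar>e * cos (b * x)\<bar>" by linarith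
    also have "... <= \<bar>b\<bar> * 1 + e * 1"
     unfolding abs_mult using e by (intro add_mono mult_mono) auto
    finally show "norm (F x) <= exp (- (e * x)) * ((\<bar>b\<bar> + e) / (e^2 + b^2))"
     using nz by (simp add: F_def abs_mult divide_right_mono)
   qed
  qed
  then show "((F \<circ> real_of_ereal) \<longlongrightarrow> 0) (at_left \<infinity>)" unfolding ereal_tendsto_simps .
 qed (auto intro!: continuous_intros)
 then show ?thesis by (simp add: integral_hl_einterval abelP_def)
qed

lemma integral_exp_sin_sin:
 assumes e: "0 < e"
 shows "(LI x. exp (- (e * x)) * (sin (a * x) * sin (b * x))) = (abelP e (a - b) - abelP e (a + b)) / 2"
proof -
 have I: "integrable hl (%x. exp (- (e * x)) * cos (c * x))" for c
  by (rule integrable_exp_bounded[OF e, where C=1]) auto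
 have "(LI x. exp (- (e * x)) * (sin (a * x) * sin (b * x)))
   = (LI x. (exp (- (e * x)) * cos ((a - b) * x) - exp (- (e * x)) * cos ((a + b) * x)) / 2)"
  by (rule Bochner_Integration.integral_cong) (auto simp: cos_add cos_diff algebra_simps)
 also have "... = (abelP e (a - b) - abelP e (a + b)) / 2"
  using I[of "a-b"] I[of "a+b"] integral_exp_cos[OF e, of "a-b"] integral_exp_cos[OF e, of "a+b"]
  by (simp add: Bochner_Integration.integral_diff)
 finally show ?thesis .
qed

lemma integral_exp_cos_cos:
 assumes e: "0 < e"
 shows "(LI x. exp (- (e * x)) * (cos (a * x) * cos (b * x))) = (abelP e (a - b) + abelP e (a + b)) / 2"
proof -
 have I: "integrable hl (%x. exp (- (e * x)) * cos (c * x))" for c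
  by (rule integrable_exp_bounded[OF e, where C=1]) auto
 have "(LI x. exp (- (e * x)) * (cos (a * x) * cos (b * x)))
   = (LI x. (exp (- (e * x)) * cos ((a - b) * x) + exp (- (e * x)) * cos ((a + b) * x)) / 2)"
  by (rule Bochner_Integration.integral_cong) (auto simp: cos_add cos_diff algebra_simps)
 also have "... = (abelP e (a - b) + abelP e (a + b)) / 2"
  using I[of "a-b"] I[of "a+b"] integral_exp_cos[OF e, of "a-b"] integral_exp_cos[OF e, of "a+b"]
  by (simp add: Bochner_Integration.integral_add)
 finally show ?thesis .
qed

text \<open>The two kernels, at \<open>a - y\<close> and \<open>a + y\<close>, are the Poisson
  kernel of the whole line folded onto the half line. The antiderivative is a sum of two arctangents
  that cancels at 0 and tends to \<open>pi\<close> at infinity.\<close>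

lemma integral_abelP:
 assumes e: "0 < e"
 shows "integrable hl (%y. abelP e (a - y) + abelP e (a + y))"
  and "(LI y. abelP e (a - y) + abelP e (a + y)) = pi"
proof -
 define F where "F y = arctan ((y - a) / e) + arctan ((y + a) / e)" for y
 have nz: "e^2 + z^2 > 0" for z using e by (simp add: add_pos_nonneg)
 have a: "DERIV (%y. arctan ((y + c) / e)) x :> abelP e (x + c)" for c x
  using e nz[of "x+c"] by (auto intro!: derivative_eq_intros simp: abelP_def field_simps power2_eq_square)
 have D: "DERIV F x :> abelP e (a - x) + abelP e (a + x)" for x
  unfolding F_def using DERIV_add[OF a[of "-a" x] a[of a x]] by (simp add: abelP_def power2_commute add.commute)
 have C: "isCont (%x. abelP e (a - x) + abelP e (a + x)) x" for x
  unfolding abelP_def using nz[of "a-x"] nz[of "a+x"] by (intro continuous_intros) auto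
 have "isCont F 0" unfolding F_def using e by (intro continuous_intros) auto
 then have "(F \<longlongrightarrow> F 0) (at_right 0)" by (simp add: isCont_def filterlim_at_split)
 then have L: "((F \<circ> real_of_ereal) \<longlongrightarrow> 0) (at_right 0)"
  unfolding zero_ereal_def ereal_tendsto_simps by (simp add: F_def arctan_minus)
 have "(F \<longlongrightarrow> pi / 2 + pi / 2) at_top" unfolding F_def
  using e by (intro tendsto_add filterlim_compose[OF tendsto_arctan_at_top]) real_asymp+
 then have R: "((F \<circ> real_of_ereal) \<longlongrightarrow> pi) (at_left \<infinity>)" unfolding ereal_tendsto_simps by simp
 have "set_integrable lborel (einterval 0 \<infinity>) (%y. abelP e (a - y) + abelP e (a + y))"
  "(LBINT y=0..\<infinity>. abelP e (a - y) + abelP e (a + y)) = pi - 0"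
  using interval_integral_FTC_nonneg[where F=F and f="%y. abelP e (a - y) + abelP e (a + y)" and a=0 and b=\<infinity>, OF _ D C _ L R]
   abelP_nonneg[of e] e by auto
 then show "integrable hl (%y. abelP e (a - y) + abelP e (a + y))"
  "(LI y. abelP e (a - y) + abelP e (a + y)) = pi"
  by (subst integral_hl_einterval integrable_hl_einterval; simp)+
qed

lemma abelP_bounded: assumes "0 < e" shows "\<bar>abelP e z\<bar> <= 1 / e"
proof -
 have "e * e <= e^2 + z^2" by (simp add: power2_eq_square)
 moreover have "e / S <= 1 / e" if "e * e <= S" for S
  using that assms less_le_trans[OF mult_pos_pos[OF assms assms] that] by (simp add: field_simps)
 ultimately show ?thesis using assms by (simp add: abelP_def)
qed

text \<open>The damped square integral of the transform of \<open>g\<close> is a quadratic form in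
  \<open>g\<close> with kernel \<open>K l m\<close>, by two uses of Fubini. The kernel is bounded by
  \<open>Q\<close>, a symmetric combination of Poisson kernels with row integral
  \<open>pi / 2\<close>, and Schur's test turns the row integral into the constant. The damping is
  what makes \<open>K\<close> a convergent integral.\<close>

lemma Bessel_aux:
 fixes k :: "real => real"
 assumes k: "k = sin \<or> k = cos" and g: "integrable hl g" and e: "0 < e"
 shows "(NN x. ennreal (exp (- (e * x)) * (LI l. k (l * x) * g l)^2))
   \<le> ennreal (pi / 2) * (NN l. ennreal ((g l)^2))"
proof -
 have [measurable]: "g \<in> borel_measurable hl" using g by auto
 have [measurable]: "k \<in> BM" using k by auto
 have k1: "\<bar>k z\<bar> <= 1" for z using k by auto
 define y where "y x = (LI l. k (l * x) * g l)" for x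
 have ym[measurable]: "y \<in> borel_measurable hl" unfolding y_def by measurable
 have yb: "\<bar>y x\<bar> <= (LI l. \<bar>g l\<bar>)" for x
 proof -
  have I: "integrable hl (%l. k (l * x) * g l)"
   by (rule Bochner_Integration.integrable_bound[OF g]) (use k1 in "auto simp: abs_mult intro!: AE_I2 mult_left_le_one_le")
  have "\<bar>y x\<bar> <= (LI l. \<bar>k (l * x) * g l\<bar>)" unfolding y_def by (rule integral_abs_bound)
  also have "... <= (LI l. \<bar>g l\<bar>)"
   using integrable_norm[OF I] integrable_norm[OF g] k1 by (intro integral_mono) (auto simp: abs_mult intro!: mult_left_le_one_le)
  finally show ?thesis .
 qed
 have yb2: "\<bar>y x * y x\<bar> <= (LI l. \<bar>g l\<bar>)^2" for x
  using power_mono[OF yb[of x], of 2] by (simp add: power2_eq_square abs_mult)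
 define K where "K l m = (LI x. exp (- (e * x)) * (k (l * x) * k (m * x)))" for l m
 define Q where "Q l m = (abelP e (l - m) + abelP e (l + m)) / 2" for l m
 have Qn: "0 <= Q l m" for l m using e abelP_nonneg by (simp add: Q_def)
 have KQ: "\<bar>K l m\<bar> <= Q l m" for l m
  using k integral_exp_sin_sin[OF e, of l m] integral_exp_cos_cos[OF e, of l m] abelP_nonneg[of e "l-m"] abelP_nonneg[of e "l+m"] e
  by (auto simp: K_def Q_def)
 have Kb: "\<bar>K l m\<bar> <= 1 / e" for l m
  using order_trans[OF KQ] abelP_bounded[OF e, of "l-m"] abelP_bounded[OF e, of "l+m"] by (fastforce simp: Q_def)
 have [measurable]: "(%p. Q (fst p) (snd p)) \<in> borel_measurable (hl \<Otimes>\<^sub>M hl)" unfolding Q_def by measurable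
 have [measurable]: "Q l \<in> borel_measurable hl" for l unfolding Q_def by measurable
 have [measurable]: "(%p. Q (snd p) (fst p)) \<in> borel_measurable (hl \<Otimes>\<^sub>M hl)" unfolding Q_def by measurable
 have [measurable]: "(%p. K (fst p) (snd p)) \<in> borel_measurable (hl \<Otimes>\<^sub>M hl)" unfolding K_def by measurable
 define ey where "ey x = exp (- (e * x)) * y x" for x
 have ey: "integrable hl ey" unfolding ey_def by (rule integrable_exp_bounded[OF e _ yb]) auto
 have iA: "integrable hl (%x. exp (- (e * x)) * k (l * x))" for l
  by (rule integrable_exp_bounded[OF e, where C=1]) (use k1 in auto)
 have A: "(LI x. k (l * x) * ey x) = (LI m. g m * K l m)" for l
 proof -
  have "(LI x. k (l * x) * ey x) = (LI x. (exp (- (e * x)) * k (l * x)) * (LI m. (%(x, m). k (m * x)) (x, m) * g m))"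
   by (simp add: ey_def y_def ac_simps)
  also have "... = (LI m. g m * (LI x. (%(x, m). k (m * x)) (x, m) * (exp (- (e * x)) * k (l * x))))"
   by (rule hl2.bounded_kernel_Fubini[OF iA g, where C=1]) (use k1 in auto)
  finally show ?thesis by (simp add: K_def ac_simps)
 qed
 have i1: "integrable hl (%x. exp (- (e * x)) * (y x * y x))"
  by (rule integrable_exp_bounded[OF e, where C="(LI l. \<bar>g l\<bar>)^2"]) (use yb2 in auto)
 have "(LI x. exp (- (e * x)) * (y x)^2) = (LI x. ey x * (LI l. (%(x, l). k (l * x)) (x, l) * g l))"
  by (simp add: ey_def y_def power2_eq_square ac_simps)
 also have "... = (LI l. g l * (LI x. (%(x, l). k (l * x)) (x, l) * ey x))"
  by (rule hl2.bounded_kernel_Fubini[OF ey g, where C=1]) (use k1 in auto)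
 also have "... = (LI l. g l * (LI m. g m * K l m))"
  by (rule Bochner_Integration.integral_cong) (use A in auto)
 finally have eq: "(LI x. exp (- (e * x)) * (y x)^2) = (LI l. g l * (LI m. g m * K l m))" .
 have QI: "(NN m. ennreal (Q l m)) = ennreal (pi / 2)" for l
 proof -
  have "(NN m. ennreal (Q l m)) = ennreal (LI m. Q l m)"
   using integral_abelP(1)[OF e, of l] Qn by (intro nn_integral_eq_integral) (auto simp: Q_def)
  then show ?thesis using integral_abelP(2)[OF e, of l] by (simp add: Q_def)
 qed
 have Qs: "Q l m = Q m l" for l m by (simp add: Q_def abelP_def power2_commute add.commute)
 \<comment> \<open>Were the outer integrand not integrable, its integral would be 0 by convention
   and the inequality trivial.\<close>
 have "ennreal (LI l. g l * (LI m. g m * K l m)) <= (NN l. ennreal (norm (g l * (LI m. g m * K l m))))"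
 proof (cases "integrable hl (%l. g l * (LI m. g m * K l m))")
  case True
  show ?thesis
   by (rule order_trans[OF ennreal_leI integral_norm_bound_ennreal[OF True]]) simp
 qed (simp add: not_integrable_integral_eq)
 also have "... <= (NN l. NN m. ennreal (\<bar>g l\<bar> * (\<bar>g m\<bar> * Q l m)))"
 proof (rule nn_integral_mono)
  fix l :: real
  have I: "integrable hl (%m. g m * K l m)"
  proof (rule Bochner_Integration.integrable_bound)
   show "integrable hl (%m. (1 / e) * g m)" using g by auto
   show "(%m. g m * K l m) \<in> borel_measurable hl" unfolding K_def by measurable
   show "AE m in hl. norm (g m * K l m) <= norm ((1 / e) * g m)"
   proof (rule AE_I2)
    fix m show "norm (g m * K l m) <= norm ((1 / e) * g m)"
     using mult_left_mono[OF Kb[of l m], of "\<bar>g m\<bar>"] e by (simp add: abs_mult)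
   qed
  qed
  have "ennreal (norm (g l * (LI m. g m * K l m))) = ennreal \<bar>g l\<bar> * ennreal (norm (LI m. g m * K l m))"
   by (simp add: abs_mult ennreal_mult)
  also have "... <= ennreal \<bar>g l\<bar> * (NN m. ennreal (norm (g m * K l m)))"
   by (intro mult_left_mono integral_norm_bound_ennreal I) auto
  also have "... <= ennreal \<bar>g l\<bar> * (NN m. ennreal (\<bar>g m\<bar> * Q l m))"
   by (intro mult_left_mono nn_integral_mono ennreal_leI) (auto simp: abs_mult KQ intro!: mult_left_mono)
  also have "... = (NN m. ennreal (\<bar>g l\<bar> * (\<bar>g m\<bar> * Q l m)))"
   by (subst nn_integral_cmult[symmetric]) (auto simp: Qn ennreal_mult[symmetric] intro!: nn_integral_cong)
  finally show "ennreal (norm (g l * (LI m. g m * K l m))) <= (NN m. ennreal (\<bar>g l\<bar> * (\<bar>g m\<bar> * Q l m)))" .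
 qed
 \<comment> \<open>Schur's test: the product of the two values is split by the arithmetic-geometric
   mean inequality, and the symmetry of \<open>Q\<close> makes both halves equal.\<close>
 also have "... <= (NN l. NN m. ennreal ((g l)^2 / 2 * Q l m) + ennreal ((g m)^2 / 2 * Q l m))"
 proof (intro nn_integral_mono)
  fix l m :: real
  have "2 * (\<bar>g l\<bar> * \<bar>g m\<bar>) <= (g l)^2 + (g m)^2"
   using sum_squares_bound[of "\<bar>g l\<bar>" "\<bar>g m\<bar>"] by simp
  then have "\<bar>g l\<bar> * (\<bar>g m\<bar> * Q l m) <= ((g l)^2 / 2 + (g m)^2 / 2) * Q l m"
   using Qn[of l m] mult_right_mono[of "\<bar>g l\<bar> * \<bar>g m\<bar>" "(g l)^2 / 2 + (g m)^2 / 2" "Q l m"] by (simp add: mult.assoc)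
  then show "ennreal (\<bar>g l\<bar> * (\<bar>g m\<bar> * Q l m)) <= ennreal ((g l)^2 / 2 * Q l m) + ennreal ((g m)^2 / 2 * Q l m)"
   using Qn[of l m] ennreal_leI[of _ "(g l)^2 / 2 * Q l m + (g m)^2 / 2 * Q l m"] by (simp add: distrib_right)
 qed
 also have "... = (NN l. NN m. ennreal ((g l)^2 / 2 * Q l m)) + (NN l. NN m. ennreal ((g m)^2 / 2 * Q l m))"
  by (subst nn_integral_add[symmetric]) (auto intro!: nn_integral_cong nn_integral_add)
 also have "(NN l. NN m. ennreal ((g m)^2 / 2 * Q l m)) = (NN m. NN l. ennreal ((g m)^2 / 2 * Q l m))"
  by (rule hl2.Fubini') measurable
 also have "... = (NN l. NN m. ennreal ((g l)^2 / 2 * Q l m))" by (simp add: Qs)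
 also have "(NN l. NN m. ennreal ((g l)^2 / 2 * Q l m)) = (NN l. ennreal ((g l)^2 / 2) * ennreal (pi / 2))"
 proof (rule nn_integral_cong)
  fix l
  have "(NN m. ennreal ((g l)^2 / 2 * Q l m)) = (NN m. ennreal ((g l)^2 / 2) * ennreal (Q l m))"
   by (intro nn_integral_cong ennreal_mult Qn) simp
  also have "... = ennreal ((g l)^2 / 2) * ennreal (pi / 2)" by (simp add: nn_integral_cmult QI)
  finally show "(NN m. ennreal ((g l)^2 / 2 * Q l m)) = ennreal ((g l)^2 / 2) * ennreal (pi / 2)" .
 qed
 also have "... + ... = (NN l. ennreal (pi / 2) * ennreal ((g l)^2))"
  by (subst nn_integral_add[symmetric]) (auto intro!: nn_integral_cong simp: ennreal_mult[symmetric] ennreal_plus[symmetric] simp del: ennreal_plus)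
 also have "... = ennreal (pi / 2) * (NN l. ennreal ((g l)^2))" by (rule nn_integral_cmult) measurable
 finally have fin: "ennreal (LI x. exp (- (e * x)) * (y x)^2) <= ennreal (pi / 2) * (NN l. ennreal ((g l)^2))"
  by (simp add: eq)
 have "(NN x. ennreal (exp (- (e * x)) * (y x)^2)) = ennreal (LI x. exp (- (e * x)) * (y x)^2)"
  using i1 by (intro nn_integral_eq_integral) (auto simp: power2_eq_square)
 then show ?thesis using fin by (simp add: y_def)
qed

text \<open>The bound of \<open>Bessel_aux\<close> does not depend on \<open>e\<close>, so Fatou's
  lemma along \<open>e = 1 / (n + 1)\<close> removes the damping.\<close>

lemma Bessel:
 fixes k :: "real => real"
 assumes k: "k = sin \<or> k = cos" and g: "integrable hl g"
 shows "(NN x. ennreal ((LI l. k (l * x) * g l)^2)) <= ennreal (pi / 2) * (NN l. ennreal ((g l)^2))"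
proof (rule nn_integral_le_of_tendsto)
 have [measurable]: "g \<in> borel_measurable hl" using g by auto
 have [measurable]: "k \<in> BM" using k by auto
 show "(%x. exp (- (inverse (real (Suc n)) * x)) * (LI l. k (l * x) * g l)^2) \<in> borel_measurable hl" for n
  by measurable
 show "AE x in hl. (%n. exp (- (inverse (real (Suc n)) * x)) * (LI l. k (l * x) * g l)^2) ----> (LI l. k (l * x) * g l)^2"
 proof (rule AE_I2)
  fix x :: real
  have "(%n. exp (- (inverse (real (Suc n)) * x))) ----> exp (- (0 * x))"
   by (intro tendsto_intros LIMSEQ_inverse_real_of_nat)
  from tendsto_mult_right[OF this, of "(LI l. k (l * x) * g l)^2"]
  show "(%n. exp (- (inverse (real (Suc n)) * x)) * (LI l. k (l * x) * g l)^2) ----> (LI l. k (l * x) * g l)^2"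
   by simp
 qed
 show "(NN x. ennreal (exp (- (inverse (real (Suc n)) * x)) * (LI l. k (l * x) * g l)^2))
   \<le> ennreal (pi / 2) * (NN l. ennreal ((g l)^2))" for n
  by (rule Bessel_aux[OF k g]) simp
qed

text \<open>Joint measurability restated for curried functions, the form in which it can be
  registered as a rule for the measurability automation.\<close>

lemma measurable_two:
 fixes F :: "real => real => 'a :: topological_space"
 assumes "(%p. F (fst p) (snd p)) \<in> borel_measurable (borel \<Otimes>\<^sub>M borel)"
  "f \<in> borel_measurable N" "g \<in> borel_measurable N"
 shows "(%x. F (f x) (g x)) \<in> borel_measurable N"
 using measurable_compose[OF measurable_Pair[OF assms(2,3)] assms(1)] by simp

section \<open>The sine transform and its bound in \<open>L^4(dx/x)\<close>\<close>

definition cS :: real where "cS = sqrt (2 / pi)"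

lemma cS_pos: "0 < cS" and cS_nonneg: "0 <= cS" and cS_sq: "cS^2 = 2 / pi" and cS_le_1: "cS <= 1"
 using pi_gt3 by (auto simp: cS_def real_le_lsqrt)

definition sine_tr :: "(real => real) => real => real" where
 "sine_tr g x = cS * (LI l. sin (l * x) * g l)"

text \<open>\<open>ns\<close> and \<open>nm\<close> are the squared homogeneous norms of order 1/2
  and -1/2 without the factor \<open>4 * pi\<close>, and \<open>E4\<close> is the fourth power of
  the norm of \<open>L^4(dx/x)\<close>. Keeping powers instead of roots keeps all three in
  \<open>ennreal\<close>, where infinite values need no special treatment.\<close>

definition ns :: "(real => real) => ennreal" where "ns g = (NN l. ennreal (l * (g l)^2))"

definition nm :: "(real => real) => ennreal" where "nm g = (NN l. ennreal ((g l)^2 / l))"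

definition E4 :: "(real => real) => ennreal" where "E4 v = (NN x. ennreal ((v x) ^ 4 / x))"

text \<open>By \<open>\<bar>sin (l * x)\<bar> <= max 1 x * min 1 l\<close> this weighted
  integrability makes the sine integral absolutely convergent at every \<open>x > 0\<close>, low
  frequencies included.\<close>

definition sine_class :: "(real => real) => bool" where
 "sine_class g \<longleftrightarrow> integrable hl (%l. min 1 l * g l) \<and> g \<in> BM"

lemma sine_tr_measurable[measurable]:
 assumes [measurable]: "g \<in> BM" shows "sine_tr g \<in> BM"
 unfolding sine_tr_def by measurable

lemma Cauchy_Schwarz_real:
 fixes f g :: "'a => real"
 assumes [measurable]: "f \<in> borel_measurable M" "g \<in> borel_measurable M"
  and fn: "!!x. x \<in> space M ==> 0 <= f x" and gn: "!!x. x \<in> space M ==> 0 <= g x" and "0 <= A" "0 <= B"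
  and "(\<integral>\<^sup>+x. ennreal ((f x)^2) \<partial>M) <= ennreal (A^2)" "(\<integral>\<^sup>+x. ennreal ((g x)^2) \<partial>M) <= ennreal (B^2)"
 shows "(\<integral>\<^sup>+x. ennreal (f x * g x) \<partial>M) <= ennreal (A * B)"
proof -
 let ?I = "\<integral>\<^sup>+x. ennreal (f x * g x) \<partial>M"
 have "?I = (\<integral>\<^sup>+x. ennreal (f x) * ennreal (g x) \<partial>M)"
  by (intro nn_integral_cong) (simp add: ennreal_mult fn gn)
 then have "?I^2 <= (\<integral>\<^sup>+x. (ennreal (f x))^2 \<partial>M) * (\<integral>\<^sup>+x. (ennreal (g x))^2 \<partial>M)"
  using Cauchy_Schwarz_nn_integral[of "%x. ennreal (f x)" M "%x. ennreal (g x)"] by simp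
 also have "... = (\<integral>\<^sup>+x. ennreal ((f x)^2) \<partial>M) * (\<integral>\<^sup>+x. ennreal ((g x)^2) \<partial>M)"
  by (intro arg_cong2[where f="(*)"] nn_integral_cong) (simp_all add: ennreal_power fn gn)
 also have "... <= ennreal (A^2) * ennreal (B^2)" using assms by (intro mult_mono) auto
 also have "... = ennreal ((A * B)^2)" by (simp add: ennreal_mult[symmetric] power_mult_distrib)
 finally have le: "?I^2 <= ennreal ((A * B)^2)" .
 show ?thesis
 proof (cases ?I)
  case (real r)
  have "r^2 <= (A * B)^2" using le real by (simp add: ennreal_power)
  then have "r <= A * B" by (rule power2_le_imp_le) (use \<open>0 <= A\<close> \<open>0 <= B\<close> in simp)
  then show ?thesis using real by (simp add: ennreal_leI)
 next
  case top
  then show ?thesis using le by (simp add: power2_eq_square ennreal_top_mult top_unique)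
 qed
qed

lemma sin_min_bound: "0 < (l :: real) ==> 0 < x ==> \<bar>sin (l * x)\<bar> <= max 1 x * min 1 l"
proof -
 assume l: "0 < l" and x: "0 < x"
 have 1: "\<bar>sin (l * x)\<bar> <= l * x" using abs_sin_x_le_abs_x[of "l*x"] l x by simp
 show ?thesis
 proof (cases "l <= 1")
  case True
  have "l * x <= max 1 x * l" using l by (simp add: mult.commute mult_right_mono)
  then show ?thesis using 1 True by (simp add: min_def)
 next
  case False
  then show ?thesis using order_trans[OF abs_sin_le_one[of "l*x"], of "max 1 x"] by (simp add: min_def)
 qed
qed

text \<open>The geometric mean of the bounds 1 and \<open>l * x\<close>. Two such factors produce
  one power of \<open>x\<close>, which cancels the weight \<open>1 / x\<close> of
  \<open>E4\<close>.\<close>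

lemma sin_sqrt_bound: "0 < (l :: real) ==> 0 < x ==> \<bar>sin (l * x)\<bar> <= sqrt (l * x)"
proof (rule real_le_rsqrt)
 assume l: "0 < l" "0 < x"
 have "\<bar>sin (l * x :: real)\<bar>^2 <= \<bar>sin (l * x)\<bar> * 1" unfolding power2_eq_square by (rule mult_left_mono) auto
 also have "... <= l * x" using abs_sin_x_le_abs_x[of "l*x"] l by simp
 finally show "\<bar>sin (l * x)\<bar>^2 <= l * x" .
qed

lemma sine_class_integrable:
 assumes "sine_class g" "0 < x" shows "integrable hl (%l. sin (l * x) * g l)"
proof (rule integrable_hl_bound)
 have [measurable]: "g \<in> BM" using assms by (auto simp: sine_class_def)
 show "integrable hl (%l. max 1 x * (min 1 l * g l))" using assms by (auto simp: sine_class_def)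
 show "(%l. sin (l * x) * g l) \<in> BM" by measurable
 show "\<bar>sin (l * x) * g l\<bar> <= \<bar>max 1 x * (min 1 l * g l)\<bar>" if "0 < l" for l
  using mult_right_mono[OF sin_min_bound[of l x], of "\<bar>g l\<bar>"] assms that by (simp add: abs_mult mult.assoc)
qed

lemma sine_class_tail:
 assumes "sine_class g" "0 < l" shows "integrable hl (%m. indicator {l<..} m * g m)"
proof (rule integrable_hl_bound)
 have [measurable]: "g \<in> BM" using assms by (auto simp: sine_class_def)
 show "integrable hl (%m. (1 / min 1 l) * (min 1 m * g m))" using assms by (auto simp: sine_class_def)
 show "(%m. indicator {l<..} m * g m) \<in> BM" by measurable
 show "\<bar>indicator {l<..} m * g m\<bar> <= \<bar>(1 / min 1 l) * (min 1 m * g m)\<bar>" if "0 < m" for m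
 proof -
  have "1 <= (1 / min 1 l) * min 1 m" if "l < m" using that assms by (simp add: field_simps min_def)
  from mult_right_mono[OF this, of "\<bar>g m\<bar>"] \<open>0 < m\<close> \<open>0 < l\<close>
  show ?thesis by (auto simp: indicator_def abs_mult)
 qed
qed

text \<open>The square is a double integral; its diagonal is null and the two triangles contribute
  equally. Ordering the two frequencies allows the larger one to be treated by Bessel's inequality
  and the smaller one pointwise.\<close>

lemma square_integral_symmetrize:
 fixes f :: "real => real"
 assumes f: "integrable hl f"
 shows "(LI l. f l)^2 = 2 * (LI l. f l * (LI m. indicator {l<..} m * f m))"
proof -
 have [measurable]: "f \<in> BM" using f by auto
 define K where "K = (%(l :: real, m). indicator {l<..} m :: real)"
 define K' where "K' = (%(l :: real, m). if l < m then 0 else 1 :: real)"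
 have Km[measurable]: "K \<in> borel_measurable (hl \<Otimes>\<^sub>M hl)"
  unfolding K_def indicator_def greaterThan_iff by measurable
 have Km'[measurable]: "K' \<in> borel_measurable (hl \<Otimes>\<^sub>M hl)" unfolding K'_def by measurable
 have Ie: "integrable hl (%m. h m * f m)" if "!!m. \<bar>h m\<bar> <= 1" "h \<in> BM" for h
  by (rule Bochner_Integration.integrable_bound[OF f]) (use that in "auto simp: abs_mult intro!: mult_left_le_one_le AE_I2")
 have bnd: "\<bar>\<integral>m. h m * f m \<partial>hl\<bar> <= (LI m. \<bar>f m\<bar>)" if "!!m. \<bar>h m\<bar> <= 1" "h \<in> BM" for h
  by (rule order_trans[OF integral_abs_bound], rule integral_mono)
   (use integrable_norm[OF Ie[OF that]] integrable_norm[OF f] that in "auto simp: abs_mult intro!: mult_left_le_one_le")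
 have If: "integrable hl (%l. f l * (LI m. J (l, m) * f m))"
  if J: "J \<in> borel_measurable (hl \<Otimes>\<^sub>M hl)" "!!p. \<bar>J p\<bar> <= 1" for J
 proof (rule integrable_hl_bound)
  note J(1)[measurable]
  show "integrable hl (%l. (LI m. \<bar>f m\<bar>) * f l)" using f by auto
  show "(%l. f l * (LI m. J (l, m) * f m)) \<in> BM" by measurable
  show "\<bar>f l * (LI m. J (l, m) * f m)\<bar> <= \<bar>(LI m. \<bar>f m\<bar>) * f l\<bar>" for l
  proof -
   have "(%m. J (l, m)) \<in> BM" by measurable
   then have "\<bar>\<integral>m. J (l, m) * f m \<partial>hl\<bar> <= (LI m. \<bar>f m\<bar>)" by (intro bnd J)
   from mult_right_mono[OF this, of "\<bar>f l\<bar>"]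
   show "\<bar>f l * (LI m. J (l, m) * f m)\<bar> <= \<bar>(LI m. \<bar>f m\<bar>) * f l\<bar>"
    by (simp add: abs_mult mult.commute)
  qed
 qed
 have 1: "\<bar>K p\<bar> <= 1" "\<bar>K' p\<bar> <= 1" for p by (auto simp: K_def K'_def split: prod.splits)
 have "(LI l. f l)^2 = (LI l. f l * (LI m. f m))" by (simp add: power2_eq_square)
 also have "... = (LI l. f l * (LI m. K (l, m) * f m) + f l * (LI m. K' (l, m) * f m))"
 proof (rule Bochner_Integration.integral_cong)
  fix l
  have "(LI m. K (l, m) * f m) + (LI m. K' (l, m) * f m) = (LI m. K (l, m) * f m + K' (l, m) * f m)"
  proof (intro Bochner_Integration.integral_add[symmetric] Ie 1)
   show "(%m. K (l, m)) \<in> BM" "(%m. K' (l, m)) \<in> BM"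
    by measurable
  qed
  also have "... = (LI m. f m)"
   by (rule Bochner_Integration.integral_cong) (auto simp: K_def K'_def indicator_def)
  finally show "f l * (LI m. f m) = f l * (LI m. K (l, m) * f m) + f l * (LI m. K' (l, m) * f m)"
   by (simp flip: distrib_left)
 qed simp
 also have "... = (LI l. f l * (LI m. K (l, m) * f m)) + (LI l. f l * (LI m. K' (l, m) * f m))"
  by (intro Bochner_Integration.integral_add If Km Km' 1)
 also have "(LI l. f l * (LI m. K' (l, m) * f m)) = (LI m. f m * (LI l. K' (l, m) * f l))"
  by (rule hl2.bounded_kernel_Fubini[OF f f Km', where C=1]) (use 1 in auto)
 also have "... = (LI l. f l * (LI m. K (l, m) * f m))"
 proof (rule Bochner_Integration.integral_cong[OF refl])
  fix m :: real
  have "AE l in lborel. l \<noteq> (m::real)" by (rule AE_lborel_singleton)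
  then have "AE l in hl. l \<noteq> m" unfolding AE_hl by eventually_elim auto
  then have "AE l in hl. K' (l, m) * f l = K (m, l) * f l"
   by eventually_elim (auto simp: K_def K'_def)
  moreover have "(%l. K' (l, m) * f l) \<in> BM" "(%l. K (m, l) * f l) \<in> BM"
   by measurable
  ultimately have "(LI l. K' (l, m) * f l) = (LI l. K (m, l) * f l)"
   by (intro integral_cong_AE) auto
  then show "f m * (LI l. K' (l, m) * f l) = f m * (LI l. K (m, l) * f l)" by (simp only:)
 qed
 finally show ?thesis by (simp add: K_def)
qed

text \<open>Symmetrization writes the square of the transform as twice an integral over
  \<open>l\<close> of \<open>sin (l * x) * g l\<close> times the part \<open>V l x\<close> of the
  transform carried by frequencies above \<open>l\<close>. In the fourth power two sines occur,
  together at most \<open>sqrt (l * m) * x\<close>, which removes the weight \<open>1 / x\<close>.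
  What is left is \<open>\<bar>V l x\<bar> * \<bar>V m x\<bar>\<close> integrated in
  \<open>x\<close>, controlled by Cauchy-Schwarz and Bessel through the tail norms
  \<open>b l\<close> and \<open>b m\<close>. The square integral of \<open>b\<close> is
  \<open>ns g\<close> again.\<close>

theorem E4_sine_tr_le:
 assumes g: "sine_class g"
 shows "E4 (sine_tr g) <= 4 * (ns g)^2"
proof (cases "ns g < \<infinity>")
 case False
 then have "ns g = \<infinity>" by (metis infinity_ennreal_def less_top)
 then show ?thesis by (simp add: power2_eq_square ennreal_top_mult ennreal_mult_top)
next
 case True
 have [measurable]: "g \<in> BM" using g by (simp add: sine_class_def)
 define V where "V l x = cS * (LI m. indicator {l<..} m * (sin (m * x) * g m))" for l x
 have "(%p. V (fst p) (snd p)) \<in> borel_measurable (borel \<Otimes>\<^sub>M borel)"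
  unfolding V_def indicator_def greaterThan_iff by measurable
 note Vm[measurable (raw)] = measurable_two[OF this]
 define B where "B l = (NN m. ennreal (indicator {l<..} m * (g m)^2))" for l
 have Bm[measurable]: "B \<in> BM" unfolding B_def indicator_def greaterThan_iff by measurable
 have Bfin: "B l < \<infinity>" if "l > 0" for l
 proof -
  have "B l <= (NN m. ennreal (1 / l) * ennreal (m * (g m)^2))"
   unfolding B_def
  proof (rule nn_integral_hl_mono)
   fix m :: real assume m: "0 < m"
   have "(g m)^2 <= m * (g m)^2 / l" if "l < m"
    using that \<open>l > 0\<close> mult_right_mono[of l m "(g m)^2"] by (simp add: field_simps)
   then show "ennreal (indicator {l<..} m * (g m)^2) <= ennreal (1 / l) * ennreal (m * (g m)^2)"
    using \<open>l > 0\<close> m by (subst ennreal_mult[symmetric]) (auto simp: indicator_def intro!: ennreal_leI)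
  qed
  also have "... = ennreal (1 / l) * ns g" unfolding ns_def by (rule nn_integral_cmult) measurable
  also have "... < \<infinity>" using True by (simp add: ennreal_mult_less_top)
  finally show ?thesis .
 qed
 define b where "b l = sqrt (enn2real (B l))" for l
 have [measurable]: "b \<in> BM" unfolding b_def by measurable
 have bn: "0 <= b l" for l by (simp add: b_def)
 have bB: "ennreal ((b l)^2) = B l" if "l > 0" for l using Bfin[OF that] by (simp add: b_def)
 have V2: "(NN x. ennreal (\<bar>V l x\<bar>^2)) <= ennreal ((b l)^2)" if l: "l > 0" for l
 proof -
  have "(NN x. ennreal (\<bar>V l x\<bar>^2))
   = (NN x. ennreal (cS^2) * ennreal ((LI m. sin (m * x) * (indicator {l<..} m * g m))^2))"
   by (intro nn_integral_cong) (simp add: V_def power_mult_distrib ennreal_mult ac_simps)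
  also have "... = ennreal (cS^2) * (NN x. ennreal ((LI m. sin (m * x) * (indicator {l<..} m * g m))^2))"
   by (rule nn_integral_cmult) measurable
  also have "... <= ennreal (cS^2) * (ennreal (pi / 2) * (NN m. ennreal ((indicator {l<..} m * g m)^2)))"
   by (intro mult_left_mono Bessel sine_class_tail g l) auto
  also have "... = B l"
   by (simp add: B_def cS_sq mult.assoc[symmetric] ennreal_mult[symmetric] power_mult_distrib indicator_def)
    (auto intro!: nn_integral_cong)
  finally show ?thesis using bB[OF l] by simp
 qed
 define a where "a x l = \<bar>sin (l * x)\<bar> * \<bar>g l\<bar> * \<bar>V l x\<bar>" for x l
 have an: "0 <= a x l" for x l by (simp add: a_def)
 have "(%p. a (fst p) (snd p)) \<in> borel_measurable (borel \<Otimes>\<^sub>M borel)"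
  unfolding a_def by measurable
 note am[measurable (raw)] = measurable_two[OF this]
 have sq: "ennreal ((sine_tr g x)^2) <= 2 * (NN l. ennreal (a x l))" if x: "x > 0" for x
 proof -
  let ?f = "%l. sin (l * x) * g l"
  have If: "integrable hl ?f" using sine_class_integrable[OF g x] .
  have "(sine_tr g x)^2 = 2 * cS * (LI l. ?f l * V l x)"
  proof -
   have "(LI l. ?f l * V l x) = cS * (LI l. ?f l * (LI m. indicator {l<..} m * ?f m))"
    by (subst integral_mult_right_zero[symmetric]) (rule Bochner_Integration.integral_cong, auto simp: V_def)
   then show ?thesis
    using square_integral_symmetrize[OF If] by (simp add: sine_tr_def power_mult_distrib power2_eq_square[of cS])
  qed
  also have "... <= 2 * cS * \<bar>\<integral>l. ?f l * V l x \<partial>hl\<bar>"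
   by (rule mult_left_mono) (use cS_nonneg in auto)
  also have "... <= 2 * 1 * \<bar>\<integral>l. ?f l * V l x \<partial>hl\<bar>"
   by (rule mult_right_mono) (use cS_le_1 in auto)
  finally have 1: "(sine_tr g x)^2 <= 2 * \<bar>\<integral>l. ?f l * V l x \<partial>hl\<bar>" by simp
  have 2: "ennreal \<bar>\<integral>l. ?f l * V l x \<partial>hl\<bar> <= (NN l. ennreal (a x l))"
  proof (cases "integrable hl (%l. ?f l * V l x)")
   case True
   then show ?thesis using integral_norm_bound_ennreal[OF True] by (simp add: a_def abs_mult)
  qed (simp add: not_integrable_integral_eq)
  have "ennreal ((sine_tr g x)^2) <= 2 * ennreal \<bar>\<integral>l. ?f l * V l x \<partial>hl\<bar>"
   using ennreal_leI[OF 1] by (simp add: ennreal_mult)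
  also have "... <= 2 * (NN l. ennreal (a x l))" by (intro mult_left_mono 2) simp
  finally show ?thesis .
 qed
 define p where "p l = \<bar>g l\<bar> * (sqrt l * b l)" for l
 have [measurable]: "p \<in> BM" unfolding p_def by measurable
 have pn: "0 <= p l" if "l > 0" for l using that bn by (simp add: p_def)
 have inner: "(NN x. ennreal (a x l * a x m / x)) <= ennreal (p l * p m)" if lm: "l > 0" "m > 0" for l m
 proof -
  have "(NN x. ennreal (a x l * a x m / x)) <= (NN x. ennreal (\<bar>g l\<bar> * \<bar>g m\<bar> * sqrt (l * m)) * ennreal (\<bar>V l x\<bar> * \<bar>V m x\<bar>))"
  proof (rule nn_integral_hl_mono)
   fix x :: real assume x: "0 < x"
   have "\<bar>sin (l * x)\<bar> * \<bar>sin (m * x)\<bar> <= sqrt (l * x) * sqrt (m * x)"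
    using x lm by (intro mult_mono sin_sqrt_bound) auto
   also have "... = sqrt (l * m) * x" using x by (simp add: real_sqrt_mult)
   finally have "\<bar>sin (l * x)\<bar> * \<bar>sin (m * x)\<bar> / x <= sqrt (l * m)" using x by (simp add: field_simps)
   from mult_right_mono[OF this, of "\<bar>g l\<bar> * \<bar>g m\<bar> * (\<bar>V l x\<bar> * \<bar>V m x\<bar>)"]
   have "a x l * a x m / x <= \<bar>g l\<bar> * \<bar>g m\<bar> * sqrt (l * m) * (\<bar>V l x\<bar> * \<bar>V m x\<bar>)"
    by (simp add: a_def ac_simps)
   then show "ennreal (a x l * a x m / x) <= ennreal (\<bar>g l\<bar> * \<bar>g m\<bar> * sqrt (l * m)) * ennreal (\<bar>V l x\<bar> * \<bar>V m x\<bar>)"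
    using lm by (subst ennreal_mult[symmetric]) (auto intro!: ennreal_leI)
  qed
  also have "... = ennreal (\<bar>g l\<bar> * \<bar>g m\<bar> * sqrt (l * m)) * (NN x. ennreal (\<bar>V l x\<bar> * \<bar>V m x\<bar>))"
   by (rule nn_integral_cmult) (auto simp: V_def)
  also have "... <= ennreal (\<bar>g l\<bar> * \<bar>g m\<bar> * sqrt (l * m)) * ennreal (b l * b m)"
   by (rule mult_left_mono, rule Cauchy_Schwarz_real[OF _ _ _ _ bn bn V2[OF lm(1)] V2[OF lm(2)]]) (auto simp: V_def)
  also have "... = ennreal (p l * p m)"
   using lm bn by (subst ennreal_mult[symmetric]) (auto simp: p_def real_sqrt_mult ac_simps)
  finally show ?thesis .
 qed
 have "E4 (sine_tr g) <= (NN x. 4 * (NN l. NN m. ennreal (a x l * a x m / x)))"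
  unfolding E4_def
 proof (rule nn_integral_hl_mono)
  fix x :: real assume x: "0 < x"
  let ?A = "NN l. ennreal (a x l)"
  have "ennreal ((sine_tr g x) ^ 4 / x) = ennreal (1 / x) * (ennreal ((sine_tr g x)^2) * ennreal ((sine_tr g x)^2))"
  proof -
   have "(sine_tr g x) ^ 4 = (sine_tr g x)^2 * (sine_tr g x)^2" by (simp flip: power_add)
   then show ?thesis using x by (simp add: ennreal_mult[symmetric])
  qed
  also have "... <= ennreal (1 / x) * ((2 * ?A) * (2 * ?A))"
   using x by (intro mult_left_mono mult_mono sq) auto
  also have "... = 4 * (ennreal (1 / x) * (?A * ?A))" by (simp add: ac_simps)
  also have "?A * ?A = (NN l. ennreal (a x l) * ?A)"
   by (subst nn_integral_multc) measurable
  also have "ennreal (1 / x) * ... = (NN l. ennreal (1 / x) * (ennreal (a x l) * ?A))"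
   by (subst nn_integral_cmult) measurable
  also have "... = (NN l. NN m. ennreal (a x l * a x m / x))"
  proof (rule nn_integral_cong)
   fix l
   have "ennreal (1 / x) * (ennreal (a x l) * ?A) = ennreal (a x l / x) * ?A"
    using x an by (simp add: mult.assoc[symmetric] ennreal_mult[symmetric])
   also have "... = (NN m. ennreal (a x l / x) * ennreal (a x m))"
    by (subst nn_integral_cmult) measurable
   also have "... = (NN m. ennreal (a x l * a x m / x))"
    using x an by (intro nn_integral_cong) (simp add: ennreal_mult[symmetric])
   finally show "ennreal (1 / x) * (ennreal (a x l) * ?A) = (NN m. ennreal (a x l * a x m / x))" .
  qed
  finally show "ennreal ((sine_tr g x) ^ 4 / x) <= 4 * (NN l. NN m. ennreal (a x l * a x m / x))" .
 qed
 also have "... = 4 * (NN x. NN l. NN m. ennreal (a x l * a x m / x))"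
  by (rule nn_integral_cmult) measurable
 also have "(NN x. NN l. NN m. ennreal (a x l * a x m / x))
   = (NN l. NN x. NN m. ennreal (a x l * a x m / x))"
  by (rule hl2.Fubini') measurable
 also have "... = (NN l. NN m. NN x. ennreal (a x l * a x m / x))"
  by (rule nn_integral_cong, rule hl2.Fubini') measurable
 also have "... <= (NN l. NN m. ennreal (p l * p m))"
  by (intro nn_integral_hl_mono inner)
 also have "... = (NN l. ennreal (p l) * (NN m. ennreal (p m)))"
  using pn by (intro nn_integral_hl_cong) (subst nn_integral_cmult[symmetric], auto intro!: nn_integral_hl_cong ennreal_mult)
 also have "... = (NN l. ennreal (p l))^2" by (simp add: nn_integral_multc power2_eq_square)
 also have "(NN l. ennreal (p l)) = (NN l. ennreal (sqrt l * \<bar>g l\<bar>) * ennreal (b l))"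
  using bn by (intro nn_integral_hl_cong) (simp add: p_def ennreal_mult[symmetric] ac_simps)
 also have "(...)^2 <= (NN l. (ennreal (sqrt l * \<bar>g l\<bar>))^2) * (NN l. (ennreal (b l))^2)"
  by (rule Cauchy_Schwarz_nn_integral) measurable
 also have "(NN l. (ennreal (sqrt l * \<bar>g l\<bar>))^2) = ns g"
  unfolding ns_def by (intro nn_integral_hl_cong) (simp add: ennreal_power power_mult_distrib)
 also have "(NN l. (ennreal (b l))^2) = (NN l. B l)"
  using bn by (intro nn_integral_hl_cong) (simp add: ennreal_power bB)
 \<comment> \<open>The tails are summed by Fubini: the frequency \<open>m\<close> belongs to the
   tail of every \<open>l < m\<close>, an interval of length \<open>m\<close>, which recovers the
   weight of \<open>ns\<close>.\<close>
 also have "... = (NN m. NN l. ennreal (indicator {l<..} m * (g m)^2))"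
  unfolding B_def by (rule hl2.Fubini'[symmetric]) (unfold indicator_def greaterThan_iff, measurable)
 also have "... = ns g" unfolding ns_def
 proof (rule nn_integral_hl_cong)
  fix m :: real assume m: "0 < m"
  have "(NN l. ennreal (indicator {l<..} m * (g m)^2)) = (\<integral>\<^sup>+l. ennreal ((g m)^2) * indicator {0<..<m} l \<partial>lborel)"
   by (subst nn_integral_hl) (auto intro!: nn_integral_cong simp: indicator_def)
  also have "... = ennreal ((g m)^2) * ennreal m" using m by (subst nn_integral_cmult_indicator) auto
  finally show "(NN l. ennreal (indicator {l<..} m * (g m)^2)) = ennreal (m * (g m)^2)"
   using m by (simp add: ennreal_mult[symmetric] mult.commute)
 qed
 finally show ?thesis by (simp add: power2_eq_square mult_left_mono)
qed

section \<open>Weighted norms and the profile of a Fourier-side function\<close>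

definition wsq :: "(real => real) => (real => real) => ennreal" where
 "wsq w g = (NN l. ennreal (w l * (g l)^2))"

lemma ns_wsq: "ns = wsq (%l. l)" and nm_wsq: "nm = wsq inverse"
 by (auto simp: fun_eq_iff ns_def nm_def wsq_def divide_inverse mult.commute)

lemma wsq_cong_AE: "AE l in hl. f l = g l ==> wsq w f = wsq w g"
 unfolding wsq_def by (rule nn_integral_cong_AE) (auto elim: eventually_mono)

lemma wsq_zero[simp]: "wsq w (%l. 0) = 0"
 by (simp add: wsq_def)

lemma wsq_minus: "wsq w (%l. f l - g l) = wsq w (%l. g l - f l)"
 unfolding wsq_def by (simp add: power2_commute)

lemma wsq_cmult:
 assumes [measurable]: "w \<in> BM" "g \<in> BM"
 shows "wsq w (%l. c * g l) = ennreal (c^2) * wsq w g"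
proof -
 have "wsq w (%l. c * g l) = (NN l. ennreal (c^2) * ennreal (w l * (g l)^2))"
  unfolding wsq_def by (intro nn_integral_cong) (simp add: ennreal_mult'[symmetric] power_mult_distrib ac_simps)
 also have "... = ennreal (c^2) * wsq w g" unfolding wsq_def by (rule nn_integral_cmult) measurable
 finally show ?thesis .
qed

lemma wsq_mult_le:
 assumes [measurable]: "w \<in> BM" "g \<in> BM"
  and w: "!!l. 0 < l ==> 0 <= w l" and c: "!!l. 0 < l ==> \<bar>f l\<bar> <= c * \<bar>g l\<bar>"
 shows "wsq w f <= ennreal (c^2) * wsq w g"
proof -
 have "wsq w f <= wsq w (%l. c * g l)" unfolding wsq_def
 proof (rule nn_integral_hl_mono)
  fix l :: real assume l: "0 < l"
  have "\<bar>f l\<bar>^2 <= (c * \<bar>g l\<bar>)^2" by (rule power_mono) (use c[OF l] in auto)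
  then show "ennreal (w l * (f l)^2) <= ennreal (w l * (c * g l)^2)"
   using w[OF l] by (intro ennreal_leI mult_left_mono) (auto simp: power_mult_distrib)
 qed
 then show ?thesis by (simp add: wsq_cmult)
qed

lemma wsq_add_le:
 assumes [measurable]: "w \<in> BM" "f \<in> BM" "g \<in> BM"
  and w: "!!l. 0 < l ==> 0 <= w l"
 shows "wsq w (%l. f l + g l) <= 2 * (wsq w f + wsq w g)"
proof -
 have "wsq w (%l. f l + g l) <= (NN l. 2 * (ennreal (w l * (f l)^2) + ennreal (w l * (g l)^2)))"
  unfolding wsq_def
 proof (rule nn_integral_hl_mono)
  fix l :: real assume l: "0 < l"
  have "(f l + g l)^2 <= 2 * ((f l)^2 + (g l)^2)"
   using sum_squares_bound[of "f l" "g l"] by (simp add: power2_sum)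
  then have "w l * (f l + g l)^2 <= 2 * (w l * (f l)^2 + w l * (g l)^2)"
   using mult_left_mono[OF _ w[OF l]] by (fastforce simp: algebra_simps)
  then have "ennreal (w l * (f l + g l)^2) <= ennreal (2 * (w l * (f l)^2 + w l * (g l)^2))" by (rule ennreal_leI)
  also have "... = 2 * (ennreal (w l * (f l)^2) + ennreal (w l * (g l)^2))"
   using w[OF l] by (simp add: ennreal_mult)
  finally show "ennreal (w l * (f l + g l)^2) <= 2 * (ennreal (w l * (f l)^2) + ennreal (w l * (g l)^2))" .
 qed
 also have "... = 2 * (wsq w f + wsq w g)" unfolding wsq_def
  by (subst nn_integral_cmult, measurable, subst nn_integral_add) auto
 finally show ?thesis .
qed

lemma wsq_diff_le:
 assumes "w \<in> BM" "f \<in> BM" "g \<in> BM"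
  and w: "!!l. 0 < l ==> 0 <= w l"
 shows "wsq w (%l. f l - g l) <= 2 * (wsq w f + wsq w g)"
 using wsq_add_le[of w f "%l. - g l"] assms by (simp add: wsq_def)

lemma wsq_eq_0_AE:
 assumes [measurable]: "w \<in> BM" "g \<in> BM"
  and w: "!!l. 0 < l ==> 0 < w l" and 0: "wsq w g = 0"
 shows "AE l in hl. g l = 0"
proof -
 have "AE l in hl. ennreal (w l * (g l)^2) = 0"
  using 0 unfolding wsq_def by (subst (asm) nn_integral_0_iff_AE) auto
 moreover have "AE l in hl. 0 < w l" using w by (rule AE_hlI)
 ultimately show ?thesis
 proof eventually_elim
  case (elim l)
  then have "w l * (g l)^2 <= 0" by (simp add: ennreal_eq_0_iff)
  then show ?case using elim by (simp add: mult_le_0_iff)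
 qed
qed

lemma ns_diff_le: "f \<in> BM ==> g \<in> BM ==> ns (%l. f l - g l) <= 2 * (ns f + ns g)"
 and ns_add_le: "f \<in> BM ==> g \<in> BM ==> ns (%l. f l + g l) <= 2 * (ns f + ns g)"
 and ns_cmult: "f \<in> BM ==> ns (%l. c * f l) = ennreal (c^2) * ns f"
 and ns_minus: "ns (%l. f l - g l) = ns (%l. g l - f l)"
 and ns_cong_AE: "AE l in hl. f l = g l ==> ns f = ns g"
 unfolding ns_wsq by (rule wsq_diff_le wsq_add_le wsq_cmult wsq_minus wsq_cong_AE; simp)+

lemma nm_diff_le: "f \<in> BM ==> g \<in> BM ==> nm (%l. f l - g l) <= 2 * (nm f + nm g)"
 and nm_add_le: "f \<in> BM ==> g \<in> BM ==> nm (%l. f l + g l) <= 2 * (nm f + nm g)"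
 and nm_cmult: "f \<in> BM ==> nm (%l. c * f l) = ennreal (c^2) * nm f"
 and nm_minus: "nm (%l. f l - g l) = nm (%l. g l - f l)"
 and nm_cong_AE: "AE l in hl. f l = g l ==> nm f = nm g"
 unfolding nm_wsq by (rule wsq_diff_le wsq_add_le wsq_cmult wsq_minus wsq_cong_AE; simp)+

lemma ns_eq_0_AE: "g \<in> BM ==> ns g = 0 ==> AE l in hl. g l = 0"
 and nm_eq_0_AE: "g \<in> BM ==> nm g = 0 ==> AE l in hl. g l = 0"
 unfolding ns_wsq nm_wsq by (auto intro: wsq_eq_0_AE[where w="%l. l"] wsq_eq_0_AE[where w=inverse])

lemma E4_cong_AE: "AE l in hl. f l = g l ==> E4 f = E4 g"
 unfolding E4_def by (rule nn_integral_cong_AE) (auto elim: eventually_mono)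

lemma E4_diff_le:
 assumes [measurable]: "f \<in> BM" "g \<in> BM"
 shows "E4 (%l. f l - g l) <= 8 * (E4 f + E4 g)"
proof -
 have "E4 (%l. f l - g l) <= (NN x. 8 * (ennreal ((f x) ^ 4 / x) + ennreal ((g x) ^ 4 / x)))"
  unfolding E4_def
 proof (rule nn_integral_hl_mono)
  fix x :: real assume x: "0 < x"
  have sq: "(a - b)^2 <= 2 * (a^2 + b^2)" for a b :: real
   using zero_le_power2[of "a + b"] by (simp add: power2_eq_square algebra_simps)
  have "((f x - g x)^2)^2 <= (2 * ((f x)^2 + (g x)^2))^2" by (rule power_mono[OF sq]) simp
  also have "... <= 4 * (2 * (((f x)^2)^2 + ((g x)^2)^2))"
   unfolding power_mult_distrib using sq[of "(f x)^2" "- (g x)\<^sup>2"] by simp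
  finally have "(f x - g x) ^ 4 <= 8 * ((f x) ^ 4 + (g x) ^ 4)" by (simp flip: power_mult)
  then have "(f x - g x) ^ 4 / x <= 8 * ((f x) ^ 4 / x + (g x) ^ 4 / x)" using x by (simp add: field_simps)
  then have "ennreal ((f x - g x) ^ 4 / x) <= ennreal (8 * ((f x) ^ 4 / x + (g x) ^ 4 / x))" by (rule ennreal_leI)
  also have "... = 8 * (ennreal ((f x) ^ 4 / x) + ennreal ((g x) ^ 4 / x))"
   using x by (subst ennreal_mult) (auto simp: ennreal_plus[symmetric] simp del: ennreal_plus)
  finally show "ennreal ((f x - g x) ^ 4 / x) <= 8 * (ennreal ((f x) ^ 4 / x) + ennreal ((g x) ^ 4 / x))" .
 qed
 also have "... = 8 * (E4 f + E4 g)" unfolding E4_def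
  by (subst nn_integral_cmult, measurable, subst nn_integral_add) auto
 finally show ?thesis .
qed

lemma E4_eq_0_AE:
 assumes [measurable]: "v \<in> BM" and 0: "E4 v = 0"
 shows "AE x in hl. v x = 0"
proof -
 have "AE x in hl. ennreal ((v x) ^ 4 / x) = 0"
  using 0 unfolding E4_def by (subst (asm) nn_integral_0_iff_AE) auto
 moreover have "AE x in hl. (0 :: real) < x" by (rule AE_hlI)
 ultimately show ?thesis
 proof eventually_elim
  case (elim x)
  then have "(v x) ^ 4 / x <= 0" by (simp add: ennreal_eq_0_iff)
  then have "(v x) ^ 4 <= 0" using elim by (simp add: divide_le_0_iff)
  moreover have "0 <= (v x) ^ 4" by simp
  ultimately have "(v x) ^ 4 = 0" by linarith
  then show ?case by simp
 qed
qed

section \<open>Almost everywhere limits of fast Cauchy sequences\<close>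

lemma geometric_Cauchy_convergent:
 fixes f :: "nat => real"
 assumes p: "even p" "0 < p" and w: "0 < w" and B: "!!k. (4/3) ^ k * (w * (f (Suc k) - f k) ^ p) <= B"
 shows "convergent f"
proof -
 have "summable (%k. f (Suc k) - f k)"
 proof (rule summable_comparison_test')
  show "summable (%k. root p (B / w) * (root p (3/4)) ^ k)"
   using p by (intro summable_mult summable_geometric) (simp add: real_root_lt_1_iff)
  fix k
  have "(f (Suc k) - f k) ^ p <= B / w * (3/4) ^ k"
   using B[of k] w by (simp add: field_simps)
  then have "root p (\<bar>f (Suc k) - f k\<bar> ^ p) <= root p (B / w * (3/4) ^ k)"
   using p by (intro real_root_le_mono) (auto simp: power_even_abs)
  then show "norm (f (Suc k) - f k) <= root p (B / w) * (root p (3/4)) ^ k"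
   using p by (simp add: real_root_power_cancel real_root_mult[symmetric] real_root_power[symmetric])
 qed
 then have "convergent (%n. \<Sum>k<n. f (Suc k) - f k)" by (simp add: summable_iff_convergent)
 then have "convergent (%n. f n - f 0)" by (simp add: sum_lessThan_telescope)
 then have "convergent (%n. (f n - f 0) + f 0)" by (intro convergent_add convergent_const)
 then show ?thesis by simp
qed

text \<open>Completeness of a weighted \<open>L^p\<close>, with a rate. The factor
  \<open>(4/3) ^ k\<close> is compatible with the decay \<open>(1/2) ^ k\<close>, since
  \<open>(2/3) ^ k\<close> is summable, and it forces the increments to be almost everywhere at most
  geometric, with ratio the \<open>p\<close>-th root of \<open>3/4\<close>. Fatou's lemma then
  carries the tail bounds over to the limit.\<close>

lemma geometric_Cauchy_limit:
 fixes f :: "nat => real => real" and w :: "real => real"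
 assumes [measurable]: "!!k. f k \<in> BM" "w \<in> BM"
  and p: "even p" "0 < p" and w: "!!x. 0 < x ==> 0 < w x" and C: "0 <= C"
  and le: "!!k j. k <= j ==> (NN x. ennreal (w x * (f j x - f k x) ^ p)) <= ennreal (C * (1/2) ^ k)"
 shows "\<exists>F. F \<in> BM \<and> (\<forall>k. (NN x. ennreal (w x * (F x - f k x) ^ p)) <= ennreal (C * (1/2) ^ k))"
proof -
 let ?h = "%k x. ennreal ((4/3) ^ k * (w x * (f (Suc k) x - f k x) ^ p))"
 have "(NN x. (\<Sum>k. ?h k x)) = (\<Sum>k. NN x. ?h k x)" by (rule nn_integral_suminf) measurable
 also have "... <= (\<Sum>k. ennreal (C * (2/3) ^ k))"
 proof (rule suminf_le)
  fix k
  have "(NN x. ?h k x) = ennreal ((4/3) ^ k) * (NN x. ennreal (w x * (f (Suc k) x - f k x) ^ p))"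
   by (subst nn_integral_cmult[symmetric]) (auto intro!: nn_integral_cong ennreal_mult')
  also have "... <= ennreal ((4/3) ^ k) * ennreal (C * (1/2) ^ k)" by (intro mult_left_mono le) auto
  also have "... = ennreal (C * (2/3) ^ k)"
   using C by (subst ennreal_mult[symmetric]) (auto simp: power_mult_distrib[symmetric] mult.left_commute)
  finally show "(NN x. ?h k x) <= ennreal (C * (2/3) ^ k)" .
 qed auto
 also have "... = ennreal (\<Sum>k. C * (2/3) ^ k)" using C by (intro suminf_ennreal_eq) (auto intro!: summable_sums summable_mult summable_geometric)
 also have "... < \<infinity>" by simp
 finally have fin: "AE x in hl. (\<Sum>k. ?h k x) \<noteq> \<infinity>" by (intro nn_integral_PInf_AE) auto
 have wpos: "AE x in hl. 0 < w x" using w by (rule AE_hlI)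
 have conv: "AE x in hl. convergent (%k. f k x)"
  using fin wpos
 proof eventually_elim
  case (elim x)
  obtain B where B: "(\<Sum>k. ?h k x) = ennreal B" "0 <= B" using elim by (cases "\<Sum>k. ?h k x") auto
  show ?case
  proof (rule geometric_Cauchy_convergent[OF p])
   show "0 < w x" by fact
   fix k
   have "?h k x <= (\<Sum>k. ?h k x)" using sum_le_suminf[of "%k. ?h k x" "{k}"] by simp
   then show "(4/3) ^ k * (w x * (f (Suc k) x - f k x) ^ p) <= B" using B by simp
  qed
 qed
 define F where "F x = lim (%k. f k x)" for x
 have Fm[measurable]: "F \<in> BM" unfolding F_def by (rule borel_measurable_lim_metric) measurable
 have "(NN x. ennreal (w x * (F x - f k x) ^ p)) <= ennreal (C * (1/2) ^ k)" for k
 proof (rule nn_integral_le_of_tendsto)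
  show "(%x. w x * (f (n + k) x - f k x) ^ p) \<in> borel_measurable hl" for n by measurable
  show "(NN x. ennreal (w x * (f (n + k) x - f k x) ^ p)) <= ennreal (C * (1/2) ^ k)" for n by (rule le) simp
  show "AE x in hl. (%n. w x * (f (n + k) x - f k x) ^ p) ----> w x * (F x - f k x) ^ p"
   using conv
  proof eventually_elim
   case (elim x)
   then have "(%n. f n x) ----> F x" by (simp add: F_def convergent_LIMSEQ_iff)
   then have "(%n. f (n + k) x) ----> F x" by (rule LIMSEQ_ignore_initial_segment)
   then show ?case by (intro tendsto_intros)
  qed
 qed
 with Fm show ?thesis by blast
qed

section \<open>Profiles of elements of the critical space\<close>

definition Hhalf :: "(real => real) => bool" where "Hhalf g \<longleftrightarrow> g \<in> BM \<and> ns g < \<infinity>"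

definition Hdual :: "(real => real) => bool" where "Hdual g \<longleftrightarrow> g \<in> BM \<and> nm g < \<infinity>"

lemma Hhalf_measurable[measurable_dest]: "Hhalf g ==> g \<in> BM" by (simp add: Hhalf_def)
lemma Hdual_measurable[measurable_dest]: "Hdual g ==> g \<in> BM" by (simp add: Hdual_def)

lemma Hhalf_diff: "Hhalf f ==> Hhalf g ==> Hhalf (%l. f l - g l)"
 using ns_diff_le[of f g] by (auto simp: Hhalf_def ennreal_mult_less_top intro: le_less_trans)

lemma Hhalf_add: "Hhalf f ==> Hhalf g ==> Hhalf (%l. f l + g l)"
 using ns_add_le[of f g] by (auto simp: Hhalf_def ennreal_mult_less_top intro: le_less_trans)

lemma Hdual_diff: "Hdual f ==> Hdual g ==> Hdual (%l. f l - g l)"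
 using nm_diff_le[of f g] by (auto simp: Hdual_def ennreal_mult_less_top intro: le_less_trans)

lemma Hhalf_cmult: "Hhalf f ==> Hhalf (%l. c * f l)"
 using ns_cmult[of f c] by (auto simp: Hhalf_def ennreal_mult_less_top)

lemma Hhalf_zero[simp]: "Hhalf (%l. 0)" and ns_zero[simp]: "ns (%l. 0) = 0" and Hdual_zero[simp]: "Hdual (%l. 0)" and nm_zero[simp]: "nm (%l. 0) = 0"
 by (auto simp: Hhalf_def Hdual_def ns_def nm_def)

text \<open>The integral defining the sine transform of an element of \<open>L^2(l dl)\<close> may diverge at \<open>l = 0\<close> and at infinity;
  the profile is the limit in \<open>L^4(dx/x)\<close> of transforms that converge.\<close>

definition profile_rep :: "(real => real) => (real => real) => bool" where
 "profile_rep v g \<longleftrightarrow> v \<in> BM \<and> Hhalf g \<and>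
   (\<exists>gk. (\<forall>k. sine_class (gk k)) \<and> (%k. ns (%l. gk k l - g l)) ----> 0 \<and>
    (%k. E4 (%x. sine_tr (gk k) x - v x)) ----> 0)"

lemma profile_rep_measurable[measurable_dest]: "profile_rep v g ==> v \<in> BM"
 and profile_rep_Hhalf: "profile_rep v g ==> Hhalf g"
 by (simp_all add: profile_rep_def)

lemma sine_class_measurable[measurable_dest]: "sine_class g ==> g \<in> BM"
 by (simp add: sine_class_def)

lemma sine_class_diff: "sine_class f ==> sine_class g ==> sine_class (%l. f l - g l)"
 by (auto simp: sine_class_def right_diff_distrib)

lemma sine_tr_diff:
 "sine_class f ==> sine_class g ==> 0 < x ==> sine_tr (%l. f l - g l) x = sine_tr f x - sine_tr g x"
 using sine_class_integrable[of f x] sine_class_integrable[of g x] by (simp add: sine_tr_def right_diff_distrib)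

lemma profile_rep_sine_tr: "sine_class g ==> Hhalf g ==> profile_rep (sine_tr g) g"
 unfolding profile_rep_def by (auto intro!: exI[of _ "%_. g"] sine_tr_measurable simp: E4_def dest: sine_class_measurable)

lemma ennreal_tendsto_0_squeeze:
 fixes f g :: "'a => ennreal"
 assumes "(g \<longlongrightarrow> 0) F" "!!x. f x <= c * g x" "c < \<top>" shows "(f \<longlongrightarrow> 0) F"
proof (rule tendsto_sandwich[OF _ _ tendsto_const])
 show "((%x. c * g x) \<longlongrightarrow> 0) F" using ennreal_tendsto_cmult[OF assms(3,1)] by simp
qed (use assms(2) in auto)

lemma profile_rep_diff:
 assumes "profile_rep v g" "profile_rep v' g'" shows "profile_rep (%x. v x - v' x) (%l. g l - g' l)"
proof -
 obtain gk where gk: "!!k. sine_class (gk k)" "(%k. ns (%l. gk k l - g l)) ----> 0" "(%k. E4 (%x. sine_tr (gk k) x - v x)) ----> 0"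
  using assms(1) unfolding profile_rep_def by blast
 obtain gk' where gk': "!!k. sine_class (gk' k)" "(%k. ns (%l. gk' k l - g' l)) ----> 0" "(%k. E4 (%x. sine_tr (gk' k) x - v' x)) ----> 0"
  using assms(2) unfolding profile_rep_def by blast
 note [measurable] = gk(1)[THEN sine_class_measurable] gk'(1)[THEN sine_class_measurable]
  assms[THEN profile_rep_measurable] assms[THEN profile_rep_Hhalf, THEN Hhalf_measurable]
 have 1: "(%k. ns (%l. (gk k l - gk' k l) - (g l - g' l))) ----> 0"
 proof (rule ennreal_tendsto_0_squeeze)
  show "(%k. ns (%l. gk k l - g l) + ns (%l. gk' k l - g' l)) ----> 0" using tendsto_add[OF gk(2) gk'(2)] by simp
  show "ns (%l. (gk k l - gk' k l) - (g l - g' l)) <= 2 * (ns (%l. gk k l - g l) + ns (%l. gk' k l - g' l))" for k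
   using ns_diff_le[of "%l. gk k l - g l" "%l. gk' k l - g' l"] by (simp add: algebra_simps)
 qed simp
 have 2: "(%k. E4 (%x. sine_tr (%l. gk k l - gk' k l) x - (v x - v' x))) ----> 0"
 proof (rule ennreal_tendsto_0_squeeze)
  show "(%k. E4 (%x. sine_tr (gk k) x - v x) + E4 (%x. sine_tr (gk' k) x - v' x)) ----> 0" using tendsto_add[OF gk(3) gk'(3)] by simp
  fix k
  have "E4 (%x. sine_tr (%l. gk k l - gk' k l) x - (v x - v' x)) = E4 (%x. (sine_tr (gk k) x - v x) - (sine_tr (gk' k) x - v' x))"
   by (intro E4_cong_AE AE_hlI) (simp add: sine_tr_diff gk gk')
  also have "... <= 8 * (E4 (%x. sine_tr (gk k) x - v x) + E4 (%x. sine_tr (gk' k) x - v' x))" by (rule E4_diff_le) measurable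
  finally show "E4 (%x. sine_tr (%l. gk k l - gk' k l) x - (v x - v' x)) <= 8 * (E4 (%x. sine_tr (gk k) x - v x) + E4 (%x. sine_tr (gk' k) x - v' x))" .
 qed simp
 show ?thesis
  unfolding profile_rep_def
  using 1 2 gk(1) gk'(1) assms
  by (auto intro!: exI[of _ "%k l. gk k l - gk' k l"] sine_class_diff Hhalf_diff dest: profile_rep_Hhalf)
qed

text \<open>The embedding passes to the limit along approximants. The constant is
  \<open>8 * 4 * 2^2\<close>: 8 from the triangle inequality for fourth powers, 4 from the
  convergent case, and \<open>2^2\<close> from the triangle inequality for \<open>ns\<close>,
  squared.\<close>

theorem profile_rep_E4:
 assumes "profile_rep v g" shows "E4 v <= 128 * (ns g)^2"
proof -
 obtain gk where gk: "!!k. sine_class (gk k)" "(%k. ns (%l. gk k l - g l)) ----> 0" "(%k. E4 (%x. sine_tr (gk k) x - v x)) ----> 0"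
  using assms(1) unfolding profile_rep_def by blast
 have g: "Hhalf g" "ns g < \<infinity>" using assms by (auto simp: profile_rep_def Hhalf_def)
 note [measurable] = gk(1)[THEN sine_class_measurable] assms[THEN profile_rep_measurable] g(1)[THEN Hhalf_measurable]
 have "E4 v <= 8 * (4 * (2 * (ns (%l. gk k l - g l) + ns g))^2 + E4 (%x. sine_tr (gk k) x - v x))" for k
 proof -
  have "E4 v <= 8 * (E4 (sine_tr (gk k)) + E4 (%x. sine_tr (gk k) x - v x))"
   using E4_diff_le[of "sine_tr (gk k)" "%x. sine_tr (gk k) x - v x"] by simp
  also have "E4 (sine_tr (gk k)) <= 4 * (ns (gk k))^2" by (rule E4_sine_tr_le[OF gk(1)])
  also have "ns (gk k) <= 2 * (ns (%l. gk k l - g l) + ns g)"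
   using ns_add_le[of "%l. gk k l - g l" g] by simp
  finally show ?thesis by (simp add: add_mono mult_left_mono power_mono)
 qed
 moreover have "(%k. 8 * (4 * (2 * (ns (%l. gk k l - g l) + ns g))^2 + E4 (%x. sine_tr (gk k) x - v x)))
   ----> 8 * (4 * (2 * (0 + ns g))^2 + 0)"
  unfolding power2_eq_square
  using g(2) by (intro ennreal_tendsto_cmult tendsto_add tendsto_mult_ennreal gk tendsto_const) (auto simp: ennreal_mult_eq_top_iff)
 ultimately have "E4 v <= 8 * (4 * (2 * (0 + ns g))^2 + 0)" by (intro LIMSEQ_le_const) auto
 also have "... = 128 * (ns g)^2" by (simp add: power_mult_distrib mult.assoc[symmetric])
 finally show ?thesis .
qed

lemma profile_rep_unique:
 assumes "profile_rep v g" "profile_rep v' g'" "AE l in hl. g l = g' l" shows "AE x in hl. v x = v' x"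
proof -
 have "ns (%l. g l - g' l) = ns (%l. 0)" using assms(3) by (intro ns_cong_AE) auto
 then have "E4 (%x. v x - v' x) = 0" using profile_rep_E4[OF profile_rep_diff[OF assms(1,2)]] by simp
 then have "AE x in hl. v x - v' x = 0"
  using assms(1,2)[THEN profile_rep_measurable] by (intro E4_eq_0_AE) auto
 then show ?thesis by simp
qed

lemma profile_rep_cong:
 assumes "profile_rep v g" "AE l in hl. g l = g' l" "AE x in hl. v x = v' x" "g' \<in> BM" "v' \<in> BM"
 shows "profile_rep v' g'"
proof -
 have "ns g' = ns g" using assms(2) by (intro ns_cong_AE) (auto elim: eventually_mono)
 moreover have "ns (%l. h l - g' l) = ns (%l. h l - g l)" for h using assms(2) by (intro ns_cong_AE) (auto elim: eventually_mono)
 moreover have "E4 (%x. h x - v' x) = E4 (%x. h x - v x)" for h using assms(3) by (intro E4_cong_AE) (auto elim: eventually_mono)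
 ultimately show ?thesis using assms unfolding profile_rep_def Hhalf_def by simp
qed

text \<open>On bounded frequencies the inequality \<open>z <= 1 + z^2\<close> derives integrability
  from \<open>ns\<close>. Near \<open>l = 0\<close> the factor \<open>min 1 l\<close> provides the
  weight, because its square is at most \<open>l\<close>. A cut at high frequencies is therefore
  enough for absolute convergence.\<close>

lemma Hhalf_cutoff:
 assumes g: "Hhalf g" shows "sine_class (%l. indicator {..<K} l * g l)" "Hhalf (%l. indicator {..<K} l * g l)"
proof -
 note [measurable] = Hhalf_measurable[OF g]
 have "ns (%l. indicator {..<K} l * g l) <= ennreal (1^2) * ns g"
  unfolding ns_wsq by (rule wsq_mult_le) (auto simp: indicator_def)
 then show "Hhalf (%l. indicator {..<K} l * g l)" using g by (auto simp: Hhalf_def intro: le_less_trans)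
 have "integrable hl (%l. min 1 l * (indicator {..<K} l * g l))"
 proof (rule integrable_hl_bound)
  have "integrable hl (%l. l * (g l)^2)"
   using g by (intro integrableI_nonneg) (auto simp: Hhalf_def ns_def intro!: AE_hlI)
  moreover have "integrable hl (%l. indicator {..<K} l :: real)"
  proof (rule integrableI_nonneg)
   have "(NN l. ennreal (indicator {..<K} l)) = emeasure lborel {0<..<K}"
    by (subst nn_integral_hl, measurable, subst nn_integral_indicator[symmetric], simp, intro nn_integral_cong)
     (auto simp: indicator_def)
   also have "... < \<infinity>" using emeasure_bounded_finite[of "{0<..<K}"] by simp
   finally show "(NN l. ennreal (indicator {..<K} l)) < \<infinity>" .
  qed auto
  ultimately show "integrable hl (%l. indicator {..<K} l + l * (g l)^2)" by (intro Bochner_Integration.integrable_add)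
  fix l :: real assume l: "0 < l"
  have "\<bar>min 1 l * g l\<bar> <= 1 + l * (g l)^2"
  proof -
   have "(min 1 l * \<bar>g l\<bar>)^2 <= l * (g l)^2"
   proof -
    have "(min 1 l)^2 <= l" using l by (simp add: min_def power2_eq_square mult_left_le_one_le)
    from mult_right_mono[OF this, of "(g l)^2"] show ?thesis by (simp add: power_mult_distrib)
   qed
   moreover have "z <= 1 + z^2" for z :: real
   proof -
    have "2 * z <= z^2 + 1" using zero_le_power2[of "z - 1"] by (simp add: power2_diff)
    moreover have "0 <= z^2" by simp
    ultimately show ?thesis by linarith
   qed
   note facts = calculation this
   from facts(2)[of "min 1 l * \<bar>g l\<bar>"] facts(1) have "min 1 l * \<bar>g l\<bar> <= 1 + l * (g l)^2" by linarith
   then show ?thesis using l by (simp add: abs_mult)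
  qed
  then show "\<bar>min 1 l * (indicator {..<K} l * g l)\<bar> <= \<bar>indicator {..<K} l + l * (g l)^2\<bar>"
   using l by (auto simp: indicator_def)
 qed measurable
 then show "sine_class (%l. indicator {..<K} l * g l)" unfolding sine_class_def by auto
qed

lemma ns_tendsto_0_dominated:
 assumes [measurable]: "!!k. f k \<in> BM" and g: "Hhalf g"
  and le: "!!k l. 0 < l ==> \<bar>f k l\<bar> <= \<bar>g l\<bar>" and lim: "!!l. 0 < l ==> (%k. f k l) ----> 0"
 shows "(%k. ns (f k)) ----> 0"
proof -
 note [measurable] = Hhalf_measurable[OF g]
 have "(%k. NN l. ennreal (l * (f k l)^2)) ----> (NN l. 0)"
 proof (rule nn_integral_dominated_convergence[where w="%l. ennreal (l * (g l)^2)"])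
  show "AE l in hl. ennreal (l * (f k l)^2) <= ennreal (l * (g l)^2)" for k
   using le by (auto intro!: AE_hlI ennreal_leI mult_left_mono simp: abs_le_square_iff)
  show "AE l in hl. (%k. ennreal (l * (f k l)^2)) ----> 0"
  proof (rule AE_hlI)
   fix l :: real assume "0 < l"
   have "(%k. l * (f k l)^2) ----> l * 0^2" by (intro tendsto_intros lim \<open>0 < l\<close>)
   then show "(%k. ennreal (l * (f k l)^2)) ----> 0" using tendsto_ennrealI by fastforce
  qed
  show "(NN l. ennreal (l * (g l)^2)) < \<infinity>" using g by (simp add: Hhalf_def ns_def)
 qed auto
 then show ?thesis by (simp add: ns_def)
qed

lemma Hhalf_cutoff_tendsto:
 assumes g: "Hhalf g" shows "(%k. ns (%l. indicator {..<real k} l * g l - g l)) ----> 0"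
proof (rule ns_tendsto_0_dominated[OF _ g])
 note [measurable] = Hhalf_measurable[OF g]
 show "(%l. indicator {..<real k} l * g l - g l) \<in> BM" for k by measurable
 show "\<bar>indicator {..<real k} l * g l - g l\<bar> <= \<bar>g l\<bar>" for k l by (simp add: indicator_def)
 fix l :: real
 have "\<forall>\<^sub>F k in sequentially. indicator {..<real k} l * g l - g l = 0"
  using eventually_gt_at_top[of "nat \<lceil>l\<rceil>"] by eventually_elim (auto simp: indicator_def, linarith)
 then show "(%k. indicator {..<real k} l * g l - g l) ----> 0" by (rule tendsto_eventually)
qed

text \<open>The transforms of the high-frequency cutoffs form a Cauchy sequence in
  \<open>L^4(dx/x)\<close> by the embedding; a fast subsequence has an almost everywhere
  limit.\<close>

theorem profile_rep_exists:
 assumes g: "Hhalf g" shows "\<exists>v. profile_rep v g"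
proof -
 note [measurable] = Hhalf_measurable[OF g]
 let ?c = "%k l. indicator {..<real k} l * g l"
 \<comment> \<open>The factor 1/4 makes twice the sum of two such errors at most
   \<open>(1/2) ^ k\<close>.\<close>
 have "\<exists>n. ns (%l. ?c n l - g l) < ennreal ((1/4) * (1/2) ^ k)" for k
  using order_tendstoD(2)[OF Hhalf_cutoff_tendsto[OF g], of "ennreal ((1/4) * (1/2) ^ k)"]
  by (auto simp: eventually_sequentially)
 then obtain n where n: "!!k. ns (%l. ?c (n k) l - g l) < ennreal ((1/4) * (1/2) ^ k)" by metis
 let ?g = "%k. ?c (n k)"
 have sc: "sine_class (?g k)" for k by (rule Hhalf_cutoff[OF g])
 have m[measurable]: "sine_tr (?g k) \<in> BM" for k by (rule sine_tr_measurable) measurable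
 have le: "(NN x. ennreal (inverse x * (sine_tr (?g j) x - sine_tr (?g k) x) ^ 4)) <= ennreal (4 * (1/2) ^ k)" if "k <= j" for j k
 proof -
  have "(NN x. ennreal (inverse x * (sine_tr (?g j) x - sine_tr (?g k) x) ^ 4)) = E4 (sine_tr (%l. ?g j l - ?g k l))"
   unfolding E4_def by (intro nn_integral_hl_cong) (simp only: sine_tr_diff[OF sc sc] divide_inverse mult.commute[of "inverse _"])
  also have "... <= 4 * (ns (%l. ?g j l - ?g k l))^2" by (intro E4_sine_tr_le sine_class_diff sc)
  also have "ns (%l. ?g j l - ?g k l) <= 2 * (ns (%l. ?g j l - g l) + ns (%l. ?g k l - g l))"
   using ns_diff_le[of "%l. ?g j l - g l" "%l. ?g k l - g l"] by simp
  also have "... <= 2 * (ennreal ((1/4) * (1/2) ^ k) + ennreal ((1/4) * (1/2) ^ k))"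
  proof -
   have "(1/2 :: real) ^ j <= (1/2) ^ k" using that by (intro power_decreasing) auto
   then have "ns (%l. ?g j l - g l) <= ennreal ((1/4) * (1/2) ^ k)"
    using n[of j] by (intro order_trans[OF less_imp_le[OF n[of j]]] ennreal_leI) auto
   then show ?thesis using n[of k] by (intro mult_left_mono add_mono) auto
  qed
  also have "... = ennreal ((1/2) ^ k)" by (simp flip: ennreal_plus ennreal_numeral ennreal_mult)
  finally have "(NN x. ennreal (inverse x * (sine_tr (?g j) x - sine_tr (?g k) x) ^ 4)) <= 4 * (ennreal ((1/2) ^ k))^2"
   by (simp add: power_mono mult_left_mono)
  also have "... <= ennreal (4 * (1/2) ^ k)"
  proof -
   have "(1/2 :: real) ^ k * (1/2) ^ k <= (1/2) ^ k * 1" by (intro mult_left_mono power_le_one) auto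
   then have "ennreal (4 * ((1/2) ^ k)^2) <= ennreal (4 * (1/2) ^ k)" by (intro ennreal_leI) (simp add: power2_eq_square)
   then show ?thesis by (simp add: ennreal_mult ennreal_power)
  qed
  finally show ?thesis .
 qed
 obtain v where v[measurable]: "v \<in> BM"
  and vk: "!!k. (NN x. ennreal (inverse x * (v x - sine_tr (?g k) x) ^ 4)) <= ennreal (4 * (1/2) ^ k)"
  using geometric_Cauchy_limit[of "%k. sine_tr (?g k)" inverse 4 4, OF m _ _ _ _ _ le] by auto
 have E: "E4 (%x. sine_tr (?g k) x - v x) <= ennreal (4 * (1/2) ^ k)" for k
 proof -
  have "(a - b) ^ 4 = (b - a) ^ 4" for a b :: real
   using power_minus_even[of 4 "a - b"] by simp
  then have "E4 (%x. sine_tr (?g k) x - v x) = (NN x. ennreal (inverse x * (v x - sine_tr (?g k) x) ^ 4))"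
   unfolding E4_def divide_inverse by (simp only: mult.commute)
  then show ?thesis using vk[of k] by (simp only:)
 qed
 have z: "(%k. ennreal (c * (1/2) ^ k)) ----> 0" for c
  using tendsto_ennrealI[OF tendsto_mult_right[OF LIMSEQ_power_zero[of "1/2 :: real"], of c]] by (simp add: mult.commute)
 have "(%k. E4 (%x. sine_tr (?g k) x - v x)) ----> 0"
  by (rule tendsto_sandwich[OF _ _ tendsto_const z[of 4]]) (use E in auto)
 moreover have "(%k. ns (%l. ?g k l - g l)) ----> 0"
  by (rule tendsto_sandwich[OF _ _ tendsto_const z[of "1/4"]]) (use less_imp_le[OF n] in auto)
 ultimately show ?thesis unfolding profile_rep_def using sc g v by (intro exI[of _ v]) (auto intro!: exI[of _ ?g])
qed

text \<open>A choice, because the profile is fixed only up to null sets; by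
  \<open>profile_rep_unique\<close> nothing measured by integrals depends on it.\<close>

definition prof :: "(real => real) => real => real" where "prof g = (SOME v. profile_rep v g)"

lemma prof_rep: "Hhalf g ==> profile_rep (prof g) g"
 unfolding prof_def by (rule someI_ex[OF profile_rep_exists])

text \<open>The part of \<open>\<bar>v\<bar>\<close> above \<open>m\<close> is at most the distance
  from \<open>v\<close> to a transform that obeys the bound, so its \<open>E4\<close> is dominated
  by a sequence tending to 0.\<close>

lemma profile_rep_bound:
 assumes v: "profile_rep v g" and [measurable]: "m \<in> BM" and b: "!!k x. 0 < x ==> \<bar>sine_tr (%l. indicator {..<real k} l * g l) x\<bar> <= m x"
 shows "AE x in hl. \<bar>v x\<bar> <= m x"
proof -
 have g: "Hhalf g" using v by (rule profile_rep_Hhalf)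
 note [measurable] = profile_rep_measurable[OF v] Hhalf_measurable[OF g]
 let ?g = "%k l. indicator {..<real k} l * g l"
 note [measurable] = sine_tr_measurable[of "?g k" for k]
 define w where "w x = max 0 (\<bar>v x\<bar> - m x)" for x
 have [measurable]: "w \<in> BM" unfolding w_def by measurable
 have le: "E4 w <= 128 * (ns (%l. ?g k l - g l))^2" for k
 proof -
  have "E4 w <= E4 (%x. sine_tr (?g k) x - v x)" unfolding E4_def
  proof (rule nn_integral_hl_mono)
   fix x :: real assume x: "0 < x"
   have "w x <= \<bar>sine_tr (?g k) x - v x\<bar>" using b[OF x, of k] by (auto simp: w_def)
   then have "(w x) ^ 4 <= \<bar>sine_tr (?g k) x - v x\<bar> ^ 4" by (intro power_mono) (auto simp: w_def)
   then show "ennreal ((w x) ^ 4 / x) <= ennreal ((sine_tr (?g k) x - v x) ^ 4 / x)"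
    using x by (intro ennreal_leI divide_right_mono) (auto simp: power_even_abs)
  qed
  also have "... <= 128 * (ns (%l. ?g k l - g l))^2"
   by (intro profile_rep_E4 profile_rep_diff profile_rep_sine_tr Hhalf_cutoff g v)
  finally show ?thesis .
 qed
 have "(%k. 128 * (ns (%l. ?g k l - g l))^2) ----> 128 * (0 * 0)"
  unfolding power2_eq_square by (intro ennreal_tendsto_cmult tendsto_mult_ennreal Hhalf_cutoff_tendsto g) auto
 then have "E4 w <= 128 * (0 * 0)" using le by (intro LIMSEQ_le_const) auto
 then have "AE x in hl. w x = 0" by (intro E4_eq_0_AE) auto
 then show ?thesis by eventually_elim (auto simp: w_def max_def split: if_splits)
qed

section \<open>Duality and the master Lipschitz estimate\<close>

lemma Cauchy_Schwarz_hl: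
 fixes f g :: "real => real"
 assumes [measurable]: "f \<in> BM" "g \<in> BM" and "0 <= A" "0 <= B"
  and "(NN x. ennreal ((f x)^2)) <= ennreal (A^2)" "(NN x. ennreal ((g x)^2)) <= ennreal (B^2)"
 shows "(NN x. ennreal \<bar>f x * g x\<bar>) <= ennreal (A * B)"
 using Cauchy_Schwarz_real[of "%x. \<bar>f x\<bar>" hl "%x. \<bar>g x\<bar>" A B] assms by (simp add: abs_mult)

lemma sine_tr_le:
 assumes N: "integrable hl N" shows "\<bar>sine_tr N l\<bar> <= (LI x. \<bar>N x\<bar>)"
proof -
 have [measurable]: "N \<in> BM" using borel_measurable_integrable[OF N] by simp
 have I: "integrable hl (%x. sin (x * l) * N x)"
  by (rule integrable_hl_bound[OF N]) (auto simp: abs_mult intro!: mult_left_le_one_le)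
 have "\<bar>sine_tr N l\<bar> <= 1 * \<bar>\<integral>x. sin (x * l) * N x \<partial>hl\<bar>"
  unfolding sine_tr_def abs_mult using cS_le_1 cS_nonneg by (intro mult_right_mono) auto
 also have "... <= (LI x. \<bar>sin (x * l) * N x\<bar>)" by simp
 also have "... <= (LI x. \<bar>N x\<bar>)"
  using integrable_norm[OF I] integrable_norm[OF N]
  by (intro integral_hl_mono) (auto simp: abs_mult intro!: mult_left_le_one_le)
 finally show ?thesis .
qed

lemma sine_tr_continuous:
 assumes N: "integrable hl N" shows "continuous_on UNIV (sine_tr N)"
proof -
 have [measurable]: "N \<in> BM" using borel_measurable_integrable[OF N] by simp
 have "isCont (sine_tr N) l" for l
  unfolding continuous_at_sequentially
 proof (intro allI impI)
   fix s assume s: "s ----> l"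
   have "(%n. LI x. sin (x * s n) * N x) ----> (LI x. sin (x * l) * N x)"
   proof (rule integral_dominated_convergence[where w="%x. \<bar>N x\<bar>"])
    show "AE x in hl. (%n. sin (x * s n) * N x) ----> sin (x * l) * N x"
     by (intro AE_I2 tendsto_intros s)
    show "AE x in hl. norm (sin (x * s n) * N x) <= \<bar>N x\<bar>" for n
     by (auto simp: abs_mult intro!: mult_left_le_one_le)
   qed (use N in auto)
   then show "(sine_tr N \<circ> s) ----> sine_tr N l"
    unfolding sine_tr_def comp_def by (intro tendsto_intros)
 qed
 then show ?thesis by (simp add: continuous_on_eq_continuous_at)
qed

lemma sine_tr_symmetric:
 assumes N: "integrable hl N" and h: "integrable hl h"
 shows "(LI l. h l * sine_tr N l) = (LI x. N x * sine_tr h x)"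
proof -
 have "(LI l. h l * sine_tr N l) = cS * (LI l. h l * (LI x. (%(l, x). sin (x * l)) (l, x) * N x))"
  by (simp add: sine_tr_def mult.left_commute[of _ cS])
 also have "... = cS * (LI x. N x * (LI l. (%(l, x). sin (x * l)) (l, x) * h l))"
  by (subst hl2.bounded_kernel_Fubini[OF h N, where C=1]) auto
 also have "... = (LI x. N x * sine_tr h x)"
  by (simp add: sine_tr_def mult.left_commute[of _ cS] mult.commute)
 finally show ?thesis .
qed

lemma integrable_indicator_hl:
 assumes [measurable]: "A \<in> sets borel" and "bounded A" shows "integrable hl (%l. indicator A l :: real)"
proof (rule integrableI_nonneg)
 have "(NN l. ennreal (indicator A l)) <= (\<integral>\<^sup>+l. indicator A l \<partial>lborel)"
  by (subst nn_integral_hl, measurable, intro nn_integral_mono) (auto simp: indicator_def)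
 also have "... = emeasure lborel A" by simp
 also have "... < \<infinity>" using emeasure_bounded_finite[OF assms(2)] by simp
 finally show "(NN l. ennreal (indicator A l)) < \<infinity>" .
qed auto

text \<open>Duality with the embedding. Testing \<open>N\<close> against the transform of
  \<open>h l = sine_tr N l / l\<close>, restricted to a bounded band of frequencies, gives
  \<open>A = ns h\<close> on one side and at most \<open>\<kappa> * sqrt (2 * A)\<close> on the
  other. The band makes \<open>A\<close> finite, so one power of it can be absorbed; Fatou's lemma
  then exhausts the half line by such bands.\<close>

lemma nm_sine_tr_le:
 assumes N: "integrable hl N" and kap: "0 <= \<kappa>"
  and dual: "!!phi m. phi \<in> BM ==> 0 <= m ==> E4 phi <= ennreal (m ^ 4) ==>
   (NN x. ennreal \<bar>N x * phi x\<bar>) <= ennreal (\<kappa> * m)"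
 shows "nm (sine_tr N) <= ennreal (2 * \<kappa>^2)"
proof -
 have [measurable]: "N \<in> BM" using borel_measurable_integrable[OF N] by simp
 let ?n = "sine_tr N"
 have nm': "?n \<in> BM" by measurable
 define B where "B = (LI x. \<bar>N x\<bar>)"
 have B: "\<bar>?n l\<bar> <= B" for l unfolding B_def by (rule sine_tr_le[OF N])
 have fin: "(NN l. ennreal (indicator {1/real (Suc k)<..<real (Suc k)} l * (?n l)^2 / l)) <= ennreal (2 * \<kappa>^2)" for k
 proof -
  define K where "K = real (Suc k)"
  have K: "0 < K" by (simp add: K_def)
  define h where "h l = indicator {1/K<..<K} l * ?n l / l" for l
  have hm[measurable]: "h \<in> BM" unfolding h_def by measurable
  have "integrable hl (%l. indicator {1/K<..<K} l :: real)"
   by (rule integrable_indicator_hl) auto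
  then have Ib: "integrable hl (%l. C * indicator {1/K<..<K} l)" for C :: real by auto
  have ib: "\<bar>?n l / l\<bar> <= B * K" if "1/K < l" for l
  proof -
   have "0 < l" using that K by (metis less_trans zero_less_divide_1_iff)
   then have "\<bar>?n l / l\<bar> = \<bar>?n l\<bar> * (1 / l)" by (simp add: abs_divide)
   also have "... <= B * K" using B[of l] that K \<open>0 < l\<close> by (intro mult_mono) (auto simp: field_simps)
   finally show ?thesis .
  qed
  have h: "integrable hl h"
  proof (rule integrable_hl_bound[OF Ib])
   show "\<bar>h l\<bar> <= \<bar>(B * K) * indicator {1/K<..<K} l\<bar>" for l
    using ib[of l] by (auto simp: h_def indicator_def)
  qed measurable
  have nB: "0 <= B" using B[of 0] by linarith
  have hn: "integrable hl (%l. h l * ?n l)"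
  proof (rule integrable_hl_bound[OF Ib])
   show "\<bar>h l * ?n l\<bar> <= \<bar>(B * K * B) * indicator {1/K<..<K} l\<bar>" for l
    using mult_mono[OF ib[of l] B[of l]] nB K by (auto simp: h_def indicator_def abs_mult)
  qed measurable
  define A where "A = (LI l. h l * ?n l)"
  have eq: "(NN l. ennreal (indicator {1/K<..<K} l * (?n l)^2 / l)) = ennreal A"
  proof -
   have "(NN l. ennreal (indicator {1/K<..<K} l * (?n l)^2 / l)) = (NN l. ennreal (h l * ?n l))"
    by (simp add: h_def power2_eq_square mult.assoc)
   also have "... = ennreal A" unfolding A_def
   proof (rule nn_integral_eq_integral[OF hn AE_hlI])
    fix l :: real assume "0 < l"
    then show "0 <= h l * ?n l" by (simp add: h_def indicator_def)
   qed
   finally show ?thesis .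
  qed
  have A0: "0 <= A" unfolding A_def by (rule integral_nonneg_AE, rule AE_hlI) (simp add: h_def indicator_def)
  have nsh: "ns h = ennreal A"
   unfolding eq[symmetric] ns_def by (intro nn_integral_hl_cong) (simp add: h_def indicator_def power2_eq_square)
  have "integrable hl (%l. min 1 l * h l)" by (rule integrable_hl_bound[OF h]) (auto simp: abs_mult intro!: mult_left_le_one_le)
  then have sc: "sine_class h" by (auto simp: sine_class_def)
  \<comment> \<open>Chosen so that \<open>m ^ 4 = 4 * A^2\<close>, the bound of
    \<open>E4_sine_tr_le\<close> for \<open>ns h = A\<close>.\<close>
  define m where "m = sqrt (2 * A)"
  have m4: "m ^ 4 = 4 * A^2"
  proof -
   have "m ^ 4 = (m^2)^2" by (simp flip: power_mult)
   then show ?thesis using A0 by (simp add: m_def power_mult_distrib)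
  qed
  have E: "E4 (sine_tr h) <= ennreal (m ^ 4)"
   using E4_sine_tr_le[OF sc] A0 by (simp add: nsh m4 ennreal_mult ennreal_power)
  have "ennreal A <= ennreal (\<kappa> * m)"
  proof -
   have Aeq: "A = (LI x. N x * sine_tr h x)" unfolding A_def by (rule sine_tr_symmetric[OF N h])
   have "ennreal A <= (NN x. ennreal \<bar>N x * sine_tr h x\<bar>)"
   proof (cases "integrable hl (%x. N x * sine_tr h x)")
    case True
    have "ennreal A <= ennreal (norm (LI x. N x * sine_tr h x))" unfolding Aeq by (rule ennreal_leI) simp
    also have "... <= (NN x. ennreal (norm (N x * sine_tr h x)))" by (rule integral_norm_bound_ennreal[OF True])
    finally show ?thesis by simp
   qed (simp add: Aeq not_integrable_integral_eq)
   also have "... <= ennreal (\<kappa> * m)" by (rule dual) (use E A0 in "auto simp: m_def")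
   finally show ?thesis .
  qed
  then have le: "A <= \<kappa> * m" using kap A0 by (simp add: m_def)
  have "A <= 2 * \<kappa>^2"
  proof (cases "A = 0")
   case False
   have "A^2 <= (\<kappa> * m)^2" using le A0 by (rule power_mono)
   moreover have "m^2 = 2 * A" using A0 by (simp add: m_def)
   ultimately have "A * A <= (2 * \<kappa>^2) * A" by (simp add: power_mult_distrib power2_eq_square[of A] mult.left_commute)
   then show ?thesis using False A0 by simp
  qed simp
  then show ?thesis using eq unfolding K_def by (simp add: ennreal_leI)
 qed
 show ?thesis unfolding nm_def
 proof (rule nn_integral_le_of_tendsto[OF _ _ fin])
  show "(%l. indicator {1/real (Suc k)<..<real (Suc k)} l * (?n l)^2 / l) \<in> borel_measurable hl" for k by measurable
  show "AE l in hl. (%k. indicator {1/real (Suc k)<..<real (Suc k)} l * (?n l)^2 / l) ----> (?n l)^2 / l"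
  proof (rule AE_hlI)
   fix l :: real assume l: "0 < l"
   have "\<forall>\<^sub>F k in sequentially. 1 / l < real (Suc k) \<and> l < real (Suc k)"
    by (intro eventually_conj; real_asymp)
   then have "\<forall>\<^sub>F k in sequentially. indicator {1/real (Suc k)<..<real (Suc k)} l * (?n l)^2 / l = (?n l)^2 / l"
    by eventually_elim (use l in "auto simp: field_simps indicator_def")
   then show "(%k. indicator {1/real (Suc k)<..<real (Suc k)} l * (?n l)^2 / l) ----> (?n l)^2 / l" by (rule tendsto_eventually)
  qed
 qed
qed

lemma nn_integral_inverse_square: "(NN x. ennreal ((1 / (1 + x))^2)) <= 1"
proof -
 have "(NN x. ennreal ((1 / (1 + x))^2)) <= (\<integral>\<^sup>+x. ennreal ((1 / (1 + x))^2) * indicator {0..} x \<partial>lborel)"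
  by (subst nn_integral_hl) (auto intro!: nn_integral_mono simp: indicator_def)
 also have "... = 0 - (- 1 / (1 + 0 :: real))"
 proof (rule nn_integral_FTC_atLeast)
  show "DERIV (%x. - 1 / (1 + x)) x :> (1 / (1 + x))^2" if "0 <= x" for x :: real
   using that by (auto intro!: derivative_eq_intros simp: power2_eq_square)
  show "((%x::real. - 1 / (1 + x)) \<longlongrightarrow> 0) at_top" by real_asymp
 qed auto
 finally show ?thesis by simp
qed

lemma E4_Cauchy_Schwarz:
 assumes [measurable]: "d \<in> BM" "phi \<in> BM" and "0 <= D" "0 <= m"
  and d: "E4 d <= ennreal (D ^ 4)" and phi: "E4 phi <= ennreal (m ^ 4)"
 shows "(NN x. ennreal ((d x * phi x / sqrt x)^2)) <= ennreal ((D * m)^2)"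
proof -
 have e: "(NN x. ennreal (((f x)^2 / sqrt x)^2)) = E4 f" for f :: "real => real"
  unfolding E4_def by (intro nn_integral_hl_cong) (simp add: power_divide flip: power_mult)
 have "(NN x. ennreal ((d x * phi x / sqrt x)^2)) = (NN x. ennreal \<bar>((d x)^2 / sqrt x) * ((phi x)^2 / sqrt x)\<bar>)"
  by (intro nn_integral_hl_cong) (simp add: power_divide power_mult_distrib)
 also have "... <= ennreal (D^2 * m^2)"
  by (rule Cauchy_Schwarz_hl) (use d phi in "auto simp: e simp flip: power_mult")
 finally show ?thesis by (simp add: power_mult_distrib)
qed

text \<open>Hoelder's inequality in the splitting \<open>(p * sqrt x) * (d * phi / sqrt x)\<close>:
  two functions of \<open>L^4(dx/x)\<close> make the second factor square integrable, and
  \<open>x <= (1 + x)^2\<close> puts the first one under \<open>Q\<close>. The dual norm follows by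
  \<open>nm_sine_tr_le\<close>. The \<open>L^1\<close> bound uses the same splitting after an
  auxiliary \<open>f0\<close> has been multiplied in and divided out.\<close>

theorem sine_tr_master:
 assumes [measurable]: "N \<in> BM" "p \<in> BM" "d \<in> BM"
  and N: "!!x. 0 < x ==> \<bar>N x\<bar> <= p x * \<bar>d x\<bar>" and p0: "!!x. 0 < x ==> 0 <= p x"
  and Q: "(NN x. ennreal ((1 + x)^2 * (p x)^2)) <= ennreal (Q^2)" "0 <= Q"
  and D: "E4 d <= ennreal (D ^ 4)" "0 <= D"
 shows "integrable hl N" "(LI x. \<bar>N x\<bar>) <= Q * D" "nm (sine_tr N) <= ennreal (2 * (Q * D)^2)"
proof -
 have wp: "(NN x. ennreal ((p x * q x)^2)) <= ennreal (Q^2)"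
  if q: "!!x. 0 < x ==> (q x)^2 <= (1 + x)^2" for q :: "real => real"
 proof -
  have "(NN x. ennreal ((p x * q x)^2)) <= (NN x. ennreal ((1 + x)^2 * (p x)^2))"
  proof (intro nn_integral_hl_mono ennreal_leI)
   fix x :: real assume x: "0 < x"
   show "(p x * q x)^2 <= (1 + x)^2 * (p x)^2"
    using mult_right_mono[OF q[OF x], of "(p x)^2"] by (simp add: power_mult_distrib mult.commute)
  qed
  with Q show ?thesis by simp
 qed
 have poly: "x <= (1 + x)^2" if "0 < x" for x :: real
  using that by (simp add: power2_eq_square algebra_simps)
 have sx: "sqrt x <= 1 + x" if "0 < x" for x :: real
  using that poly by (intro real_le_lsqrt) auto
 have dual: "(NN x. ennreal \<bar>N x * phi x\<bar>) <= ennreal ((Q * D) * m)"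
  if [measurable]: "phi \<in> BM" and m: "0 <= m" "E4 phi <= ennreal (m ^ 4)" for phi m
 proof -
  have "(NN x. ennreal \<bar>N x * phi x\<bar>) <= (NN x. ennreal \<bar>(p x * sqrt x) * (d x * phi x / sqrt x)\<bar>)"
  proof (intro nn_integral_hl_mono ennreal_leI)
   fix x :: real assume x: "0 < x"
   show "\<bar>N x * phi x\<bar> <= \<bar>(p x * sqrt x) * (d x * phi x / sqrt x)\<bar>"
    using mult_right_mono[OF N[OF x], of "\<bar>phi x\<bar>"] x p0[OF x] by (simp add: abs_mult mult.assoc)
  qed
  also have "... <= ennreal (Q * (D * m))"
  proof (rule Cauchy_Schwarz_hl)
   show "(NN x. ennreal ((d x * phi x / sqrt x)^2)) <= ennreal ((D * m)^2)"
    by (rule E4_Cauchy_Schwarz) (use D m in auto)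
   show "(NN x. ennreal ((p x * sqrt x)^2)) <= ennreal (Q^2)"
    by (rule wp) (simp add: poly)
  qed (use Q D m in auto)
  finally show ?thesis by (simp add: mult.assoc)
 qed
 \<comment> \<open>\<open>(f0 x) ^ 4 / x = (1 / (1 + x))^2\<close>, hence \<open>E4 f0 <= 1\<close>,
   while dividing by \<open>f0\<close> costs only
   \<open>(sqrt x / f0 x)^2 = sqrt x * (1 + x) <= (1 + x)^2\<close>.\<close>
 define f0 where "f0 x = sqrt (sqrt x) / sqrt (1 + x)" for x :: real
 have [measurable]: "f0 \<in> BM" unfolding f0_def by measurable
 have "E4 f0 = (NN x. ennreal ((1 / (1 + x))^2))" unfolding E4_def
 proof (rule nn_integral_hl_cong)
  fix x :: real assume x: "0 < x"
  have "(f0 x) ^ 4 = ((f0 x)^2)^2" by (simp flip: power_mult)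
  also have "... = x / (1 + x)^2" using x by (simp add: f0_def power_divide)
  finally show "ennreal ((f0 x) ^ 4 / x) = ennreal ((1 / (1 + x))^2)" using x by (simp add: power_divide)
 qed
 then have f0: "E4 f0 <= ennreal (1 ^ 4)" using nn_integral_inverse_square by simp
 have L1: "(NN x. ennreal \<bar>N x\<bar>) <= ennreal (Q * (D * 1))"
 proof -
  have "(NN x. ennreal \<bar>N x\<bar>) <= (NN x. ennreal \<bar>(p x * (sqrt x / f0 x)) * (d x * f0 x / sqrt x)\<bar>)"
  proof (intro nn_integral_hl_mono ennreal_leI)
   fix x :: real assume x: "0 < x"
   then have "0 < f0 x" by (simp add: f0_def)
   then show "\<bar>N x\<bar> <= \<bar>(p x * (sqrt x / f0 x)) * (d x * f0 x / sqrt x)\<bar>"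
    using N[OF x] x p0[OF x] by (simp add: abs_mult)
  qed
  also have "... <= ennreal (Q * (D * 1))"
  proof (rule Cauchy_Schwarz_hl)
   show "(NN x. ennreal ((d x * f0 x / sqrt x)^2)) <= ennreal ((D * 1)^2)"
    by (rule E4_Cauchy_Schwarz[OF _ _ D(2) _ D(1) f0]) auto
   show "(NN x. ennreal ((p x * (sqrt x / f0 x))^2)) <= ennreal (Q^2)"
   proof (rule wp)
    fix x :: real assume x: "0 < x"
    have "(sqrt x / f0 x)^2 = sqrt x * (1 + x)"
     using x by (simp add: f0_def power_divide power_mult_distrib real_div_sqrt field_simps)
    also have "... <= (1 + x)^2" unfolding power2_eq_square using sx[OF x] x by (intro mult_right_mono) auto
    finally show "(sqrt x / f0 x)^2 <= (1 + x)^2" .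
   qed
  qed (use Q D in auto)
  finally show ?thesis .
 qed
 show I: "integrable hl N"
  by (rule integrableI_bounded) (use L1 in "auto intro: le_less_trans")
 have "ennreal (LI x. \<bar>N x\<bar>) = (NN x. ennreal \<bar>N x\<bar>)"
  using I by (intro nn_integral_eq_integral[symmetric]) auto
 then have "ennreal (LI x. \<bar>N x\<bar>) <= ennreal (Q * D)" using L1 by simp
 then show "(LI x. \<bar>N x\<bar>) <= Q * D" by (subst (asm) ennreal_le_iff) (use Q D in auto)
 show "nm (sine_tr N) <= ennreal (2 * (Q * D)^2)"
  by (rule nm_sine_tr_le[OF I _ dual]) (use Q D in auto)
qed

section \<open>Pointwise inversion\<close>

text \<open>With the odd extension \<open>w\<close> the difference of the two kernels on the half
  line becomes one Poisson kernel on the line. Rescaling by \<open>\<epsilon>\<close> moves the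
  parameter into the argument of \<open>w\<close>, and dominated convergence with the weight
  \<open>inverse (1 + z^2)\<close> of mass \<open>pi\<close> gives the limit.\<close>

lemma abel_means_tendsto:
 fixes v :: "real => real"
 assumes c: "continuous_on {0..} v" and v0: "v 0 = 0" and [measurable]: "v \<in> BM"
  and b: "!!x. 0 <= x ==> \<bar>v x\<bar> <= B" and vi: "integrable hl v" and x: "0 < x"
  and e: "!!n. 0 < e n" "e ----> 0"
 shows "(%n. (LI y. (abelP (e n) (x - y) - abelP (e n) (x + y)) * v y) / pi) ----> v x"
proof -
 define w where "w y = (if 0 <= y then v y else - v (- y))" for y
 have wm[measurable]: "w \<in> BM" unfolding w_def by measurable
 have wb: "\<bar>w y\<bar> <= B" for y using b[of y] b[of "- y"] by (auto simp: w_def)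
 have wc: "isCont w y" if "0 < y" for y
 proof -
  have "continuous_on {0<..} w \<longleftrightarrow> continuous_on {0<..} v" by (rule continuous_on_cong) (auto simp: w_def)
  then have "continuous_on {0<..} w" using continuous_on_subset[OF c, of "{0<..}"] by (simp add: subset_eq)
  then show ?thesis using that by (simp add: continuous_on_eq_continuous_at)
 qed
 have I1: "integrable lborel (%z. inverse (1 + z^2) :: real)"
  using integrable_inverse_1_plus_square by (simp add: set_integrable_def)
 have eq: "(LI y. (abelP \<epsilon> (x - y) - abelP \<epsilon> (x + y)) * v y) = (\<integral>z. inverse (1 + z^2) * w (x + \<epsilon> * z) \<partial>lborel)" if eps: "0 < \<epsilon>" for \<epsilon>
 proof -
  have Pb: "\<bar>abelP \<epsilon> z\<bar> <= 1 / \<epsilon>" for z by (rule abelP_bounded[OF eps])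
  have Iv: "integrable hl (%y. abelP \<epsilon> (h y) * v y)" if [measurable]: "h \<in> BM" for h
  proof (rule integrable_hl_bound)
   show "integrable hl (%y. 1 / \<epsilon> * v y)" using vi by auto
   show "\<bar>abelP \<epsilon> (h y) * v y\<bar> <= \<bar>1 / \<epsilon> * v y\<bar>" for y
    unfolding abs_mult using Pb[of "h y"] eps by (intro mult_right_mono) auto
  qed measurable
  let ?p = "%y. indicator {0<..} y * (abelP \<epsilon> (x - y) * v y)"
  let ?q = "%y. indicator {0<..} y * (abelP \<epsilon> (x + y) * v y)"
  have Ip: "integrable lborel ?p" "integrable lborel ?q"
   using Iv[of "%y. x - y"] Iv[of "%y. x + y"] by (simp_all add: integrable_hl set_integrable_def)
  have Iq': "integrable lborel (%y. ?q (- y))"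
   using lborel_integrable_real_affine[OF Ip(2), of "-1" 0] by simp
  have "(LI y. (abelP \<epsilon> (x - y) - abelP \<epsilon> (x + y)) * v y) = (LI y. abelP \<epsilon> (x - y) * v y) - (LI y. abelP \<epsilon> (x + y) * v y)"
   unfolding left_diff_distrib by (rule Bochner_Integration.integral_diff) (use Iv[of "%y. x - y"] Iv[of "%y. x + y"] in auto)
  also have "... = (\<integral>y. ?p y \<partial>lborel) - (\<integral>y. ?q y \<partial>lborel)"
   by (simp add: integral_hl set_lebesgue_integral_def)
  also have "(\<integral>y. ?q y \<partial>lborel) = (\<integral>y. ?q (- y) \<partial>lborel)"
   using lborel_integral_real_affine[of "-1" ?q 0] by simp
  also have "(\<integral>y. ?p y \<partial>lborel) - (\<integral>y. ?q (- y) \<partial>lborel) = (\<integral>y. ?p y - ?q (- y) \<partial>lborel)"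
   by (rule Bochner_Integration.integral_diff[symmetric]) (use Ip Iq' in auto)
  also have "... = (\<integral>y. abelP \<epsilon> (x - y) * w y \<partial>lborel)"
   by (intro Bochner_Integration.integral_cong) (auto simp: w_def indicator_def v0)
  also have "... = \<bar>\<epsilon>\<bar> * (\<integral>z. abelP \<epsilon> (x - (x + \<epsilon> * z)) * w (x + \<epsilon> * z) \<partial>lborel)"
   using lborel_integral_real_affine[of \<epsilon> "%y. abelP \<epsilon> (x - y) * w y" x] eps by simp
  also have "... = (\<integral>z. \<epsilon> * (abelP \<epsilon> (x - (x + \<epsilon> * z)) * w (x + \<epsilon> * z)) \<partial>lborel)" using eps by simp
  also have "... = (\<integral>z. inverse (1 + z^2) * w (x + \<epsilon> * z) \<partial>lborel)"
  proof (rule Bochner_Integration.integral_cong[OF refl])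
   fix z :: real
   have "\<epsilon> * abelP \<epsilon> (x - (x + \<epsilon> * z)) = \<epsilon>^2 / (\<epsilon>^2 * (1 + z^2))"
    by (simp add: abelP_def power_mult_distrib distrib_left power2_eq_square[of \<epsilon>])
   also have "... = inverse (1 + z^2)" using eps by (simp add: inverse_eq_divide)
   finally show "\<epsilon> * (abelP \<epsilon> (x - (x + \<epsilon> * z)) * w (x + \<epsilon> * z)) = inverse (1 + z^2) * w (x + \<epsilon> * z)"
    by (simp only: mult.assoc[symmetric])
  qed
  finally show ?thesis .
 qed
 have "(%n. \<integral>z. inverse (1 + z^2) * w (x + e n * z) \<partial>lborel) ----> (\<integral>z. inverse (1 + z^2) * w x \<partial>lborel)"
 proof (rule integral_dominated_convergence[where w="%z. inverse (1 + z^2) * B"])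
  show "integrable lborel (%z. inverse (1 + z^2) * B)" using I1 by auto
  show "AE z in lborel. (%n. inverse (1 + z^2) * w (x + e n * z)) ----> inverse (1 + z^2) * w x"
  proof (rule AE_I2)
   fix z :: real
   have "(%n. x + e n * z) ----> x + 0 * z" by (intro tendsto_intros e)
   then have "(%n. w (x + e n * z)) ----> w x" using isCont_tendsto_compose[OF wc[OF x], of "%n. x + e n * z" sequentially] by simp
   then show "(%n. inverse (1 + z^2) * w (x + e n * z)) ----> inverse (1 + z^2) * w x" by (intro tendsto_intros)
  qed
  show "AE z in lborel. norm (inverse (1 + z^2) * w (x + e n * z)) <= inverse (1 + z^2) * B" for n
   using wb by (auto simp: abs_mult intro!: mult_left_mono)
 qed measurable
 moreover have "(\<integral>z. inverse (1 + z^2) * w x \<partial>lborel) = pi * v x"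
  using LBINT_inverse_1_plus_square x by (simp add: w_def interval_lebesgue_integral_def set_lebesgue_integral_def)
 ultimately have "(%n. \<integral>z. inverse (1 + z^2) * w (x + e n * z) \<partial>lborel) ----> pi * v x" by simp
 then have "(%n. (\<integral>z. inverse (1 + z^2) * w (x + e n * z) \<partial>lborel) / pi) ----> pi * v x / pi" by (intro tendsto_intros) auto
 then show ?thesis using eq e by simp
qed

text \<open>Abel summation: the factor \<open>exp (- (e n * l))\<close> makes the inverse transform
  converge absolutely. The damped inverse transforms tend to \<open>v\<close> pointwise by the
  Poisson kernel, and to the profile of \<open>sine_tr v\<close> in \<open>L^4(dx/x)\<close> by the
  embedding; Fatou's lemma identifies the two limits.\<close>

theorem profile_rep_inversion:
 assumes c: "continuous_on {0..} v" and v0: "v 0 = 0" and vm[measurable]: "v \<in> BM"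
  and b: "!!x. 0 <= x ==> \<bar>v x\<bar> <= B" and vi: "integrable hl v" and fin: "ns (sine_tr v) < \<infinity>"
 shows "profile_rep v (sine_tr v)"
proof -
 let ?g = "sine_tr v"
 have gm[measurable]: "?g \<in> BM" by measurable
 have g: "Hhalf ?g" using fin by (simp add: Hhalf_def)
 define e where "e n = inverse (real (Suc n))" for n
 have e: "0 < e n" "e ----> 0" for n unfolding e_def by (simp, rule LIMSEQ_inverse_real_of_nat)
 define gk where "gk n l = exp (- (e n * l)) * ?g l" for n l
 have gkm[measurable]: "gk n \<in> BM" for n unfolding gk_def by measurable
 have gki: "integrable hl (gk n)" for n
  unfolding gk_def by (rule integrable_exp_bounded[OF e(1) _ sine_tr_le[OF vi]]) measurable
 have sc: "sine_class (gk n)" for n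
 proof -
  have "integrable hl (%l. min 1 l * gk n l)" by (rule integrable_hl_bound[OF gki[of n]]) (auto simp: abs_mult intro!: mult_left_le_one_le)
  then show ?thesis by (auto simp: sine_class_def)
 qed
 have ex: "exp (- (e n * l)) <= 1" if "0 < l" for n l using that e(1)[of n] by simp
 have lim: "(%n. ns (%l. gk n l - ?g l)) ----> 0"
 proof (rule ns_tendsto_0_dominated[OF _ g])
  fix n and l :: real assume l: "0 < l"
  have "gk n l - ?g l = (exp (- (e n * l)) - 1) * ?g l" by (simp add: gk_def left_diff_distrib)
  then show "\<bar>gk n l - ?g l\<bar> <= \<bar>?g l\<bar>" using ex[OF l, of n]
   by (simp only: abs_mult) (rule mult_left_le_one_le, auto)
 next
  fix l :: real
  have "(%n. exp (- (e n * l)) * ?g l - ?g l) ----> exp (- (0 * l)) * ?g l - ?g l" by (intro tendsto_intros e)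
  then show "(%n. gk n l - ?g l) ----> 0" by (simp add: gk_def)
 qed measurable
 have gkH: "Hhalf (gk n)" for n
 proof -
  have "ns (gk n) <= ennreal (1^2) * ns ?g" unfolding ns_wsq
   by (rule wsq_mult_le) (use ex in "auto simp: gk_def abs_mult intro!: mult_left_le_one_le")
  then show ?thesis using fin by (auto simp: Hhalf_def intro: le_less_trans)
 qed
 have S: "sine_tr (gk n) x = (LI y. (abelP (e n) (x - y) - abelP (e n) (x + y)) * v y) / pi" for n x
 proof -
  have Ie: "integrable hl (%l. exp (- (e n * l)) * sin (l * x))" by (rule integrable_exp_bounded[OF e(1), where C=1]) auto
  have "sin (l * x) * gk n l = cS * ((exp (- (e n * l)) * sin (l * x)) * (LI y. (%(l, y). sin (y * l)) (l, y) * v y))" for l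
   by (simp add: gk_def sine_tr_def)
  then have "sine_tr (gk n) x = cS^2 * (LI l. (exp (- (e n * l)) * sin (l * x)) * (LI y. (%(l, y). sin (y * l)) (l, y) * v y))"
   unfolding sine_tr_def[of "gk n"] by (simp only: integral_mult_right_zero power2_eq_square mult.assoc)
  also have "... = cS^2 * (LI y. v y * (LI l. (%(l, y). sin (y * l)) (l, y) * (exp (- (e n * l)) * sin (l * x))))"
   by (subst hl2.bounded_kernel_Fubini[OF Ie vi, where C=1]) auto
  also have "... = cS^2 * (LI y. v y * ((abelP (e n) (x - y) - abelP (e n) (x + y)) / 2))"
   unfolding integral_exp_sin_sin[OF e(1), symmetric] by (simp add: ac_simps)
  also have "... = (LI y. (abelP (e n) (x - y) - abelP (e n) (x + y)) * v y) / pi"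
   by (simp add: cS_sq mult.commute)
  finally show ?thesis .
 qed
 have pw: "(%n. sine_tr (gk n) x) ----> v x" if "0 < x" for x
  unfolding S by (rule abel_means_tendsto[OF c v0 vm b vi that e])
 obtain V where V: "profile_rep V ?g" using profile_rep_exists[OF g] by blast
 note [measurable] = profile_rep_measurable[OF V]
 have "(%n. 128 * (ns (%l. gk n l - ?g l))^2) ----> 128 * (0 * 0)"
  unfolding power2_eq_square by (intro ennreal_tendsto_cmult tendsto_mult_ennreal lim) auto
 then have l0: "(%n. 128 * (ns (%l. gk n l - ?g l))^2) ----> 0" by simp
 have "E4 (%x. v x - V x) <= \<epsilon>" if "0 < \<epsilon>" for \<epsilon>
 proof -
  from order_tendstoD(2)[OF l0 that]
  obtain M where M: "!!n. M <= n ==> 128 * (ns (%l. gk n l - ?g l))^2 < \<epsilon>"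
   by (auto simp: eventually_sequentially)
  show ?thesis unfolding E4_def
  proof (rule nn_integral_le_of_tendsto)
   show "(%x. (sine_tr (gk (n + M)) x - V x) ^ 4 / x) \<in> borel_measurable hl" for n by measurable
   show "(NN x. ennreal ((sine_tr (gk (n + M)) x - V x) ^ 4 / x)) <= \<epsilon>" for n
    using profile_rep_E4[OF profile_rep_diff[OF profile_rep_sine_tr[OF sc gkH] V], of "n + M"] M[of "n + M"]
    by (simp add: E4_def)
   show "AE x in hl. (%n. (sine_tr (gk (n + M)) x - V x) ^ 4 / x) ----> (v x - V x) ^ 4 / x"
    by (rule AE_hlI) (intro tendsto_intros LIMSEQ_ignore_initial_segment pw, auto)
  qed
 qed
 then have "E4 (%x. v x - V x) = 0" by (meson less_irrefl not_gr_zero dense order.strict_trans1)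
 then have "AE x in hl. v x - V x = 0" by (intro E4_eq_0_AE) measurable
 then show ?thesis by (intro profile_rep_cong[OF V]) auto
qed

section \<open>The nonlinearity as a Lipschitz map\<close>

lemma Hhalf_real:
 assumes "Hhalf g" obtains a where "0 <= a" "ns g = ennreal (a^2)"
proof
 show "0 <= sqrt (enn2real (ns g))" by simp
 show "ns g = ennreal ((sqrt (enn2real (ns g)))^2)" using assms by (simp add: Hhalf_def)
qed

lemma sine_tr_diff_integrable:
 assumes "integrable hl f" "integrable hl g"
 shows "sine_tr (%x. f x - g x) l = sine_tr f l - sine_tr g l"
proof -
 have I: "integrable hl (%x. sin (x * l) * h x)" if "integrable hl h" for h
  by (rule integrable_hl_bound[OF that]) (use borel_measurable_integrable[OF that] in "auto simp: abs_mult intro!: mult_left_le_one_le")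
 show ?thesis using I[OF assms(1)] I[OF assms(2)] by (simp add: sine_tr_def right_diff_distrib)
qed

text \<open>\<open>E4\<close> of the difference of the profiles is at most
  \<open>128 * a ^ 4 <= (4 * a) ^ 4\<close>, so the master estimate applies with
  \<open>D = 4 * a\<close> and yields \<open>2 * (4 * Q * a)^2 = 32 * Q^2 * a^2\<close>. The second
  conclusion, uniform in \<open>l\<close>, serves the continuity of the forcing in time at each
  frequency.\<close>

lemma sine_tr_nonlinear_Lipschitz:
 assumes v: "profile_rep v g" "profile_rep v' g'" and N: "integrable hl N" "integrable hl N'"
  and [measurable]: "p \<in> BM"
  and le: "!!x. 0 < x ==> \<bar>N x - N' x\<bar> <= p x * \<bar>v x - v' x\<bar>" and p0: "!!x. 0 < x ==> 0 <= p x"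
  and Q: "(NN x. ennreal ((1 + x)^2 * (p x)^2)) <= ennreal (Q^2)" "0 <= Q"
 shows "nm (%l. sine_tr N l - sine_tr N' l) <= ennreal (32 * Q^2) * ns (%l. g l - g' l)"
  and "ennreal ((sine_tr N l - sine_tr N' l)^2) <= ennreal (32 * Q^2) * ns (%l. g l - g' l)"
proof -
 have [measurable]: "N \<in> BM" "N' \<in> BM"
  using N[THEN borel_measurable_integrable] by auto
 note [measurable] = v[THEN profile_rep_measurable]
 have H: "Hhalf (%l. g l - g' l)" using v by (intro Hhalf_diff profile_rep_Hhalf)
 obtain a where a: "0 <= a" "ns (%l. g l - g' l) = ennreal (a^2)" using Hhalf_real[OF H] .
 have "E4 (%x. v x - v' x) <= 128 * (ennreal (a^2))^2"
  using profile_rep_E4[OF profile_rep_diff[OF v]] a by simp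
 also have "... = ennreal (128 * a ^ 4)" by (simp add: ennreal_mult ennreal_power flip: power_mult)
 also have "... <= ennreal ((4 * a) ^ 4)" by (intro ennreal_leI) (simp add: power_mult_distrib)
 finally have D: "E4 (%x. v x - v' x) <= ennreal ((4 * a) ^ 4)" .
 have S: "sine_tr N l - sine_tr N' l = sine_tr (%x. N x - N' x) l" for l
  by (rule sine_tr_diff_integrable[OF N, symmetric])
 have M: "integrable hl (%x. N x - N' x)" "(LI x. \<bar>N x - N' x\<bar>) <= Q * (4 * a)"
  "nm (sine_tr (%x. N x - N' x)) <= ennreal (2 * (Q * (4 * a))^2)"
  using sine_tr_master[of "%x. N x - N' x" p "%x. v x - v' x" Q "4 * a", OF _ _ _ le p0 Q D] a by auto
 have e: "ennreal (2 * (Q * (4 * a))^2) = ennreal (32 * Q^2) * ns (%l. g l - g' l)"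
  using a by (simp add: ennreal_mult[symmetric] power_mult_distrib mult.assoc)
 show "nm (%l. sine_tr N l - sine_tr N' l) <= ennreal (32 * Q^2) * ns (%l. g l - g' l)"
  using M(3) unfolding S e .
 have "\<bar>sine_tr (%x. N x - N' x) l\<bar>^2 <= (Q * (4 * a))^2"
  by (rule power_mono[OF order_trans[OF sine_tr_le[OF M(1)] M(2)]]) simp
 then have "ennreal ((sine_tr (%x. N x - N' x) l)^2) <= ennreal (2 * (Q * (4 * a))^2)"
  by (intro ennreal_leI) (simp, smt (verit) zero_le_power2)
 then show "ennreal ((sine_tr N l - sine_tr N' l)^2) <= ennreal (32 * Q^2) * ns (%l. g l - g' l)"
  unfolding S e .
qed

definition cubic :: "(real => real) => real => real" where "cubic v x = (v x) ^ 3 / (1 + x)^2"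

lemma cubic_measurable[measurable]:
 assumes [measurable]: "v \<in> BM" shows "cubic v \<in> BM"
 unfolding cubic_def by measurable

lemma le_one_plus_square: "0 < x ==> x <= (1 + x)^2" for x :: real
 by (simp add: power2_eq_square algebra_simps)

lemma mult_divide_square: "z \<noteq> 0 ==> z * (C / z^2) = C / z" for z C :: real
 by (simp add: power2_eq_square)

lemma cubic_integrable:
 assumes [measurable]: "v \<in> BM" and E: "E4 v < \<infinity>"
 shows "integrable hl (cubic v)"
proof -
 define D where "D = root 4 (enn2real (E4 v))"
 have D4: "D ^ 4 = enn2real (E4 v)" by (simp add: D_def)
 have D: "E4 v <= ennreal (D ^ 4)" "0 <= D" using E by (simp_all add: D4, simp add: D_def)
 show ?thesis
 proof (rule sine_tr_master(1)[where p="%x. (v x)^2 / (1 + x)^2" and d=v, OF _ _ _ _ _ _ _ D])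
  show "\<bar>cubic v x\<bar> <= (v x)^2 / (1 + x)^2 * \<bar>v x\<bar>" if "0 < x" for x
   by (simp add: cubic_def abs_mult power2_eq_square power3_eq_cube)
  have "(NN x. ennreal ((1 + x)^2 * ((v x)^2 / (1 + x)^2)^2)) <= E4 v" unfolding E4_def
  proof (intro nn_integral_hl_mono ennreal_leI)
   fix x :: real assume x: "0 < x"
   have "(1 + x)^2 * ((v x)^2 / (1 + x)^2)^2 = (v x) ^ 4 / (1 + x)^2"
    using x by (simp add: power_divide field_simps flip: power_mult power_add)
   also have "... <= (v x) ^ 4 / x" using x by (intro divide_left_mono le_one_plus_square) auto
   finally show "(1 + x)^2 * ((v x)^2 / (1 + x)^2)^2 <= (v x) ^ 4 / x" .
  qed
  then show "(NN x. ennreal ((1 + x)^2 * ((v x)^2 / (1 + x)^2)^2)) <= ennreal ((D^2)^2)"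
   using D(1) by (simp flip: power_mult)
 qed auto
qed

lemma profile_rep_E4_finite: "profile_rep v g ==> E4 v < \<infinity>"
 using profile_rep_E4[of v g] profile_rep_Hhalf[of v g]
 by (auto simp: Hhalf_def ennreal_mult_less_top power2_eq_square intro: le_less_trans)

definition cubic_force :: "(real => real) => real => real" where "cubic_force g = sine_tr (cubic (prof g))"

lemma sine_tr_cong_AE: "AE x in hl. f x = g x ==> f \<in> BM ==> g \<in> BM ==> sine_tr f = sine_tr g"
 unfolding sine_tr_def by (intro ext arg_cong2[where f="(*)"] integral_cong_AE refl) (auto elim: eventually_mono)

lemma cubic_force_rep: "profile_rep v g ==> cubic_force g = sine_tr (cubic v)"
proof -
 assume v: "profile_rep v g"
 note p = prof_rep[OF profile_rep_Hhalf[OF v]]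
 show ?thesis unfolding cubic_force_def
  using profile_rep_unique[OF p v] profile_rep_measurable[OF v] profile_rep_measurable[OF p]
  by (intro sine_tr_cong_AE) (auto simp: cubic_def elim: eventually_mono)
qed

text \<open>\<open>36864 = 32 * 1152\<close>: 32 comes from
  \<open>sine_tr_nonlinear_Lipschitz\<close>, and \<open>1152 = (9/2) * (128 + 128)\<close> from the
  squared weighted norm of the slope of the cube.\<close>

definition cubeL :: "real => real" where "cubeL R = 36864 * R ^ 4"

text \<open>The slope of the cube is at most \<open>p\<close>. Squared and multiplied by the weight
  \<open>(1 + x)^2\<close> of the master estimate, it leaves fourth powers over
  \<open>(1 + x)^2\<close>, and \<open>x <= (1 + x)^2\<close> turns these into \<open>E4\<close>.
  This uses that the denominator of the exterior problem stays away from 0 at the boundary.\<close>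

lemma cubic_force_Lipschitz:
 assumes H: "Hhalf g" "Hhalf g'" and R: "ns g <= ennreal (R^2)" "ns g' <= ennreal (R^2)"
 shows "nm (%l. cubic_force g l - cubic_force g' l) <= ennreal (cubeL R) * ns (%l. g l - g' l)"
  and "ennreal ((cubic_force g l - cubic_force g' l)^2) <= ennreal (cubeL R) * ns (%l. g l - g' l)"
proof -
 define v v' where "v = prof g" and "v' = prof g'"
 have v: "profile_rep v g" "profile_rep v' g'" unfolding v_def v'_def by (auto intro: prof_rep H)
 note [measurable] = v[THEN profile_rep_measurable]
 have N: "integrable hl (cubic v)" "integrable hl (cubic v')"
  by (intro cubic_integrable profile_rep_E4_finite[OF v(1)] profile_rep_E4_finite[OF v(2)]; measurable)+
 define p where "p x = (3/2) * ((v x)^2 + (v' x)^2) / (1 + x)^2" for x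
 have [measurable]: "p \<in> BM" unfolding p_def by measurable
 have le: "\<bar>cubic v x - cubic v' x\<bar> <= p x * \<bar>v x - v' x\<bar>" if "0 < x" for x
 proof -
  define a b where "a = v x" and "b = v' x"
  have 1: "a ^ 3 - b ^ 3 = (a^2 + a * b + b^2) * (a - b)" by (simp add: power2_eq_square power3_eq_cube algebra_simps)
  have "\<bar>a^2 + a * b + b^2\<bar> <= (3/2) * (a^2 + b^2)"
   using sum_squares_bound[of a b] sum_squares_bound[of a "-b"] by (simp add: abs_le_iff)
  from mult_right_mono[OF this, of "\<bar>a - b\<bar>"] have "\<bar>a ^ 3 - b ^ 3\<bar> <= (3/2) * (a^2 + b^2) * \<bar>a - b\<bar>"
   unfolding 1 abs_mult by simp
  from divide_right_mono[OF this, of "(1 + x)^2"] show ?thesis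
   unfolding cubic_def p_def a_def b_def by (simp add: abs_divide flip: diff_divide_distrib)
 qed
 have Q: "(NN x. ennreal ((1 + x)^2 * (p x)^2)) <= ennreal ((sqrt (1152 * R ^ 4))^2)"
 proof -
  have "(NN x. ennreal ((1 + x)^2 * (p x)^2)) <= (NN x. ennreal (9/2) * (ennreal ((v x) ^ 4 / x) + ennreal ((v' x) ^ 4 / x)))"
  proof (rule nn_integral_hl_mono)
   fix x :: real assume x: "0 < x"
   define a b where "a = (v x)^2" and "b = (v' x)^2"
   have ab: "(a + b)^2 <= 2 * (a^2 + b^2)" using sum_squares_bound[of a b] by (simp add: power2_sum)
   have p2: "(p x)^2 = (9/4) * (a + b)^2 / ((1 + x)^2)^2"
    unfolding p_def a_def[symmetric] b_def[symmetric] by (simp only: power_divide power_mult_distrib) simp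
   have "(1 + x)^2 * (p x)^2 = (9/4) * (a + b)^2 / (1 + x)^2"
    unfolding p2 using x by (intro mult_divide_square) simp
   also have "... <= (9/2) * (a^2 + b^2) / (1 + x)^2" using ab by (intro divide_right_mono) auto
   also have "... <= (9/2) * (a^2 + b^2) / x" using x by (intro divide_left_mono le_one_plus_square) auto
   also have "... = (9/2) * ((v x) ^ 4 / x + (v' x) ^ 4 / x)"
    by (simp add: a_def b_def add_divide_distrib flip: power_mult)
   finally have "ennreal ((1 + x)^2 * (p x)^2) <= ennreal ((9/2) * ((v x) ^ 4 / x + (v' x) ^ 4 / x))" by (rule ennreal_leI)
   also have "... = ennreal (9/2) * (ennreal ((v x) ^ 4 / x) + ennreal ((v' x) ^ 4 / x))"
    using x by (subst ennreal_mult) (auto simp: ennreal_plus[symmetric] simp del: ennreal_plus)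
   finally show "ennreal ((1 + x)^2 * (p x)^2) <= ennreal (9/2) * (ennreal ((v x) ^ 4 / x) + ennreal ((v' x) ^ 4 / x))" .
  qed
  also have "... = ennreal (9/2) * (E4 v + E4 v')" unfolding E4_def
   by (subst nn_integral_cmult, measurable, subst nn_integral_add) auto
  also have "... <= ennreal (9/2) * (128 * (ennreal (R^2))^2 + 128 * (ennreal (R^2))^2)"
   by (intro mult_left_mono add_mono order_trans[OF profile_rep_E4[OF v(1)]] order_trans[OF profile_rep_E4[OF v(2)]] power_mono R) auto
  also have "... = ennreal (9/2) * (ennreal (128 * R ^ 4) + ennreal (128 * R ^ 4))"
   by (simp add: ennreal_mult ennreal_power flip: power_mult)
  also have "... = ennreal (1152 * R ^ 4)"
   by (subst ennreal_plus[symmetric], simp, simp, subst ennreal_mult[symmetric]) auto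
  finally show ?thesis by simp
 qed
 have e: "32 * (sqrt (1152 * R ^ 4))^2 = cubeL R" by (simp add: cubeL_def)
 have p0: "0 <= p x" for x by (simp add: p_def)
 note L = sine_tr_nonlinear_Lipschitz[OF v N _ le p0 Q, unfolded e]
 show "nm (%l. cubic_force g l - cubic_force g' l) <= ennreal (cubeL R) * ns (%l. g l - g' l)"
  unfolding cubic_force_rep[OF v(1)] cubic_force_rep[OF v(2)] by (rule L(1)) auto
 show "ennreal ((cubic_force g l - cubic_force g' l)^2) <= ennreal (cubeL R) * ns (%l. g l - g' l)"
  unfolding cubic_force_rep[OF v(1)] cubic_force_rep[OF v(2)] by (rule L(2)) auto
qed

lemma cubic_force_continuous: "Hhalf g ==> continuous_on UNIV (cubic_force g)"
 unfolding cubic_force_def using prof_rep[of g]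
 by (intro sine_tr_continuous cubic_integrable) (auto dest: profile_rep_measurable profile_rep_E4_finite)

lemma profile_rep_zero: "profile_rep (%x. 0) (%l. 0)"
proof -
 have "sine_tr (%l. 0) = (%x. 0)" by (simp add: sine_tr_def fun_eq_iff)
 then show ?thesis using profile_rep_sine_tr[of "%l. 0"] by (simp add: sine_class_def)
qed

lemma cubic_force_zero: "cubic_force (%l. 0) = (%l. 0)"
 using cubic_force_rep[OF profile_rep_zero] by (simp add: cubic_def[abs_def] sine_tr_def fun_eq_iff)

text \<open>The interface shared by both truncated nonlinearities. Continuity in \<open>l\<close>
  together with the pointwise bound, uniform in \<open>l\<close>, gives joint continuity along a
  path, which the norm bound alone would not.\<close>

definition lip_map :: "((real => real) => real => real) => real => bool" where
 "lip_map F L \<longleftrightarrow> 0 <= L \<and> F (%l. 0) = (%l. 0) \<and> (\<forall>g. Hhalf g --> continuous_on UNIV (F g)) \<and>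
   (\<forall>g g'. Hhalf g --> Hhalf g' --> nm (%l. F g l - F g' l) <= ennreal L * ns (%l. g l - g' l) \<and>
    (\<forall>l. ennreal ((F g l - F g' l)^2) <= ennreal L * ns (%l. g l - g' l)))"

text \<open>The radial retraction onto the ball of radius \<open>R\<close> of the critical space. It
  is the identity inside, so a solution of the cut equation that stays in the ball solves the
  original one.\<close>

definition radial_cut :: "real => (real => real) => real => real" where
 "radial_cut R g = (%l. (if ns g <= ennreal (R^2) then 1 else R / sqrt (enn2real (ns g))) * g l)"

lemma radial_cut_id: "ns g <= ennreal (R^2) ==> radial_cut R g = g"
 by (simp add: radial_cut_def)

lemma ns_reverse_triangle:
 assumes H: "Hhalf g" "Hhalf g'" and a: "ns g = ennreal (a^2)" "0 <= a" and b: "ns g' = ennreal (b^2)" "0 <= b"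
 shows "ennreal ((a - b)^2) <= ns (%l. g l - g' l)"
proof -
 note [measurable] = H[THEN Hhalf_measurable]
 obtain d where d: "0 <= d" "ns (%l. g l - g' l) = ennreal (d^2)" using Hhalf_real[OF Hhalf_diff[OF H]] .
 have sq: "(NN l. ennreal ((sqrt l * f l)^2)) = ns f" for f
  unfolding ns_def by (intro nn_integral_hl_cong) (simp add: power_mult_distrib)
 have CS: "(NN l. ennreal \<bar>(sqrt l * g l) * (sqrt l * g' l)\<bar>) <= ennreal (a * b)"
  by (rule Cauchy_Schwarz_hl) (use a b in "auto simp: sq")
 have "ennreal (a^2) + ennreal (b^2) = (NN l. ennreal (l * (g l)^2) + ennreal (l * (g' l)^2))"
  by (subst nn_integral_add) (auto simp: ns_def[symmetric] a b)
 also have "... <= (NN l. ennreal (l * (g l - g' l)^2) + 2 * ennreal \<bar>(sqrt l * g l) * (sqrt l * g' l)\<bar>)"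
 proof (rule nn_integral_hl_mono)
  fix l :: real assume l: "0 < l"
  have e: "(sqrt l * g l) * (sqrt l * g' l) = l * (g l * g' l)" using l by (simp add: mult.left_commute mult.assoc[symmetric])
  have "l * (g l)^2 + l * (g' l)^2 = l * (g l - g' l)^2 + 2 * (l * (g l * g' l))"
   by (simp add: power2_diff algebra_simps)
  also have "... <= l * (g l - g' l)^2 + 2 * \<bar>(sqrt l * g l) * (sqrt l * g' l)\<bar>" unfolding e by simp
  finally have "ennreal (l * (g l)^2 + l * (g' l)^2) <= ennreal (l * (g l - g' l)^2 + 2 * \<bar>(sqrt l * g l) * (sqrt l * g' l)\<bar>)"
   by (rule ennreal_leI)
  then show "ennreal (l * (g l)^2) + ennreal (l * (g' l)^2) <= ennreal (l * (g l - g' l)^2) + 2 * ennreal \<bar>(sqrt l * g l) * (sqrt l * g' l)\<bar>"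
   using l by (simp add: ennreal_mult)
 qed
 also have "... = ns (%l. g l - g' l) + 2 * (NN l. ennreal \<bar>(sqrt l * g l) * (sqrt l * g' l)\<bar>)"
  by (subst nn_integral_add, measurable, subst nn_integral_cmult) (auto simp: ns_def)
 also have "... <= ennreal (d^2) + 2 * ennreal (a * b)" using CS d by (intro add_mono mult_left_mono) auto
 finally have "ennreal (a^2) + ennreal (b^2) <= ennreal (d^2) + 2 * ennreal (a * b)" .
 also have "2 * ennreal (a * b) = ennreal (2 * (a * b))" using a b by (simp add: ennreal_mult)
 finally have "ennreal (a^2 + b^2) <= ennreal (d^2 + 2 * (a * b))" using a b d by simp
 then have "a^2 + b^2 <= d^2 + 2 * (a * b)" using a b by (subst (asm) ennreal_le_iff) auto
 then show ?thesis unfolding d by (intro ennreal_leI) (simp add: power2_diff)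
qed

text \<open>The difference is written as
  \<open>\<theta> a * (g l - g' l) + (\<theta> a - \<theta> b) * g' l\<close>. The first factor is
  at most 1, and the second term has norm at most \<open>\<bar>a - b\<bar>\<close>, hence at most
  that of the difference of \<open>g\<close> and \<open>g'\<close>. The retraction is Lipschitz with
  constant 2, which is 4 for squared norms.\<close>

lemma radial_cut:
 assumes R: "0 < R" and H: "Hhalf g" "Hhalf g'"
 shows "Hhalf (radial_cut R g)" "ns (radial_cut R g) <= ennreal (R^2)"
  "ns (%l. radial_cut R g l - radial_cut R g' l) <= 4 * ns (%l. g l - g' l)"
proof -
 note [measurable] = H[THEN Hhalf_measurable]
 obtain a where a: "0 <= a" "ns g = ennreal (a^2)" using Hhalf_real[OF H(1)] .
 obtain b where b: "0 <= b" "ns g' = ennreal (b^2)" using Hhalf_real[OF H(2)] .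
 define \<theta> where "\<theta> c = (if c <= R then 1 else R / c)" for c
 have ca: "radial_cut R f = (%l. \<theta> c * f l)" if "0 <= c" "ns f = ennreal (c^2)" for c f
 proof -
  have "ns f <= ennreal (R^2) \<longleftrightarrow> c <= R"
   using that R by (simp add: power_mono_iff) 
  then show ?thesis using that by (simp add: radial_cut_def \<theta>_def)
 qed
 have th: "0 <= \<theta> c" "\<theta> c <= 1" "\<theta> c * c <= R" if "0 <= c" for c using that R by (auto simp: \<theta>_def)
 show "Hhalf (radial_cut R g)" unfolding ca[OF a] by (rule Hhalf_cmult[OF H(1)])
 have "ns (radial_cut R g) = ennreal ((\<theta> a * a)^2)"
  unfolding ca[OF a] by (subst ns_cmult) (auto simp: a ennreal_mult[symmetric] power_mult_distrib)
 also have "... <= ennreal (R^2)" using th[OF a(1)] a by (intro ennreal_leI power_mono) auto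
 finally show "ns (radial_cut R g) <= ennreal (R^2)" .
 have tb: "\<bar>\<theta> a - \<theta> b\<bar> * b <= \<bar>a - b\<bar>"
 proof -
  consider "a <= R" "b <= R" | "a <= R" "R < b" | "R < a" "b <= R" | "R < a" "R < b" by linarith
  then show ?thesis
  proof cases
   case 2
   then have "\<bar>\<theta> a - \<theta> b\<bar> * b = b - R" using R by (simp add: \<theta>_def field_simps)
   then show ?thesis using 2 by simp
  next
   case 3
   then have "\<bar>\<theta> a - \<theta> b\<bar> * b = (a - R) * (b / a)" using R by (simp add: \<theta>_def field_simps)
   also have "... <= (a - R) * 1" using 3 R by (intro mult_left_mono) auto
   finally show ?thesis using 3 by simp
  next
   case 4
   then have "R / a - R / b = R * (b - a) / (a * b)" using R by (simp add: field_simps)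
   then have "\<bar>\<theta> a - \<theta> b\<bar> * b = (R / a) * \<bar>a - b\<bar>" using 4 R by (simp add: \<theta>_def abs_mult abs_minus_commute)
   also have "... <= 1 * \<bar>a - b\<bar>" using 4 R by (intro mult_right_mono) auto
   finally show ?thesis by simp
  qed (simp add: \<theta>_def)
 qed
 have "ns (%l. radial_cut R g l - radial_cut R g' l) = ns (%l. \<theta> a * (g l - g' l) + (\<theta> a - \<theta> b) * g' l)"
  unfolding ca[OF a] ca[OF b] by (simp add: algebra_simps)
 also have "... <= 2 * (ns (%l. \<theta> a * (g l - g' l)) + ns (%l. (\<theta> a - \<theta> b) * g' l))" by (rule ns_add_le) measurable
 also have "ns (%l. \<theta> a * (g l - g' l)) <= 1 * ns (%l. g l - g' l)"
  using th[OF a(1)] by (subst ns_cmult, measurable, intro mult_right_mono) (auto simp: power_le_one)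
 also have "ns (%l. (\<theta> a - \<theta> b) * g' l) <= ns (%l. g l - g' l)"
 proof -
  have "ns (%l. (\<theta> a - \<theta> b) * g' l) = ennreal ((\<bar>\<theta> a - \<theta> b\<bar> * b)^2)"
   by (subst ns_cmult) (auto simp: b ennreal_mult[symmetric] power_mult_distrib)
  also have "... <= ennreal (\<bar>a - b\<bar>^2)" using tb b by (intro ennreal_leI power_mono) auto
  also have "... <= ns (%l. g l - g' l)" using ns_reverse_triangle[OF H a(2,1) b(2,1)] by simp
  finally show ?thesis .
 qed
 finally show "ns (%l. radial_cut R g l - radial_cut R g' l) <= 4 * ns (%l. g l - g' l)"
  by (simp add: mult_left_mono add_mono mult.assoc[symmetric] mult_2[symmetric])
qed

theorem lip_map_radial_cut:
 assumes R: "0 < R" shows "lip_map (%g. cubic_force (radial_cut R g)) (4 * cubeL R)"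
proof -
 have "radial_cut R (%l. 0) = (%l. 0)" by (simp add: radial_cut_def)
 moreover have m: "ennreal (cubeL R) * ns (%l. radial_cut R g l - radial_cut R g' l) <= ennreal (4 * cubeL R) * ns (%l. g l - g' l)"
  if "Hhalf g" "Hhalf g'" for g g'
 proof -
  have "ennreal (cubeL R) * ns (%l. radial_cut R g l - radial_cut R g' l) <= ennreal (cubeL R) * (4 * ns (%l. g l - g' l))"
   by (intro mult_left_mono radial_cut that R) simp
  moreover have "ennreal (4 * cubeL R) = 4 * ennreal (cubeL R)" by (subst ennreal_mult) (auto simp: cubeL_def)
  ultimately show ?thesis by (simp only: mult.assoc mult.left_commute)
 qed
 ultimately show ?thesis
  unfolding lip_map_def
 proof (intro conjI allI impI)
  fix g g' l assume H: "Hhalf g" "Hhalf g'"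
  note c = radial_cut(1)[OF R H(1,1)] radial_cut(1)[OF R H(2,2)] radial_cut(2)[OF R H(1,1)] radial_cut(2)[OF R H(2,2)]
  show "nm (%l. cubic_force (radial_cut R g) l - cubic_force (radial_cut R g') l) <= ennreal (4 * cubeL R) * ns (%l. g l - g' l)"
   by (rule order_trans[OF cubic_force_Lipschitz(1)[OF c] m[OF H]])
  show "ennreal ((cubic_force (radial_cut R g) l - cubic_force (radial_cut R g') l)^2) <= ennreal (4 * cubeL R) * ns (%l. g l - g' l)"
   by (rule order_trans[OF cubic_force_Lipschitz(2)[OF c] m[OF H]])
 qed (use R in "auto simp: cubic_force_zero cubeL_def intro!: cubic_force_continuous radial_cut")
qed

definition clamp_cubic :: "(real => real) => (real => real) => real => real" where
 "clamp_cubic m v = cubic (%x. max (- m x) (min (m x) (v x)))"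

text \<open>On clamped values the cube has slope at most \<open>3 * (m x)^2\<close>, a bound without
  reference to \<open>v\<close>. The Lipschitz estimate is therefore global as soon as
  \<open>(m x) ^ 4 / (1 + x)^2\<close> is integrable.\<close>

theorem lip_map_clamp:
 assumes m[measurable]: "m \<in> BM" and m0: "!!x. 0 <= m x"
  and Q: "(NN x. ennreal (9 * (m x) ^ 4 / (1 + x)^2)) <= ennreal (Q^2)" "0 <= Q"
 shows "lip_map (%g. sine_tr (clamp_cubic m (prof g))) (32 * Q^2)"
  and "!!v g. profile_rep v g ==> integrable hl (clamp_cubic m v)"
  and "!!v g. profile_rep v g ==> sine_tr (clamp_cubic m (prof g)) = sine_tr (clamp_cubic m v)"
proof -
 define cl where "cl x a = max (- m x) (min (m x) a)" for x a
 have clm[measurable]: "(%x. cl x (v x)) \<in> BM" if [measurable]: "v \<in> BM" for v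
  unfolding cl_def by measurable
 have cc: "clamp_cubic m v = cubic (%x. cl x (v x))" for v by (simp add: clamp_cubic_def cl_def)
 have ccm[measurable]: "clamp_cubic m v \<in> BM" if [measurable]: "v \<in> BM" for v
  unfolding cc by measurable
 show int: "integrable hl (clamp_cubic m v)" if v: "profile_rep v g" for v g
 proof -
  note [measurable] = profile_rep_measurable[OF v]
  have "E4 (%x. cl x (v x)) <= E4 v" unfolding E4_def
  proof (intro nn_integral_hl_mono ennreal_leI divide_right_mono)
   fix x :: real
   have "\<bar>cl x (v x)\<bar> ^ 4 <= \<bar>v x\<bar> ^ 4" using m0[of x] by (intro power_mono) (auto simp: cl_def)
   then show "(cl x (v x)) ^ 4 <= (v x) ^ 4" by (simp add: power_even_abs)
  qed auto
  then show ?thesis unfolding cc using profile_rep_E4_finite[OF v] by (intro cubic_integrable) (auto intro: le_less_trans)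
 qed
 show rep: "sine_tr (clamp_cubic m (prof g)) = sine_tr (clamp_cubic m v)" if v: "profile_rep v g" for v g
 proof -
  note p = prof_rep[OF profile_rep_Hhalf[OF v]]
  show ?thesis
   using profile_rep_unique[OF p v] profile_rep_measurable[OF v] profile_rep_measurable[OF p]
   by (intro sine_tr_cong_AE) (auto simp: clamp_cubic_def cubic_def elim: eventually_mono)
 qed
 have L: "\<bar>clamp_cubic m v x - clamp_cubic m v' x\<bar> <= 3 * (m x)^2 / (1 + x)^2 * \<bar>v x - v' x\<bar>" for v v' x
 proof -
  define a b where "a = cl x (v x)" and "b = cl x (v' x)"
  have ab: "\<bar>a\<bar> <= m x" "\<bar>b\<bar> <= m x" "\<bar>a - b\<bar> <= \<bar>v x - v' x\<bar>" using m0[of x] by (auto simp: a_def b_def cl_def)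
  have 1: "a ^ 3 - b ^ 3 = (a * a + a * b + b * b) * (a - b)" by (simp add: power3_eq_cube algebra_simps)
  have "\<bar>a * a + a * b + b * b\<bar> <= \<bar>a\<bar> * \<bar>a\<bar> + \<bar>a\<bar> * \<bar>b\<bar> + \<bar>b\<bar> * \<bar>b\<bar>" unfolding abs_mult[symmetric] by linarith
  also have "... <= m x * m x + m x * m x + m x * m x" by (intro add_mono mult_mono ab) (auto simp: m0)
  finally have 2: "\<bar>a * a + a * b + b * b\<bar> <= 3 * (m x)^2" by (simp add: power2_eq_square)
  have "\<bar>a ^ 3 - b ^ 3\<bar> <= 3 * (m x)^2 * \<bar>v x - v' x\<bar>" unfolding 1 abs_mult by (intro mult_mono 2 ab) auto
  from divide_right_mono[OF this, of "(1 + x)^2"] show ?thesis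
   unfolding cc cubic_def a_def b_def by (simp add: abs_divide flip: diff_divide_distrib)
 qed
 have Q': "(NN x. ennreal ((1 + x)^2 * (3 * (m x)^2 / (1 + x)^2)^2)) <= ennreal (Q^2)"
 proof -
  have "(NN x. ennreal ((1 + x)^2 * (3 * (m x)^2 / (1 + x)^2)^2)) = (NN x. ennreal (9 * (m x) ^ 4 / (1 + x)^2))"
  proof (intro nn_integral_hl_cong arg_cong[where f=ennreal])
   fix x :: real assume "0 < x"
   then have "(1 + x)^2 * (9 * (m x) ^ 4 / ((1 + x)^2)^2) = 9 * (m x) ^ 4 / (1 + x)^2" by (intro mult_divide_square) simp
   moreover have "(3 * (m x)^2 / (1 + x)^2)^2 = 9 * (m x) ^ 4 / ((1 + x)^2)^2"
    by (simp only: power_divide power_mult_distrib) (simp flip: power_mult)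
   ultimately show "(1 + x)^2 * (3 * (m x)^2 / (1 + x)^2)^2 = 9 * (m x) ^ 4 / (1 + x)^2" by simp
  qed
  with Q show ?thesis by simp
 qed
 have Z: "sine_tr (clamp_cubic m (prof (%l. 0))) = (%l. 0)"
 proof -
  have "cl x 0 = 0" for x using m0[of x] by (simp add: cl_def)
  then show ?thesis unfolding rep[OF profile_rep_zero] by (simp add: cc cubic_def[abs_def] sine_tr_def fun_eq_iff)
 qed
 show "lip_map (%g. sine_tr (clamp_cubic m (prof g))) (32 * Q^2)"
  unfolding lip_map_def
 proof (intro conjI allI impI)
  fix g g' l assume H: "Hhalf g" "Hhalf g'"
  note lp = sine_tr_nonlinear_Lipschitz[OF prof_rep[OF H(1)] prof_rep[OF H(2)] int[OF prof_rep[OF H(1)]] int[OF prof_rep[OF H(2)]] _ L _ Q']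
  show "nm (%l. sine_tr (clamp_cubic m (prof g)) l - sine_tr (clamp_cubic m (prof g')) l) <= ennreal (32 * Q^2) * ns (%l. g l - g' l)"
   by (rule lp(1)) (use Q in auto)
  show "ennreal ((sine_tr (clamp_cubic m (prof g)) l - sine_tr (clamp_cubic m (prof g')) l)^2) <= ennreal (32 * Q^2) * ns (%l. g l - g' l)"
   by (rule lp(2)) (use Q in auto)
 qed (use Z in "auto intro!: sine_tr_continuous int prof_rep")
qed

section \<open>Paths and the Duhamel operator\<close>

text \<open>Continuity in time in a weighted \<open>L^2\<close>, phrased with sequences. Paths live
  on the whole time axis because the truncated equations are solved globally.\<close>

definition wpath :: "(real => real) => (real => real => real) => bool" where
 "wpath w u \<longleftrightarrow> (\<forall>t. u t \<in> BM \<and> wsq w (u t) < \<infinity>) \<and>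
   (\<forall>t s. s ----> t --> (%k. wsq w (%l. u (s k) l - u t l)) ----> 0)"

locale weight =
 fixes w :: "real => real"
 assumes w_meas: "w \<in> BM" and w_pos: "!!l. 0 < l ==> 0 < w l"
begin

lemma wsq_split: "f \<in> BM ==> g \<in> BM ==> wsq w f <= 2 * (wsq w (%l. f l - g l) + wsq w g)"
 using wsq_add_le[of w "%l. f l - g l" g] w_meas less_imp_le[OF w_pos] by simp

lemma wpath_bounded:
 assumes u: "wpath w u" obtains C where "0 <= C" "!!t. \<bar>t\<bar> <= T ==> wsq w (u t) <= ennreal C"
proof -
 have m: "u t \<in> BM" and fin: "wsq w (u t) < \<infinity>" for t using u by (auto simp: wpath_def)
 have "\<exists>k :: nat. \<forall>t. \<bar>t\<bar> <= T --> wsq w (u t) <= ennreal k"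
 proof (rule ccontr)
  assume "\<not> ?thesis"
  then have "\<forall>k :: nat. \<exists>t. \<bar>t\<bar> <= T \<and> ennreal k < wsq w (u t)" by (auto simp: not_le)
  then obtain s :: "nat => real" where s: "!!k. \<bar>s k\<bar> <= T" "!!k :: nat. ennreal k < wsq w (u (s k))" by metis
  have "compact {-T..T}" by simp
  moreover have "\<forall>k. s k \<in> {-T..T}" using s(1) by (auto simp: abs_le_iff minus_le_iff)
  ultimately obtain t and r :: "nat => nat" where r: "strict_mono r" "(s \<circ> r) ----> t"
   unfolding compact_def by blast
  have lim: "(%k. wsq w (%l. u ((s \<circ> r) k) l - u t l)) ----> 0" using u r(2) unfolding wpath_def by blast
  then have "\<forall>\<^sub>F k in sequentially. wsq w (%l. u ((s \<circ> r) k) l - u t l) < 1" by (rule order_tendstoD) simp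
  moreover obtain M :: nat where M: "2 * (1 + wsq w (u t)) < ennreal M"
  proof -
   obtain c where c: "0 <= c" "2 * (1 + wsq w (u t)) = ennreal c"
    using fin[of t] by (cases "2 * (1 + wsq w (u t))") (auto simp: ennreal_mult_eq_top_iff)
   obtain M :: nat where "c < M" using reals_Archimedean2 by blast
   then show thesis using that[of M] c by (simp add: ennreal_lessI)
  qed
  ultimately have "\<forall>\<^sub>F k in sequentially. wsq w (%l. u ((s \<circ> r) k) l - u t l) < 1 \<and> M <= k"
   using eventually_ge_at_top[of M] by (auto elim: eventually_conj)
  then obtain k where k: "wsq w (%l. u ((s \<circ> r) k) l - u t l) < 1" "M <= k" by (auto dest: eventually_happens)
  have "ennreal k <= ennreal (r k)" using seq_suble[OF r(1), of k] by (intro ennreal_leI) simp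
  also have "... < wsq w (u (s (r k)))" by (rule s)
  also have "... <= 2 * (wsq w (%l. u (s (r k)) l - u t l) + wsq w (u t))" by (rule wsq_split[OF m m])
  also have "... <= 2 * (1 + wsq w (u t))" using k by (intro mult_left_mono add_mono) auto
  also have "... < ennreal k" using k(2) by (intro less_le_trans[OF M] ennreal_leI) simp
  finally show False by (rule less_irrefl[THEN notE])
 qed
 then obtain k :: nat where "!!t. \<bar>t\<bar> <= T ==> wsq w (u t) <= ennreal k" by blast
 then show thesis using that[of "real k"] by simp
qed

lemma wpath_eps:
 assumes u: "wpath w u" and e: "0 < \<epsilon>" obtains d where "0 < d" "!!s. \<bar>s - t\<bar> < d ==> wsq w (%l. u s l - u t l) < \<epsilon>"
proof -
 have "\<exists>k :: nat. \<forall>s. \<bar>s - t\<bar> < inverse (Suc k) --> wsq w (%l. u s l - u t l) < \<epsilon>"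
 proof (rule ccontr)
  assume "\<not> ?thesis"
  then have "\<forall>k :: nat. \<exists>s. \<bar>s - t\<bar> < inverse (Suc k) \<and> \<epsilon> <= wsq w (%l. u s l - u t l)" by (auto simp: not_less)
  then obtain s :: "nat => real" where s: "!!k :: nat. \<bar>s k - t\<bar> < inverse (Suc k)" "!!k. \<epsilon> <= wsq w (%l. u (s k) l - u t l)" by metis
  have "(%k. s k - t) ----> 0"
   by (rule Lim_null_comparison[OF _ LIMSEQ_inverse_real_of_nat]) (use less_imp_le[OF s(1)] in auto)
  then have "s ----> t" by (simp add: LIM_zero_iff)
  then have "(%k. wsq w (%l. u (s k) l - u t l)) ----> 0" using u by (auto simp: wpath_def)
  then have "\<forall>\<^sub>F k in sequentially. wsq w (%l. u (s k) l - u t l) < \<epsilon>" using e by (rule order_tendstoD)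
  then show False using s(2) by (auto dest: eventually_happens simp: not_less[symmetric])
 qed
 then obtain k :: nat where "!!s. \<bar>s - t\<bar> < inverse (Suc k) ==> wsq w (%l. u s l - u t l) < \<epsilon>" by blast
 then show thesis using that[of "inverse (Suc k)"] by simp
qed

lemma wsq_tendsto_0_dominated:
 assumes [measurable]: "!!k. f k \<in> BM" "g \<in> BM" and fin: "wsq w g < \<infinity>"
  and le: "!!k l. 0 < l ==> \<bar>f k l\<bar> <= \<bar>g l\<bar>" and lim: "!!l. 0 < l ==> (%k. f k l) ----> 0"
 shows "(%k. wsq w (f k)) ----> 0"
proof -
 note w_meas[measurable]
 have "(%k. NN l. ennreal (w l * (f k l)^2)) ----> (NN l. 0)"
 proof (rule nn_integral_dominated_convergence[where w="%l. ennreal (w l * (g l)^2)"])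
  show "AE l in hl. ennreal (w l * (f k l)^2) <= ennreal (w l * (g l)^2)" for k
   using le less_imp_le[OF w_pos] by (auto intro!: AE_hlI ennreal_leI mult_left_mono simp: abs_le_square_iff)
  show "AE l in hl. (%k. ennreal (w l * (f k l)^2)) ----> 0"
  proof (rule AE_hlI)
   fix l :: real assume "0 < l"
   have "(%k. w l * (f k l)^2) ----> w l * 0^2" by (intro tendsto_intros lim \<open>0 < l\<close>)
   then show "(%k. ennreal (w l * (f k l)^2)) ----> 0" using tendsto_ennrealI by fastforce
  qed
  show "(NN l. ennreal (w l * (g l)^2)) < \<infinity>" using fin by (simp add: wsq_def)
 qed auto
 then show ?thesis by (simp add: wsq_def)
qed

end

interpretation wl: weight "%l. l" by unfold_locales auto
interpretation wi: weight inverse by unfold_locales auto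

abbreviation "hpath \<equiv> wpath (%l. l)"
abbreviation "dpath \<equiv> wpath inverse"

text \<open>Joint continuity makes every time integral at a fixed frequency one of a continuous
  function, with no exceptional set of frequencies that varies with time; \<open>dpath\<close>
  carries the norm.\<close>

definition forcing :: "(real => real => real) => bool" where
 "forcing n \<longleftrightarrow> continuous_on UNIV (%p. n (fst p) (snd p)) \<and> dpath n"

lemma path_Hhalf: "hpath u ==> Hhalf (u t)" unfolding wpath_def Hhalf_def ns_wsq by blast
lemma dpath_Hdual: "dpath u ==> Hdual (u t)" unfolding wpath_def Hdual_def nm_wsq by blast

lemma path_tendsto: "hpath u ==> s ----> t ==> (%k. ns (%l. u (s k) l - u t l)) ----> 0"
 unfolding wpath_def ns_wsq by blast

lemma dpath_tendsto: "dpath u ==> s ----> t ==> (%k. nm (%l. u (s k) l - u t l)) ----> 0"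
 unfolding wpath_def nm_wsq by blast

lemma forcing_measurable2: "forcing n ==> (%p. n (fst p) (snd p)) \<in> borel_measurable (borel \<Otimes>\<^sub>M borel)"
 unfolding forcing_def borel_prod by (blast intro: borel_measurable_continuous_onI)

lemma forcing_isCont: assumes "forcing n" shows "isCont (%ta. n ta l) t"
proof -
 have "continuous_on UNIV ((%p. n (fst p) (snd p)) \<circ> (%ta. (ta, l)))"
  by (rule continuous_on_compose) (use assms in "auto simp: forcing_def intro!: continuous_intros intro: continuous_on_subset")
 then show ?thesis by (simp add: comp_def continuous_on_eq_continuous_at)
qed

lemma real_tendsto_0_of_ennreal_square:
 fixes f :: "nat => real"
 assumes "!!k. ennreal ((f k)^2) <= a k" "a ----> 0" shows "f ----> 0"
proof -
 have "(%k. ennreal ((f k)^2)) ----> ennreal 0"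
  using tendsto_sandwich[OF _ _ tendsto_const assms(2)] assms(1) by (simp add: always_eventually)
 then have "(%k. (f k)^2) ----> 0" by (subst (asm) tendsto_ennreal_iff) auto
 then show ?thesis by simp
qed

text \<open>Time increments are small uniformly in \<open>l\<close> by the pointwise Lipschitz
  bound, and at a fixed time the value is continuous in \<open>l\<close>; together this is joint
  continuity. Since \<open>F\<close> vanishes at 0, the Lipschitz bound also gives finite
  norms.\<close>

theorem forcing_lip_map:
 assumes F: "lip_map F L" and u: "hpath u" shows "forcing (%ta. F (u ta))"
proof -
 have H: "Hhalf (u t)" for t by (rule path_Hhalf[OF u])
 have L: "nm (%l. F (u ta) l - F (u t) l) <= ennreal L * ns (%l. u ta l - u t l)"
  "ennreal ((F (u ta) l - F (u t) l)^2) <= ennreal L * ns (%l. u ta l - u t l)" for ta t l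
  using F H unfolding lip_map_def by blast+
 have c: "continuous_on UNIV (F (u t))" for t using F H unfolding lip_map_def by blast
 have m: "F (u t) \<in> BM" for t by (rule borel_measurable_continuous_onI[OF c])
 have lim: "(%k. ennreal L * ns (%l. u (s k) l - u t l)) ----> 0" if "s ----> t" for s t
  using ennreal_tendsto_cmult[OF _ path_tendsto[OF u that], of "ennreal L"] by simp
 have "isCont (%p. F (u (fst p)) (snd p)) p" for p
  unfolding continuous_at_sequentially
 proof (intro allI impI)
  fix s assume s: "s ----> p"
  have s1: "(%k. fst (s k)) ----> fst p" "(%k. snd (s k)) ----> snd p" using s by (auto intro: tendsto_intros)
  have "(%k. F (u (fst (s k))) (snd (s k)) - F (u (fst p)) (snd (s k))) ----> 0"
   by (rule real_tendsto_0_of_ennreal_square[OF L(2) lim[OF s1(1)]])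
  moreover have "(%k. F (u (fst p)) (snd (s k))) ----> F (u (fst p)) (snd p)"
   by (rule isCont_tendsto_compose[OF _ s1(2)]) (use c[of "fst p"] in "simp add: continuous_on_eq_continuous_at")
  ultimately show "((%p. F (u (fst p)) (snd p)) \<circ> s) ----> F (u (fst p)) (snd p)"
   using tendsto_add by (fastforce simp: comp_def)
 qed
 then have 1: "continuous_on UNIV (%p. F (u (fst p)) (snd p))" by (simp add: continuous_on_eq_continuous_at)
 have fin: "nm (F (u t)) < \<infinity>" for t
 proof -
  have "nm (%l. F (u t) l - F (%l. 0) l) <= ennreal L * ns (%l. u t l - 0)"
   using F H[of t] Hhalf_zero unfolding lip_map_def by blast
  moreover have "F (%l. 0) = (%l. 0)" using F unfolding lip_map_def by blast
  ultimately have "nm (F (u t)) <= ennreal L * ns (u t)" by simp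
  also have "... < \<infinity>" using H[of t] by (simp add: Hhalf_def ennreal_mult_less_top)
  finally show ?thesis .
 qed
 have "(%k. nm (%l. F (u (s k)) l - F (u t) l)) ----> 0" if "s ----> t" for s t
  by (rule tendsto_sandwich[OF _ _ tendsto_const lim[OF that]]) (auto simp: L)
 then show ?thesis unfolding forcing_def wpath_def using 1 m fin by (auto simp: nm_wsq)
qed

section \<open>Time integrals of forcings\<close>

definition seg :: "real => real => real measure" where
 "seg s t = density lborel (%ta. ennreal (indicator {min s t<..<max s t} ta))"

lemma sets_seg[measurable_cong, simp]: "sets (seg s t) = sets borel" and space_seg[simp]: "space (seg s t) = UNIV"
 by (simp_all add: seg_def)

lemma emeasure_seg: "emeasure (seg s t) UNIV = ennreal \<bar>t - s\<bar>"
 unfolding seg_def by (subst emeasure_density) (auto simp: ennreal_indicator min_def max_def)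

lemma finite_measure_seg: "finite_measure (seg s t)"
 by (rule finite_measureI) (simp add: emeasure_seg del: sets_seg)

interpretation seg: finite_measure "seg s t" for s t by (rule finite_measure_seg)
interpretation hs: pair_sigma_finite hl "seg s t" for s t by unfold_locales
interpretation sh: pair_sigma_finite "seg s t" hl for s t by unfold_locales

lemma AE_seg: "(!!ta. min s t < ta ==> ta < max s t ==> P ta) ==> AE ta in seg s t. P ta"
 unfolding seg_def by (subst AE_density) (auto simp: indicator_def)

text \<open>\<open>seg s t\<close> carries no orientation; the sign of the oriented integral is
  restored here.\<close>

lemma LBINT_seg:
 fixes f :: "real => real"
 assumes [measurable]: "f \<in> BM"
 shows "(LBINT ta=ereal s..ereal t. f ta) = (if s <= t then 1 else - 1) * (\<integral>ta. f ta \<partial>seg s t)"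
 unfolding seg_def interval_lebesgue_integral_def set_lebesgue_integral_def
 by (subst integral_density) (auto simp: min_def max_def)

lemma LBINT_integrable:
 fixes f :: "real => real"
 assumes "!!x. isCont f x" shows "interval_lebesgue_integrable lborel (ereal s) (ereal t) f"
 by (rule interval_integrable_isCont) (rule assms)

lemma isCont_borel: "(!!x. isCont f x) ==> f \<in> BM" for f :: "real => real"
 by (intro borel_measurable_continuous_onI) (simp add: continuous_on_eq_continuous_at)

lemma LBINT_square_le:
 fixes f :: "real => real"
 assumes c: "!!x. isCont f x"
 shows "ennreal ((LBINT ta=ereal s..ereal t. f ta)^2) <= ennreal \<bar>t - s\<bar> * (\<integral>\<^sup>+ta. ennreal ((f ta)^2) \<partial>seg s t)"
proof -
 note [measurable] = isCont_borel[OF c]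
 have "ennreal \<bar>\<integral>ta. f ta \<partial>seg s t\<bar> <= (\<integral>\<^sup>+ta. ennreal \<bar>f ta\<bar> \<partial>seg s t)"
 proof (cases "integrable (seg s t) f")
  case True
  from integral_norm_bound_ennreal[OF True] show ?thesis by simp
 qed (simp add: not_integrable_integral_eq)
 then have "(ennreal \<bar>\<integral>ta. f ta \<partial>seg s t\<bar>)^2 <= (\<integral>\<^sup>+ta. 1 * ennreal \<bar>f ta\<bar> \<partial>seg s t)^2" by (intro power_mono) auto
 also have "... <= (\<integral>\<^sup>+ta. 1^2 \<partial>seg s t) * (\<integral>\<^sup>+ta. (ennreal \<bar>f ta\<bar>)^2 \<partial>seg s t)"
  by (rule Cauchy_Schwarz_nn_integral) measurable
 also have "... = ennreal \<bar>t - s\<bar> * (\<integral>\<^sup>+ta. ennreal ((f ta)^2) \<partial>seg s t)" by (simp add: emeasure_seg ennreal_power)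
 finally have "ennreal ((\<integral>ta. f ta \<partial>seg s t)^2) <= ennreal \<bar>t - s\<bar> * (\<integral>\<^sup>+ta. ennreal ((f ta)^2) \<partial>seg s t)"
  by (simp add: ennreal_power)
 moreover have "(LBINT ta=ereal s..ereal t. f ta)^2 = (\<integral>ta. f ta \<partial>seg s t)^2" by (simp add: LBINT_seg)
 ultimately show ?thesis by (simp only:)
qed

text \<open>\<open>k\<close> will be the sine, the cosine or the constant 1. The first two are the
  pieces of the Duhamel kernel; the constant serves the pointwise bounds, where the oscillation is
  made part of the forcing.\<close>

definition duh :: "(real => real) => (real => real => real) => real => real => real => real" where
 "duh k n s t l = (LBINT ta=ereal s..ereal t. k (ta * l) * n ta l)"

context
 fixes k :: "real => real"
 assumes k: "!!x. isCont k x" "!!x. \<bar>k x\<bar> <= 1"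
begin

lemma k_measurable: "k \<in> BM" by (rule isCont_borel[OF k(1)])

lemma duh_isCont: "forcing n ==> isCont (%ta. k (ta * l) * n ta l) t"
 by (rule isCont_mult[OF isCont_o2[OF _ k(1)] forcing_isCont]) (auto intro: continuous_intros)

lemma duh_measurable: assumes n: "forcing n" shows "duh k n s t \<in> BM"
proof -
 note k_measurable[measurable]
 note [measurable (raw)] = measurable_two[OF forcing_measurable2[OF n]]
 have "duh k n s t = (%l. (if s <= t then 1 else - 1) * (\<integral>ta. k (ta * l) * n ta l \<partial>seg s t))"
  unfolding duh_def by (subst LBINT_seg) auto
 then show ?thesis by simp
qed

text \<open>The oriented integral is rewritten over the whole line with a signed indicator, so that
  the measure no longer depends on \<open>t\<close> and joint measurability is that of a
  parametrised integral.\<close>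

lemma duh_measurable2: assumes n: "forcing n" shows "(%p. duh k n 0 (fst p) (snd p)) \<in> borel_measurable (borel \<Otimes>\<^sub>M borel)"
proof -
 note k_measurable[measurable]
 note [measurable (raw)] = measurable_two[OF forcing_measurable2[OF n]]
 have "duh k n 0 t l = (\<integral>ta. (if 0 < ta \<and> ta < t then 1 else if t < ta \<and> ta < 0 then - 1 else 0) * (k (ta * l) * n ta l) \<partial>lborel)" for t l
 proof -
  have "duh k n 0 t l = (if 0 <= t then 1 else - 1) * (\<integral>ta. indicator {min 0 t<..<max 0 t} ta * (k (ta * l) * n ta l) \<partial>lborel)"
   unfolding duh_def by (subst LBINT_seg) (auto simp: seg_def integral_density)
  also have "... = (\<integral>ta. (if 0 <= t then 1 else - 1) * (indicator {min 0 t<..<max 0 t} ta * (k (ta * l) * n ta l)) \<partial>lborel)" by simp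
  also have "... = (\<integral>ta. (if 0 < ta \<and> ta < t then 1 else if t < ta \<and> ta < 0 then - 1 else 0) * (k (ta * l) * n ta l) \<partial>lborel)"
   by (intro Bochner_Integration.integral_cong) (auto simp: indicator_def)
  finally show ?thesis .
 qed
 then show ?thesis by simp
qed

text \<open>Cauchy-Schwarz in time at a fixed frequency costs the factor
  \<open>\<bar>t - s\<bar>\<close>; the frequency integral is then taken inside by Fubini.\<close>

lemma duh_nm: assumes n: "forcing n" shows "nm (duh k n s t) <= ennreal \<bar>t - s\<bar> * (\<integral>\<^sup>+ta. nm (n ta) \<partial>seg s t)"
proof -
 note [measurable (raw)] = measurable_two[OF forcing_measurable2[OF n]]
 have "nm (duh k n s t) <= (NN l. ennreal \<bar>t - s\<bar> * (\<integral>\<^sup>+ta. ennreal ((n ta l)^2 / l) \<partial>seg s t))" unfolding nm_def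
 proof (rule nn_integral_hl_mono)
  fix l :: real assume l: "0 < l"
  have "ennreal ((duh k n s t l)^2 / l) = ennreal (1 / l) * ennreal ((duh k n s t l)^2)" using l by (simp add: ennreal_mult[symmetric])
  also have "... <= ennreal (1 / l) * (ennreal \<bar>t - s\<bar> * (\<integral>\<^sup>+ta. ennreal ((k (ta * l) * n ta l)^2) \<partial>seg s t))"
   unfolding duh_def by (intro mult_left_mono LBINT_square_le duh_isCont n) simp
  also have "... <= ennreal (1 / l) * (ennreal \<bar>t - s\<bar> * (\<integral>\<^sup>+ta. ennreal ((n ta l)^2) \<partial>seg s t))"
  proof (intro mult_left_mono nn_integral_mono ennreal_leI)
   fix ta
   have "\<bar>k (ta * l) * n ta l\<bar> <= \<bar>n ta l\<bar>" unfolding abs_mult using k(2) by (intro mult_left_le_one_le) auto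
   then show "(k (ta * l) * n ta l)^2 <= (n ta l)^2" by (simp add: abs_le_square_iff)
  qed auto
  also have "... = ennreal \<bar>t - s\<bar> * (ennreal (1 / l) * (\<integral>\<^sup>+ta. ennreal ((n ta l)^2) \<partial>seg s t))" by (rule mult.left_commute)
  also have "ennreal (1 / l) * (\<integral>\<^sup>+ta. ennreal ((n ta l)^2) \<partial>seg s t) = (\<integral>\<^sup>+ta. ennreal ((n ta l)^2 / l) \<partial>seg s t)"
   using l by (subst nn_integral_cmult[symmetric]) (auto intro!: nn_integral_cong simp: ennreal_mult[symmetric])
  finally show "ennreal ((duh k n s t l)^2 / l) <= ennreal \<bar>t - s\<bar> * (\<integral>\<^sup>+ta. ennreal ((n ta l)^2 / l) \<partial>seg s t)" .
 qed
 also have "... = ennreal \<bar>t - s\<bar> * (NN l. \<integral>\<^sup>+ta. ennreal ((n ta l)^2 / l) \<partial>seg s t)" by (rule nn_integral_cmult) measurable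
 also have "(NN l. \<integral>\<^sup>+ta. ennreal ((n ta l)^2 / l) \<partial>seg s t) = (\<integral>\<^sup>+ta. nm (n ta) \<partial>seg s t)"
  unfolding nm_def by (rule hs.Fubini'[symmetric]) measurable
 finally show ?thesis .
qed

lemma duh_nm_bound:
 assumes n: "forcing n" and C: "!!ta. min s t < ta ==> ta < max s t ==> nm (n ta) <= ennreal C" "0 <= C"
 shows "nm (duh k n s t) <= ennreal (C * (t - s)^2)"
proof -
 have "nm (duh k n s t) <= ennreal \<bar>t - s\<bar> * (\<integral>\<^sup>+ta. ennreal C \<partial>seg s t)"
  by (rule order_trans[OF duh_nm[OF n]], rule mult_left_mono, rule nn_integral_mono_AE, rule AE_seg) (use C in auto)
 also have "... = ennreal (C * (t - s)^2)"
  using C(2) by (simp add: emeasure_seg ennreal_mult[symmetric] power2_eq_square abs_mult_self_eq mult.left_commute)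
 finally show ?thesis .
qed

lemma duh_sum: "forcing n ==> duh k n s t l + duh k n t r l = duh k n s r l"
 unfolding duh_def by (intro interval_integral_sum LBINT_integrable[of _ "min s (min t r)" "max s (max t r)", simplified] )
  (auto intro!: LBINT_integrable duh_isCont simp flip: ereal_min ereal_max)

lemma duh_same[simp]: "duh k n s s l = 0" by (simp add: duh_def)

lemma duh_diff: "forcing n ==> forcing n' ==> duh k (%ta l. n ta l - n' ta l) s t l = duh k n s t l - duh k n' s t l"
 unfolding duh_def right_diff_distrib
 by (intro interval_lebesgue_integral_diff(2) LBINT_integrable duh_isCont)

lemma duh_deriv: assumes n: "forcing n" shows "((%t. duh k n 0 t l) has_real_derivative k (t * l) * n t l) (at t)"
proof -
 let ?f = "%ta. k (ta * l) * n ta l"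
 let ?a = "min 0 t - 1" and ?b = "max 0 t + 1"
 have "((%u. LBINT y=ereal 0..ereal u. ?f y) has_vector_derivative ?f t) (at t within {?a..?b})"
  by (rule interval_integral_FTC2) (auto intro!: continuous_at_imp_continuous_on duh_isCont n)
 moreover have "at t within {?a..?b} = at t" by (rule at_within_interior) (auto simp: interior_atLeastAtMost_real)
 ultimately show ?thesis unfolding duh_def by (simp add: has_real_derivative_iff_has_vector_derivative)
qed

end

section \<open>Mild solutions: energy estimate, Gronwall and Picard iteration\<close>

lemma sin_cos_ok: "isCont sin (x :: real)" "\<bar>sin (x :: real)\<bar> <= 1" "isCont cos (x :: real)" "\<bar>cos (x :: real)\<bar> <= 1"
 by auto

lemmas duhs = duh_measurable[of sin, OF sin_cos_ok(1,2)] duh_measurable[of cos, OF sin_cos_ok(3,4)]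
lemmas duhs_nm = duh_nm[of sin, OF sin_cos_ok(1,2)] duh_nm[of cos, OF sin_cos_ok(3,4)]
lemmas duhs_bound = duh_nm_bound[of sin, OF sin_cos_ok(1,2)] duh_nm_bound[of cos, OF sin_cos_ok(3,4)]
lemmas duhs_sum = duh_sum[of sin, OF sin_cos_ok(1,2)] duh_sum[of cos, OF sin_cos_ok(3,4)]
lemmas duhs_diff = duh_diff[of sin, OF sin_cos_ok(1,2)] duh_diff[of cos, OF sin_cos_ok(3,4)]
lemmas duhs_deriv = duh_deriv[of sin, OF sin_cos_ok(1,2)] duh_deriv[of cos, OF sin_cos_ok(3,4)]

text \<open>Variation of constants with \<open>sin ((t - s) * l)\<close> expanded by the addition theorem, so that the integrals no longer
  depend on \<open>t\<close> through the kernel. \<open>US\<close> is the solution and \<open>WS\<close> its time derivative.\<close>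

definition US :: "(real => real) => (real => real) => (real => real => real) => real => real => real" where
 "US u0 u1 n t l = cos (t * l) * (u0 l + duh sin n 0 t l / l) + sin (t * l) * (u1 l - duh cos n 0 t l) / l"

definition WS :: "(real => real) => (real => real) => (real => real => real) => real => real => real" where
 "WS u0 u1 n t l = l * (- sin (t * l) * (u0 l + duh sin n 0 t l / l)) + cos (t * l) * (u1 l - duh cos n 0 t l)"

lemma ns_divide: "ns (%l. f l / l) = nm f"
 unfolding ns_def nm_def by (intro nn_integral_hl_cong) (simp add: power_divide power2_eq_square)

lemma nm_times: "nm (%l. l * f l) = ns f"
proof -
 have "(l * f l)^2 / l = l * (f l)^2" if "0 < l" for l using that by (simp add: power_mult_distrib power2_eq_square[of l])
 then show ?thesis unfolding ns_def nm_def by (intro nn_integral_hl_cong) (simp only:)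
qed

lemma ns_trig: "f \<in> BM ==> (!!l. \<bar>k l\<bar> <= c) ==> ns (%l. k l * f l) <= ennreal (c^2) * ns f"
 unfolding ns_wsq by (rule wsq_mult_le) (auto simp: abs_mult mult_right_mono)

lemma nm_trig: "f \<in> BM ==> (!!l. \<bar>k l\<bar> <= c) ==> nm (%l. k l * f l) <= ennreal (c^2) * nm f"
 unfolding nm_wsq by (rule wsq_mult_le) (auto simp: abs_mult mult_right_mono)

lemma US_parts:
 assumes [measurable]: "a \<in> BM" "b \<in> BM" "p \<in> BM" "q \<in> BM"
  and p: "!!l. \<bar>p l\<bar> <= 1" and q: "!!l. \<bar>q l\<bar> <= 1"
 shows "ns (%l. p l * a l + q l * b l / l) <= 2 * (ns a + nm b)"
  and "nm (%l. l * (p l * a l) + q l * b l) <= 2 * (ns a + nm b)"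
proof -
 have 1: "ns (%l. p l * a l) <= ns a" "nm (%l. q l * b l) <= nm b"
  using ns_trig[OF _ p, of a] nm_trig[OF _ q, of b] by auto
 have "ns (%l. p l * a l + q l * b l / l) <= 2 * (ns (%l. p l * a l) + ns (%l. q l * b l / l))" by (rule ns_add_le) measurable
 also have "... <= 2 * (ns a + nm b)" unfolding ns_divide using 1 by (intro mult_left_mono add_mono) auto
 finally show "ns (%l. p l * a l + q l * b l / l) <= 2 * (ns a + nm b)" .
 have "nm (%l. l * (p l * a l) + q l * b l) <= 2 * (nm (%l. l * (p l * a l)) + nm (%l. q l * b l))" by (rule nm_add_le) measurable
 also have "... <= 2 * (ns a + nm b)" unfolding nm_times using 1 by (intro mult_left_mono add_mono) auto
 finally show "nm (%l. l * (p l * a l) + q l * b l) <= 2 * (ns a + nm b)" .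
qed

text \<open>The squared triangle inequality is applied twice, inside each amplitude and between the
  two, which gives 4 on the data. A Duhamel integral sits in both amplitudes, which doubles its
  constant to 8.\<close>

theorem US_energy:
 assumes [measurable]: "u0 \<in> BM" "u1 \<in> BM" and n: "forcing n"
 shows "ns (US u0 u1 n t) <= 4 * (ns u0 + nm u1) + 8 * (ennreal \<bar>t\<bar> * (\<integral>\<^sup>+ta. nm (n ta) \<partial>seg 0 t))" (is "_ <= ?R")
  and "nm (WS u0 u1 n t) <= 4 * (ns u0 + nm u1) + 8 * (ennreal \<bar>t\<bar> * (\<integral>\<^sup>+ta. nm (n ta) \<partial>seg 0 t))"
proof -
 note [measurable] = duhs[OF n]
 define a where "a = (%l. u0 l + duh sin n 0 t l / l)"
 define b where "b = (%l. u1 l - duh cos n 0 t l)"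
 have m[measurable]: "a \<in> BM" "b \<in> BM" unfolding a_def b_def by measurable
 define E where "E = ennreal \<bar>t\<bar> * (\<integral>\<^sup>+ta. nm (n ta) \<partial>seg 0 t)"
 have E: "nm (duh sin n 0 t) <= E" "nm (duh cos n 0 t) <= E" unfolding E_def using duhs_nm[OF n, of 0 t] by simp_all
 have "ns a <= 2 * (ns u0 + ns (%l. duh sin n 0 t l / l))" unfolding a_def by (rule ns_add_le) measurable
 also have "... <= 2 * (ns u0 + E)" unfolding ns_divide by (intro mult_left_mono add_mono E) auto
 finally have 1: "ns a <= 2 * (ns u0 + E)" .
 have "nm b <= 2 * (nm u1 + nm (duh cos n 0 t))" unfolding b_def by (rule nm_diff_le) measurable
 also have "... <= 2 * (nm u1 + E)" by (intro mult_left_mono add_mono E) auto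
 finally have 2: "nm b <= 2 * (nm u1 + E)" .
 have "2 * (ns a + nm b) <= 2 * (2 * (ns u0 + E) + 2 * (nm u1 + E))" by (intro mult_left_mono add_mono 1 2) auto
 also have "... = 4 * (ns u0 + nm u1) + 8 * E" 
 proof -
  have "8 * E = 4 * E + 4 * E" by (simp flip: distrib_right)
  moreover have "2 * (2 * (ns u0 + E) + 2 * (nm u1 + E)) = (4 * ns u0 + 4 * E) + (4 * nm u1 + 4 * E)"
   by (simp add: distrib_left mult.assoc[symmetric])
  ultimately show ?thesis by (simp only: distrib_left ac_simps)
 qed
 finally have le: "2 * (ns a + nm b) <= ?R" unfolding E_def .
 have "ns (US u0 u1 n t) = ns (%l. cos (t * l) * a l + sin (t * l) * b l / l)" by (simp add: US_def[abs_def] a_def b_def)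
 also have "... <= 2 * (ns a + nm b)" by (rule US_parts) auto
 also note le
 finally show "ns (US u0 u1 n t) <= ?R" .
 have "nm (WS u0 u1 n t) = nm (%l. l * (- sin (t * l) * a l) + cos (t * l) * b l)" by (simp add: WS_def[abs_def] a_def b_def)
 also have "... <= 2 * (ns a + nm b)" by (rule US_parts) auto
 also note le
 finally show "nm (WS u0 u1 n t) <= ?R" .
qed

lemma US_diff: "forcing n ==> forcing n' ==>
  US (%l. u0 l - w0 l) (%l. u1 l - w1 l) (%ta l. n ta l - n' ta l) t = (%l. US u0 u1 n t l - US w0 w1 n' t l)"
 and WS_diff: "forcing n ==> forcing n' ==>
  WS (%l. u0 l - w0 l) (%l. u1 l - w1 l) (%ta l. n ta l - n' ta l) t = (%l. WS u0 u1 n t l - WS w0 w1 n' t l)"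
 by (simp_all add: fun_eq_iff US_def WS_def duhs_diff algebra_simps diff_divide_distrib add_divide_distrib)

lemma forcing_diff: assumes "forcing n" "forcing n'" shows "forcing (%ta l. n ta l - n' ta l)"
proof -
 have d: "dpath n" "dpath n'" using assms by (auto simp: forcing_def)
 note [measurable] = dpath_Hdual[OF d(1), THEN Hdual_measurable] dpath_Hdual[OF d(2), THEN Hdual_measurable]
 have "(%k. nm (%l. (n (s k) l - n' (s k) l) - (n t l - n' t l))) ----> 0" if s: "s ----> t" for s t
 proof (rule ennreal_tendsto_0_squeeze)
  show "(%k. nm (%l. n (s k) l - n t l) + nm (%l. n' (s k) l - n' t l)) ----> 0"
   using tendsto_add[OF dpath_tendsto[OF d(1) s] dpath_tendsto[OF d(2) s]] by simp
  show "nm (%l. (n (s k) l - n' (s k) l) - (n t l - n' t l)) <= 2 * (nm (%l. n (s k) l - n t l) + nm (%l. n' (s k) l - n' t l))" for k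
   using nm_diff_le[of "%l. n (s k) l - n t l" "%l. n' (s k) l - n' t l"] by (simp add: algebra_simps)
 qed simp
 moreover have "Hdual (%l. n t l - n' t l)" for t by (intro Hdual_diff dpath_Hdual d)
 ultimately show ?thesis using assms unfolding forcing_def wpath_def nm_wsq[symmetric] Hdual_def
  by (auto intro!: continuous_intros)
qed

theorem US_compare:
 assumes m: "u0 \<in> BM" "u1 \<in> BM" "w0 \<in> BM" "w1 \<in> BM"
  and n: "forcing n" "forcing n'" and B: "!!ta. min 0 t < ta ==> ta < max 0 t ==> nm (%l. n ta l - n' ta l) <= D ta"
 shows "ns (%l. US u0 u1 n t l - US w0 w1 n' t l) <= 4 * (ns (%l. u0 l - w0 l) + nm (%l. u1 l - w1 l)) + 8 * (ennreal \<bar>t\<bar> * (\<integral>\<^sup>+ta. D ta \<partial>seg 0 t))"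
  and "nm (%l. WS u0 u1 n t l - WS w0 w1 n' t l) <= 4 * (ns (%l. u0 l - w0 l) + nm (%l. u1 l - w1 l)) + 8 * (ennreal \<bar>t\<bar> * (\<integral>\<^sup>+ta. D ta \<partial>seg 0 t))"
proof -
 note [measurable] = m
 have "(\<integral>\<^sup>+ta. nm (%l. n ta l - n' ta l) \<partial>seg 0 t) <= (\<integral>\<^sup>+ta. D ta \<partial>seg 0 t)"
  by (rule nn_integral_mono_AE, rule AE_seg) (use B in auto)
 then have le: "4 * (ns (%l. u0 l - w0 l) + nm (%l. u1 l - w1 l)) + 8 * (ennreal \<bar>t\<bar> * (\<integral>\<^sup>+ta. nm (%l. n ta l - n' ta l) \<partial>seg 0 t))
   \<le> 4 * (ns (%l. u0 l - w0 l) + nm (%l. u1 l - w1 l)) + 8 * (ennreal \<bar>t\<bar> * (\<integral>\<^sup>+ta. D ta \<partial>seg 0 t))"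
  by (intro add_left_mono mult_left_mono) auto
 show "ns (%l. US u0 u1 n t l - US w0 w1 n' t l) <= 4 * (ns (%l. u0 l - w0 l) + nm (%l. u1 l - w1 l)) + 8 * (ennreal \<bar>t\<bar> * (\<integral>\<^sup>+ta. D ta \<partial>seg 0 t))"
  unfolding US_diff[OF n, symmetric] by (rule order_trans[OF US_energy(1)[OF _ _ forcing_diff[OF n]] le]) measurable
 show "nm (%l. WS u0 u1 n t l - WS w0 w1 n' t l) <= 4 * (ns (%l. u0 l - w0 l) + nm (%l. u1 l - w1 l)) + 8 * (ennreal \<bar>t\<bar> * (\<integral>\<^sup>+ta. D ta \<partial>seg 0 t))"
  unfolding WS_diff[OF n, symmetric] by (rule order_trans[OF US_energy(2)[OF _ _ forcing_diff[OF n]] le]) measurable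
qed

text \<open>An increment in time is split into increments of the amplitudes \<open>a\<close> and
  \<open>b\<close>, which are Duhamel integrals over short intervals, and increments of the
  trigonometric factors against fixed amplitudes, which vanish by dominated convergence.\<close>

theorem US_paths:
 assumes u0: "Hhalf u0" and u1: "Hdual u1" and n: "forcing n"
 shows "hpath (US u0 u1 n)" "dpath (WS u0 u1 n)"
proof -
 note [measurable] = duhs[OF n] Hhalf_measurable[OF u0] Hdual_measurable[OF u1]
 define a where "a t l = u0 l + duh sin n 0 t l / l" for t l
 define b where "b t l = u1 l - duh cos n 0 t l" for t l
 have m[measurable]: "a t \<in> BM" "b t \<in> BM" for t unfolding a_def b_def by measurable
 have dn: "dpath n" using n by (simp add: forcing_def)
 have dfin: "nm (duh sin n 0 t) < \<infinity>" "nm (duh cos n 0 t) < \<infinity>" for t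
 proof -
  obtain C where C: "0 <= C" "!!ta. \<bar>ta\<bar> <= \<bar>t\<bar> ==> nm (n ta) <= ennreal C"
   using wi.wpath_bounded[OF dn, of "\<bar>t\<bar>"] unfolding nm_wsq by blast
  have "nm (duh sin n 0 t) <= ennreal (C * (t - 0)^2)" "nm (duh cos n 0 t) <= ennreal (C * (t - 0)^2)"
   by (rule duhs_bound[OF n]; use C in auto)+
  then show "nm (duh sin n 0 t) < \<infinity>" "nm (duh cos n 0 t) < \<infinity>" by (auto intro: le_less_trans)
 qed
 have Ha: "Hhalf (a t)" for t unfolding a_def
  by (rule Hhalf_add[OF u0]) (use dfin in "auto simp: Hhalf_def ns_divide")
 have Hb: "Hdual (b t)" for t unfolding b_def
  by (rule Hdual_diff[OF u1]) (use dfin in "auto simp: Hdual_def")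
 have US: "US u0 u1 n t = (%l. cos (t * l) * a t l + sin (t * l) * b t l / l)" for t by (simp add: US_def[abs_def] a_def b_def)
 have WS: "WS u0 u1 n t = (%l. l * (- sin (t * l) * a t l) + cos (t * l) * b t l)" for t by (simp add: WS_def[abs_def] a_def b_def)
 have fin: "ns (US u0 u1 n t) < \<infinity>" "nm (WS u0 u1 n t) < \<infinity>" for t
 proof -
  have "2 * (ns (a t) + nm (b t)) < \<infinity>" using Ha[of t] Hb[of t] by (simp add: Hhalf_def Hdual_def ennreal_mult_less_top)
  moreover have "ns (US u0 u1 n t) <= 2 * (ns (a t) + nm (b t))" unfolding US by (rule US_parts) auto
  moreover have "nm (WS u0 u1 n t) <= 2 * (ns (a t) + nm (b t))" unfolding WS by (rule US_parts) auto
  ultimately show "ns (US u0 u1 n t) < \<infinity>" "nm (WS u0 u1 n t) < \<infinity>" by (auto intro: le_less_trans)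
 qed
 have meas: "US u0 u1 n t \<in> BM" "WS u0 u1 n t \<in> BM" for t unfolding US WS by measurable
 have key: "(%k. ns (%l. US u0 u1 n (s k) l - US u0 u1 n t l)) ----> 0 \<and> (%k. nm (%l. WS u0 u1 n (s k) l - WS u0 u1 n t l)) ----> 0"
  if s: "s ----> t" for s t
 proof -
  obtain T where T: "!!k. \<bar>s k\<bar> <= T" using convergent_imp_Bseq[of s] s by (auto simp: convergent_def Bseq_def)
  obtain C where C: "0 <= C" "!!ta. \<bar>ta\<bar> <= max T \<bar>t\<bar> ==> nm (n ta) <= ennreal C"
   using wi.wpath_bounded[OF dn, of "max T \<bar>t\<bar>"] unfolding nm_wsq by blast
  have Cb: "nm (n ta) <= ennreal C" if "min t (s k) < ta" "ta < max t (s k)" for ta k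
   by (rule C(2)) (use T[of k] that in auto)
  have da: "a (s k) l - a t l = duh sin n t (s k) l / l" and db: "b (s k) l - b t l = - duh cos n t (s k) l" for k l
   using duhs_sum(1)[OF n, of 0 t l "s k"] duhs_sum(2)[OF n, of 0 t l "s k"]
   by (auto simp: a_def b_def diff_divide_distrib[symmetric])
  have z: "(%k. ennreal (C * (s k - t)^2)) ----> 0"
  proof -
   have "(%k. C * (s k - t)^2) ----> C * (t - t)^2" by (intro tendsto_intros s)
   from tendsto_ennrealI[OF this] show ?thesis by simp
  qed
  have 1: "(%k. ns (%l. a (s k) l - a t l)) ----> 0"
  proof (rule tendsto_sandwich[OF _ _ tendsto_const z])
   show "\<forall>\<^sub>F k in sequentially. ns (%l. a (s k) l - a t l) <= ennreal (C * (s k - t)^2)"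
    unfolding da ns_divide by (intro always_eventually allI duhs_bound n C Cb)
  qed auto
  have 2: "(%k. nm (%l. b (s k) l - b t l)) ----> 0"
  proof (rule tendsto_sandwich[OF _ _ tendsto_const z])
   have "nm (%l. - duh cos n t (s k) l) = nm (duh cos n t (s k))" for k by (simp add: nm_def)
   then show "\<forall>\<^sub>F k in sequentially. nm (%l. b (s k) l - b t l) <= ennreal (C * (s k - t)^2)"
    unfolding db using duhs_bound(2)[OF n Cb C(1)] by (auto intro!: always_eventually)
  qed auto
  have tr: "(%k. cos (s k * l) - cos (t * l)) ----> 0" "(%k. sin (s k * l) - sin (t * l)) ----> 0" for l
   using tendsto_diff[OF tendsto_cos[OF tendsto_mult_right[OF s, of l]] tendsto_const[of "cos (t * l)"]]
    tendsto_diff[OF tendsto_sin[OF tendsto_mult_right[OF s, of l]] tendsto_const[of "sin (t * l)"]] by simp_all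
  have tb: "\<bar>cos x - cos y\<bar> <= 2" "\<bar>sin x - sin y\<bar> <= 2" for x y :: real
   using sin_cos_ok(2)[of x] sin_cos_ok(2)[of y] sin_cos_ok(4)[of x] sin_cos_ok(4)[of y] by linarith+
  have A: "(%k. ns (%l. h k l * a t l)) ----> 0" and B: "(%k. nm (%l. h k l * b t l)) ----> 0"
   if h: "!!k. h k \<in> BM" "!!k l. \<bar>h k l\<bar> <= 2" "!!l. (%k. h k l) ----> 0" for h
  proof -
   note [measurable] = h(1)
   have "Hhalf (%l. 2 * a t l)" by (rule Hhalf_cmult[OF Ha])
   then show "(%k. ns (%l. h k l * a t l)) ----> 0" unfolding ns_wsq Hhalf_def
    by (intro wl.wsq_tendsto_0_dominated[where g="%l. 2 * a t l"])
     (auto simp: abs_mult h intro!: mult_right_mono tendsto_mult_left_zero)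
   have "nm (%l. 2 * b t l) < \<infinity>" using Hb[of t] by (subst nm_cmult) (auto simp: Hdual_def ennreal_mult_less_top)
   then show "(%k. nm (%l. h k l * b t l)) ----> 0" unfolding nm_wsq
    by (intro wi.wsq_tendsto_0_dominated[where g="%l. 2 * b t l"])
     (auto simp: abs_mult h intro!: mult_right_mono tendsto_mult_left_zero)
  qed
  define G where "G k = 2 * (2 * (ns (%l. a (s k) l - a t l) + nm (%l. b (s k) l - b t l))
    + 2 * (ns (%l. (cos (s k * l) - cos (t * l)) * a t l) + nm (%l. (sin (s k * l) - sin (t * l)) * b t l)))" for k
  define G' where "G' k = 2 * (2 * (ns (%l. a (s k) l - a t l) + nm (%l. b (s k) l - b t l))
    + 2 * (ns (%l. - (sin (s k * l) - sin (t * l)) * a t l) + nm (%l. (cos (s k * l) - cos (t * l)) * b t l)))" for k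
  have "G ----> 2 * (2 * (0 + 0) + 2 * (0 + 0))" unfolding G_def
   by (intro ennreal_tendsto_cmult tendsto_add 1 2 A B tr tb) auto
  then have G0: "G ----> 0" by simp
  have tr': "(%k. - (sin (s k * l) - sin (t * l))) ----> 0" for l
   using tendsto_minus[OF tr(2)[of l]] by (simp only: minus_zero)
  have tb': "\<bar>- (sin x - sin y)\<bar> <= 2" for x y :: real by (simp only: abs_minus_cancel tb)
  have A3: "(%k. ns (%l. - (sin (s k * l) - sin (t * l)) * a t l)) ----> 0"
   by (rule A; (rule tr' tb' | measurable))
  have "G' ----> 2 * (2 * (0 + 0) + 2 * (0 + 0))" unfolding G'_def
   by (intro ennreal_tendsto_cmult tendsto_add 1 2 A3 B tr tb) auto
  then have G'0: "G' ----> 0" by simp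
  have le: "ns (%l. US u0 u1 n (s k) l - US u0 u1 n t l) <= G k" for k
  proof -
   have "ns (%l. US u0 u1 n (s k) l - US u0 u1 n t l) = ns (%l. (cos (s k * l) * (a (s k) l - a t l) + sin (s k * l) * (b (s k) l - b t l) / l)
     + (1 * ((cos (s k * l) - cos (t * l)) * a t l) + 1 * ((sin (s k * l) - sin (t * l)) * b t l) / l))"
    unfolding US by (simp add: algebra_simps diff_divide_distrib)
   also have "... <= 2 * (ns (%l. cos (s k * l) * (a (s k) l - a t l) + sin (s k * l) * (b (s k) l - b t l) / l)
     + ns (%l. 1 * ((cos (s k * l) - cos (t * l)) * a t l) + 1 * ((sin (s k * l) - sin (t * l)) * b t l) / l))" by (rule ns_add_le) measurable
   also have "... <= G k" unfolding G_def by (rule mult_left_mono, rule add_mono; (rule US_parts)?; simp)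
   finally show ?thesis .
  qed
  have le': "nm (%l. WS u0 u1 n (s k) l - WS u0 u1 n t l) <= G' k" for k
  proof -
   have "nm (%l. WS u0 u1 n (s k) l - WS u0 u1 n t l) = nm (%l. (l * (- sin (s k * l) * (a (s k) l - a t l)) + cos (s k * l) * (b (s k) l - b t l))
     + (l * (1 * (- (sin (s k * l) - sin (t * l)) * a t l)) + 1 * ((cos (s k * l) - cos (t * l)) * b t l)))"
    unfolding WS by (simp add: algebra_simps)
   also have "... <= 2 * (nm (%l. l * (- sin (s k * l) * (a (s k) l - a t l)) + cos (s k * l) * (b (s k) l - b t l))
     + nm (%l. l * (1 * (- (sin (s k * l) - sin (t * l)) * a t l)) + 1 * ((cos (s k * l) - cos (t * l)) * b t l)))" by (rule nm_add_le) measurable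
   also have "... <= G' k" unfolding G'_def by (rule mult_left_mono, rule add_mono; (rule US_parts)?; simp)
   finally show ?thesis .
  qed
  show ?thesis
   using tendsto_sandwich[OF _ _ tendsto_const G0, of "%k. ns (%l. US u0 u1 n (s k) l - US u0 u1 n t l)"]
    tendsto_sandwich[OF _ _ tendsto_const G'0, of "%k. nm (%l. WS u0 u1 n (s k) l - WS u0 u1 n t l)"] le le' by auto
 qed
 show "hpath (US u0 u1 n)" "dpath (WS u0 u1 n)"
  unfolding wpath_def ns_wsq[symmetric] nm_wsq[symmetric] using meas fin key by blast+
qed

lemma US_deriv: assumes n: "forcing n" and l: "0 < l" shows "((%t. US u0 u1 n t l) has_real_derivative WS u0 u1 n t l) (at t)"
proof -
 note [derivative_intros] = DERIV_chain2[OF duhs_deriv(1)[OF n]] DERIV_chain2[OF duhs_deriv(2)[OF n]]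
 show ?thesis unfolding US_def WS_def using l
  by (auto intro!: derivative_eq_intros simp: field_simps)
qed

lemma WS_isCont: assumes n: "forcing n" shows "isCont (%t. WS u0 u1 n t l) t"
 unfolding WS_def divide_inverse by (intro continuous_intros DERIV_isCont[OF duhs_deriv(1)[OF n]] DERIV_isCont[OF duhs_deriv(2)[OF n]])

lemma WS_measurable2:
 assumes [measurable]: "u0 \<in> BM" "u1 \<in> BM" and n: "forcing n"
 shows "(%p. WS u0 u1 n (fst p) (snd p)) \<in> borel_measurable (borel \<Otimes>\<^sub>M borel)"
proof -
 note [measurable (raw)] = measurable_two[OF duh_measurable2[of sin, OF sin_cos_ok(1,2) n]] measurable_two[OF duh_measurable2[of cos, OF sin_cos_ok(3,4) n]]
 show ?thesis unfolding WS_def by measurable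
qed

text \<open>At a fixed frequency the error is the mean, over the segment between the two times, of
  \<open>WS\<close> minus its value at \<open>t\<close>. Cauchy-Schwarz and Fubini move this into
  the norm, where continuity of the path \<open>WS\<close> makes it small.\<close>

theorem US_difference_quotient:
 assumes u0: "Hhalf u0" and u1: "Hdual u1" and n: "forcing n" and s: "s ----> t" "!!k. s k \<noteq> t"
 shows "(%k. nm (%l. (US u0 u1 n (s k) l - US u0 u1 n t l) / (s k - t) - WS u0 u1 n t l)) ----> 0"
proof -
 note m[measurable] = Hhalf_measurable[OF u0] Hdual_measurable[OF u1]
 let ?W = "WS u0 u1 n"
 note [measurable (raw)] = measurable_two[OF WS_measurable2[OF m n]]
 have dp: "dpath ?W" by (rule US_paths(2)[OF u0 u1 n])
 have le: "nm (%l. (US u0 u1 n r l - US u0 u1 n t l) / (r - t) - ?W t l) <= ennreal (1 / \<bar>r - t\<bar>) * (\<integral>\<^sup>+sg. nm (%l. ?W sg l - ?W t l) \<partial>seg t r)" if r: "r \<noteq> t" for r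
 proof -
  have "nm (%l. (US u0 u1 n r l - US u0 u1 n t l) / (r - t) - ?W t l) <= (NN l. ennreal (1 / \<bar>r - t\<bar>) * (\<integral>\<^sup>+sg. ennreal ((?W sg l - ?W t l)^2 / l) \<partial>seg t r))"
   unfolding nm_def
  proof (rule nn_integral_hl_mono)
   fix l :: real assume l: "0 < l"
   have c: "isCont (%sg. ?W sg l - ?W t l) x" for x by (intro continuous_intros WS_isCont n)
   have "(LBINT sg=ereal t..ereal r. ?W sg l) = US u0 u1 n r l - US u0 u1 n t l"
   proof (rule interval_integral_FTC_finite)
    show "continuous_on {min t r..max t r} (%sg. ?W sg l)"
     by (intro continuous_at_imp_continuous_on ballI WS_isCont n)
    show "((%sg. US u0 u1 n sg l) has_vector_derivative ?W sg l) (at sg within {min t r..max t r})" for sg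
     unfolding has_real_derivative_iff_has_vector_derivative[symmetric]
     by (rule has_field_derivative_at_within[OF US_deriv[OF n l]])
   qed
   moreover have "(LBINT sg=ereal t..ereal r. ?W sg l - ?W t l) = (LBINT sg=ereal t..ereal r. ?W sg l) - (LBINT sg=ereal t..ereal r. ?W t l)"
    by (intro interval_lebesgue_integral_diff(2) LBINT_integrable WS_isCont n) auto
   moreover have "(LBINT sg=ereal t..ereal r. ?W t l) = (r - t) * ?W t l" by (simp add: interval_integral_const)
   ultimately have e: "(US u0 u1 n r l - US u0 u1 n t l) / (r - t) - ?W t l = (LBINT sg=ereal t..ereal r. ?W sg l - ?W t l) / (r - t)"
    using r by (simp add: field_simps)
   have "ennreal (((US u0 u1 n r l - US u0 u1 n t l) / (r - t) - ?W t l)^2 / l)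
     = ennreal (1 / (l * (r - t)^2)) * ennreal ((LBINT sg=ereal t..ereal r. ?W sg l - ?W t l)^2)"
    unfolding e using l by (simp add: ennreal_mult[symmetric] power_divide mult.commute)
   also have "... <= ennreal (1 / (l * (r - t)^2)) * (ennreal \<bar>r - t\<bar> * (\<integral>\<^sup>+sg. ennreal ((?W sg l - ?W t l)^2) \<partial>seg t r))"
    by (intro mult_left_mono LBINT_square_le c) simp
   also have "... = ennreal (1 / \<bar>r - t\<bar>) * (ennreal (1 / l) * (\<integral>\<^sup>+sg. ennreal ((?W sg l - ?W t l)^2) \<partial>seg t r))"
   proof -
    have "1 / (l * (r - t)^2) * \<bar>r - t\<bar> = 1 / \<bar>r - t\<bar> * (1 / l)"
    proof -
     have "(r - t)^2 = \<bar>r - t\<bar> * \<bar>r - t\<bar>" by (simp add: power2_eq_square)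
     moreover have "\<bar>r - t\<bar> \<noteq> 0" using r by simp
     ultimately show ?thesis using l by (simp del: abs_mult_self_eq abs_eq_0)
    qed
    then show ?thesis using l by (simp add: mult.assoc[symmetric] ennreal_mult[symmetric])
   qed
   also have "ennreal (1 / l) * (\<integral>\<^sup>+sg. ennreal ((?W sg l - ?W t l)^2) \<partial>seg t r) = (\<integral>\<^sup>+sg. ennreal ((?W sg l - ?W t l)^2 / l) \<partial>seg t r)"
    using l by (subst nn_integral_cmult[symmetric]) (auto intro!: nn_integral_cong simp: ennreal_mult[symmetric])
   finally show "ennreal (((US u0 u1 n r l - US u0 u1 n t l) / (r - t) - ?W t l)^2 / l) <= ennreal (1 / \<bar>r - t\<bar>) * (\<integral>\<^sup>+sg. ennreal ((?W sg l - ?W t l)^2 / l) \<partial>seg t r)" .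
  qed
  also have "... = ennreal (1 / \<bar>r - t\<bar>) * (NN l. \<integral>\<^sup>+sg. ennreal ((?W sg l - ?W t l)^2 / l) \<partial>seg t r)" by (rule nn_integral_cmult) measurable
  also have "(NN l. \<integral>\<^sup>+sg. ennreal ((?W sg l - ?W t l)^2 / l) \<partial>seg t r) = (\<integral>\<^sup>+sg. nm (%l. ?W sg l - ?W t l) \<partial>seg t r)"
   unfolding nm_def by (rule hs.Fubini'[symmetric]) measurable
  finally show ?thesis .
 qed
 show ?thesis
 proof (rule order_tendstoI)
  fix e :: ennreal assume "0 < e"
  then obtain e' where e': "0 < e'" "e' < e" using dense by blast
  obtain d where d: "0 < d" "!!sg. \<bar>sg - t\<bar> < d ==> nm (%l. ?W sg l - ?W t l) < e'"
   using wi.wpath_eps[OF dp e'(1)] unfolding nm_wsq by blast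
  have "\<forall>\<^sub>F k in sequentially. \<bar>s k - t\<bar> < d" using tendstoD[OF s(1) d(1)] by (simp add: dist_real_def)
  then show "\<forall>\<^sub>F k in sequentially. nm (%l. (US u0 u1 n (s k) l - US u0 u1 n t l) / (s k - t) - ?W t l) < e"
  proof eventually_elim
   case (elim k)
   have "(\<integral>\<^sup>+sg. nm (%l. ?W sg l - ?W t l) \<partial>seg t (s k)) <= (\<integral>\<^sup>+sg. e' \<partial>seg t (s k))"
    by (rule nn_integral_mono_AE, rule AE_seg, rule less_imp_le, rule d) (use elim in auto)
   also have "... = e' * ennreal \<bar>s k - t\<bar>" by (simp add: emeasure_seg)
   finally have "nm (%l. (US u0 u1 n (s k) l - US u0 u1 n t l) / (s k - t) - ?W t l) <= ennreal (1 / \<bar>s k - t\<bar>) * (e' * ennreal \<bar>s k - t\<bar>)"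
    by (intro order_trans[OF le[OF s(2)[of k]]] mult_left_mono) auto
   also have "... = e' * (ennreal (1 / \<bar>s k - t\<bar>) * ennreal \<bar>s k - t\<bar>)" by (rule mult.left_commute)
   also have "ennreal (1 / \<bar>s k - t\<bar>) * ennreal \<bar>s k - t\<bar> = 1" using s(2)[of k] by (subst ennreal_mult[symmetric]) auto
   also have "e' * 1 < e" using e' by simp
   finally show ?case .
  qed
 qed simp
qed

section \<open>Gronwall's inequality\<close>

lemma exp_seg_integral:
 assumes K: "0 < K" and C: "0 <= C"
 shows "(\<integral>\<^sup>+ta. ennreal (C * exp (K * \<bar>ta\<bar>)) \<partial>seg 0 t) <= ennreal (C * exp (K * \<bar>t\<bar>) / K)"
proof -
 have main: "(\<integral>\<^sup>+ta. ennreal (f ta) * indicator {a..b} ta \<partial>lborel) <= ennreal c"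
  if "a <= b" "!!ta. a <= ta ==> ta <= b ==> DERIV F ta :> f ta" "!!ta. 0 <= f ta" "F b - F a <= c" "f \<in> BM" for f F a b c
  using nn_integral_FTC_Icc[of f a b F] that by (auto simp: has_real_derivative_iff_has_vector_derivative has_vector_derivative_at_within intro!: ennreal_leI)
 show ?thesis
 proof (cases "0 <= t")
  case True
  have "(\<integral>\<^sup>+ta. ennreal (C * exp (K * \<bar>ta\<bar>)) \<partial>seg 0 t) <= (\<integral>\<^sup>+ta. ennreal (C * exp (K * ta)) * indicator {0..t} ta \<partial>lborel)"
   unfolding seg_def using True by (subst nn_integral_density) (auto intro!: nn_integral_mono simp: indicator_def)
  also have "... <= ennreal (C * exp (K * \<bar>t\<bar>) / K)"
  proof (rule main[where F="%ta. C * exp (K * ta) / K"])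
   show "C * exp (K * t) / K - C * exp (K * 0) / K <= C * exp (K * \<bar>t\<bar>) / K" using True K C by simp
  qed (use True K C in "auto intro!: derivative_eq_intros")
  finally show ?thesis .
 next
  case False
  have "(\<integral>\<^sup>+ta. ennreal (C * exp (K * \<bar>ta\<bar>)) \<partial>seg 0 t) <= (\<integral>\<^sup>+ta. ennreal (C * exp (- (K * ta))) * indicator {t..0} ta \<partial>lborel)"
   unfolding seg_def using False by (subst nn_integral_density) (auto intro!: nn_integral_mono simp: indicator_def)
  also have "... <= ennreal (C * exp (K * \<bar>t\<bar>) / K)"
  proof (rule main[where F="%ta. - (C * exp (- (K * ta)) / K)"])
   show "- (C * exp (- (K * 0)) / K) - - (C * exp (- (K * t)) / K) <= C * exp (K * \<bar>t\<bar>) / K" using False K C by simp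
  qed (use False K C in "auto intro!: derivative_eq_intros")
  finally show ?thesis .
 qed
qed

text \<open>The weight grows at the rate \<open>2 * be * T\<close>, so integrating it gains the
  factor \<open>1 / (2 * be * T)\<close>; with \<open>\<bar>t\<bar> <= T\<close> the integral
  operator becomes a contraction by one half.\<close>

lemma Gronwall_step:
 assumes T: "0 < T" and b: "0 < be" and C: "0 <= C" and t: "\<bar>t\<bar> <= T"
  and D: "!!ta. \<bar>ta\<bar> <= T ==> D ta <= ennreal (C * exp (2 * be * T * \<bar>ta\<bar>))"
 shows "ennreal be * (ennreal \<bar>t\<bar> * (\<integral>\<^sup>+ta. D ta \<partial>seg 0 t)) <= ennreal (C / 2 * exp (2 * be * T * \<bar>t\<bar>))"
proof -
 have "(\<integral>\<^sup>+ta. D ta \<partial>seg 0 t) <= (\<integral>\<^sup>+ta. ennreal (C * exp (2 * be * T * \<bar>ta\<bar>)) \<partial>seg 0 t)"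
  by (rule nn_integral_mono_AE, rule AE_seg, rule D) (use t in auto)
 also have "... <= ennreal (C * exp (2 * be * T * \<bar>t\<bar>) / (2 * be * T))"
  by (rule exp_seg_integral) (use b T C in auto)
 finally have "ennreal be * (ennreal \<bar>t\<bar> * (\<integral>\<^sup>+ta. D ta \<partial>seg 0 t)) <= ennreal be * (ennreal T * ennreal (C * exp (2 * be * T * \<bar>t\<bar>) / (2 * be * T)))"
  using t by (intro mult_left_mono mult_mono ennreal_leI) auto
 also have "... = ennreal (be * (T * (C * exp (2 * be * T * \<bar>t\<bar>) / (2 * be * T))))"
 proof -
  define X where "X = C * exp (2 * be * T * \<bar>t\<bar>) / (2 * be * T)"
  have "0 <= X" using b T C by (simp add: X_def)
  then have "ennreal be * (ennreal T * ennreal X) = ennreal (be * (T * X))" using b T by (simp add: ennreal_mult)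
  then show ?thesis by (simp only: X_def)
 qed
 also have "be * (T * (C * exp (2 * be * T * \<bar>t\<bar>) / (2 * be * T))) = C / 2 * exp (2 * be * T * \<bar>t\<bar>)"
  using b T by (simp add: field_simps)
 finally show ?thesis .
qed

lemma ennreal_le_of_halves:
 fixes x :: ennreal
 assumes "!!k. x <= ennreal ((a + c * (1/2) ^ k) * e)" shows "x <= ennreal (a * e)"
proof (rule LIMSEQ_le_const)
 have "(%k. (a + c * (1/2) ^ k) * e) ----> (a + c * 0) * e" by (intro tendsto_intros LIMSEQ_power_zero) auto
 then show "(%k. ennreal ((a + c * (1/2) ^ k) * e)) ----> ennreal (a * e)" using tendsto_ennrealI by fastforce
qed (use assms in auto)

text \<open>The a priori bound is improved by iterating the hypothesis in the weight of
  \<open>Gronwall_step\<close>: a constant \<open>C\<close> becomes \<open>a + C / 2\<close>, whose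
  fixed point is \<open>2 * a\<close>, and the influence of \<open>c\<close> is halved each
  time.\<close>

theorem Gronwall:
 assumes T: "0 < T" and b: "0 < be" and a: "0 <= a"
  and D: "!!t. \<bar>t\<bar> <= T ==> D t <= ennreal a + ennreal be * (ennreal \<bar>t\<bar> * (\<integral>\<^sup>+ta. D ta \<partial>seg 0 t))"
  and bd: "!!t. \<bar>t\<bar> <= T ==> D t <= ennreal c" and c: "0 <= c" and t: "\<bar>t\<bar> <= T"
 shows "D t <= ennreal (2 * a * exp (2 * be * T * \<bar>t\<bar>))"
proof -
 have "\<forall>t. \<bar>t\<bar> <= T --> D t <= ennreal ((2 * a + c * (1/2) ^ k) * exp (2 * be * T * \<bar>t\<bar>))" for k
 proof (induction k)
  case 0
  have "c * 1 <= (2 * a + c) * exp (2 * be * T * \<bar>t\<bar>)" for t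
   using T b a c by (intro mult_mono) auto
  then show ?case using bd by (auto intro: order_trans[OF _ ennreal_leI])
 next
  case (Suc k)
  show ?case
  proof (intro allI impI)
   fix t assume t: "\<bar>t\<bar> <= T"
   have "D t <= ennreal a + ennreal ((2 * a + c * (1/2) ^ k) / 2 * exp (2 * be * T * \<bar>t\<bar>))"
    by (rule order_trans[OF D[OF t]], rule add_left_mono, rule Gronwall_step[OF T b _ t]) (use Suc a c in auto)
   also have "... <= ennreal (a * exp (2 * be * T * \<bar>t\<bar>)) + ennreal ((2 * a + c * (1/2) ^ k) / 2 * exp (2 * be * T * \<bar>t\<bar>))"
    using mult_left_mono[of 1 "exp (2 * be * T * \<bar>t\<bar>)" a] a T b by (intro add_right_mono ennreal_leI) auto
   also have "... = ennreal ((2 * a + c * (1/2) ^ Suc k) * exp (2 * be * T * \<bar>t\<bar>))"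
    using a c by (subst ennreal_plus[symmetric]) (auto simp: algebra_simps add_divide_distrib simp del: ennreal_plus)
   finally show "D t <= ennreal ((2 * a + c * (1/2) ^ Suc k) * exp (2 * be * T * \<bar>t\<bar>))" .
  qed
 qed
 then have "D t <= ennreal ((2 * a + c * (1/2) ^ k) * exp (2 * be * T * \<bar>t\<bar>))" for k using t by blast
 then show ?thesis by (rule ennreal_le_of_halves)
qed

section \<open>Picard iteration for globally Lipschitz nonlinearities\<close>

lemma hpath_zero: "hpath (%t l. 0)"
 by (simp add: wpath_def)

text \<open>The pointwise bound upgrades equality in norm to equality at every frequency, which lets
  the fixed point equation hold literally instead of almost everywhere.\<close>

lemma lip_map_AE_eq:
 assumes F: "lip_map F L" and "Hhalf g" "Hhalf g'" and 0: "ns (%l. g l - g' l) = 0"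
 shows "F g = F g'"
proof
 fix l
 have "ennreal ((F g l - F g' l)^2) <= ennreal L * ns (%l. g l - g' l)" using assms unfolding lip_map_def by blast
 then have "(F g l - F g' l)^2 <= 0" using 0 by (simp add: ennreal_eq_0_iff)
 then show "F g l = F g' l" by simp
qed

text \<open>In the weight \<open>exp (2 * be * T * \<bar>t\<bar>)\<close> the iteration contracts by
  one half on \<open>{- T..T}\<close> for every \<open>T\<close>, so the solution is global and no
  smallness of time is involved.\<close>

theorem mild_solution_exists:
 assumes F: "lip_map F L" and u0: "Hhalf u0" and u1: "Hdual u1"
 shows "\<exists>u. hpath u \<and> (\<forall>t. u t = US u0 u1 (%ta. F (u ta)) t)"
proof -
 note [measurable] = Hhalf_measurable[OF u0] Hdual_measurable[OF u1]
 have L0: "0 <= L" using F by (simp add: lip_map_def)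
 \<comment> \<open>8 is the constant of the energy estimate in front of the time integral; adding 1
   to \<open>L\<close> keeps the rate positive.\<close>
 define be where "be = 8 * (L + 1)"
 have b: "0 < be" using L0 by (simp add: be_def)
 have bL: "8 * ennreal L <= ennreal be" using L0 by (simp add: be_def ennreal_mult[symmetric] flip: ennreal_numeral)
 have Lip: "nm (%l. F g l - F g' l) <= ennreal L * ns (%l. g l - g' l)" if "Hhalf g" "Hhalf g'" for g g'
  using F that unfolding lip_map_def by blast
 define a where "a = enn2real (4 * (ns u0 + nm u1))"
 have a: "0 <= a" "4 * (ns u0 + nm u1) = ennreal a" using u0 u1 by (auto simp: a_def Hhalf_def Hdual_def ennreal_mult_less_top)
 define U where "U = rec_nat (%t l. 0) (%k V. US u0 u1 (%ta. F (V ta)))"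
 have U0: "U 0 = (%t l. 0)" and US: "U (Suc k) = US u0 u1 (%ta. F (U k ta))" for k by (simp_all add: U_def)
 have hU: "hpath (U k)" for k
  by (induction k) (use hpath_zero US_paths(1)[OF u0 u1 forcing_lip_map[OF F]] in "auto simp: U0 US")
 have HU: "Hhalf (U k t)" for k t by (rule path_Hhalf[OF hU])
 have fU: "forcing (%ta. F (U k ta))" for k by (rule forcing_lip_map[OF F hU])
 have intle: "8 * (ennreal \<bar>t\<bar> * (\<integral>\<^sup>+ta. ennreal L * D ta \<partial>seg 0 t)) <= ennreal be * (ennreal \<bar>t\<bar> * (\<integral>\<^sup>+ta. E ta \<partial>seg 0 t))"
  if DE: "!!ta. min 0 t < ta ==> ta < max 0 t ==> D ta <= E ta" and [measurable]: "E \<in> BM" for D E t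
 proof -
  have "(\<integral>\<^sup>+ta. ennreal L * D ta \<partial>seg 0 t) <= (\<integral>\<^sup>+ta. ennreal L * E ta \<partial>seg 0 t)"
   by (rule nn_integral_mono_AE, rule AE_seg, rule mult_left_mono) (use DE in auto)
  also have "... = ennreal L * (\<integral>\<^sup>+ta. E ta \<partial>seg 0 t)" by (rule nn_integral_cmult) measurable
  finally have "8 * (ennreal \<bar>t\<bar> * (\<integral>\<^sup>+ta. ennreal L * D ta \<partial>seg 0 t)) <= 8 * (ennreal \<bar>t\<bar> * (ennreal L * (\<integral>\<^sup>+ta. E ta \<partial>seg 0 t)))"
   by (intro mult_left_mono) auto
  also have "... = (8 * ennreal L) * (ennreal \<bar>t\<bar> * (\<integral>\<^sup>+ta. E ta \<partial>seg 0 t))" by (simp only: mult.assoc mult.left_commute)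
  also have "... <= ennreal be * (ennreal \<bar>t\<bar> * (\<integral>\<^sup>+ta. E ta \<partial>seg 0 t))" by (intro mult_right_mono bL) auto
  finally show ?thesis .
 qed
 have step: "8 * (ennreal \<bar>t\<bar> * (\<integral>\<^sup>+ta. ennreal L * D ta \<partial>seg 0 t)) <= ennreal (C / 2 * exp (2 * be * T * \<bar>t\<bar>))"
  if T: "0 < T" "\<bar>t\<bar> <= T" and C: "0 <= C" and D: "!!ta. \<bar>ta\<bar> <= T ==> D ta <= ennreal (C * exp (2 * be * T * \<bar>ta\<bar>))" for D t T C
 proof -
  have "8 * (ennreal \<bar>t\<bar> * (\<integral>\<^sup>+ta. ennreal L * D ta \<partial>seg 0 t)) <= ennreal be * (ennreal \<bar>t\<bar> * (\<integral>\<^sup>+ta. ennreal (C * exp (2 * be * T * \<bar>ta\<bar>)) \<partial>seg 0 t))"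
   by (rule intle, rule D) (use T in auto)
  also have "... <= ennreal (C / 2 * exp (2 * be * T * \<bar>t\<bar>))" by (rule Gronwall_step[OF T(1) b C T(2)]) simp
  finally show ?thesis .
 qed
 have bnd: "ns (U k t) <= ennreal (2 * a * exp (2 * be * T * \<bar>t\<bar>))" if T: "0 < T" "\<bar>t\<bar> <= T" for k t T
  using T(2)
 proof (induction k arbitrary: t)
  case (Suc k)
  have "ns (U (Suc k) t) <= ennreal a + 8 * (ennreal \<bar>t\<bar> * (\<integral>\<^sup>+ta. nm (F (U k ta)) \<partial>seg 0 t))"
   unfolding US a(2)[symmetric] by (rule US_energy(1)[OF _ _ fU]) measurable
  also have "... <= ennreal a + 8 * (ennreal \<bar>t\<bar> * (\<integral>\<^sup>+ta. ennreal L * ns (U k ta) \<partial>seg 0 t))"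
  proof (intro add_left_mono mult_left_mono nn_integral_mono)
   fix ta
   have "F (%l. 0) = (%l. 0)" using F unfolding lip_map_def by blast
   then show "nm (F (U k ta)) <= ennreal L * ns (U k ta)" using Lip[OF HU[of k ta] Hhalf_zero] by simp
  qed auto
  also have "... <= ennreal (a * exp (2 * be * T * \<bar>t\<bar>)) + ennreal (2 * a / 2 * exp (2 * be * T * \<bar>t\<bar>))"
   using mult_left_mono[of 1 "exp (2 * be * T * \<bar>t\<bar>)" a] a T b
   by (intro add_mono step[OF T(1) Suc.prems] Suc.IH ennreal_leI) auto
  also have "... = ennreal (2 * a * exp (2 * be * T * \<bar>t\<bar>))" using a by (subst ennreal_plus[symmetric]) auto
  finally show ?case .
 qed (simp add: U0)
 have diff: "ns (%l. U (k + i) t l - U k t l) <= ennreal (2 * a * (1/2) ^ k * exp (2 * be * T * \<bar>t\<bar>))" if T: "0 < T" "\<bar>t\<bar> <= T" for k i t T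
  using T(2)
 proof (induction k arbitrary: t)
  case 0
  then show ?case using bnd[OF T(1), of t i] by (simp add: U0)
 next
  case (Suc k)
  have "ns (%l. U (Suc k + i) t l - U (Suc k) t l) <= 4 * (ns (%l. u0 l - u0 l) + nm (%l. u1 l - u1 l))
   + 8 * (ennreal \<bar>t\<bar> * (\<integral>\<^sup>+ta. ennreal L * ns (%l. U (k + i) ta l - U k ta l) \<partial>seg 0 t))"
   unfolding add_Suc US by (rule US_compare(1)[OF _ _ _ _ fU fU Lip[OF HU HU]]) auto
  also have "... <= ennreal (2 * a * (1/2) ^ k / 2 * exp (2 * be * T * \<bar>t\<bar>))"
   using step[OF T(1) Suc.prems _ Suc.IH] a by simp
  finally show ?case by simp
 qed
 define CT where "CT T = 2 * a * exp (2 * be * T * T)" for T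
 have CTpos: "0 <= CT T" for T using a by (simp add: CT_def)
 have CTmono: "CT S <= CT T" if "0 <= S" "S <= T" for S T unfolding CT_def using that a b by (intro mult_left_mono) (auto intro!: mult_mono)
 have diff': "ns (%l. U j t l - U k t l) <= ennreal (CT T * (1/2) ^ k)" if "0 < T" "\<bar>t\<bar> <= T" "k <= j" for j k t T
 proof -
  have "2 * a * (1/2) ^ k * exp (2 * be * T * \<bar>t\<bar>) <= 2 * a * (1/2) ^ k * exp (2 * be * T * T)" using that a b by (intro mult_left_mono) auto
  then show ?thesis using diff[OF that(1,2), of k "j - k"] that(3)
   by (auto simp: CT_def mult.commute mult.left_commute intro: order_trans[OF _ ennreal_leI])
 qed
 have "\<exists>u. u \<in> BM \<and> (\<forall>k. ns (%l. u l - U k t l) <= ennreal (CT (\<bar>t\<bar> + 1) * (1/2) ^ k))" for t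
  using geometric_Cauchy_limit[of "%k. U k t" "%l. l" 2 "CT (\<bar>t\<bar> + 1)"] diff'[of "\<bar>t\<bar> + 1" t] CTpos Hhalf_measurable[OF HU[of _ t]]
  unfolding ns_def by auto
 then obtain u where um[measurable]: "!!t. u t \<in> BM"
  and uU0: "!!t k. ns (%l. u t l - U k t l) <= ennreal (CT (\<bar>t\<bar> + 1) * (1/2) ^ k)" by metis
 have uU: "ns (%l. u t l - U k t l) <= ennreal (CT (T + 1) * (1/2) ^ k)" if "\<bar>t\<bar> <= T" for t k T
  by (rule order_trans[OF uU0], rule ennreal_leI, rule mult_right_mono, rule CTmono) (use that in auto)
 have Hu: "Hhalf (u t)" for t using uU0[of t 0] um by (auto simp: U0 Hhalf_def intro: le_less_trans)
 note [measurable] = Hhalf_measurable[OF HU]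
 have lim: "(%k. ns (%l. u (s k) l - u t l)) ----> 0" if s: "s ----> t" for s t
 proof (rule order_tendstoI)
  fix e :: ennreal assume e: "0 < e"
  obtain T where T: "!!k. \<bar>s k\<bar> <= T" "\<bar>t\<bar> <= T"
  proof -
   obtain T where "!!k. \<bar>s k\<bar> <= T" using convergent_imp_Bseq[of s] s by (auto simp: convergent_def Bseq_def)
   then show thesis using that[of "max T \<bar>t\<bar>"] by (auto simp: le_max_iff_disj)
  qed
  have z: "(%j. ennreal (CT (T + 1) * (1/2) ^ j)) ----> ennreal (CT (T + 1) * 0)"
   by (intro tendsto_ennrealI tendsto_mult tendsto_const LIMSEQ_power_zero) simp
  have "(%j. 2 * (2 * (ennreal (CT (T + 1) * (1/2) ^ j) + 0) + ennreal (CT (T + 1) * (1/2) ^ j))) ----> 2 * (2 * (ennreal (CT (T + 1) * 0) + 0) + ennreal (CT (T + 1) * 0))"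
   by (intro ennreal_tendsto_cmult tendsto_add z tendsto_const) auto
  then have "\<forall>\<^sub>F j in sequentially. 2 * (2 * (ennreal (CT (T + 1) * (1/2) ^ j) + 0) + ennreal (CT (T + 1) * (1/2) ^ j)) < e"
   using e by (intro order_tendstoD) auto
  then obtain j where j: "2 * (2 * (ennreal (CT (T + 1) * (1/2) ^ j) + 0) + ennreal (CT (T + 1) * (1/2) ^ j)) < e"
   by (auto dest: eventually_happens)
  have "(%k. 2 * (2 * (ennreal (CT (T + 1) * (1/2) ^ j) + ns (%l. U j (s k) l - U j t l)) + ennreal (CT (T + 1) * (1/2) ^ j)))
    ----> 2 * (2 * (ennreal (CT (T + 1) * (1/2) ^ j) + 0) + ennreal (CT (T + 1) * (1/2) ^ j))"
   by (intro ennreal_tendsto_cmult tendsto_add tendsto_const path_tendsto[OF hU s]) auto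
  then have "\<forall>\<^sub>F k in sequentially. 2 * (2 * (ennreal (CT (T + 1) * (1/2) ^ j) + ns (%l. U j (s k) l - U j t l)) + ennreal (CT (T + 1) * (1/2) ^ j)) < e"
   using j by (rule order_tendstoD)
  then show "\<forall>\<^sub>F k in sequentially. ns (%l. u (s k) l - u t l) < e"
  proof eventually_elim
   case (elim k)
   have "ns (%l. u (s k) l - u t l) <= 2 * (ns (%l. u (s k) l - U j t l) + ns (%l. u t l - U j t l))"
    using ns_diff_le[of "%l. u (s k) l - U j t l" "%l. u t l - U j t l"] by simp
   also have "ns (%l. u (s k) l - U j t l) <= 2 * (ns (%l. u (s k) l - U j (s k) l) + ns (%l. U j (s k) l - U j t l))"
    using ns_add_le[of "%l. u (s k) l - U j (s k) l" "%l. U j (s k) l - U j t l"] by simp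
   also have "2 * (2 * (ns (%l. u (s k) l - U j (s k) l) + ns (%l. U j (s k) l - U j t l)) + ns (%l. u t l - U j t l))
    \<le> 2 * (2 * (ennreal (CT (T + 1) * (1/2) ^ j) + ns (%l. U j (s k) l - U j t l)) + ennreal (CT (T + 1) * (1/2) ^ j))"
    by (intro mult_left_mono add_mono uU T) auto
   also note elim
   finally show ?case by (simp add: mult_left_mono add_mono)
  qed
 qed simp
 have hu: "hpath u" unfolding wpath_def ns_wsq[symmetric] using Hu lim by (auto simp: Hhalf_def)
 \<comment> \<open>The limit \<open>u\<close> satisfies the equation only up to null sets of
   frequencies. One more application of the Duhamel operator gives \<open>v\<close>, equal to
   \<open>u\<close> in norm; \<open>F\<close> does not see the difference, so \<open>v\<close>
   satisfies the equation exactly.\<close>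
 define v where "v = US u0 u1 (%ta. F (u ta))"
 have fu: "forcing (%ta. F (u ta))" by (rule forcing_lip_map[OF F hu])
 have hv: "hpath v" unfolding v_def by (rule US_paths(1)[OF u0 u1 fu])
 note [measurable] = path_Hhalf[OF hv, THEN Hhalf_measurable]
 have "ns (%l. v t l - u t l) = 0" for t
 proof -
  define T where "T = \<bar>t\<bar> + 1"
  define C where "C = CT (T + 1)"
  have C0: "0 <= C" by (simp add: C_def CTpos)
  have T: "0 < T" "\<bar>t\<bar> <= T" by (auto simp: T_def)
  have 1: "ns (%l. v t l - U (Suc k) t l) <= ennreal (C * (1/2) ^ k * exp (2 * be * T * T))" for k
  proof -
   have "ns (%l. v t l - U (Suc k) t l) <= 4 * (ns (%l. u0 l - u0 l) + nm (%l. u1 l - u1 l))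
    + 8 * (ennreal \<bar>t\<bar> * (\<integral>\<^sup>+ta. ennreal L * ns (%l. u ta l - U k ta l) \<partial>seg 0 t))"
    unfolding v_def US by (rule US_compare(1)[OF _ _ _ _ fu fU Lip[OF Hu HU]]) auto
   also have "... = 8 * (ennreal \<bar>t\<bar> * (\<integral>\<^sup>+ta. ennreal L * ns (%l. u ta l - U k ta l) \<partial>seg 0 t))" by simp
   also have "... <= ennreal (C * (1/2) ^ k / 2 * exp (2 * be * T * \<bar>t\<bar>))"
   proof (rule step[OF T])
    fix ta assume "\<bar>ta\<bar> <= T"
    have "C * (1/2) ^ k * 1 <= C * (1/2) ^ k * exp (2 * be * T * \<bar>ta\<bar>)" using C0 b T by (intro mult_left_mono) auto
    then show "ns (%l. u ta l - U k ta l) <= ennreal (C * (1/2) ^ k * exp (2 * be * T * \<bar>ta\<bar>))"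
     using uU[OF \<open>\<bar>ta\<bar> <= T\<close>, of k] by (auto simp: C_def intro: order_trans[OF _ ennreal_leI])
   qed (use C0 in simp)
   also have "... <= ennreal (C * (1/2) ^ k * exp (2 * be * T * T))"
    using C0 b T by (intro ennreal_leI mult_mono) auto
   finally show ?thesis .
  qed
  have 2: "ns (%l. u t l - U (Suc k) t l) <= ennreal (C * (1/2) ^ k * exp (2 * be * T * T))" for k
  proof -
   have "C * (1/2) ^ Suc k * 1 <= C * (1/2) ^ k * exp (2 * be * T * T)" using C0 b T by (intro mult_mono) auto
   then show ?thesis using uU[OF T(2), of "Suc k"] by (auto simp: C_def intro: order_trans[OF _ ennreal_leI])
  qed
  have "ns (%l. v t l - u t l) <= ennreal ((0 + C * (1/2) ^ k) * (4 * exp (2 * be * T * T)))" for k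
  proof -
   have "ns (%l. v t l - u t l) <= 2 * (ns (%l. v t l - U (Suc k) t l) + ns (%l. u t l - U (Suc k) t l))"
    using ns_diff_le[of "%l. v t l - U (Suc k) t l" "%l. u t l - U (Suc k) t l"] by simp
   also have "... <= 2 * (ennreal (C * (1/2) ^ k * exp (2 * be * T * T)) + ennreal (C * (1/2) ^ k * exp (2 * be * T * T)))"
    by (intro mult_left_mono add_mono 1 2) auto
   also have "... = ennreal ((0 + C * (1/2) ^ k) * (4 * exp (2 * be * T * T)))"
    using C0 by (simp flip: ennreal_plus ennreal_numeral ennreal_mult)
   finally show ?thesis .
  qed
  from ennreal_le_of_halves[OF this] show ?thesis by simp
 qed
 then have "F (v t) = F (u t)" for t by (rule lip_map_AE_eq[OF F path_Hhalf[OF hv] Hu])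
 then have "v = US u0 u1 (%ta. F (v ta))" unfolding v_def by simp
 then show ?thesis using hv by metis
qed

section \<open>Test functions and represented profiles\<close>

text \<open>An element of the spaces in the statement is measurable on positive frequencies only.
  Setting it to 0 elsewhere gives a Borel function with the same norms.\<close>

definition cutp :: "(real => real) => real => real" where "cutp g l = indicator {0<..} l * g l"

lemma cutp_pos[simp]: "0 < l ==> cutp g l = g l" by (simp add: cutp_def)

lemma cutp_measurable_iff: "set_borel_measurable lborel {0<..} g \<longleftrightarrow> cutp g \<in> BM"
 by (simp add: set_borel_measurable_def cutp_def[abs_def])

lemma cutp_borel: "g \<in> BM ==> cutp g \<in> BM"
 unfolding cutp_def[abs_def] by measurable

lemma cutp_AE: "AE l in hl. cutp g l = g l" by (rule AE_hlI) simp

lemma Hdot_sq_half: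
 assumes "cutp g \<in> BM"
 shows "Hdot_sq (1/2) g = ennreal (4 * pi) * ns (cutp g)"
proof -
 have "(\<integral>\<^sup>+l\<in>{0<..}. ennreal ((l powr (1/2) * g l)^2) \<partial>lborel) = (\<integral>\<^sup>+l\<in>{0<..}. ennreal (l * (cutp g l)^2) \<partial>lborel)"
  by (intro nn_integral_cong) (auto simp: indicator_def power_mult_distrib powr_half_sqrt)
 also have "... = ns (cutp g)" unfolding ns_def using assms by (subst nn_integral_hl) auto
 finally show ?thesis by (simp add: Hdot_sq_def)
qed

lemma Hdot_sq_minus_half:
 assumes "cutp g \<in> BM"
 shows "Hdot_sq (- (1/2)) g = ennreal (4 * pi) * nm (cutp g)"
proof -
 have "(\<integral>\<^sup>+l\<in>{0<..}. ennreal ((l powr (- (1/2)) * g l)^2) \<partial>lborel) = (\<integral>\<^sup>+l\<in>{0<..}. ennreal ((cutp g l)^2 / l) \<partial>lborel)"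
  by (intro nn_integral_cong) (auto simp: indicator_def power_mult_distrib powr_half_sqrt powr_minus inverse_eq_divide power_divide)
 also have "... = nm (cutp g)" unfolding nm_def using assms by (subst nn_integral_hl) auto
 finally show ?thesis by (simp add: Hdot_sq_def)
qed

lemma four_pi_mult: "ennreal (4 * pi) * x < \<infinity> \<longleftrightarrow> x < \<infinity>"
 "((%k. ennreal (4 * pi) * f k) \<longlongrightarrow> 0) G \<longleftrightarrow> (f \<longlongrightarrow> 0) G"
proof -
 show "ennreal (4 * pi) * x < \<infinity> \<longleftrightarrow> x < \<infinity>" by (cases "x = 0") (auto simp: ennreal_mult_less_top)
 have "((%k. ennreal (1 / (4 * pi)) * (ennreal (4 * pi) * f k)) \<longlongrightarrow> ennreal (1 / (4 * pi)) * 0) G" if "((%k. ennreal (4 * pi) * f k) \<longlongrightarrow> 0) G"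
  by (rule ennreal_tendsto_cmult[OF _ that]) simp
 moreover have "ennreal (1 / (4 * pi)) * (ennreal (4 * pi) * y) = y" for y
  by (simp add: mult.assoc[symmetric] ennreal_mult[symmetric])
 moreover have "((%k. ennreal (4 * pi) * f k) \<longlongrightarrow> ennreal (4 * pi) * 0) G" if "(f \<longlongrightarrow> 0) G"
  by (rule ennreal_tendsto_cmult[OF _ that]) simp
 ultimately show "((%k. ennreal (4 * pi) * f k) \<longlongrightarrow> 0) G \<longleftrightarrow> (f \<longlongrightarrow> 0) G" by auto
qed

text \<open>The cut to \<open>x > 0\<close> makes this a Borel function, since radial profiles are
  measurable on \<open>{1..}\<close> only.\<close>

definition phys :: "(real => real) => real => real" where "phys f x = indicator {0<..} x * ((1 + x) * f (1 + x))"

lemma phys_measurable: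
 assumes "set_borel_measurable lborel {1..} f" shows "phys f \<in> BM"
proof -
 define h where "h r = indicator {1..} r * f r" for r
 have [measurable]: "h \<in> BM" using assms by (simp add: set_borel_measurable_def h_def[abs_def])
 have "(%x. indicator {0<..} x * ((1 + x) * h (1 + x))) \<in> BM" by measurable
 moreover have "(%x. indicator {0<..} x * ((1 + x) * h (1 + x))) = phys f"
  by (auto simp: fun_eq_iff phys_def indicator_def h_def)
 ultimately show ?thesis by simp
qed

lemma FD_eq_sine_tr:
 assumes "set_borel_measurable lborel {1..} f" shows "FD f l = sine_tr (phys f) l"
proof -
 note [measurable] = phys_measurable[OF assms]
 have "(LINT r:{1..}|lborel. sin (l * (r - 1)) / r * f r * r^2) = (\<integral>x. indicator {1..} (1 + x) * (sin (l * ((1 + x) - 1)) / (1 + x) * f (1 + x) * (1 + x)^2) \<partial>lborel)"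
  unfolding set_lebesgue_integral_def using lborel_integral_real_affine[of 1 "%r. indicator {1..} r *\<^sub>R (sin (l * (r - 1)) / r * f r * r^2)" 1] by simp
 also have "... = (\<integral>x. indicator {0<..} x * (sin (x * l) * phys f x) \<partial>lborel)"
  by (intro Bochner_Integration.integral_cong) (auto simp: indicator_def phys_def power2_eq_square mult.commute)
 also have "... = (LI x. sin (x * l) * phys f x)"
  by (subst integral_hl) (auto simp: set_lebesgue_integral_def)
 finally show ?thesis by (simp add: FD_def sine_tr_def cS_def)
qed

lemma radial_test_continuous:
 assumes "phi \<in> radial_test" shows "continuous_on {0..} phi"
proof -
 let ?f = "%x :: real ^ 3. phi (norm x)"
 have "\<forall>vs x. iterated_dderiv vs ?f differentiable (at x)" using assms unfolding radial_test_def Cc_infinity_def by blast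
 then have "\<forall>x. ?f differentiable (at x)" using iterated_dderiv.simps(1)[of ?f] by metis
 then have c: "continuous_on UNIV ?f" by (simp add: continuous_on_eq_continuous_at differentiable_imp_continuous_within)
 have "continuous_on {0..} (?f \<circ> (%r. r *\<^sub>R axis 1 1))"
  by (rule continuous_on_compose[OF _ continuous_on_subset[OF c]]) (auto intro!: continuous_intros)
 moreover have "(?f \<circ> (%r. r *\<^sub>R axis 1 1)) r = phi r" if "0 <= r" for r using that by (simp add: norm_axis_1)
 ultimately show ?thesis by (rule continuous_on_eq) auto
qed

lemma radial_test_support:
 assumes "phi \<in> radial_test" obtains a b where "1 < a" "!!r. 0 <= r ==> r < a \<or> b < r ==> phi r = 0"
proof -
 obtain K where K: "compact K" "K \<subseteq> Omega" "!!x :: real ^ 3. x \<notin> K ==> phi (norm x) = 0"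
  using assms unfolding radial_test_def Cc_infinity_def by blast
 have z: "phi r = 0" if "0 <= r" "r \<notin> norm ` K" for r
 proof -
  have "norm (r *\<^sub>R axis 1 1 :: real ^ 3) = r" using that by (simp add: norm_axis_1)
  then show ?thesis using K(3)[of "r *\<^sub>R axis 1 1"] that by (metis image_eqI)
 qed
 have cn: "compact (norm ` K)" by (intro compact_continuous_image continuous_intros K)
 show thesis
 proof (cases "K = {}")
  case True
  then show ?thesis using that[of 2 0] z by auto
 next
  case False
  obtain m where m: "m \<in> norm ` K" "!!r. r \<in> norm ` K ==> m <= r" using compact_attains_inf[OF cn] False by auto
  obtain M where M: "!!r. r \<in> norm ` K ==> r <= M" using compact_attains_sup[OF cn] False by auto
  have "1 < m" using m(1) K(2) by (auto simp: Omega_def)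
  moreover have "phi r = 0" if "0 <= r" "r < m \<or> M < r" for r using that z[of r] m(2)[of r] M[of r] by fastforce
  ultimately show ?thesis using that by blast
 qed
qed

lemma radial_test_phys:
 assumes phi: "phi \<in> radial_test"
 shows "set_borel_measurable lborel {1..} phi" "phys phi \<in> BM" "continuous_on {0..} (phys phi)" "phys phi 0 = 0"
  "\<exists>B. \<forall>x. \<bar>phys phi x\<bar> <= B" "integrable hl (phys phi)" "FD phi = sine_tr (phys phi)"
proof -
 obtain a b where ab: "1 < a" "!!r. 0 <= r ==> r < a \<or> b < r ==> phi r = 0" by (rule radial_test_support[OF phi]) blast
 have c: "continuous_on {0..} phi" by (rule radial_test_continuous[OF phi])
 have "(%r. indicator {1..} r *\<^sub>R phi r) \<in> BM"
  by (rule borel_measurable_continuous_on_indicator) (auto intro: continuous_on_subset[OF c])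
 then show m: "set_borel_measurable lborel {1..} phi" by (simp add: set_borel_measurable_def)
 then show pm: "phys phi \<in> BM" by (rule phys_measurable)
 show "FD phi = sine_tr (phys phi)" using FD_eq_sine_tr[OF m] by (simp add: fun_eq_iff)
 show "phys phi 0 = 0" by (simp add: phys_def)
 have e: "phys phi x = (1 + x) * phi (1 + x)" if "0 <= x" for x using that ab by (auto simp: phys_def indicator_def)
 have "continuous_on {0..} (%x. (1 + x) * phi (1 + x))"
  by (intro continuous_intros continuous_on_compose2[OF c]) auto
 then show cp: "continuous_on {0..} (phys phi)" by (rule continuous_on_eq) (simp add: e)
 define R where "R = max 0 b"
 have z: "phys phi x = 0" if "x \<notin> {0..R}" for x
 proof (cases "0 < x")
  case True
  then have "b < 1 + x" using that by (auto simp: R_def)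
  then show ?thesis using ab(2)[of "1 + x"] True by (simp add: phys_def)
 qed (simp add: phys_def)
 have "compact (phys phi ` {0..R})" by (intro compact_continuous_image continuous_on_subset[OF cp]) auto
 then obtain B where B: "!!y. y \<in> phys phi ` {0..R} ==> norm y <= B" using compact_imp_bounded bounded_iff by metis
 have bd: "\<bar>phys phi x\<bar> <= \<bar>B\<bar>" for x using B[of "phys phi x"] z[of x] by (cases "x \<in> {0..R}") auto
 then show "\<exists>B. \<forall>x. \<bar>phys phi x\<bar> <= B" by blast
 show "integrable hl (phys phi)"
 proof (rule integrable_hl_bound[OF _ pm])
  show "integrable hl (%x. \<bar>B\<bar> * indicator {0..R} x)" using integrable_indicator_hl[of "{0..R}"] by auto
  show "\<bar>phys phi x\<bar> <= \<bar>\<bar>B\<bar> * indicator {0..R} x\<bar>" for x using bd[of x] z[of x] by (auto simp: indicator_def)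
 qed
qed

text \<open>A test profile is continuous, bounded, integrable and 0 at the boundary, so the
  inversion theorem applies: the abstract profile of its transform is the function itself.\<close>

lemma radial_test_rep:
 assumes phi: "phi \<in> radial_test" and fin: "Hdot_sq (1/2) (FD phi) < \<infinity>"
 shows "profile_rep (phys phi) (FD phi)"
proof -
 note p = radial_test_phys[OF phi]
 note [measurable] = p(2)
 have "Hdot_sq (1/2) (FD phi) = ennreal (4 * pi) * ns (cutp (FD phi))"
  unfolding p(7) by (intro Hdot_sq_half cutp_borel) measurable
 then have "ns (cutp (FD phi)) < \<infinity>" using fin four_pi_mult(1)[of "ns (cutp (FD phi))"] by metis
 then have "ns (sine_tr (phys phi)) < \<infinity>" using ns_cong_AE[OF cutp_AE[of "FD phi"]] by (simp add: p(7))
 then show ?thesis unfolding p(7) using p(5) by (elim exE) (rule profile_rep_inversion[OF p(3,4,2) _ p(6)], auto)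
qed

text \<open>Values below \<open>\<eta>\<close> contribute at most \<open>\<eta>\<close> times the
  length. Above it \<open>\<bar>a n x\<bar> <= (a n x) ^ 4 / \<eta> ^ 3\<close>, and
  \<open>1 <= S / x\<close> brings in the weight of \<open>E4\<close>. The first part is made small
  by \<open>\<eta>\<close>, the second by \<open>n\<close>.\<close>

lemma E4_L1_local:
 assumes m[measurable]: "!!n. a n \<in> BM" and lim: "(%n. E4 (a n)) ----> 0"
 shows "(%n. NN x. ennreal (indicator {..R} x * \<bar>a n x\<bar>)) ----> 0"
proof -
 define S where "S = max 1 R"
 have S: "1 <= S" "R <= S" by (auto simp: S_def)
 have le: "(NN x. ennreal (indicator {..R} x * \<bar>a n x\<bar>)) <= ennreal (\<eta> * S) + ennreal (S / \<eta> ^ 3) * E4 (a n)" if eta: "0 < \<eta>" for \<eta> n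
 proof -
  have "(NN x. ennreal (indicator {..R} x * \<bar>a n x\<bar>)) <= (NN x. ennreal (\<eta> * indicator {..S} x) + ennreal (S / \<eta> ^ 3) * ennreal ((a n x) ^ 4 / x))"
  proof (rule nn_integral_hl_mono)
   fix x :: real assume x: "0 < x"
   have "\<bar>a n x\<bar> <= \<eta> + S / \<eta> ^ 3 * ((a n x) ^ 4 / x)" if "x <= R"
   proof (cases "\<bar>a n x\<bar> <= \<eta>")
    case False
    have "1 <= (\<bar>a n x\<bar> / \<eta>) ^ 3" using False eta by (intro one_le_power) simp
    then have "\<bar>a n x\<bar> * 1 <= \<bar>a n x\<bar> * (\<bar>a n x\<bar> / \<eta>) ^ 3" by (rule mult_left_mono) simp
    also have "... = (a n x) ^ 4 / \<eta> ^ 3" by (simp add: power_divide power3_eq_cube power4_eq_xxxx abs_mult[symmetric])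
    also have "... <= S / x * ((a n x) ^ 4 / \<eta> ^ 3)"
     using x that S eta by (intro order_trans[OF _ mult_right_mono[of 1 "S / x"]]) auto
    finally show ?thesis using eta by (simp add: mult.commute)
   qed (use x S eta in "auto intro: add_increasing2")
   then have "indicator {..R} x * \<bar>a n x\<bar> <= \<eta> * indicator {..S} x + S / \<eta> ^ 3 * ((a n x) ^ 4 / x)"
    using S x eta by (auto simp: indicator_def)
   then have "ennreal (indicator {..R} x * \<bar>a n x\<bar>) <= ennreal (\<eta> * indicator {..S} x + S / \<eta> ^ 3 * ((a n x) ^ 4 / x))" by (rule ennreal_leI)
   also have "... = ennreal (\<eta> * indicator {..S} x) + ennreal (S / \<eta> ^ 3) * ennreal ((a n x) ^ 4 / x)"
    using x S eta by (subst ennreal_plus; (subst ennreal_mult[of "S / \<eta> ^ 3"])?; simp)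
   finally show "ennreal (indicator {..R} x * \<bar>a n x\<bar>) <= ennreal (\<eta> * indicator {..S} x) + ennreal (S / \<eta> ^ 3) * ennreal ((a n x) ^ 4 / x)" .
  qed
  also have "... = (NN x. ennreal (\<eta> * indicator {..S} x)) + ennreal (S / \<eta> ^ 3) * E4 (a n)"
   unfolding E4_def by (subst nn_integral_add, measurable, subst nn_integral_cmult) auto
  also have "(NN x. ennreal (\<eta> * indicator {..S} x)) = (\<integral>\<^sup>+x. ennreal \<eta> * indicator {0<..S} x \<partial>lborel)"
   by (subst nn_integral_hl, measurable, intro nn_integral_cong) (auto simp: indicator_def)
  also have "... = ennreal (\<eta> * S)" using S eta by (subst nn_integral_cmult_indicator) (auto simp: ennreal_mult)
  finally show ?thesis .
 qed
 show ?thesis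
 proof (rule order_tendstoI)
  fix e :: ennreal assume "0 < e"
  then obtain r where r: "0 < r" "ennreal r < e"
  proof -
   obtain y where "0 < y" "y < e" using dense[OF \<open>0 < e\<close>] by blast
   then show thesis using that[of "enn2real y"] by (cases y) (auto simp: top_unique)
  qed
  define \<eta> where "\<eta> = r / S"
  have eta: "0 < \<eta>" "\<eta> * S = r" using r S by (auto simp: \<eta>_def)
  have "(%n. ennreal r + ennreal (S / \<eta> ^ 3) * E4 (a n)) ----> ennreal r + ennreal (S / \<eta> ^ 3) * 0"
   by (intro tendsto_add tendsto_const ennreal_tendsto_cmult lim) simp
  then have "\<forall>\<^sub>F n in sequentially. ennreal r + ennreal (S / \<eta> ^ 3) * E4 (a n) < e" using r by (intro order_tendstoD) auto
  then show "\<forall>\<^sub>F n in sequentially. (NN x. ennreal (indicator {..R} x * \<bar>a n x\<bar>)) < e"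
   by eventually_elim (rule le_less_trans[OF le[OF eta(1)]], simp add: eta)
 qed simp
qed

lemma nn_integral_shift:
 assumes [measurable]: "(%r. indicator {1..} r * f r) \<in> BM"
 shows "(\<integral>\<^sup>+r\<in>{1..R}. ennreal (\<bar>f r\<bar> * r^2) \<partial>lborel) = (NN x. ennreal (indicator {..R - 1} x * ((1 + x) * \<bar>phys f x\<bar>)))"
proof -
 have [measurable]: "phys f \<in> BM" by (rule phys_measurable) (use assms in "simp add: set_borel_measurable_def")
 have "(\<integral>\<^sup>+r\<in>{1..R}. ennreal (\<bar>f r\<bar> * r^2) \<partial>lborel) = (\<integral>\<^sup>+r. ennreal (\<bar>indicator {1..} r * f r\<bar> * r^2) * indicator {1..R} r \<partial>lborel)"
  by (intro nn_integral_cong) (auto simp: indicator_def)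
 also have "... = (\<integral>\<^sup>+x. ennreal (\<bar>indicator {1..} (1 + 1 * x) * f (1 + 1 * x)\<bar> * (1 + 1 * x)^2) * indicator {1..R} (1 + 1 * x) \<partial>lborel)"
  by (subst nn_integral_real_affine[where c=1 and t=1]) auto
 also have "... = (\<integral>\<^sup>+x\<in>{0<..}. ennreal (indicator {..R - 1} x * ((1 + x) * \<bar>phys f x\<bar>)) \<partial>lborel)"
 proof (rule nn_integral_cong_AE)
  have "AE x in lborel. x \<noteq> (0 :: real)" by (rule AE_lborel_singleton)
  then show "AE x in lborel. ennreal (\<bar>indicator {1..} (1 + 1 * x) * f (1 + 1 * x)\<bar> * (1 + 1 * x)^2) * indicator {1..R} (1 + 1 * x)
   = ennreal (indicator {..R - 1} x * ((1 + x) * \<bar>phys f x\<bar>)) * indicator {0<..} x"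
   by eventually_elim (auto simp: indicator_def phys_def abs_mult power2_eq_square mult.commute)
 qed
 also have "... = (NN x. ennreal (indicator {..R - 1} x * ((1 + x) * \<bar>phys f x\<bar>)))"
  by (subst nn_integral_hl) auto
 finally show ?thesis .
qed

lemma radial_test_E4:
 assumes V: "profile_rep V (cutp g)"
  and phi: "!!n :: nat. phi n \<in> radial_test" "!!n. Hdot_sq (1/2) (FD (phi n)) < \<infinity>"
  and lim: "(%n. Hdot_sq (1/2) (%l. FD (phi n) l - g l)) ----> 0"
 shows "(%n. E4 (%x. phys (phi n) x - V x)) ----> 0"
proof -
 have g: "Hhalf (cutp g)" by (rule profile_rep_Hhalf[OF V])
 note R = radial_test_rep[OF phi]
 note [measurable] = Hhalf_measurable[OF g] Hhalf_measurable[OF profile_rep_Hhalf[OF R]]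
 have nsl: "(%n. ns (%l. FD (phi n) l - cutp g l)) ----> 0"
 proof -
  have "cutp (%l. FD (phi n) l - g l) = (%l. cutp (FD (phi n)) l - cutp g l)" for n by (simp add: fun_eq_iff cutp_def right_diff_distrib)
  moreover have "(%l. cutp (FD (phi n)) l - cutp g l) \<in> BM" for n by (intro borel_measurable_diff cutp_borel[of "FD (phi n)"]) measurable
  ultimately have "Hdot_sq (1/2) (%l. FD (phi n) l - g l) = ennreal (4 * pi) * ns (%l. cutp (FD (phi n)) l - cutp g l)" for n
   by (subst Hdot_sq_half) auto
  moreover have "ns (%l. cutp (FD (phi n)) l - cutp g l) = ns (%l. FD (phi n) l - cutp g l)" for n
   by (intro ns_cong_AE AE_hlI) simp
  ultimately show ?thesis using lim by (simp add: four_pi_mult)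
 qed
 have E: "(%n. E4 (%x. phys (phi n) x - V x)) ----> 0"
 proof (rule tendsto_sandwich[OF _ _ tendsto_const])
  show "\<forall>\<^sub>F n in sequentially. E4 (%x. phys (phi n) x - V x) <= 128 * (ns (%l. FD (phi n) l - cutp g l))^2"
   by (intro always_eventually allI profile_rep_E4 profile_rep_diff R V)
  have "(%n. 128 * (ns (%l. FD (phi n) l - cutp g l))^2) ----> 128 * (0 * 0)"
   unfolding power2_eq_square by (intro ennreal_tendsto_cmult tendsto_mult_ennreal nsl) auto
  then show "(%n. 128 * (ns (%l. FD (phi n) l - cutp g l))^2) ----> 0" by simp
 qed simp
 show ?thesis by (rule E)
qed

text \<open>The same test functions have two limits in \<open>L^1\<close> on bounded sets: the
  profile of \<open>cutp g\<close>, by the embedding, and \<open>phys f\<close>, by hypothesis. The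
  two therefore agree almost everywhere.\<close>

theorem represents_function_profile:
 assumes rep: "represents_function (1/2) g f" and g: "Hhalf (cutp g)"
 shows "profile_rep (phys f) (cutp g)"
proof -
 obtain phi where fm: "set_borel_measurable lborel {1..} f" and phi: "!!n :: nat. phi n \<in> radial_test" "!!n. Hdot_sq (1/2) (FD (phi n)) < \<infinity>"
  and lim: "(%n. Hdot_sq (1/2) (%l. FD (phi n) l - g l)) ----> 0"
  and L1: "!!R. (%n. \<integral>\<^sup>+ r\<in>{1..R}. ennreal (\<bar>phi n r - f r\<bar> * r^2) \<partial>lborel) ----> 0"
  using rep unfolding represents_function_def by blast
 note p = radial_test_phys[OF phi(1)]
 note R = radial_test_rep[OF phi]
 note [measurable] = phys_measurable[OF fm] p(2) Hhalf_measurable[OF g] Hhalf_measurable[OF profile_rep_Hhalf[OF R]]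
 define V where "V = prof (cutp g)"
 have V: "profile_rep V (cutp g)" unfolding V_def by (rule prof_rep[OF g])
 note [measurable] = profile_rep_measurable[OF V]
 have E: "(%n. E4 (%x. phys (phi n) x - V x)) ----> 0"
  by (rule radial_test_E4[OF V phi lim])
 have "(NN x. ennreal (indicator {..R} x * \<bar>V x - phys f x\<bar>)) = 0" for R :: real
 proof -
  have 1: "(%n. NN x. ennreal (indicator {..R} x * \<bar>phys (phi n) x - V x\<bar>)) ----> 0"
   by (rule E4_L1_local[OF _ E]) measurable
  have sh: "(\<integral>\<^sup>+ r\<in>{1..R + 1}. ennreal (\<bar>phi n r - f r\<bar> * r^2) \<partial>lborel) = (NN x. ennreal (indicator {..R} x * ((1 + x) * \<bar>phys (phi n) x - phys f x\<bar>)))" for n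
  proof -
   have "(%r. indicator {1..} r * (phi n r - f r)) \<in> BM"
    using borel_measurable_diff[of "%r. indicator {1..} r * phi n r" borel "%r. indicator {1..} r * f r"] fm p(1)[of n]
    by (simp add: set_borel_measurable_def right_diff_distrib)
   moreover have "phys (%r. phi n r - f r) x = phys (phi n) x - phys f x" for x by (simp add: phys_def right_diff_distrib)
   ultimately show ?thesis by (subst nn_integral_shift) auto
  qed
  have "(NN x. ennreal (indicator {..R} x * \<bar>V x - phys f x\<bar>)) \<le>
    (NN x. ennreal (indicator {..R} x * \<bar>phys (phi n) x - V x\<bar>)) + (\<integral>\<^sup>+ r\<in>{1..R + 1}. ennreal (\<bar>phi n r - f r\<bar> * r^2) \<partial>lborel)" for n
  proof -
   have "(NN x. ennreal (indicator {..R} x * \<bar>V x - phys f x\<bar>)) \<le>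
    (NN x. ennreal (indicator {..R} x * \<bar>phys (phi n) x - V x\<bar>) + ennreal (indicator {..R} x * ((1 + x) * \<bar>phys (phi n) x - phys f x\<bar>)))"
   proof (rule nn_integral_hl_mono)
    fix x :: real assume x: "0 < x"
    have "1 * \<bar>phys (phi n) x - phys f x\<bar> <= (1 + x) * \<bar>phys (phi n) x - phys f x\<bar>" using x by (intro mult_right_mono) auto
    moreover have "\<bar>V x - phys f x\<bar> <= \<bar>phys (phi n) x - V x\<bar> + 1 * \<bar>phys (phi n) x - phys f x\<bar>"
     using abs_triangle_ineq[of "V x - phys (phi n) x" "phys (phi n) x - phys f x"] by (simp add: abs_minus_commute)
    ultimately have "\<bar>V x - phys f x\<bar> <= \<bar>phys (phi n) x - V x\<bar> + (1 + x) * \<bar>phys (phi n) x - phys f x\<bar>"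
     by (meson add_left_mono order_trans)
    then have "ennreal (indicator {..R} x * \<bar>V x - phys f x\<bar>) <= ennreal (indicator {..R} x * \<bar>phys (phi n) x - V x\<bar> + indicator {..R} x * ((1 + x) * \<bar>phys (phi n) x - phys f x\<bar>))"
     by (intro ennreal_leI) (auto simp: indicator_def)
    then show "ennreal (indicator {..R} x * \<bar>V x - phys f x\<bar>) <= ennreal (indicator {..R} x * \<bar>phys (phi n) x - V x\<bar>) + ennreal (indicator {..R} x * ((1 + x) * \<bar>phys (phi n) x - phys f x\<bar>))"
     using x by simp
   qed
   then show ?thesis unfolding sh by (subst (asm) nn_integral_add) auto
  qed
  moreover have "(%n. (NN x. ennreal (indicator {..R} x * \<bar>phys (phi n) x - V x\<bar>)) + (\<integral>\<^sup>+ r\<in>{1..R + 1}. ennreal (\<bar>phi n r - f r\<bar> * r^2) \<partial>lborel)) ----> 0 + 0"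
   by (intro tendsto_add 1 L1)
  ultimately have "(NN x. ennreal (indicator {..R} x * \<bar>V x - phys f x\<bar>)) <= 0 + 0" by (intro LIMSEQ_le_const) auto
  then show ?thesis by simp
 qed
 then have "AE x in hl. ennreal (indicator {..real k} x * \<bar>V x - phys f x\<bar>) = 0" for k
  by (subst (asm) nn_integral_0_iff_AE) auto
 then have "AE x in hl. \<forall>k. ennreal (indicator {..real k} x * \<bar>V x - phys f x\<bar>) = 0" unfolding AE_all_countable by blast
 then have "AE x in hl. V x = phys f x"
 proof eventually_elim
  case (elim x)
  obtain k :: nat where "x <= real k" using real_arch_simple by blast
  then show ?case using elim[rule_format, of k] by (simp add: ennreal_eq_0_iff)
 qed
 then show ?thesis by (intro profile_rep_cong[OF V]) auto
qed

text \<open>Dividing by \<open>r\<close> undoes \<open>phys\<close>. The demanded convergence in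
  \<open>L^1\<close> on bounded sets follows from that in \<open>L^4(dx/x)\<close>, since the
  remaining weight \<open>1 + x\<close> is bounded there.\<close>

theorem profile_represents_function:
 assumes g: "Hhalf (cutp g)" and v: "profile_rep v (cutp g)"
  and phi: "!!n :: nat. phi n \<in> radial_test" "!!n. Hdot_sq (1/2) (FD (phi n)) < \<infinity>"
  and lim: "(%n. Hdot_sq (1/2) (%l. FD (phi n) l - g l)) ----> 0"
 shows "represents_function (1/2) g (%r. v (r - 1) / r)"
proof -
 note p = radial_test_phys[OF phi(1)]
 note [measurable] = p(2) profile_rep_measurable[OF v]
 let ?f = "%r. v (r - 1) / r"
 have fm: "set_borel_measurable lborel {1..} ?f" unfolding set_borel_measurable_def by measurable
 have "(%n. \<integral>\<^sup>+ r\<in>{1..R}. ennreal (\<bar>phi n r - ?f r\<bar> * r^2) \<partial>lborel) ----> 0" for R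
 proof -
  define S where "S = \<bar>R\<bar>"
  have 1: "(%n. NN x. ennreal (indicator {..R - 1} x * \<bar>phys (phi n) x - v x\<bar>)) ----> 0"
   by (rule E4_L1_local[OF _ radial_test_E4[OF v phi lim]]) measurable
  show ?thesis
  proof (rule ennreal_tendsto_0_squeeze[OF 1])
   fix n
   have "(%r. indicator {1..} r * (phi n r - ?f r)) \<in> BM"
    using borel_measurable_diff[of "%r. indicator {1..} r * phi n r" borel "%r. indicator {1..} r * ?f r"] fm p(1)[of n]
    by (simp add: set_borel_measurable_def right_diff_distrib)
   then have "(\<integral>\<^sup>+ r\<in>{1..R}. ennreal (\<bar>phi n r - ?f r\<bar> * r^2) \<partial>lborel)
     = (NN x. ennreal (indicator {..R - 1} x * ((1 + x) * \<bar>phys (%r. phi n r - ?f r) x\<bar>)))"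
    by (rule nn_integral_shift)
   also have "... <= (NN x. ennreal S * ennreal (indicator {..R - 1} x * \<bar>phys (phi n) x - v x\<bar>))"
   proof (rule nn_integral_hl_mono)
    fix x :: real assume x: "0 < x"
    have "phys (%r. phi n r - ?f r) x = phys (phi n) x - v x" using x by (simp add: phys_def right_diff_distrib)
    moreover have "(1 + x) * \<bar>phys (phi n) x - v x\<bar> <= S * \<bar>phys (phi n) x - v x\<bar>" if "x <= R - 1"
     using that by (intro mult_right_mono) (auto simp: S_def)
    ultimately have "indicator {..R - 1} x * ((1 + x) * \<bar>phys (%r. phi n r - ?f r) x\<bar>) <= S * (indicator {..R - 1} x * \<bar>phys (phi n) x - v x\<bar>)"
     by (auto simp: indicator_def)
    then show "ennreal (indicator {..R - 1} x * ((1 + x) * \<bar>phys (%r. phi n r - ?f r) x\<bar>)) <= ennreal S * ennreal (indicator {..R - 1} x * \<bar>phys (phi n) x - v x\<bar>)"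
     by (subst ennreal_mult[symmetric]) (auto simp: S_def intro!: ennreal_leI)
   qed
   also have "... = ennreal S * (NN x. ennreal (indicator {..R - 1} x * \<bar>phys (phi n) x - v x\<bar>))"
    by (rule nn_integral_cmult) measurable
   finally show "(\<integral>\<^sup>+ r\<in>{1..R}. ennreal (\<bar>phi n r - ?f r\<bar> * r^2) \<partial>lborel) <= ennreal S * (NN x. ennreal (indicator {..R - 1} x * \<bar>phys (phi n) x - v x\<bar>))" .
  qed simp
 qed
 then show ?thesis unfolding represents_function_def using fm phi lim by blast
qed

section \<open>Smooth radial test functions\<close>

text \<open>Differentiability of order \<open>k\<close>, peeling derivatives off from the inside:
  the recursion passes to the derivatives of \<open>f\<close> itself, the form that the inductive
  proofs of the product and chain rules use. \<open>smo_iterated\<close> converts it to iterated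
  directional derivatives.\<close>

fun smo :: "nat => 'a::real_normed_vector set => ('a => real) => bool" where
 "smo 0 U f = True"
| "smo (Suc k) U f = ((\<forall>x\<in>U. f differentiable (at x)) \<and> (\<forall>v. smo k U (%x. frechet_derivative f (at x) v)))"

lemma smo_Un: "smo k U f ==> smo k V f ==> smo k (U \<union> V) f"
 by (induction k arbitrary: f) auto

lemma smo_cong:
 assumes U: "open U" and eq: "!!x. x \<in> U ==> f x = g x" and f: "smo k U f"
 shows "smo k U g"
 using eq f
proof (induction k arbitrary: f g)
 case (Suc k)
 have D: "(g has_derivative frechet_derivative f (at x)) (at x)" if x: "x \<in> U" for x
 proof -
  have "(f has_derivative frechet_derivative f (at x)) (at x)" using Suc.prems(2) x by (simp add: frechet_derivative_works)
  then show ?thesis by (rule has_derivative_transform_within_open[OF _ U x Suc.prems(1)])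
 qed
 then have e: "frechet_derivative g (at x) = frechet_derivative f (at x)" if "x \<in> U" for x
  using frechet_derivative_at[OF D[OF that]] by simp
 have "smo k U (%x. frechet_derivative g (at x) v)" for v
  by (rule Suc.IH[of "%x. frechet_derivative f (at x) v"]) (use Suc.prems e in auto)
 then show ?case using D by (auto simp: differentiable_def)
qed simp

lemma smo_SucI:
 assumes U: "open U" and D: "!!x. x \<in> U ==> (f has_derivative D x) (at x)" and s: "!!v. smo k U (%x. D x v)"
 shows "smo (Suc k) U f"
proof -
 have "smo k U (%x. frechet_derivative f (at x) v)" for v
  by (rule smo_cong[OF U _ s[of v]]) (metis D frechet_derivative_at)
 then show ?thesis using D by (auto simp: differentiable_def)
qed

lemma smo_SucD:
 assumes "smo (Suc k) U f" "x \<in> U" shows "(f has_derivative frechet_derivative f (at x)) (at x)"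
 using assms by (simp add: frechet_derivative_works)

lemma smo_Suc_mono: "smo (Suc k) U f ==> smo k U f"
 by (induction k arbitrary: f) auto

lemma smo_const: "open U ==> smo k U (%x. c)"
proof (induction k arbitrary: c)
 case (Suc k) then show ?case by (intro smo_SucI[where D="%x v. 0"]) auto
qed simp

lemma smo_add: "open U ==> smo k U f ==> smo k U g ==> smo k U (%x. f x + g x)"
proof (induction k arbitrary: f g)
 case (Suc k)
 show ?case
  by (rule smo_SucI[OF Suc.prems(1), where D="%x v. frechet_derivative f (at x) v + frechet_derivative g (at x) v"])
   (use Suc in "auto intro!: has_derivative_add smo_SucD[OF Suc.prems(2)] smo_SucD[OF Suc.prems(3)]")
qed simp

lemma smo_mult: "open U ==> smo k U f ==> smo k U g ==> smo k U (%x. f x * g x)"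
proof (induction k arbitrary: f g)
 case (Suc k)
 show ?case
 proof (rule smo_SucI[OF Suc.prems(1), where D="%x v. f x * frechet_derivative g (at x) v + frechet_derivative f (at x) v * g x"])
  show "((%x. f x * g x) has_derivative (%v. f x * frechet_derivative g (at x) v + frechet_derivative f (at x) v * g x)) (at x)" if "x \<in> U" for x
   by (rule has_derivative_mult[OF smo_SucD[OF Suc.prems(2) that] smo_SucD[OF Suc.prems(3) that]])
  show "smo k U (%x. f x * frechet_derivative g (at x) v + frechet_derivative f (at x) v * g x)" for v
   using Suc.prems smo_Suc_mono[OF Suc.prems(2)] smo_Suc_mono[OF Suc.prems(3)] by (intro smo_add Suc.IH) auto
 qed
qed simp

lemma smo_sum: "open U ==> (!!i. i \<in> I ==> smo k U (f i)) ==> smo k U (%x. \<Sum>i\<in>I. f i x)"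
 by (induction I rule: infinite_finite_induct) (auto intro: smo_const smo_add)

lemma smo_compose:
 fixes h :: "real => real"
 shows "open U ==> smo k U f ==> smo k UNIV h ==> smo k U (%x. h (f x))"
proof (induction k arbitrary: f h)
 case (Suc k)
 show ?case
 proof (rule smo_SucI[OF Suc.prems(1), where D="%x v. frechet_derivative f (at x) v * frechet_derivative h (at (f x)) 1"])
  fix x assume x: "x \<in> U"
  have Dh: "(h has_derivative frechet_derivative h (at (f x))) (at (f x))" by (rule smo_SucD[OF Suc.prems(3)]) simp
  have "((%x. h (f x)) has_derivative (%v. frechet_derivative h (at (f x)) (frechet_derivative f (at x) v))) (at x)"
   using diff_chain_at[OF smo_SucD[OF Suc.prems(2) x] Dh] by (simp add: comp_def)
  moreover have "frechet_derivative h (at (f x)) y = y * frechet_derivative h (at (f x)) 1" for y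
   using linear_cmul[OF has_derivative_linear[OF Dh], of y 1] by simp
  note e = this
  show "((%x. h (f x)) has_derivative (%v. frechet_derivative f (at x) v * frechet_derivative h (at (f x)) 1)) (at x)"
   using calculation unfolding e[of "frechet_derivative f (at x) _"] .
 next
  fix v
  show "smo k U (%x. frechet_derivative f (at x) v * frechet_derivative h (at (f x)) 1)"
   using Suc.prems smo_Suc_mono[OF Suc.prems(2)] by (intro smo_mult Suc.IH[where h="%y. frechet_derivative h (at y) 1"]) auto
 qed
qed simp

lemma smo_ident: "smo k UNIV (%x :: real. x)"
proof (cases k)
 case (Suc m)
 show ?thesis unfolding Suc by (rule smo_SucI[where D="%x v. v"]) (auto intro!: smo_const)
qed simp

lemma smo_real_SucI:
 fixes f :: "real => real"
 assumes "!!x. (f has_real_derivative f' x) (at x)" "smo k UNIV f'"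
 shows "smo (Suc k) UNIV f"
proof (rule smo_SucI[where D="%x v. f' x * v"])
 show "(f has_derivative (%v. f' x * v)) (at x)" for x using assms(1)[of x] by (simp add: has_field_derivative_def)
 show "smo k UNIV (%x. f' x * v)" for v by (intro smo_mult assms(2) smo_const) auto
qed simp

lemma smo_exp: "smo k UNIV (exp :: real => real)"
proof (induction k)
 case (Suc k)
 show ?case by (rule smo_real_SucI[OF DERIV_exp Suc.IH])
qed simp

text \<open>The standard flat function is \<open>bump 0\<close>. The factor
  \<open>inverse t ^ j\<close> makes the linear span of the family closed under differentiation, so
  all orders of smoothness follow by one induction.\<close>

definition bump :: "nat => real => real" where "bump j t = (if 0 < t then inverse t ^ j * exp (- inverse t) else 0)"

lemma bump_deriv: "(bump j has_real_derivative (- real j * bump (Suc j) t + bump (Suc (Suc j)) t)) (at t)"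
proof -
 consider "0 < t" | "t < 0" | "t = 0" by linarith
 then show ?thesis
 proof cases
  case 1
  have "((%t. inverse t ^ j) has_real_derivative real j * (- (inverse t ^ Suc (Suc 0)) * inverse t ^ (j - Suc 0))) (at t)"
   by (rule DERIV_power[OF DERIV_inverse]) (use 1 in simp)
  moreover have "real j * (- (inverse t ^ Suc (Suc 0)) * inverse t ^ (j - Suc 0)) = - real j * inverse t ^ Suc j"
   by (cases j) (auto simp: algebra_simps)
  ultimately have d: "((%t. inverse t ^ j) has_real_derivative - real j * inverse t ^ Suc j) (at t)" by (simp only:)
  have "((%t. exp (- inverse t)) has_real_derivative exp (- inverse t) * (inverse t * inverse t)) (at t)"
   using 1 by (auto intro!: derivative_eq_intros)
  from DERIV_mult[OF d this]
  have "((%t. inverse t ^ j * exp (- inverse t)) has_real_derivative (- real j * bump (Suc j) t + bump (Suc (Suc j)) t)) (at t)"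
   using 1 by (simp add: bump_def algebra_simps)
  then show ?thesis
   by (rule has_field_derivative_transform_within_open[where S="{0<..}"]) (use 1 in "auto simp: bump_def")
 next
  case 2
  have "((%t. 0) has_real_derivative (- real j * bump (Suc j) t + bump (Suc (Suc j)) t)) (at t)" using 2 by (simp add: bump_def)
  then show ?thesis
   by (rule has_field_derivative_transform_within_open[where S="{..<0}"]) (use 2 in "auto simp: bump_def")
 next
  case 3
  have "((%h. bump j h / h) \<longlongrightarrow> 0) (at 0)"
  proof (rule filterlim_split_at)
   have "\<forall>\<^sub>F h in at_left (0::real). bump j h / h = 0" by (auto simp: eventually_at_filter bump_def)
   then show "((%h. bump j h / h) \<longlongrightarrow> 0) (at_left 0)" by (rule tendsto_eventually)
   \<comment> \<open>From the right the difference quotient at 0 is \<open>y ^ Suc j / exp y\<close>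
     with \<open>y = inverse h\<close>, and the exponential wins.\<close>
   have "((%y. y ^ Suc j / exp y) \<longlongrightarrow> 0) (at_top :: real filter)" by (rule tendsto_power_div_exp_0)
   then have "((%h. inverse h ^ Suc j / exp (inverse h)) \<longlongrightarrow> 0) (at_right (0::real))"
    by (rule filterlim_compose[OF _ filterlim_inverse_at_top_right])
   moreover have "\<forall>\<^sub>F h in at_right (0::real). inverse h ^ Suc j / exp (inverse h) = bump j h / h"
    unfolding eventually_at_filter by (auto simp: bump_def exp_minus divide_inverse)
   ultimately show "((%h. bump j h / h) \<longlongrightarrow> 0) (at_right 0)" by (rule Lim_transform_eventually)
  qed
  then show ?thesis using 3 by (simp add: has_field_derivative_iff bump_def)
 qed
qed

lemma smo_bump: "smo k UNIV (bump j)"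
proof (induction k arbitrary: j)
 case (Suc k)
 show ?case by (rule smo_real_SucI[OF bump_deriv]) (intro smo_add smo_mult smo_const Suc.IH open_UNIV)
qed simp

lemma smo_inner: "smo k (- {0}) (%x :: 'a::euclidean_space. x \<bullet> v)"
proof (cases k)
 case (Suc m)
 show ?thesis unfolding Suc
  by (rule smo_SucI[where D="%x w. w \<bullet> v"]) (auto intro!: smo_const derivative_eq_intros)
qed simp

text \<open>The derivative of the norm contains the inverse norm, so both are carried through one
  induction.\<close>

lemma smo_norm: "smo k (- {0}) (%x :: 'a::euclidean_space. norm x) \<and> smo k (- {0}) (%x :: 'a. inverse (norm x))"
proof (induction k)
 case (Suc k)
 have o: "open (- {0 :: 'a})" by (intro open_Compl closed_singleton)
 have D: "(norm has_derivative (%v. (x \<bullet> v) * inverse (norm x))) (at x)" if "x \<noteq> 0" for x :: 'a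
  by (rule has_derivative_eq_rhs[OF has_derivative_norm[OF that]]) (auto simp: fun_eq_iff sgn_div_norm inner_commute)
 have s: "smo k (- {0}) (%x :: 'a. x \<bullet> v)" for v by (rule smo_inner)
 have 1: "smo (Suc k) (- {0}) (%x :: 'a. norm x)"
  by (rule smo_SucI[where D="%x v. (x \<bullet> v) * inverse (norm x)"]) (use D Suc s in "auto intro!: smo_mult")
 have 2: "smo (Suc k) (- {0}) (%x :: 'a. inverse (norm x))"
 proof (rule smo_SucI[where D="%x v. (- 1) * ((x \<bullet> v) * (inverse (norm x) * (inverse (norm x) * inverse (norm x))))"])
  fix x :: 'a assume "x \<in> - {0}"
  then have x: "x \<noteq> 0" by simp
  have "((%x. inverse (norm x)) has_derivative (%v. - (inverse (norm x) * ((x \<bullet> v) * inverse (norm x)) * inverse (norm x)))) (at x)"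
   by (rule Deriv.has_derivative_inverse[OF _ D[OF x]]) (use x in simp)
  then show "((%x. inverse (norm x)) has_derivative (%v. (- 1) * ((x \<bullet> v) * (inverse (norm x) * (inverse (norm x) * inverse (norm x)))))) (at x)"
   by (rule has_derivative_eq_rhs) (auto simp: fun_eq_iff)
 next
  show "smo k (- {0}) (%x :: 'a. (- 1) * ((x \<bullet> v) * (inverse (norm x) * (inverse (norm x) * inverse (norm x)))))" for v
   by (intro smo_mult[OF o] smo_const[OF o]) (use Suc s in auto)
 qed (rule o)
 show ?case using 1 2 by blast
qed simp

lemma smo_iterated: assumes "!!k. smo k UNIV f" shows "iterated_dderiv vs f differentiable (at x)"
proof -
 have "\<forall>k. smo k UNIV (iterated_dderiv vs f)"
 proof (induction vs)
  case (Cons v vs)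
  then have "smo (Suc k) UNIV (iterated_dderiv vs f)" for k by blast
  then show ?case by simp
 qed (use assms in simp)
 then have "smo (Suc 0) UNIV (iterated_dderiv vs f)" by blast
 then show ?thesis by simp
qed

text \<open>The widths are chosen so that the sine transform of \<open>x\<close> times the
  \<open>i\<close>-th Gaussian is a multiple of \<open>l * exp (- (l^2)) ^ Suc i\<close>.\<close>

definition gauss_sum :: "(nat => real) => nat => real => real" where
 "gauss_sum c N x = (\<Sum>i\<le>N. c i * exp (- (x^2 / (4 * real (Suc i)))))"

text \<open>With \<open>x = r - 1\<close> the factor \<open>1 - inverse r\<close> is
  \<open>x / (1 + x)\<close>, so \<open>phys\<close> of the test function is
  \<open>x * gauss_sum c N x\<close> times two cutoffs, the first vanishing for
  \<open>x <= 1 / n\<close> and the second for \<open>x >= n\<close>.\<close>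

definition cut_test :: "(nat => real) => nat => nat => real => real" where
 "cut_test c N n r = (1 - inverse r) * (gauss_sum c N (r - 1) * (bump 0 (real n * (r - 1) - 1) * bump 0 (real n - (r - 1))))"

lemma smo_square: "smo k UNIV (%x :: real. a * x^2)"
 using smo_mult[OF open_UNIV smo_const[OF open_UNIV, of k a] smo_mult[OF open_UNIV smo_ident smo_ident]] by (simp add: power2_eq_square)

lemma smo_affine: "open U ==> smo k U f ==> smo k U (%x. a * f x + b)"
 by (intro smo_add smo_mult smo_const)

lemma smo_gauss_sum: "smo k UNIV (gauss_sum c N)"
proof -
 have "smo k UNIV (%x. exp ((- 1 / (4 * real (Suc i))) * x^2))" for i
  by (rule smo_compose[OF open_UNIV smo_square smo_exp])
 then have "smo k UNIV (%x. \<Sum>i\<le>N. c i * exp ((- 1 / (4 * real (Suc i))) * x^2))"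
  by (rule smo_sum[OF open_UNIV smo_mult[OF open_UNIV smo_const[OF open_UNIV]]])
 then show ?thesis by (simp add: gauss_sum_def[abs_def])
qed

text \<open>The norm is smooth only off the origin, but the function vanishes on the whole unit
  ball; the ball and the punctured space are open and cover everything.\<close>

theorem cut_test_radial: assumes n: "0 < n" shows "cut_test c N n \<in> radial_test"
proof -
 let ?f = "%x :: real ^ 3. cut_test c N n (norm x)"
 have o: "open (- {0 :: real ^ 3})" by (intro open_Compl closed_singleton)
 have nm: "smo k (- {0}) (%x :: real ^ 3. norm x)" "smo k (- {0}) (%x :: real ^ 3. inverse (norm x))" for k using smo_norm by auto
 have s1: "smo k (- {0}) ?f" for k
 proof -
  have "smo k (- {0}) (%x :: real ^ 3. (- 1 * inverse (norm x) + 1) * (gauss_sum c N (1 * norm x + (- 1)) * (bump 0 (real n * norm x + (- real n - 1)) * bump 0 (- 1 * norm x + (real n + 1)))))"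
   by (intro smo_mult[OF o] smo_affine[OF o nm(2)] smo_compose[OF o smo_affine[OF o nm(1)] smo_gauss_sum] smo_compose[OF o smo_affine[OF o nm(1)] smo_bump])
  moreover have "(- 1 * inverse (norm x) + 1) * (gauss_sum c N (1 * norm x + (- 1)) * (bump 0 (real n * norm x + (- real n - 1)) * bump 0 (- 1 * norm x + (real n + 1)))) = ?f x" for x :: "real ^ 3"
   by (simp add: cut_test_def algebra_simps)
  ultimately show ?thesis by (simp only:)
 qed
 have z: "cut_test c N n r = 0" if "r <= 1 + 1 / real n \<or> real n + 1 <= r" for r
  using that n by (auto simp: cut_test_def bump_def field_simps)
 have s2: "smo k (ball 0 1) ?f" for k
 proof (rule smo_cong[OF open_ball _ smo_const[OF open_ball, of k 0 1 0]])
  fix x :: "real ^ 3" assume "x \<in> ball 0 1"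
  then show "0 = cut_test c N n (norm x)" using n by (intro z[symmetric]) (auto intro: order_trans[of _ 1])
 qed
 have "- {0} \<union> ball 0 1 = (UNIV :: (real ^ 3) set)" by auto
 then have s: "smo k UNIV ?f" for k using smo_Un[OF s1 s2] by metis
 have K: "compact (cball 0 (real n + 1) - ball 0 (1 + 1 / real n) :: (real ^ 3) set)" by (intro compact_diff compact_cball open_ball)
 have sub: "cball 0 (real n + 1) - ball 0 (1 + 1 / real n) \<subseteq> Omega"
 proof -
  have "1 < 1 + 1 / real n" using n by simp
  note e = this
  show ?thesis
  proof
   fix x :: "real ^ 3" assume "x \<in> cball 0 (real n + 1) - ball 0 (1 + 1 / real n)"
   then have "1 + 1 / real n <= norm x" by simp
   then have "1 < norm x" using e by linarith
   then show "x \<in> Omega" by (simp add: Omega_def)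
  qed
 qed
 have "?f x = 0" if "x \<notin> cball 0 (real n + 1) - ball 0 (1 + 1 / real n)" for x
  using that by (intro z) auto
 then show ?thesis unfolding radial_test_def Cc_infinity_def using smo_iterated[OF s] K sub by blast
qed

section \<open>Gaussians and their truncations\<close>

lemma hl_FTC:
 fixes F f :: "real => real"
 assumes "!!x. 0 < x ==> DERIV F x :> f x" "!!x. 0 < x ==> isCont f x" "integrable hl f" "f \<in> BM"
  "(F \<longlongrightarrow> A) (at_right 0)" "(F \<longlongrightarrow> B) at_top"
 shows "(LI x. f x) = B - A"
 unfolding integral_hl_einterval[OF assms(4)]
proof (rule interval_integral_FTC_integrable)
 show "set_integrable lborel (einterval 0 \<infinity>) f" using assms(3) integrable_hl_einterval[OF assms(4)] by simp
 show "((F \<circ> real_of_ereal) \<longlongrightarrow> A) (at_right 0)" unfolding zero_ereal_def ereal_tendsto_simps by (rule assms)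
 show "((F \<circ> real_of_ereal) \<longlongrightarrow> B) (at_left \<infinity>)" unfolding ereal_tendsto_simps by (rule assms)
qed (use assms in "auto simp: zero_ereal_def has_real_derivative_iff_has_vector_derivative")

lemma one_plus_power_le_exp: "0 <= x ==> 0 < k ==> (1 + x) ^ k <= real k ^ k * exp x"
proof -
 assume x: "0 <= x" and k: "0 < k"
 have "(1 + x) ^ k <= (real k * (1 + x / real k)) ^ k"
 proof (rule power_mono)
  show "1 + x <= real k * (1 + x / real k)" using x k by (simp add: distrib_left)
 qed (use x in simp)
 also have "... = real k ^ k * (1 + x / real k) ^ k" by (simp add: power_mult_distrib)
 also have "... <= real k ^ k * exp (x / real k) ^ k" using x k by (intro mult_left_mono power_mono) auto
 also have "... = real k ^ k * exp x" using k by (simp flip: exp_of_nat_mult)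
 finally show ?thesis .
qed

lemma gauss_le_exp: fixes b x :: real assumes "0 < b" "0 <= x" shows "(1 + x) ^ 3 * exp (- (b * x^2)) <= 27 * exp (1 / b) * exp (- x)"
proof -
 have "0 <= (b * x - 1)^2 / b" using assms by simp
 also have "... = b * x^2 - 2 * x + 1 / b" using assms by (simp add: power2_eq_square field_simps)
 finally have "exp (- (b * x^2)) <= exp (1 / b - 2 * x)" by simp
 then have "(1 + x) ^ 3 * exp (- (b * x^2)) <= (real 3 ^ 3 * exp x) * exp (1 / b - 2 * x)"
  using one_plus_power_le_exp[of x 3] assms by (intro mult_mono) auto
 also have "... = 27 * exp (1 / b) * exp (- x)" by (simp flip: exp_add)
 finally show ?thesis .
qed

lemma integrable_gauss: assumes b: "0 < b" and [measurable]: "k \<in> BM" and k: "!!x. 0 < x ==> \<bar>k x\<bar> <= C * (1 + x) ^ 3" and C: "0 <= C"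
 shows "integrable hl (%x. k x * exp (- (b * x^2)))"
proof (rule integrable_hl_bound)
 show "integrable hl (%x. C * (27 * exp (1 / b)) * exp (- (1 * x)))" using integrable_exp_hl[of 1] by auto
 fix x :: real assume x: "0 < x"
 have "\<bar>k x * exp (- (b * x^2))\<bar> <= C * (1 + x) ^ 3 * exp (- (b * x^2))" unfolding abs_mult using k[OF x] by (intro mult_mono) (auto simp: C x)
 also have "... <= C * (27 * exp (1 / b) * exp (- x))" using gauss_le_exp[OF b, of x] x C unfolding mult.assoc by (intro mult_left_mono) auto
 finally show "\<bar>k x * exp (- (b * x^2))\<bar> <= \<bar>C * (27 * exp (1 / b)) * exp (- (1 * x))\<bar>" using C by (simp add: mult.assoc)
qed measurable

text \<open>The real part of the characteristic function of the standard normal law, freed of its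
  normalisation.\<close>

lemma std_normal_cos: "(\<integral>y. exp (- (y^2 / 2)) * cos (t * y) \<partial>lborel) = sqrt (2 * pi) * exp (- (t^2 / 2))"
 and std_normal_cos_integrable: "integrable lborel (%y. exp (- (y^2 / 2)) * cos (t * y))"
proof -
 interpret p: prob_space std_normal_distribution by (rule prob_space_normal_density) simp
 have I: "integrable std_normal_distribution (%y. cos (t * y))"
  by (rule p.integrable_const_bound[where B=1]) auto
 have "Re (char std_normal_distribution t) = (\<integral>y. Re (iexp (t * y)) \<partial>std_normal_distribution)"
  unfolding char_def by (rule integral_Re[symmetric]) (rule p.integrable_iexp, auto)
 then have c: "(\<integral>y. cos (t * y) \<partial>std_normal_distribution) = exp (- (t^2 / 2))"
  by (simp add: char_std_normal_distribution Re_exp)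
 have d: "std_normal_density y = inverse (sqrt (2 * pi)) * exp (- (y^2 / 2))" for y by (simp add: normal_density_def inverse_eq_divide)
 have "integrable lborel (%y. std_normal_density y * cos (t * y))" using I by (subst (asm) integrable_density) auto
 then have "integrable lborel (%y. sqrt (2 * pi) * (std_normal_density y * cos (t * y)))" by (rule integrable_mult_right)
 then show "integrable lborel (%y. exp (- (y^2 / 2)) * cos (t * y))" by (simp add: d mult.assoc[symmetric])
 have "(\<integral>y. std_normal_density y * cos (t * y) \<partial>lborel) = exp (- (t^2 / 2))" using c by (subst (asm) integral_density) auto
 then have "(\<integral>y. inverse (sqrt (2 * pi)) * (exp (- (y^2 / 2)) * cos (t * y)) \<partial>lborel) = exp (- (t^2 / 2))" by (simp add: d mult.assoc)
 then have "inverse (sqrt (2 * pi)) * (\<integral>y. exp (- (y^2 / 2)) * cos (t * y) \<partial>lborel) = exp (- (t^2 / 2))"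
  by (simp only: integral_mult_right_zero)
 then show "(\<integral>y. exp (- (y^2 / 2)) * cos (t * y) \<partial>lborel) = sqrt (2 * pi) * exp (- (t^2 / 2))"
  by (simp add: field_simps)
qed

text \<open>Half of the integral over the line, by evenness and a change of variables. The constant
  is recorded as positive, which is what the later rescaling of coefficients requires.\<close>

lemma gauss_cos:
 assumes b: "0 < b"
 shows "\<exists>K>0. \<forall>l. (LI x. cos (l * x) * exp (- (b * x^2))) = K * exp (- (l^2 / (4 * b)))"
proof (intro exI conjI allI)
 define s where "s = inverse (sqrt (2 * b))"
 have s: "0 < s" "b * s^2 = 1 / 2" using b by (auto simp: s_def power_inverse field_simps)
 show "0 < s * sqrt (2 * pi) / 2" using s by simp
 fix l :: real
 let ?f = "%x. cos (l * x) * exp (- (b * x^2))"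
 have e: "?f (0 + s * y) = exp (- (y^2 / 2)) * cos ((l * s) * y)" for y
 proof -
  have "b * (s * y)^2 = y^2 / 2" using s by (simp add: power_mult_distrib mult.assoc[symmetric])
  then show ?thesis by (simp add: ac_simps)
 qed
 have "integrable lborel (%y. ?f (0 + s * y))" unfolding e by (rule std_normal_cos_integrable)
 then have If: "integrable lborel ?f" using lborel_integrable_real_affine_iff[of s ?f 0] s by simp
 have full: "(\<integral>x. ?f x \<partial>lborel) = s * (sqrt (2 * pi) * exp (- ((l * s)^2 / 2)))"
  using lborel_integral_real_affine[of s ?f 0] s unfolding e by (simp add: std_normal_cos)
 have i1: "integrable lborel (%x. indicator {0<..} x * ?f x)"
  using integrable_real_mult_indicator[OF _ If, of "{0<..}"] by (simp add: mult.commute)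
 have i2: "integrable lborel (%x. indicator {0<..} (- x) * ?f (- x))"
  using lborel_integrable_real_affine[OF i1, of "-1" 0] by simp
 have "(\<integral>x. ?f x \<partial>lborel) = (\<integral>x. indicator {0<..} x * ?f x + indicator {0<..} (- x) * ?f (- x) \<partial>lborel)"
 proof (rule integral_cong_AE)
  have "AE x in lborel. x \<noteq> (0 :: real)" by (rule AE_lborel_singleton)
  then show "AE x in lborel. ?f x = indicator {0<..} x * ?f x + indicator {0<..} (- x) * ?f (- x)"
   by eventually_elim (auto simp: indicator_def)
 qed measurable
 also have "... = (\<integral>x. indicator {0<..} x * ?f x \<partial>lborel) + (\<integral>x. indicator {0<..} (- x) * ?f (- x) \<partial>lborel)"
  by (rule Bochner_Integration.integral_add[OF i1 i2])
 also have "(\<integral>x. indicator {0<..} (- x) * ?f (- x) \<partial>lborel) = (\<integral>x. indicator {0<..} x * ?f x \<partial>lborel)"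
  using lborel_integral_real_affine[of "-1" "%x. indicator {0<..} x * ?f x" 0] by simp
 also have "(\<integral>x. indicator {0<..} x * ?f x \<partial>lborel) = (LI x. ?f x)"
  by (subst integral_hl) (auto simp: set_lebesgue_integral_def)
 finally have "(LI x. ?f x) = s * sqrt (2 * pi) / 2 * exp (- ((l * s)^2 / 2))" using full by simp
 moreover have "(l * s)^2 / 2 = l^2 / (4 * b)"
 proof -
  have "s^2 = 1 / (2 * b)" using s(2) b by (simp add: field_simps)
  then show ?thesis by (simp add: power_mult_distrib)
 qed
 ultimately show "(LI x. ?f x) = s * sqrt (2 * pi) / 2 * exp (- (l^2 / (4 * b)))" by simp
qed

text \<open>The derivative of \<open>sin (l * x) * exp (- (b * x^2))\<close> integrates to 0, which
  expresses the sine integral through the cosine one.\<close>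

lemma gauss_sine:
 assumes b: "0 < b"
 shows "\<exists>K>0. \<forall>l. (LI x. sin (x * l) * (x * exp (- (b * x^2)))) = K * (l * exp (- (l^2 / (4 * b))))"
proof -
 obtain K where K: "0 < K" "!!l. (LI x. cos (l * x) * exp (- (b * x^2))) = K * exp (- (l^2 / (4 * b)))" using gauss_cos[OF b] by blast
 have "(LI x. sin (x * l) * (x * exp (- (b * x^2)))) = K / (2 * b) * (l * exp (- (l^2 / (4 * b))))" for l
 proof -
  have c1: "1 <= (1 + x) ^ 3" "x <= (1 + x) ^ 3" if "0 < x" for x :: real
  proof -
   show "1 <= (1 + x) ^ 3" using that by (intro one_le_power) simp
   have "x <= (1 + x) ^ 1" by simp
   also have "... <= (1 + x) ^ 3" using that by (intro power_increasing) auto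
   finally show "x <= (1 + x) ^ 3" .
  qed
  have I1: "integrable hl (%x. cos (l * x) * exp (- (b * x^2)))"
   by (rule integrable_gauss[OF b, where C=1]) (auto intro: order_trans[OF _ c1(1)])
  have I2: "integrable hl (%x. (sin (x * l) * x) * exp (- (b * x^2)))"
  proof (rule integrable_gauss[OF b, where C=1])
   fix x :: real assume x: "0 < x"
   have "\<bar>sin (x * l) * x\<bar> <= x" using x by (simp add: abs_mult mult_left_le_one_le)
   then show "\<bar>sin (x * l) * x\<bar> <= 1 * (1 + x) ^ 3" using c1(2)[OF x] by linarith
  qed auto
  have "(LI x. l * (cos (l * x) * exp (- (b * x^2))) - 2 * b * ((sin (x * l) * x) * exp (- (b * x^2)))) = 0 - 0"
  proof (rule hl_FTC[where F="%x. sin (l * x) * exp (- (b * x^2))"])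
   show "DERIV (%x. sin (l * x) * exp (- (b * x^2))) x :> l * (cos (l * x) * exp (- (b * x^2))) - 2 * b * ((sin (x * l) * x) * exp (- (b * x^2)))" for x
    by (auto intro!: derivative_eq_intros simp: algebra_simps)
   show "integrable hl (%x. l * (cos (l * x) * exp (- (b * x^2))) - 2 * b * ((sin (x * l) * x) * exp (- (b * x^2))))"
    by (intro Bochner_Integration.integrable_diff integrable_mult_right I1 I2)
   have "((%x. sin (l * x) * exp (- (b * x^2))) \<longlongrightarrow> sin (l * 0) * exp (- (b * 0^2))) (at_right 0)" by (intro tendsto_intros)
   then show "((%x. sin (l * x) * exp (- (b * x^2))) \<longlongrightarrow> 0) (at_right 0)" by simp
   show "((%x. sin (l * x) * exp (- (b * x^2))) \<longlongrightarrow> 0) at_top"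
   proof (rule Lim_null_comparison)
    show "((%x. exp (- (b * x^2))) \<longlongrightarrow> 0) at_top" using b by real_asymp
   qed (auto simp: abs_mult mult_left_le_one_le)
  qed auto
  also have "(LI x. l * (cos (l * x) * exp (- (b * x^2))) - 2 * b * ((sin (x * l) * x) * exp (- (b * x^2))))
   = l * (LI x. cos (l * x) * exp (- (b * x^2))) - 2 * b * (LI x. (sin (x * l) * x) * exp (- (b * x^2)))"
   using I1 I2 by (subst Bochner_Integration.integral_diff) auto
  finally show ?thesis using b unfolding K by (simp add: field_simps mult.assoc)
 qed
 then show ?thesis using K(1) b by (intro exI[of _ "K / (2 * b)"]) auto
qed

text \<open>One spatial norm that dominates both Fourier-side norms. The exponent is
  \<open>6 = 2 + 4\<close>: the weight \<open>(1 + x)^2\<close> of the master estimate, and the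
  square of the factor \<open>(1 + x)^2\<close> that is split off the test function there.\<close>

definition wW :: "(real => real) => ennreal" where "wW a = (NN x. ennreal ((1 + x) ^ 6 * (a x)^2))"

text \<open>For order 1/2, \<open>l <= 1 + l^2\<close> and integration by parts reduce the norm to
  Bessel's inequality for the sine transform of \<open>e\<close> and the cosine transform of
  \<open>e'\<close>. For order -1/2 the master estimate is used with
  \<open>p x = a x * (1 + x)^2\<close> and \<open>d x = x / (1 + x)^2\<close>, for which
  \<open>E4 d <= 1\<close>.\<close>

theorem sine_tr_test_norms:
 assumes [measurable]: "e \<in> BM" "e' \<in> BM" "a \<in> BM"
  and D: "!!x. 0 < x ==> DERIV e x :> e' x" and C: "!!x. 0 < x ==> isCont e' x"
  and e: "!!x. 0 < x ==> \<bar>e x\<bar> <= x * a x" and e': "!!x. 0 < x ==> \<bar>e' x\<bar> <= a x" and a: "!!x. 0 < x ==> a x <= M * exp (- x)"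
 shows "integrable hl e" "nm (sine_tr e) <= 2 * wW a" "ns (sine_tr e) <= wW a"
proof -
 have a0: "0 <= a x" if "0 < x" for x using e'[OF that] by linarith
 have "0 <= M * exp (- 1)" using a0[of 1] a[of 1] by linarith
 then have M0: "0 <= M" by (simp add: zero_le_mult_iff)
 have xe: "x * exp (- x) <= 2 * exp (- (x / 2))" if "0 < x" for x :: real
 proof -
  have "x <= 2 * exp (x / 2)" using exp_ge_add_one_self[of "x/2"] by linarith
  then have "x * exp (- x) <= (2 * exp (x / 2)) * exp (- x)" by (intro mult_right_mono) auto
  moreover have "exp (x / 2) * exp (- x) = exp (- (x / 2))" by (simp flip: exp_add)
  ultimately show ?thesis by (simp only: mult.assoc)
 qed
 have eb: "\<bar>e x\<bar> <= 2 * M * exp (- (x / 2))" if x: "0 < x" for x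
 proof -
  have "\<bar>e x\<bar> <= x * (M * exp (- x))" using e[OF x] mult_left_mono[OF a[OF x], of x] x by linarith
  also have "... <= M * (2 * exp (- (x / 2)))" using mult_left_mono[OF xe[OF x] M0] by (simp add: mult.left_commute)
  finally show ?thesis by simp
 qed
 show I: "integrable hl e"
 proof (rule integrable_hl_bound)
  show "integrable hl (%x. 2 * M * exp (- (1/2 * x)))" using integrable_exp_hl[of "1/2"] by auto
  show "\<bar>e x\<bar> <= \<bar>2 * M * exp (- (1/2 * x))\<bar>" if "0 < x" for x using eb[OF that] by simp
 qed measurable
 have I': "integrable hl e'"
 proof (rule integrable_hl_bound)
  show "integrable hl (%x. M * exp (- (1 * x)))" using integrable_exp_hl[of 1] by auto
  show "\<bar>e' x\<bar> <= \<bar>M * exp (- (1 * x))\<bar>" if "0 < x" for x using order_trans[OF e'[OF that] a[OF that]] by simp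
 qed measurable
 have parts: "l * (LI x. sin (x * l) * e x) = (LI x. cos (x * l) * e' x)" for l
 proof -
  have J1: "integrable hl (%x. sin (x * l) * e x)" by (rule integrable_hl_bound[OF I]) (auto simp: abs_mult intro!: mult_left_le_one_le)
  have J2: "integrable hl (%x. cos (x * l) * e' x)" by (rule integrable_hl_bound[OF I']) (auto simp: abs_mult intro!: mult_left_le_one_le)
  have "(LI x. l * (sin (x * l) * e x) - cos (x * l) * e' x) = 0 - 0"
  proof (rule hl_FTC[where F="%x. - (cos (x * l) * e x)"])
   show "DERIV (%x. - (cos (x * l) * e x)) x :> l * (sin (x * l) * e x) - cos (x * l) * e' x" if "0 < x" for x
    using D[OF that] by (auto intro!: derivative_eq_intros simp: algebra_simps)
   show "isCont (%x. l * (sin (x * l) * e x) - cos (x * l) * e' x) x" if "0 < x" for x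
    using DERIV_isCont[OF D[OF that]] C[OF that] by (intro continuous_intros)
   show "integrable hl (%x. l * (sin (x * l) * e x) - cos (x * l) * e' x)" using J1 J2 by auto
   show "((%x. - (cos (x * l) * e x)) \<longlongrightarrow> 0) (at_right 0)"
   proof (rule Lim_null_comparison)
    show "((%x. x * M) \<longlongrightarrow> 0) (at_right 0)" by (rule tendsto_eq_intros refl | simp)+
    show "\<forall>\<^sub>F x in at_right 0. norm (- (cos (x * l) * e x)) <= x * M"
     unfolding eventually_at_filter
    proof (intro always_eventually allI impI)
     fix x :: real assume "x \<in> {0<..}"
     then have x: "0 < x" by simp
     have "\<bar>cos (x * l) * e x\<bar> <= \<bar>e x\<bar>" by (simp add: abs_mult mult_left_le_one_le)
     also have "... <= x * (M * exp (- x))" using e[OF x] mult_left_mono[OF a[OF x], of x] x by linarith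
     also have "... <= x * (M * 1)" using x M0 by (intro mult_left_mono) auto
     finally show "norm (- (cos (x * l) * e x)) <= x * M" by simp
    qed
   qed
   show "((%x. - (cos (x * l) * e x)) \<longlongrightarrow> 0) at_top"
   proof (rule Lim_null_comparison)
    show "((%x. 2 * M * exp (- (x / 2))) \<longlongrightarrow> 0) at_top" by real_asymp
    show "\<forall>\<^sub>F x in at_top. norm (- (cos (x * l) * e x)) <= 2 * M * exp (- (x / 2))"
     using eventually_gt_at_top[of 0]
    proof eventually_elim
     case (elim x)
     have "\<bar>cos (x * l) * e x\<bar> <= \<bar>e x\<bar>" by (simp add: abs_mult mult_left_le_one_le)
     then show ?case using eb[OF elim] by simp
    qed
   qed
  qed measurable
  then show ?thesis using J1 J2 by simp
 qed
 have W: "(NN x. ennreal ((q x)^2)) + (NN x. ennreal ((r x)^2)) <= wW a"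
  if "!!x. 0 < x ==> \<bar>q x\<bar> <= x * a x" "!!x. 0 < x ==> \<bar>r x\<bar> <= a x" and [measurable]: "q \<in> BM" "r \<in> BM" for q r
 proof -
  have "(NN x. ennreal ((q x)^2)) + (NN x. ennreal ((r x)^2)) = (NN x. ennreal ((q x)^2) + ennreal ((r x)^2))"
   by (rule nn_integral_add[symmetric]) measurable
  also have "... <= wW a" unfolding wW_def
  proof (rule nn_integral_hl_mono)
   fix x :: real assume x: "0 < x"
   have "(q x)^2 <= (x * a x)^2" using power_mono[OF that(1)[OF x], of 2] by simp
   moreover have "(r x)^2 <= (a x)^2" using power_mono[OF that(2)[OF x], of 2] by simp
   moreover have "(x * a x)^2 + (a x)^2 = (x^2 + 1) * (a x)^2" by (simp add: power_mult_distrib distrib_right)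
   moreover have "(x^2 + 1) * (a x)^2 <= (1 + x) ^ 6 * (a x)^2"
   proof (rule mult_right_mono)
    have "x^2 + 1 <= (1 + x)^2" using x by (simp add: power2_sum)
    also have "... <= (1 + x) ^ 6" using x by (intro power_increasing) auto
    finally show "x^2 + 1 <= (1 + x) ^ 6" .
   qed simp
   ultimately have "(q x)^2 + (r x)^2 <= (1 + x) ^ 6 * (a x)^2" by linarith
   then show "ennreal ((q x)^2) + ennreal ((r x)^2) <= ennreal ((1 + x) ^ 6 * (a x)^2)"
    by (subst ennreal_plus[symmetric]) (simp_all add: ennreal_leI del: ennreal_plus)
  qed
  finally show ?thesis .
 qed
 have B: "(NN l. ennreal ((cS * (LI x. k (x * l) * f x))^2)) <= (NN x. ennreal ((f x)^2))"
  if k: "k = sin \<or> k = cos" and f: "integrable hl f" for k f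
 proof -
  have [measurable]: "f \<in> BM" "k \<in> BM" using borel_measurable_integrable[OF f] k by auto
  have "(NN l. ennreal ((cS * (LI x. k (x * l) * f x))^2)) = ennreal (cS^2) * (NN l. ennreal ((LI x. k (x * l) * f x)^2))"
   by (subst nn_integral_cmult[symmetric]) (auto intro!: nn_integral_cong simp: power_mult_distrib ennreal_mult)
  also have "... <= ennreal (cS^2) * (ennreal (pi / 2) * (NN x. ennreal ((f x)^2)))"
   by (intro mult_left_mono Bessel k f) simp
  also have "... = (NN x. ennreal ((f x)^2))" by (simp add: cS_sq mult.assoc[symmetric] ennreal_mult[symmetric])
  finally show ?thesis .
 qed
 show "ns (sine_tr e) <= wW a"
 proof -
  have "ns (sine_tr e) <= (NN l. ennreal ((cS * (LI x. sin (x * l) * e x))^2) + ennreal ((cS * (LI x. cos (x * l) * e' x))^2))"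
   unfolding ns_def
  proof (rule nn_integral_hl_mono)
   fix l :: real assume l: "0 < l"
   define y where "y = cS * (LI x. sin (x * l) * e x)"
   have "l <= 1 + l^2"
   proof (cases "l <= 1")
    case False
    then have "1 * l <= l * l" by (intro mult_right_mono) auto
    then show ?thesis by (simp add: power2_eq_square)
   qed (simp add: add_increasing2)
   from mult_right_mono[OF this, of "y^2"] have "l * y^2 <= y^2 + (l * y)^2" by (simp add: power_mult_distrib distrib_right)
   moreover have "l * y = cS * (LI x. cos (x * l) * e' x)" unfolding parts[symmetric] y_def by simp
   ultimately have "ennreal (l * y^2) <= ennreal (y^2 + (cS * (LI x. cos (x * l) * e' x))^2)" by (intro ennreal_leI) simp
   then show "ennreal (l * (sine_tr e l)^2) <= ennreal ((cS * (LI x. sin (x * l) * e x))^2) + ennreal ((cS * (LI x. cos (x * l) * e' x))^2)"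
    by (simp add: y_def sine_tr_def)
  qed
  also have "... = (NN l. ennreal ((cS * (LI x. sin (x * l) * e x))^2)) + (NN l. ennreal ((cS * (LI x. cos (x * l) * e' x))^2))"
   by (rule nn_integral_add) measurable
  also have "... <= (NN x. ennreal ((e x)^2)) + (NN x. ennreal ((e' x)^2))" by (intro add_mono B I I') auto
  also have "... <= wW a" by (rule W) (use e e' in auto)
  finally show ?thesis .
 qed
 show "nm (sine_tr e) <= 2 * wW a"
 proof (cases "wW a")
  case (real w)
  define d where "d x = x / (1 + x)^2" for x :: real
  have "E4 d <= (NN x. ennreal ((1 / (1 + x))^2))" unfolding E4_def
  proof (intro nn_integral_hl_mono ennreal_leI)
   fix x :: real assume x: "0 < x"
   have "(d x) ^ 4 / x = x ^ 3 / ((1 + x)^2) ^ 4" using x by (simp add: d_def power_divide power4_eq_xxxx power3_eq_cube)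
   also have "... <= (1 + x) ^ 3 / ((1 + x)^2) ^ 4" using x by (intro divide_right_mono power_mono) auto
   also have "... <= (1 + x) ^ 6 / ((1 + x)^2) ^ 4" using x by (intro divide_right_mono power_increasing) auto
   also have "... = (1 / (1 + x))^2"
   proof -
    have "((1 + x)^2) ^ 4 = (1 + x) ^ 6 * (1 + x)^2" by (simp flip: power_mult power_add)
    note e = this
    have "(1 + x) ^ 6 \<noteq> 0" using x by simp
    then show ?thesis unfolding e power_divide power_one by (rule nonzero_divide_mult_cancel_left)
   qed
   finally show "(d x) ^ 4 / x <= (1 / (1 + x))^2" .
  qed
  also have "... <= ennreal (1 ^ 4)" using nn_integral_inverse_square by simp
  finally have Ed: "E4 d <= ennreal (1 ^ 4)" .
  have "nm (sine_tr e) <= ennreal (2 * (sqrt w * 1)^2)"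
  proof (rule sine_tr_master(3)[where p="%x. a x * (1 + x)^2" and d=d, OF _ _ _ _ _ _ _ Ed])
   show "\<bar>e x\<bar> <= a x * (1 + x)^2 * \<bar>d x\<bar>" if "0 < x" for x using e[OF that] that by (simp add: d_def mult.commute)
   show "0 <= a x * (1 + x)^2" if "0 < x" for x using a0[OF that] by simp
   have "(NN x. ennreal ((1 + x)^2 * (a x * (1 + x)^2)^2)) = wW a" unfolding wW_def
   proof (intro nn_integral_cong arg_cong[where f=ennreal])
    fix x :: real
    have "(1 + x) ^ 6 = (1 + x)^2 * ((1 + x)^2)^2" by (simp flip: power_mult power_add)
    then show "(1 + x)^2 * (a x * (1 + x)^2)^2 = (1 + x) ^ 6 * (a x)^2" by (simp add: power_mult_distrib)
   qed
   then show "(NN x. ennreal ((1 + x)^2 * (a x * (1 + x)^2)^2)) <= ennreal ((sqrt w)^2)" using real by simp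
  qed (auto simp: d_def[abs_def] real)
  then show ?thesis using real by (simp add: ennreal_mult)
 qed (simp add: ennreal_mult_top)
qed

section \<open>Density of the test functions\<close>

text \<open>The factor \<open>t + 1\<close> stands for \<open>n * x\<close> at
  \<open>t = n * x - 1\<close>: the derivative of the inner cutoff carries a factor
  \<open>n\<close>, and it occurs multiplied by \<open>x\<close>.\<close>

lemma bump_bounds: "0 <= bump j t" "bump 0 t <= 1" "bump 2 t <= 2" "(t + 1) * bump 2 t <= 3"
proof -
 show "0 <= bump j t" by (simp add: bump_def)
 show "bump 0 t <= 1" by (simp add: bump_def)
 have s: "s * exp (- s) <= 1" "s^2 * exp (- s) <= 2" if "0 < s" for s :: real
 proof -
  have "s <= exp s" using exp_ge_add_one_self[of s] by linarith
  then have "s * exp (- s) <= exp s * exp (- s)" by (intro mult_right_mono) auto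
  then show "s * exp (- s) <= 1" by (simp flip: exp_add)
  have "1 + s + s^2 / 2 <= exp s" using exp_lower_Taylor_quadratic[of s] that by simp
  then have "s^2 <= 2 * exp s" using that by linarith
  then have "s^2 * exp (- s) <= 2 * exp s * exp (- s)" by (intro mult_right_mono) auto
  then show "s^2 * exp (- s) <= 2" by (simp add: mult.assoc flip: exp_add)
 qed
 show "bump 2 t <= 2" using s(2)[of "inverse t"] by (auto simp: bump_def)
 show "(t + 1) * bump 2 t <= 3"
 proof (cases "0 < t")
  case True
  have "(t + 1) * bump 2 t = inverse t * exp (- inverse t) + (inverse t)^2 * exp (- inverse t)"
   using True by (simp add: bump_def power2_eq_square field_simps)
  then show ?thesis using s[of "inverse t"] True by simp
 qed (simp add: bump_def)
qed

lemma bump_limits: "(bump 0 \<longlongrightarrow> 1) at_top" "(bump 2 \<longlongrightarrow> 0) at_top" "((%t. (t + 1) * bump 2 t) \<longlongrightarrow> 0) at_top"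
proof -
 have e: "\<forall>\<^sub>F t in at_top. inverse t ^ j * exp (- inverse t) = bump j t" for j
  using eventually_gt_at_top[of 0] by eventually_elim (simp add: bump_def)
 have "((%t :: real. inverse t ^ 0 * exp (- inverse t)) \<longlongrightarrow> 1) at_top" by real_asymp
 then show "(bump 0 \<longlongrightarrow> 1) at_top" by (rule Lim_transform_eventually[OF _ e])
 have "((%t :: real. inverse t ^ 2 * exp (- inverse t)) \<longlongrightarrow> 0) at_top" by real_asymp
 then show "(bump 2 \<longlongrightarrow> 0) at_top" by (rule Lim_transform_eventually[OF _ e])
 have "((%t :: real. (t + 1) * (inverse t ^ 2 * exp (- inverse t))) \<longlongrightarrow> 0) at_top" by real_asymp
 then show "((%t. (t + 1) * bump 2 t) \<longlongrightarrow> 0) at_top"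
  by (rule Lim_transform_eventually) (use e[of 2] in eventually_elim, simp)
qed

lemma bump_isCont: "isCont (bump j) t" by (rule DERIV_isCont[OF bump_deriv])

lemma bump_measurable[measurable]: "bump j \<in> BM"
 by (rule isCont_borel[OF bump_isCont])

lemma wW_le:
 assumes "!!x. 0 < x ==> \<bar>a x\<bar> <= M * exp (- x)"
 shows "0 < x ==> (1 + x) ^ 6 * (a x)^2 <= 6 ^ 6 * M^2 * exp (- x)"
  and "wW a < \<infinity>"
proof -
 show b: "(1 + x) ^ 6 * (a x)^2 <= 6 ^ 6 * M^2 * exp (- x)" if x: "0 < x" for x
 proof -
  have "(a x)^2 <= (M * exp (- x))^2" using power_mono[OF assms[OF x], of 2] by simp
  moreover have "(1 + x) ^ 6 <= 6 ^ 6 * exp x" using one_plus_power_le_exp[of x 6] x by simp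
  ultimately have "(1 + x) ^ 6 * (a x)^2 <= (6 ^ 6 * exp x) * (M * exp (- x))^2" by (intro mult_mono) auto
  also have "... = 6 ^ 6 * M^2 * (exp x * (exp (- x) * exp (- x)))" by (simp add: power_mult_distrib power2_eq_square)
  also have "exp x * (exp (- x) * exp (- x)) = exp (- x)" by (simp flip: exp_add)
  finally show ?thesis .
 qed
 have "wW a <= (NN x. ennreal (6 ^ 6 * M^2 * exp (- (1 * x))))"
  unfolding wW_def by (intro nn_integral_hl_mono ennreal_leI) (use b in simp)
 also have "... < \<infinity>"
  using integrable_exp_hl[of 1] by (subst nn_integral_eq_integral) auto
 finally show "wW a < \<infinity>" .
qed

definition gauss_sum' :: "(nat => real) => nat => real => real" where
 "gauss_sum' c N x = (\<Sum>i\<le>N. c i * (- (x / (2 * real (Suc i))) * exp (- (x^2 / (4 * real (Suc i))))))"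

lemma gauss_sum_deriv: "(gauss_sum c N has_real_derivative gauss_sum' c N x) (at x)"
proof -
 have "((%x. exp (- (x^2 / (4 * real (Suc i))))) has_real_derivative (- (x / (2 * real (Suc i))) * exp (- (x^2 / (4 * real (Suc i)))))) (at x)" for i
  by (auto intro!: derivative_eq_intros simp del: of_nat_Suc)
 then show ?thesis unfolding gauss_sum_def[abs_def] gauss_sum'_def by (rule DERIV_sum[OF DERIV_cmult])
qed

lemma gauss_sum'_isCont: "isCont (gauss_sum' c N) x"
 unfolding gauss_sum'_def[abs_def] by (intro continuous_intros) (auto simp del: of_nat_Suc)

lemma gauss_sum_bound:
 obtains M where "!!x. 0 < x ==> (1 + x) * (\<bar>gauss_sum c N x\<bar> + \<bar>gauss_sum c N x + x * gauss_sum' c N x\<bar>) <= M * exp (- x)" "0 <= M"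
proof
 define B where "B i = 3 * \<bar>c i\<bar> * (27 * exp (1 / (1 / (4 * real (Suc i)))))" for i
 show "0 <= (\<Sum>i\<le>N. B i)" by (auto simp: B_def intro!: sum_nonneg)
 fix x :: real assume x: "0 < x"
 let ?e = "%i. exp (- (x^2 / (4 * real (Suc i))))"
 have 1: "\<bar>gauss_sum c N x\<bar> <= (\<Sum>i\<le>N. \<bar>c i\<bar> * ?e i)"
  unfolding gauss_sum_def by (rule order_trans[OF sum_abs]) (simp add: abs_mult)
 have "\<bar>gauss_sum' c N x\<bar> <= (\<Sum>i\<le>N. \<bar>c i\<bar> * (x * ?e i))"
  unfolding gauss_sum'_def
 proof (rule order_trans[OF sum_abs], rule sum_mono)
  fix i
  have "x / (2 * real (Suc i)) <= x" using x by (simp add: field_simps)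
  then have "x / (2 * real (Suc i)) * ?e i <= x * ?e i" by (intro mult_right_mono) auto
  then have "\<bar>c i\<bar> * (x / (2 * real (Suc i)) * ?e i) <= \<bar>c i\<bar> * (x * ?e i)" by (intro mult_left_mono) auto
  then show "\<bar>c i * (- (x / (2 * real (Suc i))) * ?e i)\<bar> <= \<bar>c i\<bar> * (x * ?e i)" using x by (simp add: abs_mult)
 qed
 then have "x * \<bar>gauss_sum' c N x\<bar> <= x * (\<Sum>i\<le>N. \<bar>c i\<bar> * (x * ?e i))" using x by (intro mult_left_mono) auto
 then have 2: "\<bar>x * gauss_sum' c N x\<bar> <= (\<Sum>i\<le>N. \<bar>c i\<bar> * (x^2 * ?e i))"
  using x by (simp add: abs_mult sum_distrib_left power2_eq_square mult_ac)
 have "(1 + x) * (\<bar>gauss_sum c N x\<bar> + \<bar>gauss_sum c N x + x * gauss_sum' c N x\<bar>)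
   \<le> (1 + x) * (2 * (\<Sum>i\<le>N. \<bar>c i\<bar> * ?e i) + (\<Sum>i\<le>N. \<bar>c i\<bar> * (x^2 * ?e i)))"
  using 1 2 x by (intro mult_left_mono) auto
 also have "... = (\<Sum>i\<le>N. \<bar>c i\<bar> * (((1 + x) * (2 + x^2)) * ?e i))"
  by (simp add: sum_distrib_left sum.distrib[symmetric] algebra_simps)
 also have "... <= (\<Sum>i\<le>N. B i * exp (- x))"
 proof (rule sum_mono)
  fix i
  have "(1 + x) * (2 + x^2) <= 3 * (1 + x) ^ 3"
  proof -
   have "2 + x^2 <= 3 * (1 + x)^2" using x by (simp add: power2_sum)
   then have "(1 + x) * (2 + x^2) <= (1 + x) * (3 * (1 + x)^2)" using x by (intro mult_left_mono) auto
   then show ?thesis by (simp add: power3_eq_cube power2_eq_square mult_ac)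
  qed
  then have "(1 + x) * (2 + x^2) * ?e i <= 3 * (1 + x) ^ 3 * ?e i" by (intro mult_right_mono) auto
  also have "... <= 3 * (27 * exp (1 / (1 / (4 * real (Suc i)))) * exp (- x))"
   using gauss_le_exp[of "1 / (4 * real (Suc i))" x] x by (simp add: mult_ac)
  finally have "\<bar>c i\<bar> * ((1 + x) * (2 + x^2) * ?e i) <= \<bar>c i\<bar> * (3 * (27 * exp (1 / (1 / (4 * real (Suc i)))) * exp (- x)))"
   by (intro mult_left_mono) auto
  then show "\<bar>c i\<bar> * ((1 + x) * (2 + x^2) * ?e i) <= B i * exp (- x)" by (simp add: B_def mult_ac)
 qed
 finally show "(1 + x) * (\<bar>gauss_sum c N x\<bar> + \<bar>gauss_sum c N x + x * gauss_sum' c N x\<bar>) <= (\<Sum>i\<le>N. B i) * exp (- x)"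
  by (simp add: sum_distrib_right)
qed

text \<open>The error is \<open>x * G x * (X n x - 1)\<close>. Its quotient by \<open>x\<close> and
  its derivative are bounded by an exponentially decaying majorant \<open>A\<close> times
  \<open>k n x\<close>, which is bounded and tends to 0 pointwise, so \<open>wW\<close> tends to 0
  by dominated convergence. The factor \<open>x\<close> compensates the factor \<open>n\<close> in
  the derivative of the inner cutoff.\<close>

theorem cut_test_converges:
 defines "V \<equiv> %c N x. x * gauss_sum c N x"
 shows "integrable hl (V c N)" "ns (sine_tr (V c N)) < \<infinity>" "nm (sine_tr (V c N)) < \<infinity>"
  "(%n. ns (%l. FD (cut_test c N (Suc n)) l - sine_tr (V c N) l)) ----> 0"
  "(%n. nm (%l. FD (cut_test c N (Suc n)) l - sine_tr (V c N) l)) ----> 0"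
proof -
 obtain M where M: "!!x. 0 < x ==> (1 + x) * (\<bar>gauss_sum c N x\<bar> + \<bar>gauss_sum c N x + x * gauss_sum' c N x\<bar>) <= M * exp (- x)" "0 <= M"
  using gauss_sum_bound by blast
 define G where "G = gauss_sum c N"
 define V' where "V' x = G x + x * gauss_sum' c N x" for x
 define A where "A x = (1 + x) * (\<bar>G x\<bar> + \<bar>V' x\<bar>)" for x
 have AM: "A x <= M * exp (- x)" if "0 < x" for x using M(1)[OF that] by (simp add: A_def G_def V'_def)
 have A0: "0 <= A x" if "0 < x" for x using that by (simp add: A_def)
 have GA: "\<bar>G x\<bar> <= A x" "\<bar>V' x\<bar> <= A x" "(1 + x) * \<bar>G x\<bar> <= A x" if "0 < x" for x
 proof -
  have "1 * (\<bar>G x\<bar> + \<bar>V' x\<bar>) <= A x" unfolding A_def using that by (intro mult_right_mono) auto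
  then show "\<bar>G x\<bar> <= A x" "\<bar>V' x\<bar> <= A x" by auto
  show "(1 + x) * \<bar>G x\<bar> <= A x" unfolding A_def using that by (intro mult_left_mono) auto
 qed
 have dG: "(G has_real_derivative gauss_sum' c N x) (at x)" for x unfolding G_def by (rule gauss_sum_deriv)
 have cG: "isCont G x" for x by (rule DERIV_isCont[OF dG])
 have [measurable]: "G \<in> BM" by (rule isCont_borel[OF cG])
 have cV': "isCont V' x" for x unfolding V'_def[abs_def] by (intro continuous_intros cG gauss_sum'_isCont)
 have [measurable]: "V' \<in> BM" by (rule isCont_borel[OF cV'])
 have [measurable]: "A \<in> BM" unfolding A_def[abs_def] by measurable
 have V: "V c N = (%x. x * G x)" by (simp add: V_def G_def)
 have dV: "((%x. x * G x) has_real_derivative V' x) (at x)" for x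
  using DERIV_mult[OF DERIV_ident dG[of x]] by (simp add: V'_def algebra_simps)
 note tn = sine_tr_test_norms[of "%x. x * G x" V' A M]
 have tn: "integrable hl (%x. x * G x)" "nm (sine_tr (%x. x * G x)) <= 2 * wW A" "ns (sine_tr (%x. x * G x)) <= wW A"
  by (rule tn; use dV cV' GA AM in "(simp add: abs_mult mult_left_mono)?")+
 have "wW A < \<infinity>" by (rule wW_le(2)[of A M]) (use A0 AM in auto)
 then have fin: "2 * wW A < \<infinity>" "wW A < \<infinity>" by (auto simp: ennreal_mult_less_top)
 show IV: "integrable hl (V c N)" unfolding V by (rule tn)
 show "ns (sine_tr (V c N)) < \<infinity>" "nm (sine_tr (V c N)) < \<infinity>" unfolding V using tn fin by (auto intro: le_less_trans)
 define X where "X n x = bump 0 (real (Suc n) * x - 1) * bump 0 (real (Suc n) - x)" for n x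
 define X' where "X' n x = real (Suc n) * bump 2 (real (Suc n) * x - 1) * bump 0 (real (Suc n) - x) - bump 0 (real (Suc n) * x - 1) * bump 2 (real (Suc n) - x)" for n x
 define k where "k n x = \<bar>X n x - 1\<bar> + (x * real (Suc n) * bump 2 (real (Suc n) * x - 1) + bump 2 (real (Suc n) - x))" for n x
 have dX: "(X n has_real_derivative X' n x) (at x)" for n x
 proof -
  have b0: "(bump 0 has_real_derivative bump 2 t) (at t)" for t using bump_deriv[of 0 t] by (simp add: numeral_2_eq_2)
  have "((%x. bump 0 (real (Suc n) * x - 1)) has_real_derivative bump 2 (real (Suc n) * x - 1) * real (Suc n)) (at x)"
   by (rule DERIV_chain2[OF b0]) (auto intro!: derivative_eq_intros)
  moreover have "((%x. bump 0 (real (Suc n) - x)) has_real_derivative bump 2 (real (Suc n) - x) * (- 1)) (at x)"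
   by (rule DERIV_chain2[OF b0]) (auto intro!: derivative_eq_intros)
  ultimately show ?thesis unfolding X_def[abs_def] X'_def by (rule DERIV_cong[OF DERIV_mult]) (simp add: algebra_simps)
 qed
 have cX: "isCont (X n) x" for n x by (rule DERIV_isCont[OF dX])
 have cc: "isCont (%x. bump j (f x)) x" if "isCont f x" for j f and x :: real by (rule isCont_o2[OF that bump_isCont])
 have cX': "isCont (X' n) x" for n x unfolding X'_def[abs_def] by (intro continuous_intros cc)
 have [measurable]: "X n \<in> BM" "X' n \<in> BM" for n by (rule isCont_borel[OF cX], rule isCont_borel[OF cX'])
 have [measurable]: "k n \<in> BM" for n unfolding k_def[abs_def] by measurable
 have X01: "0 <= X n x" "X n x <= 1" for n x using bump_bounds(1,2) by (auto simp: X_def intro!: mult_le_one mult_nonneg_nonneg)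
 have k0: "0 <= x * real (Suc n) * bump 2 (real (Suc n) * x - 1)" "0 <= bump 2 (real (Suc n) - x)" "0 <= k n x" if "0 < x" for n x
  using that bump_bounds(1) by (auto simp: k_def intro!: add_nonneg_nonneg mult_nonneg_nonneg)
 \<comment> \<open>\<open>6 = 1 + 3 + 2\<close>: the first summand of \<open>k n x\<close> is at
   most 1, the two derivative terms are at most 3 and 2.\<close>
 have k6: "k n x <= 6" for n x
  using X01[of n x] bump_bounds(3)[of "real (Suc n) - x"] bump_bounds(4)[of "real (Suc n) * x - 1"] by (simp add: k_def mult_ac abs_if)
 have kX': "\<bar>x * G x * X' n x\<bar> <= A x * (x * real (Suc n) * bump 2 (real (Suc n) * x - 1) + bump 2 (real (Suc n) - x))" if x: "0 < x" for n x
 proof -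
  let ?p = "real (Suc n) * bump 2 (real (Suc n) * x - 1)" and ?q = "bump 2 (real (Suc n) - x)"
  have "?p * bump 0 (real (Suc n) - x) <= ?p * 1" "bump 0 (real (Suc n) * x - 1) * ?q <= 1 * ?q"
   by (intro mult_left_mono mult_right_mono bump_bounds(1,2) mult_nonneg_nonneg of_nat_0_le_iff)+
  moreover have "0 <= ?p * bump 0 (real (Suc n) - x)" "0 <= bump 0 (real (Suc n) * x - 1) * ?q"
   by (intro bump_bounds(1) mult_nonneg_nonneg of_nat_0_le_iff)+
  ultimately have "\<bar>X' n x\<bar> <= ?p + ?q" unfolding X'_def by linarith
  then have "x * \<bar>G x\<bar> * \<bar>X' n x\<bar> <= x * \<bar>G x\<bar> * (?p + ?q)" using x by (intro mult_left_mono) auto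
  also have "... = \<bar>G x\<bar> * (x * ?p) + (x * \<bar>G x\<bar>) * ?q" by (simp add: algebra_simps)
  also have "... <= A x * (x * ?p) + A x * ?q"
  proof (intro add_mono mult_right_mono GA(1) x bump_bounds(1))
   have "x * \<bar>G x\<bar> <= (1 + x) * \<bar>G x\<bar>" by (intro mult_right_mono) auto
   then show "x * \<bar>G x\<bar> <= A x" using GA(3)[OF x] by linarith
  qed (use x bump_bounds(1) in auto)
  also have "... = A x * (x * real (Suc n) * bump 2 (real (Suc n) * x - 1) + ?q)" by (simp only: distrib_left mult.assoc)
  also have "x * \<bar>G x\<bar> * \<bar>X' n x\<bar> = \<bar>x * G x * X' n x\<bar>" using x by (simp add: abs_mult)
  finally show ?thesis .
 qed
 have kl: "(%n. k n x) ----> 0" if x: "0 < x" for x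
 proof -
  have f1: "filterlim (%n. real (Suc n) * x - 1) at_top sequentially" using x by real_asymp
  have f2: "filterlim (%n. real (Suc n) - x) at_top sequentially" by real_asymp
  have "(%n. \<bar>bump 0 (real (Suc n) * x - 1) * bump 0 (real (Suc n) - x) - 1\<bar> + ((real (Suc n) * x - 1 + 1) * bump 2 (real (Suc n) * x - 1) + bump 2 (real (Suc n) - x)))
    ----> \<bar>1 * 1 - 1\<bar> + (0 + 0)"
   by (intro tendsto_intros filterlim_compose[OF bump_limits(1) f1] filterlim_compose[OF bump_limits(1) f2]
     filterlim_compose[OF bump_limits(2) f2] filterlim_compose[OF bump_limits(3) f1])
  then show ?thesis by (simp add: k_def X_def mult_ac)
 qed
 have e: "nm (sine_tr (%x. x * G x * (X n x - 1))) <= 2 * wW (%x. A x * k n x)" "ns (sine_tr (%x. x * G x * (X n x - 1))) <= wW (%x. A x * k n x)" for n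
 proof -
  have 1: "\<bar>x * G x * (X n x - 1)\<bar> <= x * (A x * k n x)" if x: "0 < x" for x
  proof -
   have "\<bar>G x\<bar> * \<bar>X n x - 1\<bar> <= A x * k n x" using k0[OF x, of n] GA[OF x] A0[OF x] by (intro mult_mono) (auto simp: k_def)
   then have "x * (\<bar>G x\<bar> * \<bar>X n x - 1\<bar>) <= x * (A x * k n x)" using x by (intro mult_left_mono) auto
   then show ?thesis using x by (simp add: abs_mult mult.assoc)
  qed
  have 2: "\<bar>V' x * (X n x - 1) + x * G x * X' n x\<bar> <= A x * k n x" if x: "0 < x" for x
  proof -
   have "\<bar>V' x * (X n x - 1)\<bar> <= A x * \<bar>X n x - 1\<bar>" unfolding abs_mult using GA[OF x] by (intro mult_right_mono) auto
   then show ?thesis using kX'[OF x, of n] by (auto simp: k_def distrib_left intro!: order_trans[OF abs_triangle_ineq])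
  qed
  have 3: "A x * k n x <= (6 * M) * exp (- x)" if x: "0 < x" for x
  proof -
   have "A x * k n x <= A x * 6" using k6 A0[OF x] by (intro mult_left_mono) auto
   then show ?thesis using AM[OF x] by linarith
  qed
  have D: "DERIV (%x. x * G x * (X n x - 1)) x :> V' x * (X n x - 1) + x * G x * X' n x" for x
   using DERIV_mult[OF dV[of x] DERIV_diff[OF dX[of n x] DERIV_const[where k=1]]] by (simp add: algebra_simps)
  have C: "isCont (%x. V' x * (X n x - 1) + x * G x * X' n x) x" for x by (intro continuous_intros cV' cX cX' cG)
  have m: "(%x. x * G x * (X n x - 1)) \<in> BM" "(%x. V' x * (X n x - 1) + x * G x * X' n x) \<in> BM"
   "(%x. A x * k n x) \<in> BM" by measurable
  note t = sine_tr_test_norms(2,3)[of "%x. x * G x * (X n x - 1)" "%x. V' x * (X n x - 1) + x * G x * X' n x" "%x. A x * k n x" "6 * M", OF m D C 1 2 3]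
  show "nm (sine_tr (%x. x * G x * (X n x - 1))) <= 2 * wW (%x. A x * k n x)" by (rule t(1)) assumption+
  show "ns (sine_tr (%x. x * G x * (X n x - 1))) <= wW (%x. A x * k n x)" by (rule t(2)) assumption+
 qed
 have "(%n. wW (%x. A x * k n x)) ----> (NN x. 0)"
  unfolding wW_def
 proof (rule nn_integral_dominated_convergence[where w="%x. ennreal (6 ^ 6 * (6 * M)^2 * exp (- (1 * x)))"])
  show "(NN x. ennreal (6 ^ 6 * (6 * M)^2 * exp (- (1 * x)))) < \<infinity>"
   using integrable_exp_hl[of 1] by (subst nn_integral_eq_integral) auto
  show "AE x in hl. ennreal ((1 + x) ^ 6 * (A x * k n x)^2) <= ennreal (6 ^ 6 * (6 * M)^2 * exp (- (1 * x)))" for n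
  proof (intro AE_hlI ennreal_leI)
   fix x :: real assume x: "0 < x"
   have "\<bar>A x * k n x\<bar> <= (6 * M) * exp (- x)" if x: "0 < x" for x
   proof -
    have "A x * k n x <= A x * 6" using k6 A0[OF x] by (intro mult_left_mono) auto
    then show ?thesis using AM[OF x] A0[OF x] k0(3)[OF x, of n] by simp
   qed
   from wW_le(1)[OF this x] show "(1 + x) ^ 6 * (A x * k n x)^2 <= 6 ^ 6 * (6 * M)^2 * exp (- (1 * x))" by simp
  qed
  show "AE x in hl. (%n. ennreal ((1 + x) ^ 6 * (A x * k n x)^2)) ----> 0"
  proof (rule AE_hlI)
   fix x :: real assume x: "0 < x"
   have "(%n. ennreal ((1 + x) ^ 6 * (A x * k n x)^2)) ----> ennreal ((1 + x) ^ 6 * (A x * 0)^2)"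
    by (intro tendsto_intros kl x)
   then show "(%n. ennreal ((1 + x) ^ 6 * (A x * k n x)^2)) ----> 0" by simp
  qed
 qed measurable
 then have lim: "(%n. wW (%x. A x * k n x)) ----> 0" by simp
 have eq: "(%l. FD (cut_test c N (Suc n)) l - sine_tr (V c N) l) = sine_tr (%x. x * G x * (X n x - 1))" for n
 proof
  fix l
  have t: "cut_test c N (Suc n) \<in> radial_test" by (rule cut_test_radial) simp
  note p = radial_test_phys[OF t]
  have [measurable]: "phys (cut_test c N (Suc n)) \<in> BM" by (rule p)
  have "FD (cut_test c N (Suc n)) l - sine_tr (V c N) l = sine_tr (%x. phys (cut_test c N (Suc n)) x - V c N x) l"
   unfolding p(7) by (rule sine_tr_diff_integrable[symmetric]) (use p IV in auto)
  also have "sine_tr (%x. phys (cut_test c N (Suc n)) x - V c N x) = sine_tr (%x. x * G x * (X n x - 1))"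
  proof (rule sine_tr_cong_AE)
   show "AE x in hl. phys (cut_test c N (Suc n)) x - V c N x = x * G x * (X n x - 1)"
   proof (rule AE_hlI)
    fix x :: real assume x: "0 < x"
    have "(1 + x) * (1 - inverse (1 + x)) = x" using x by (simp add: field_simps)
    then have y: "(1 + x) * ((1 - inverse (1 + x)) * y) = x * y" for y by (metis mult.assoc)
    have "phys (cut_test c N (Suc n)) x = (1 + x) * ((1 - inverse (1 + x)) * (G x * X n x))"
     using x by (simp add: phys_def cut_test_def G_def X_def)
    then show "phys (cut_test c N (Suc n)) x - V c N x = x * G x * (X n x - 1)"
     unfolding y V by (simp add: algebra_simps)
   qed
  qed (unfold V, measurable)
  finally show "FD (cut_test c N (Suc n)) l - sine_tr (V c N) l = sine_tr (%x. x * G x * (X n x - 1)) l" .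
 qed
 show "(%n. ns (%l. FD (cut_test c N (Suc n)) l - sine_tr (V c N) l)) ----> 0"
  unfolding eq by (rule ennreal_tendsto_0_squeeze[OF lim, where c=1]) (use e in auto)
 show "(%n. nm (%l. FD (cut_test c N (Suc n)) l - sine_tr (V c N) l)) ----> 0"
  unfolding eq by (rule ennreal_tendsto_0_squeeze[OF lim, where c=2]) (use e in auto)
qed

text \<open>Each Gaussian is mapped to a positive multiple of
  \<open>l * exp (- (l^2)) ^ Suc i\<close>, so every choice of coefficients \<open>d\<close> on the
  frequency side is reached by dividing these multiples out.\<close>

lemma sine_tr_gauss_sum:
 "\<exists>c. \<forall>l. sine_tr (%x. x * gauss_sum c N x) l = l * (\<Sum>i\<le>N. d i * exp (- l\<^sup>2) ^ Suc i)"
proof -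
 have "\<forall>i. \<exists>K>0. \<forall>l. (LI x. sin (x * l) * (x * exp (- (1 / (4 * real (Suc i)) * x^2)))) = K * (l * exp (- (l^2 / (4 * (1 / (4 * real (Suc i)))))))"
  by (intro allI gauss_sine) simp
 from choice[OF this] obtain K where K0: "!!i. 0 < K i" and K: "!!i l. (LI x. sin (x * l) * (x * exp (- (1 / (4 * real (Suc i)) * x^2)))) = K i * (l * exp (- (l^2 / (4 * (1 / (4 * real (Suc i)))))))"
  by blast
 define c where "c i = d i / (cS * K i)" for i
 have I: "integrable hl (%x. sin (x * l) * x * exp (- (1 / (4 * real (Suc i)) * x^2)))" for i l
 proof (rule integrable_gauss[where C=1])
  fix x :: real assume x: "0 < x"
  have "\<bar>sin (x * l) * x\<bar> <= 1 * x" unfolding abs_mult using x by (intro mult_mono) auto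
  also have "... <= (1 + x) ^ 1" by simp
  also have "... <= 1 * (1 + x) ^ 3" using x by (simp only: mult_1) (rule power_increasing, auto)
  finally show "\<bar>sin (x * l) * x\<bar> <= 1 * (1 + x) ^ 3" by simp
 qed auto
 have "sine_tr (%x. x * gauss_sum c N x) l = l * (\<Sum>i\<le>N. d i * exp (- l\<^sup>2) ^ Suc i)" for l
 proof -
  have "(LI x. sin (x * l) * (x * gauss_sum c N x)) = (LI x. (\<Sum>i\<le>N. c i * (sin (x * l) * x * exp (- (1 / (4 * real (Suc i)) * x^2)))))"
   by (rule Bochner_Integration.integral_cong) (auto simp: gauss_sum_def sum_distrib_left mult_ac simp del: of_nat_Suc)
  also have "... = (\<Sum>i\<le>N. c i * (LI x. sin (x * l) * x * exp (- (1 / (4 * real (Suc i)) * x^2))))"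
   using I by (simp add: Bochner_Integration.integral_sum del: of_nat_Suc)
  also have "... = (\<Sum>i\<le>N. c i * (K i * (l * exp (- l\<^sup>2) ^ Suc i)))"
  proof (rule sum.cong[OF refl])
   fix i
   have "l^2 / (4 * (1 / (4 * real (Suc i)))) = real (Suc i) * l^2" by (simp del: of_nat_Suc)
   then have "exp (- (l^2 / (4 * (1 / (4 * real (Suc i)))))) = exp (- l\<^sup>2) ^ Suc i"
    using exp_of_nat_mult[of "Suc i" "- l\<^sup>2"] by (simp only: mult_minus_right)
   then show "c i * (LI x. sin (x * l) * x * exp (- (1 / (4 * real (Suc i)) * x^2))) = c i * (K i * (l * exp (- l\<^sup>2) ^ Suc i))"
    using K[of l i] by (simp only: mult.assoc)
  qed
  finally have "sine_tr (%x. x * gauss_sum c N x) l = (\<Sum>i\<le>N. cS * (c i * (K i * (l * exp (- l\<^sup>2) ^ Suc i))))"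
   by (simp add: sine_tr_def sum_distrib_left)
  also have "... = (\<Sum>i\<le>N. l * (d i * exp (- l\<^sup>2) ^ Suc i))"
  proof (rule sum.cong[OF refl])
   fix i
   have d: "d i = cS * K i * c i" using K0[of i] cS_pos by (simp add: c_def)
   show "cS * (c i * (K i * (l * exp (- l\<^sup>2) ^ Suc i))) = l * (d i * exp (- l\<^sup>2) ^ Suc i)" unfolding d by (simp only: mult_ac)
  qed
  finally show ?thesis by (simp add: sum_distrib_left)
 qed
 then show ?thesis by blast
qed

section \<open>Approximation in the weighted frequency spaces\<close>

definition apx :: "(real => real) => (real => real) => bool" where
 "apx w g \<longleftrightarrow> g \<in> BM \<and>
   (\<forall>e>0. \<exists>phi\<in>radial_test. wsq w (FD phi) < \<infinity> \<and> wsq w (%l. FD phi l - g l) <= ennreal e)"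

lemma FD_test_measurable: "phi \<in> radial_test ==> FD phi \<in> BM"
 using radial_test_phys(2,7) sine_tr_measurable by metis

context weight
begin

lemma apx_limit:
 assumes g: "g \<in> BM" and h: "!!e. 0 < e ==> \<exists>h. apx w h \<and> wsq w (%l. h l - g l) <= ennreal e"
 shows "apx w g"
 unfolding apx_def
proof (intro conjI allI impI g)
 fix e :: real assume e: "0 < e"
 obtain h where h: "apx w h" "wsq w (%l. h l - g l) <= ennreal (e / 4)" using h[of "e / 4"] e by auto
 obtain phi where p: "phi \<in> radial_test" "wsq w (FD phi) < \<infinity>" "wsq w (%l. FD phi l - h l) <= ennreal (e / 4)"
  using h(1) e unfolding apx_def by (meson divide_pos_pos zero_less_numeral)
 have "wsq w (%l. (FD phi l - h l) + (h l - g l)) <= 2 * (wsq w (%l. FD phi l - h l) + wsq w (%l. h l - g l))"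
  using w_meas w_pos FD_test_measurable[OF p(1)] g h(1) by (intro wsq_add_le) (auto simp: apx_def less_imp_le)
 also have "... <= 2 * (ennreal (e / 4) + ennreal (e / 4))" using p h by (intro mult_left_mono add_mono) auto
 also have "ennreal (e / 4) + ennreal (e / 4) = ennreal (e / 2)" using e by (subst ennreal_plus[symmetric]) auto
 also have "2 * ennreal (e / 2) = ennreal e" using ennreal_mult[of 2 "e / 2"] e by simp
 finally show "\<exists>phi\<in>radial_test. wsq w (FD phi) < \<infinity> \<and> wsq w (%l. FD phi l - g l) <= ennreal e" using p by auto
qed

lemma apx_sequence:
 assumes g: "g \<in> BM" and h: "!!k :: nat. apx w (h k)" "(%k. wsq w (%l. h k l - g l)) ----> 0"
 shows "apx w g"
proof (rule apx_limit[OF g])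
 fix e :: real assume "0 < e"
 then have "\<forall>\<^sub>F k in sequentially. wsq w (%l. h k l - g l) < ennreal e" using order_tendstoD(2)[OF h(2)] by simp
 then obtain k where "wsq w (%l. h k l - g l) < ennreal e" by (auto simp: eventually_sequentially)
 then show "\<exists>h. apx w h \<and> wsq w (%l. h l - g l) <= ennreal e" using h(1) by (auto intro: less_imp_le)
qed

end

text \<open>The density argument is the same for both weights. What depends on the weight is
  isolated here: the convergence of the truncated Gaussian sums and the finiteness of their
  limits.\<close>

locale test_weight = weight +
 assumes cut_conv: "!!c N. (%n. wsq w (%l. FD (cut_test c N (Suc n)) l - sine_tr (%x. x * gauss_sum c N x) l)) ----> 0"
  and cut_fin: "!!c N. wsq w (sine_tr (%x. x * gauss_sum c N x)) < \<infinity>"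
begin

lemma apx_gauss:
 shows "apx w (%l. l * (\<Sum>i\<le>N. d i * exp (- l\<^sup>2) ^ Suc i))" "wsq w (%l. l * (\<Sum>i\<le>N. d i * exp (- l\<^sup>2) ^ Suc i)) < \<infinity>"
proof -
 obtain c where c: "!!l. sine_tr (%x. x * gauss_sum c N x) l = l * (\<Sum>i\<le>N. d i * exp (- l\<^sup>2) ^ Suc i)" using sine_tr_gauss_sum by blast
 let ?g = "%l. l * (\<Sum>i\<le>N. d i * exp (- l\<^sup>2) ^ Suc i)"
 have g: "sine_tr (%x. x * gauss_sum c N x) = ?g" using c by auto
 have [measurable]: "?g \<in> BM" by measurable
 show fin: "wsq w ?g < \<infinity>" using cut_fin[of c N] unfolding g .
 show "apx w ?g" unfolding apx_def
 proof (intro conjI allI impI)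
  fix e :: real assume e: "0 < e"
  have "\<forall>\<^sub>F n in sequentially. wsq w (%l. FD (cut_test c N (Suc n)) l - ?g l) < ennreal e" using order_tendstoD(2)[OF cut_conv[of c N, unfolded g]] e by simp
  then obtain n where n: "wsq w (%l. FD (cut_test c N (Suc n)) l - ?g l) < ennreal e" by (auto simp: eventually_sequentially)
  have t: "cut_test c N (Suc n) \<in> radial_test" by (rule cut_test_radial) simp
  have "wsq w (FD (cut_test c N (Suc n))) <= 2 * (wsq w (%l. FD (cut_test c N (Suc n)) l - ?g l) + wsq w ?g)"
   by (rule wsq_split[OF FD_test_measurable[OF t]]) measurable
  also have "... < \<infinity>" using fin less_trans[OF n ennreal_less_top] by (auto simp: ennreal_mult_less_top)
  finally show "\<exists>phi\<in>radial_test. wsq w (FD phi) < \<infinity> \<and> wsq w (%l. FD phi l - ?g l) <= ennreal e" using t n by (auto intro: less_imp_le)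
 qed measurable
qed

text \<open>In the variable \<open>z = exp (- l\<^sup>2)\<close> the transforms of the Gaussian sums are \<open>l * z\<close> times the polynomials in \<open>z\<close>,
  so that the Weierstrass theorem applies.\<close>

lemma apx_continuous:
 assumes f: "continuous_on UNIV f" and a: "0 < a" and z: "!!l. l < a \<or> b < l ==> f l = 0"
 shows "apx w f"
proof (rule apx_limit)
 show fm[measurable]: "f \<in> BM" by (rule borel_measurable_continuous_onI[OF f])
 define b' where "b' = max a b + 1"
 have ab: "0 < a / 2" "a / 2 < b'" "a / 2 < a" "b < b'" using a by (auto simp: b'_def)
 \<comment> \<open>Clamping \<open>y\<close> away from 0 and 1 keeps the logarithm negative, so
   \<open>F\<close> is continuous on the whole unit interval. The ends correspond to the frequencies
   \<open>b'\<close> and \<open>a / 2\<close> outside the support of \<open>f\<close>, so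
   \<open>F\<close> vanishes wherever the clamp acts.\<close>
 define cl where "cl y = max (exp (- b'\<^sup>2)) (min (exp (- (a / 2)\<^sup>2)) y)" for y :: real
 define F where "F y = f (sqrt (- ln (cl y))) / (sqrt (- ln (cl y)) * cl y)" for y
 have "cl y <= exp (- (a / 2)\<^sup>2)" for y
 proof -
  have "(a / 2)^2 <= b'^2" using ab by (intro power_mono) auto
  then show ?thesis by (simp add: cl_def)
 qed
 moreover have cl0: "0 < cl y" for y by (simp add: cl_def less_max_iff_disj)
 ultimately have "ln (cl y) <= - (a / 2)\<^sup>2" for y by (metis ln_exp ln_le_cancel_iff exp_gt_zero)
 then have lcl: "ln (cl y) < 0" for y using ab(1) by (smt (verit) zero_less_power)
 have ccl: "continuous_on {0..1} (%y. sqrt (- ln (cl y)))"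
  using cl0 unfolding cl_def by (intro continuous_intros) (auto simp: less_imp_neq[symmetric])
 have cF: "continuous_on {0..1} F"
  unfolding F_def
 proof (intro continuous_on_divide continuous_on_mult ccl continuous_on_compose2[OF f ccl])
  show "continuous_on {0..1} cl" unfolding cl_def by (intro continuous_intros)
  show "\<forall>y\<in>{0..1}. sqrt (- ln (cl y)) * cl y \<noteq> 0" using cl0 lcl by (metis mult_eq_0_iff real_sqrt_eq_zero_cancel_iff neg_equal_0_iff_equal less_irrefl)
 qed auto
 have Fl: "f l = l * exp (- l\<^sup>2) * F (exp (- l\<^sup>2))" if l: "0 < l" for l
 proof -
  consider "l < a / 2" | "b' < l" | "a / 2 <= l" "l <= b'" by linarith
  then show ?thesis
  proof cases
   case 1
   then have "(l)^2 <= (a / 2)^2" using l by (intro power_mono) auto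
   moreover have "(a / 2)^2 <= b'^2" using ab by (intro power_mono) auto
   ultimately have "cl (exp (- l\<^sup>2)) = exp (- (a / 2)\<^sup>2)" by (simp add: cl_def)
   then have "F (exp (- l\<^sup>2)) = 0" using ab z[of "a / 2"] by (simp add: F_def real_sqrt_divide)
   moreover have "f l = 0" using 1 ab by (intro z) auto
   ultimately show ?thesis by simp
  next
   case 2
   then have "b'^2 <= l^2" using ab by (intro power_mono) auto
   then have "cl (exp (- l\<^sup>2)) = exp (- b'\<^sup>2)" by (auto simp: cl_def intro!: max_absorb1 min.coboundedI2)
   then have "F (exp (- l\<^sup>2)) = 0" using ab z[of b'] by (simp add: F_def)
   moreover have "f l = 0" using 2 ab by (intro z) auto
   ultimately show ?thesis by simp
  next
   case 3
   then have "(a / 2)^2 <= l^2" "l^2 <= b'^2" using ab l by (intro power_mono; simp)+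
   then have "cl (exp (- l\<^sup>2)) = exp (- l\<^sup>2)" by (simp add: cl_def)
   then show ?thesis using l by (simp add: F_def)
  qed
 qed
 let ?q = "%l :: real. l * exp (- l\<^sup>2)"
 have [measurable]: "?q \<in> BM" by measurable
 have q: "wsq w ?q < \<infinity>" using apx_gauss(2)[of "%_. 1" 0] by simp
 then obtain Q where Q: "0 <= Q" "wsq w ?q = ennreal Q" by (cases "wsq w ?q") auto
 fix e :: real assume e: "0 < e"
 define \<delta> where "\<delta> = sqrt (e / (Q + 1))"
 have d: "0 < \<delta>" "\<delta>^2 * Q <= e" using e Q by (auto simp: \<delta>_def field_simps)
 obtain p where p: "real_polynomial_function p" "!!y. y \<in> {0..1} ==> \<bar>F y - p y\<bar> < \<delta>"
  using Stone_Weierstrass_real_polynomial_function[OF compact_Icc cF d(1)] by metis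
 obtain d N where dN: "p = (%x. \<Sum>i\<le>N. d i * x ^ i)" using p(1) unfolding real_polynomial_function_iff_sum by blast
 let ?h = "%l :: real. l * (\<Sum>i\<le>N. d i * exp (- l\<^sup>2) ^ Suc i)"
 have h: "?h l = l * exp (- l\<^sup>2) * p (exp (- l\<^sup>2))" for l by (simp add: dN sum_distrib_left mult_ac)
 have "wsq w (%l. ?h l - f l) <= ennreal (\<delta>^2) * wsq w ?q"
 proof (rule wsq_mult_le)
  fix l :: real assume l: "0 < l"
  have "\<bar>?h l - f l\<bar> = (l * exp (- l\<^sup>2)) * \<bar>F (exp (- l\<^sup>2)) - p (exp (- l\<^sup>2))\<bar>"
   unfolding h Fl[OF l] using l by (simp add: right_diff_distrib[symmetric] abs_mult abs_minus_commute)
  also have "... <= (l * exp (- l\<^sup>2)) * \<delta>" using p(2)[of "exp (- l\<^sup>2)"] l by (intro mult_left_mono) (auto simp: less_imp_le)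
  finally show "\<bar>?h l - f l\<bar> <= \<delta> * \<bar>l * exp (- l\<^sup>2)\<bar>" using l by (simp add: mult.commute)
 qed (use w_meas w_pos in "auto simp: less_imp_le")
 also have "... <= ennreal e" using d Q by (simp add: ennreal_mult[symmetric] ennreal_leI)
 finally show "\<exists>h. apx w h \<and> wsq w (%l. h l - f l) <= ennreal e" using apx_gauss(1) by blast
qed

text \<open>Measurability gives continuous functions converging to \<open>f\<close> almost
  everywhere. Clamping them to \<open>{- C..C}\<close> and multiplying by a continuous cutoff
  \<open>X\<close> that is 1 where \<open>f\<close> may differ from 0 keeps continuity and limit,
  and supplies the domination for convergence in the weighted norm.\<close>

lemma apx_bounded:
 assumes [measurable]: "f \<in> BM" and C: "!!l. \<bar>f l\<bar> <= C" and k: "0 < k" and z: "!!l. l < 1 / k \<or> k < l ==> f l = 0"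
 shows "apx w f"
proof -
 have "f \<in> borel_measurable (lebesgue_on UNIV)" by (simp add: lebesgue_on_UNIV_eq measurable_completion)
 then have "f measurable_on UNIV" by (simp add: measurable_on_iff_borel_measurable)
 then obtain N g where N: "negligible N" and g: "!!n. continuous_on UNIV (g n)" and lim: "!!x. x \<notin> N ==> (%n. g n x) ----> f x"
  unfolding measurable_on_def by auto
 have "AE x in lebesgue. x \<notin> N" using N by (intro AE_not_in) (simp add: negligible_iff_null_sets)
 then have "AE x in lborel. x \<notin> N" by (simp add: AE_completion_iff)
 then obtain N' where N': "N \<subseteq> N'" "N' \<in> null_sets lborel" by (auto elim!: AE_E simp: null_sets_def)
 then have [measurable]: "N' \<in> sets borel" and AEN: "AE x in hl. x \<notin> N'" using AE_not_in[OF N'(2)] by (auto simp: null_sets_def AE_hl)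
 have C0: "0 <= C" using C[of 0] by linarith
 define X where "X l = max 0 (min 1 (2 * k * l - 1)) * max 0 (min 1 (k + 1 - l))" for l :: real
 have X: "continuous_on UNIV X" unfolding X_def by (intro continuous_intros)
 have X01: "0 <= X l" "X l <= 1" for l by (auto simp: X_def intro!: mult_le_one)
 have X1: "X l * f l = f l" for l
 proof (cases "l < 1 / k \<or> k < l")
  case False
  then have "1 <= 2 * k * l - 1" "1 <= k + 1 - l" using k by (auto simp: field_simps)
  then show ?thesis by (simp add: X_def)
 qed (use z in simp)
 have X0: "X l = 0" if "l < 1 / (2 * k) \<or> k + 1 < l" for l using that k by (auto simp: X_def field_simps)
 define h where "h n l = X l * max (- C) (min C (g n l))" for n l
 have hc: "continuous_on UNIV (h n)" for n unfolding h_def by (intro continuous_intros X g)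
 have [measurable]: "h n \<in> BM" for n by (rule borel_measurable_continuous_onI[OF hc])
 have hC: "\<bar>h n l\<bar> <= C" for n l unfolding h_def abs_mult using X01[of l] C0 by (intro mult_left_le_one_le order_trans[OF mult_left_le_one_le]) auto
 define I where "I l = indicator {1 / (2 * k)..k + 1} l * (2 * C)" for l :: real
 show ?thesis
 proof (rule apx_sequence)
  show "apx w (h n)" for n
   by (rule apx_continuous[OF hc, of "1 / (2 * k)" "k + 1"]) (use X0 k in "auto simp: h_def")
  \<comment> \<open>The Borel null set \<open>N'\<close> is cut out because the dominated
    convergence rule asks for limits at every \<open>l > 0\<close>; the norm is unchanged.\<close>
  have "(%n. wsq w (%l. indicator (- N') l * (h n l - f l))) ----> 0"
  proof (rule wsq_tendsto_0_dominated[where g=I])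
   show "wsq w I < \<infinity>"
   proof -
    have q: "wsq w (%l. l * exp (- l\<^sup>2)) < \<infinity>" using apx_gauss(2)[of "%_. 1" 0] by simp
    define m where "m = 1 / (2 * k) * exp (- (k + 1)\<^sup>2)"
    have m: "0 < m" using k by (simp add: m_def)
    have "wsq w I <= ennreal ((2 * C / m)^2) * wsq w (%l. l * exp (- l\<^sup>2))"
    proof (rule wsq_mult_le)
     fix l :: real assume l: "0 < l"
     show "\<bar>I l\<bar> <= 2 * C / m * \<bar>l * exp (- l\<^sup>2)\<bar>"
     proof (cases "l \<in> {1 / (2 * k)..k + 1}")
      case True
      then have "l^2 <= (k + 1)^2" using l by (intro power_mono) auto
      then have "m <= l * exp (- l\<^sup>2)" unfolding m_def using True l by (intro mult_mono) auto
      then have "2 * C / m * m <= 2 * C / m * (l * exp (- l\<^sup>2))" using C0 m by (intro mult_left_mono) auto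
      then show ?thesis using True l m C0 by (simp add: I_def)
     qed (use l m C0 in "simp add: I_def")
    qed (use w_meas w_pos in "auto simp: less_imp_le")
    also have "... < \<infinity>" using q by (auto simp: ennreal_mult_less_top)
    finally show ?thesis .
   qed
   fix n l
   show "\<bar>indicator (- N') l * (h n l - f l)\<bar> <= \<bar>I l\<bar>"
   proof (cases "l \<in> {1 / (2 * k)..k + 1}")
    case True
    have "\<bar>indicator (- N') l * (h n l - f l)\<bar> <= \<bar>h n l - f l\<bar>" by (simp add: indicator_def)
    also have "... <= 2 * C" using hC[of n l] C[of l] by linarith
    finally show ?thesis using True by (simp add: I_def)
   next
    case False
    then have "X l = 0" by (intro X0) auto
    then show ?thesis using X1[of l] by (simp add: h_def)
   qed
  next
   fix l :: real
   show "(%n. indicator (- N') l * (h n l - f l)) ----> 0"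
   proof (cases "l \<in> N'")
    case False
    then have "(%n. X l * max (- C) (min C (g n l)) - f l) ----> X l * max (- C) (min C (f l)) - f l"
     using N' by (intro tendsto_intros lim) auto
    moreover have "max (- C) (min C (f l)) = f l" using C[of l] by linarith
    ultimately show ?thesis using False X1[of l] by (simp add: h_def)
   qed simp
  qed (unfold I_def[abs_def], measurable)
  moreover have "wsq w (%l. h n l - f l) = wsq w (%l. indicator (- N') l * (h n l - f l))" for n
   by (rule wsq_cong_AE) (use AEN in eventually_elim, simp)
  ultimately show "(%n. wsq w (%l. h n l - f l)) ----> 0" by simp
 qed measurable
qed

theorem apx_all:
 assumes g[measurable]: "g \<in> BM" and fin: "wsq w g < \<infinity>" shows "apx w g"
proof (rule apx_sequence[OF g])
 define f where "f k l = (if 1 / real (Suc k) <= l \<and> l <= real (Suc k) \<and> \<bar>g l\<bar> <= real (Suc k) then g l else 0)" for k l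
 have [measurable]: "f k \<in> BM" for k unfolding f_def[abs_def] by measurable
 show "apx w (f k)" for k
  by (rule apx_bounded[of _ "real (Suc k)" "real (Suc k)"]) (auto simp: f_def)
 show "(%k. wsq w (%l. f k l - g l)) ----> 0"
 proof (rule wsq_tendsto_0_dominated[OF _ g fin])
  fix l :: real assume l: "0 < l"
  obtain K where K: "max (1 / l) (max l \<bar>g l\<bar>) <= real K" using real_arch_simple by blast
  have "\<forall>\<^sub>F k in sequentially. f k l - g l = 0"
   using eventually_ge_at_top[of K]
  proof eventually_elim
   case (elim k)
   then have "max (1 / l) (max l \<bar>g l\<bar>) <= real (Suc k)" using K by linarith
   then show ?case using l by (simp add: f_def field_simps)
  qed
  then show "(%k. f k l - g l) ----> 0" by (rule tendsto_eventually)
 qed (auto simp: f_def)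
qed

lemma test_sequence:
 assumes g: "cutp g \<in> BM" and fin: "wsq w (cutp g) < \<infinity>"
 obtains phi where "!!n :: nat. phi n \<in> radial_test" "!!n. wsq w (cutp (FD (phi n))) < \<infinity>" "(%n. wsq w (cutp (%l. FD (phi n) l - g l))) ----> 0"
proof -
 have "\<forall>n :: nat. \<exists>phi. phi \<in> radial_test \<and> wsq w (FD phi) < \<infinity> \<and> wsq w (%l. FD phi l - cutp g l) <= ennreal (1 / real (Suc n))"
 proof
  fix n :: nat
  have "0 < 1 / real (Suc n)" by simp
  then show "\<exists>phi. phi \<in> radial_test \<and> wsq w (FD phi) < \<infinity> \<and> wsq w (%l. FD phi l - cutp g l) <= ennreal (1 / real (Suc n))"
   using apx_all[OF g fin] unfolding apx_def by blast
 qed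
 then obtain phi where p: "!!n. phi n \<in> radial_test" "!!n. wsq w (FD (phi n)) < \<infinity>" "!!n. wsq w (%l. FD (phi n) l - cutp g l) <= ennreal (1 / real (Suc n))" by metis
 have e1: "wsq w (cutp (FD (phi n))) = wsq w (FD (phi n))" for n by (rule wsq_cong_AE[OF cutp_AE])
 have e2: "wsq w (cutp (%l. FD (phi n) l - g l)) = wsq w (%l. FD (phi n) l - cutp g l)" for n
  by (rule wsq_cong_AE, rule AE_hlI) simp
 have "(%n. ennreal (1 / real (Suc n))) ----> ennreal 0" by (intro tendsto_ennrealI) real_asymp
 then have "(%n. wsq w (%l. FD (phi n) l - cutp g l)) ----> 0" using p(3) by (auto intro: ennreal_tendsto_0_squeeze[where c=1])
 then show ?thesis using that[of phi] p e1 e2 by simp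
qed

end

interpretation tl: test_weight "%l. l"
 using cut_test_converges(2,4) by unfold_locales (auto simp: ns_wsq)

interpretation ti: test_weight inverse
 using cut_test_converges(3,5) by unfold_locales (auto simp: nm_wsq)

lemmas four_pi_mult_top = four_pi_mult[unfolded infinity_ennreal_def]

lemma cutp_diff_FD_borel: "phi \<in> radial_test ==> cutp g \<in> BM ==> cutp (%l. FD phi l - g l) \<in> BM"
proof -
 assume p: "phi \<in> radial_test" and [measurable]: "cutp g \<in> BM"
 have [measurable]: "FD phi \<in> BM" by (rule FD_test_measurable[OF p])
 have "cutp (%l. FD phi l - g l) = (%l. indicator {0<..} l * FD phi l - cutp g l)" by (auto simp: cutp_def algebra_simps)
 then show ?thesis by simp
qed

lemma Hhalf_test_sequence:
 assumes g: "Hhalf (cutp g)"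
 obtains phi where "!!n :: nat. phi n \<in> radial_test" "!!n. Hdot_sq (1/2) (FD (phi n)) < \<infinity>" "(%n. Hdot_sq (1/2) (%l. FD (phi n) l - g l)) ----> 0"
proof -
 have gm: "cutp g \<in> BM" using g by (simp add: Hhalf_def)
 obtain phi where p: "!!n :: nat. phi n \<in> radial_test" "!!n. ns (cutp (FD (phi n))) < \<infinity>" "(%n. ns (cutp (%l. FD (phi n) l - g l))) ----> 0"
  using tl.test_sequence[of g] g unfolding Hhalf_def ns_wsq by blast
 show ?thesis
  using p by (intro that[of phi]) (auto simp: Hdot_sq_half cutp_borel FD_test_measurable cutp_diff_FD_borel gm four_pi_mult_top)
qed

text \<open>Density of the test functions makes the closure condition automatic, so the space is the
  whole weighted \<open>L^2\<close>.\<close>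

theorem Hdot_D_half: "g \<in> Hdot_D (1/2) \<longleftrightarrow> Hhalf (cutp g)"
proof
 assume "g \<in> Hdot_D (1/2)"
 then have "cutp g \<in> BM" "Hdot_sq (1/2) g < \<infinity>" by (auto simp: Hdot_D_def cutp_measurable_iff)
 then show "Hhalf (cutp g)" by (simp add: Hdot_sq_half four_pi_mult_top Hhalf_def)
next
 assume g: "Hhalf (cutp g)"
 obtain phi where "!!n :: nat. phi n \<in> radial_test" "!!n. Hdot_sq (1/2) (FD (phi n)) < \<infinity>" "(%n. Hdot_sq (1/2) (%l. FD (phi n) l - g l)) ----> 0"
  using Hhalf_test_sequence[OF g] by blast
 moreover have "set_borel_measurable lborel {0<..} g" "Hdot_sq (1/2) g < \<infinity>"
  using g by (auto simp: cutp_measurable_iff Hdot_sq_half Hhalf_def four_pi_mult_top)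
 ultimately show "g \<in> Hdot_D (1/2)" unfolding Hdot_D_def by blast
qed

theorem Hdot_D_minus_half: "g \<in> Hdot_D (- (1/2)) \<longleftrightarrow> Hdual (cutp g)"
proof
 assume "g \<in> Hdot_D (- (1/2))"
 then have "cutp g \<in> BM" "Hdot_sq (- (1/2)) g < \<infinity>" by (auto simp: Hdot_D_def cutp_measurable_iff)
 then show "Hdual (cutp g)" by (simp add: Hdot_sq_minus_half four_pi_mult_top Hdual_def)
next
 assume g: "Hdual (cutp g)"
 then have gm: "cutp g \<in> BM" by (simp add: Hdual_def)
 obtain phi where p: "!!n :: nat. phi n \<in> radial_test" "!!n. nm (cutp (FD (phi n))) < \<infinity>" "(%n. nm (cutp (%l. FD (phi n) l - g l))) ----> 0"
  using ti.test_sequence[of g] g unfolding Hdual_def nm_wsq by blast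
 have "\<forall>n. phi n \<in> radial_test \<and> Hdot_sq (- (1/2)) (FD (phi n)) < \<infinity>" "(%n. Hdot_sq (- (1/2)) (%l. FD (phi n) l - g l)) ----> 0"
  "Hdot_sq (- (1/2)) g < \<infinity>"
  using p g by (auto simp: Hdot_sq_minus_half cutp_borel FD_test_measurable cutp_diff_FD_borel gm four_pi_mult_top Hdual_def)
 then show "g \<in> Hdot_D (- (1/2))" unfolding Hdot_D_def using gm by (auto simp: cutp_measurable_iff)
qed

lemma represents_function_prof:
 assumes "Hhalf (cutp g)" "profile_rep v (cutp g)" shows "represents_function (1/2) g (%r. v (r - 1) / r)"
proof -
 obtain phi where "!!n :: nat. phi n \<in> radial_test" "!!n. Hdot_sq (1/2) (FD (phi n)) < \<infinity>" "(%n. Hdot_sq (1/2) (%l. FD (phi n) l - g l)) ----> 0"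
  using Hhalf_test_sequence[OF assms(1)] by blast
 then show ?thesis by (rule profile_represents_function[OF assms])
qed

section \<open>Solutions and well-posedness\<close>

lemma interval_cong:
 fixes f g :: "real => real"
 assumes "!!ta. min s t < ta ==> ta < max s t ==> f ta = g ta"
 shows "interval_lebesgue_integrable lborel (ereal s) (ereal t) f = interval_lebesgue_integrable lborel (ereal s) (ereal t) g"
  and "(LBINT ta=ereal s..ereal t. f ta) = (LBINT ta=ereal s..ereal t. g ta)"
proof -
 have e: "!!x. x \<in> einterval (min (ereal s) (ereal t)) (max (ereal s) (ereal t)) ==> f x = g x"
  using assms by (auto simp: einterval_iff min_def max_def split: if_splits)
 then show "(LBINT ta=ereal s..ereal t. f ta) = (LBINT ta=ereal s..ereal t. g ta)" by (rule interval_integral_cong)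
 show "interval_lebesgue_integrable lborel (ereal s) (ereal t) f = interval_lebesgue_integrable lborel (ereal s) (ereal t) g"
  unfolding interval_lebesgue_integrable_def set_integrable_def
  using e by (auto intro!: Bochner_Integration.integrable_cong split: split_indicator simp: min_def max_def)
qed

lemma forcing_sin_isCont:
 assumes "forcing n" shows "isCont (%ta. sin ((t - ta) * l) / l * n ta l) s"
proof -
 have "isCont (%ta. sin ((t - ta) * l) / l) s" by (cases "l = 0") (auto intro!: continuous_intros)
 then show ?thesis by (rule isCont_mult[OF _ forcing_isCont[OF assms]])
qed

lemma US_Duhamel:
 assumes n: "forcing n"
 shows "US u0 u1 n t l = cos (t * l) * u0 l + sin (t * l) / l * u1 l - (LBINT ta=ereal 0..ereal t. sin ((t - ta) * l) / l * n ta l)"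
proof -
 have "(LBINT ta=ereal 0..ereal t. sin ((t - ta) * l) / l * n ta l)
   = (LBINT ta=ereal 0..ereal t. sin (t * l) / l * (cos (ta * l) * n ta l) - cos (t * l) / l * (sin (ta * l) * n ta l))"
  by (rule interval_cong) (auto simp: left_diff_distrib sin_diff diff_divide_distrib algebra_simps)
 also have "... = sin (t * l) / l * duh cos n 0 t l - cos (t * l) / l * duh sin n 0 t l"
  unfolding duh_def
  by (subst interval_lebesgue_integral_diff(2))
   (intro interval_lebesgue_integrable_mult_right LBINT_integrable duh_isCont sin_cos_ok n, intro interval_lebesgue_integrable_mult_right LBINT_integrable duh_isCont sin_cos_ok n, simp only: interval_lebesgue_integral_mult_right)
 finally show ?thesis by (simp add: US_def algebra_simps diff_divide_distrib)
qed

lemma Hhalf_cutp: "Hhalf g ==> Hhalf (cutp g)"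
 unfolding Hhalf_def using cutp_borel ns_cong_AE[OF cutp_AE, of g] by simp

lemma Hdual_cutp: "Hdual g ==> Hdual (cutp g)"
 unfolding Hdual_def using cutp_borel nm_cong_AE[OF cutp_AE, of g] by simp

lemma Hdot_sq_borel:
 assumes "f \<in> BM"
 shows "Hdot_sq (1/2) f = ennreal (4 * pi) * ns f" "Hdot_sq (- (1/2)) f = ennreal (4 * pi) * nm f"
 using Hdot_sq_half[OF cutp_borel[OF assms]] Hdot_sq_minus_half[OF cutp_borel[OF assms]] ns_cong_AE[OF cutp_AE, of f] nm_cong_AE[OF cutp_AE, of f]
 by simp_all

lemma Hdot_sq_cutp:
 shows "Hdot_sq sg (cutp g) = Hdot_sq sg g" "Hdot_sq sg (%l. cutp f l - cutp g l) = Hdot_sq sg (%l. f l - g l)"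
  "Hdot_sq sg (%l. (cutp f l - cutp g l) / c - cutp h l) = Hdot_sq sg (%l. (f l - g l) / c - h l)"
proof -
 have c: "(\<integral>\<^sup>+l\<in>{0<..}. p l \<partial>lborel) = (\<integral>\<^sup>+l\<in>{0<..}. q l \<partial>lborel)" if "!!l :: real. 0 < l ==> p l = q l" for p q
  by (rule nn_integral_cong) (use that in "auto split: split_indicator")
 show "Hdot_sq sg (cutp g) = Hdot_sq sg g" unfolding Hdot_sq_def by (intro arg_cong2[where f="(*)"] refl c) simp
 show "Hdot_sq sg (%l. cutp f l - cutp g l) = Hdot_sq sg (%l. f l - g l)" unfolding Hdot_sq_def by (intro arg_cong2[where f="(*)"] refl c) simp
 show "Hdot_sq sg (%l. (cutp f l - cutp g l) / c - cutp h l) = Hdot_sq sg (%l. (f l - g l) / c - h l)"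
  unfolding Hdot_sq_def by (intro arg_cong2[where f="(*)"] refl c) simp
qed

lemma Hdot_sq_AE:
 assumes "AE l in hl. f l = g l" shows "Hdot_sq sg f = Hdot_sq sg g"
 unfolding Hdot_sq_def by (intro arg_cong2[where f="(*)"] refl nn_integral_cong_AE) (use assms[unfolded AE_hl] in eventually_elim, auto simp: indicator_def)

lemma cubic_force_cong:
 assumes g: "Hhalf g" and e: "AE l in hl. g l = g' l" and m: "g' \<in> BM"
 shows "cubic_force g = cubic_force g'"
proof -
 have r: "profile_rep (prof g) g" by (rule prof_rep[OF g])
 have "profile_rep (prof g) g'" by (rule profile_rep_cong[OF r e _ m]) (use r in auto)
 then show ?thesis using cubic_force_rep r by metis
qed

lemma phys_force:
 assumes f: "set_borel_measurable lborel {1..} f" and p: "profile_rep (phys f) g"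
 shows "FD (%r. f r ^ 3) = cubic_force g" "set_integrable lborel {1..} (%r. f r ^ 3 * r)"
proof -
 have fm[measurable]: "(%r. indicator {1..} r * f r) \<in> BM" using f by (simp add: set_borel_measurable_def)
 have "(%r. indicator {1..} r *\<^sub>R f r ^ 3) = (%r. (indicator {1..} r * f r) ^ 3)" by (auto simp: indicator_def)
 then have f3: "set_borel_measurable lborel {1..} (%r. f r ^ 3)" unfolding set_borel_measurable_def by simp
 have e: "phys (%r. f r ^ 3) x = cubic (phys f) x" for x
 proof (cases "0 < x")
  case True
  have "(1 + x) * y ^ 3 = ((1 + x) * y) ^ 3 / (1 + x)^2" for y
  proof -
   have "((1 + x) * y) ^ 3 = ((1 + x) * y ^ 3) * (1 + x)^2" by (simp add: power_mult_distrib power2_eq_square power3_eq_cube)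
   then show ?thesis using True by simp
  qed
  then show ?thesis using True by (simp add: phys_def cubic_def)
 qed (simp add: phys_def cubic_def)
 show "FD (%r. f r ^ 3) = cubic_force g"
 proof
  fix l
  have "phys (%r. f r ^ 3) = cubic (phys f)" by (rule ext) (rule e)
  then show "FD (%r. f r ^ 3) l = cubic_force g l" by (simp only: FD_eq_sine_tr[OF f3] cubic_force_rep[OF p])
 qed
 have [measurable]: "phys f \<in> BM" using p by measurable
 have "integrable hl (cubic (phys f))" by (rule cubic_integrable) (use profile_rep_E4_finite[OF p] in auto)
 then have i: "integrable lborel (%x. indicator {0<..} x *\<^sub>R cubic (phys f) x)" by (simp add: integrable_hl set_integrable_def)
 define F where "F r = (indicator {1..} r * f r) ^ 3 * r" for r
 have [measurable]: "F \<in> BM" unfolding F_def[abs_def] by (rule borel_measurable_times[OF borel_measurable_power[OF fm]]) simp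
 have "AE x in lborel. indicator {0<..} x *\<^sub>R cubic (phys f) x = F (1 + 1 * x)"
  using AE_lborel_singleton[of 0]
 proof eventually_elim
  case (elim x)
  show ?case
  proof (cases "0 < x")
   case True
   then have "cubic (phys f) x = (1 + x) * f (1 + x) ^ 3" using e[of x] by (simp add: phys_def)
   then show ?thesis using True by (simp add: F_def mult.commute)
  qed (use elim in "simp add: F_def indicator_def")
 qed
 then have "integrable lborel (%x. F (1 + 1 * x))" using i by (subst integrable_cong_AE[symmetric, where f="%x. indicator {0<..} x *\<^sub>R cubic (phys f) x"]) auto
 then have "integrable lborel F" using lborel_integrable_real_affine_iff[of 1 F 1] by simp
 moreover have "F = (%r. indicator {1..} r *\<^sub>R (f r ^ 3 * r))" by (auto simp: F_def indicator_def)
 ultimately show "set_integrable lborel {1..} (%r. f r ^ 3 * r)" unfolding set_integrable_def by simp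
qed

text \<open>A solution on \<open>I\<close> encoded by its forcing. \<open>n\<close> is a forcing on
  the whole time axis but has to be the cube of its own solution on \<open>I\<close> only, so
  truncated equations provide such an \<open>n\<close> directly and restriction to smaller sets is
  immediate.\<close>

definition cube_sol :: "real set => (real => real) => (real => real) => (real => real => real) => bool" where
 "cube_sol I c0 c1 n \<longleftrightarrow> Hhalf c0 \<and> Hdual c1 \<and> forcing n \<and> (\<forall>t\<in>I. n t = cubic_force (US c0 c1 n t))"

lemma between_0_in: "is_interval I ==> 0 \<in> I ==> t \<in> I ==> min 0 t < ta ==> ta < max 0 t ==> ta \<in> I" for t ta :: real
 unfolding is_interval_1 by (metis less_imp_le max_def min_def)

text \<open>The physical profile demanded by the statement is \<open>prof\<close> of the solution,
  shifted and divided by \<open>r\<close>. On \<open>I\<close> the transform of its cube is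
  \<open>n\<close>, so Duhamel's formula for \<open>US\<close> is the required one.\<close>

theorem cube_sol_nlw:
 assumes s: "cube_sol I (cutp u0) (cutp u1) n" and I: "is_interval I" "0 \<in> I"
 shows "nlw_solution (1/2) I u0 u1 (US (cutp u0) (cutp u1) n) (WS (cutp u0) (cutp u1) n)"
proof -
 let ?u = "US (cutp u0) (cutp u1) n" and ?v = "WS (cutp u0) (cutp u1) n"
 have c: "Hhalf (cutp u0)" "Hdual (cutp u1)" "forcing n" and n: "!!t. t \<in> I ==> n t = cubic_force (?u t)" using s by (auto simp: cube_sol_def)
 note P = US_paths[OF c]
 have H: "Hhalf (?u t)" "Hdual (?v t)" for t using path_Hhalf[OF P(1)] dpath_Hdual[OF P(2)] by auto
 note [measurable] = Hhalf_measurable[OF H(1)] Hdual_measurable[OF H(2)]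
 define U where "U t r = prof (cutp (?u t)) (r - 1) / r" for t r
 have R: "represents_function (1/2) (?u t) (U t)" for t
  unfolding U_def by (rule represents_function_prof[OF Hhalf_cutp[OF H(1)] prof_rep[OF Hhalf_cutp[OF H(1)]]])
 have Um: "set_borel_measurable lborel {1..} (U t)" for t using R[of t] by (simp add: represents_function_def)
 note UP = phys_force[OF Um represents_function_profile[OF R Hhalf_cutp[OF H(1)]]]
 have F: "FD (%r. U t r ^ 3) = n t" if "t \<in> I" for t
  unfolding UP(1) n[OF that] by (rule cubic_force_cong[symmetric, OF H(1) _ cutp_borel]) (auto intro: AE_hlI)
 have e: "(1/2 - 1 :: real) = - (1/2)" by simp
 show ?thesis
  unfolding nlw_solution_def e
 proof (intro conjI ballI exI[of _ U])
  fix t assume t: "t \<in> I"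
  show "?u t \<in> Hdot_D (1/2)" "?v t \<in> Hdot_D (- (1/2))" using Hdot_D_half Hdot_D_minus_half Hhalf_cutp Hdual_cutp H by auto
  show "((%ta. Hdot_sq (1/2) (%l. ?u ta l - ?u t l)) \<longlongrightarrow> 0) (at t within I)"
   unfolding tendsto_at_iff_sequentially by (auto simp: Hdot_sq_borel comp_def four_pi_mult_top intro!: path_tendsto[OF P(1)])
  show "((%ta. Hdot_sq (- (1/2)) (%l. ?v ta l - ?v t l)) \<longlongrightarrow> 0) (at t within I)"
   unfolding tendsto_at_iff_sequentially by (auto simp: Hdot_sq_borel comp_def four_pi_mult_top intro!: dpath_tendsto[OF P(2)])
  show "((%ta. Hdot_sq (- (1/2)) (%l. (?u ta l - ?u t l) / (ta - t) - ?v t l)) \<longlongrightarrow> 0) (at t within I)"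
   unfolding tendsto_at_iff_sequentially by (auto simp: Hdot_sq_borel comp_def four_pi_mult_top intro!: US_difference_quotient[OF c])
  show "represents_function (1/2) (?u t) (U t)" by (rule R)
  show "set_integrable lborel {1..} (%r. U t r ^ 3 * r)" by (rule UP(2))
  have eq: "sin ((t - ta) * l) / l * FD (%r. U ta r ^ 3) l = sin ((t - ta) * l) / l * n ta l" if "min 0 t < ta" "ta < max 0 t" for l ta
   using F[OF between_0_in[OF I t that]] by simp
  have ie: "interval_lebesgue_integrable lborel (ereal 0) (ereal t) (%ta. sin ((t - ta) * l) / l * FD (%r. U ta r ^ 3) l) = interval_lebesgue_integrable lborel (ereal 0) (ereal t) (%ta. sin ((t - ta) * l) / l * n ta l)"
   "(LBINT ta=ereal 0..ereal t. sin ((t - ta) * l) / l * FD (%r. U ta r ^ 3) l) = (LBINT ta=ereal 0..ereal t. sin ((t - ta) * l) / l * n ta l)" for l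
   by (rule interval_cong, rule eq, assumption, assumption)+
  show "AE l in lborel. 0 < l -->
      interval_lebesgue_integrable lborel (ereal 0) (ereal t) (%ta. sin ((t - ta) * l) / l * FD (%r. U ta r ^ 3) l) \<and>
      ?u t l = cos (t * l) * u0 l + sin (t * l) / l * u1 l - (LBINT ta=ereal 0..ereal t. sin ((t - ta) * l) / l * FD (%r. U ta r ^ 3) l)"
  proof (intro always_eventually allI impI conjI)
   fix l :: real assume l: "0 < l"
   show "interval_lebesgue_integrable lborel (ereal 0) (ereal t) (%ta. sin ((t - ta) * l) / l * FD (%r. U ta r ^ 3) l)"
    unfolding ie by (rule LBINT_integrable[OF forcing_sin_isCont[OF c(3)]])
   show "?u t l = cos (t * l) * u0 l + sin (t * l) / l * u1 l - (LBINT ta=ereal 0..ereal t. sin ((t - ta) * l) / l * FD (%r. U ta r ^ 3) l)"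
    unfolding ie using l by (simp add: US_Duhamel[OF c(3)])
  qed
 qed
qed

text \<open>Outside the compact interval time is frozen, which turns \<open>w\<close> into a global
  bounded path. The radial cut with a radius above its norm is invisible along it, so
  \<open>lip_map_radial_cut\<close> shows that its cube is a forcing. Duhamel's formula then
  identifies \<open>w\<close> with \<open>US\<close>, and \<open>wt\<close> with \<open>WS\<close>
  because both are limits of the same difference quotients.\<close>

theorem nlw_cube_sol:
 assumes w: "nlw_solution (1/2) I w0 w1 w wt" and H: "Hhalf (cutp w0)" "Hdual (cutp w1)" and ab: "a <= 0" "0 <= b" "a < b" "{a..b} \<subseteq> I"
 obtains n where "cube_sol {a..b} (cutp w0) (cutp w1) n"
  "!!t. t \<in> {a..b} ==> AE l in hl. w t l = US (cutp w0) (cutp w1) n t l \<and> wt t l = WS (cutp w0) (cutp w1) n t l"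
proof -
 have e12: "(1/2 - 1 :: real) = - (1/2)" by simp
 note w' = w[unfolded nlw_solution_def e12]
 have D: "!!t. t \<in> I ==> w t \<in> Hdot_D (1/2)" "!!t. t \<in> I ==> wt t \<in> Hdot_D (- (1/2))"
  and C: "!!t. t \<in> I ==> ((%ta. Hdot_sq (1/2) (%l. w ta l - w t l)) \<longlongrightarrow> 0) (at t within I)"
  and Q: "!!t. t \<in> I ==> ((%ta. Hdot_sq (- (1/2)) (%l. (w ta l - w t l) / (ta - t) - wt t l)) \<longlongrightarrow> 0) (at t within I)"
  using w' by blast+
 obtain U where U0: "\<forall>t\<in>I. represents_function (1/2) (w t) (U t) \<and> set_integrable lborel {1..} (%r. U t r ^ 3 * r)"
  "\<forall>t\<in>I. AE l in lborel. l > 0 --> interval_lebesgue_integrable lborel (ereal 0) (ereal t) (%ta. sin ((t - ta) * l) / l * FD (%r. U ta r ^ 3) l) \<and>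
   w t l = cos (t * l) * w0 l + sin (t * l) / l * w1 l - (LBINT ta=ereal 0..ereal t. sin ((t - ta) * l) / l * FD (%r. U ta r ^ 3) l)"
  using w' by (elim conjE exE) blast
 have U: "represents_function (1/2) (w t) (U t)" if "t \<in> I" for t using U0(1) that by blast
 have du: "AE l in lborel. 0 < l --> w t l = cos (t * l) * w0 l + sin (t * l) / l * w1 l
       - (LBINT ta=ereal 0..ereal t. sin ((t - ta) * l) / l * FD (%r. U ta r ^ 3) l)" if "t \<in> I" for t
  by (rule eventually_mono[OF bspec[OF U0(2) that]]) blast
 define cl where "cl ta = max a (min b ta)" for ta
 have clI: "cl ta \<in> I" for ta using ab by (auto simp: cl_def)
 have clt: "cl ta = ta" if "ta \<in> {a..b}" for ta using that by (auto simp: cl_def)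
 define W where "W ta = cutp (w (cl ta))" for ta
 have HW: "Hhalf (W ta)" for ta using D(1)[OF clI] by (simp add: W_def Hdot_D_half)
 note [measurable] = Hhalf_measurable[OF HW]
 have pW: "hpath W"
  unfolding wpath_def ns_wsq[symmetric]
 proof (intro conjI allI impI)
  show "W t \<in> BM" "ns (W t) < \<infinity>" for t using HW[of t] by (auto simp: Hhalf_def)
  fix t s assume s: "s ----> (t :: real)"
  let ?f = "%ta. Hdot_sq (1/2) (%l. w ta l - w (cl t) l)"
  have "Hdot_sq (1/2) (%l. 0) = 0" by (simp add: Hdot_sq_def)
  then have "continuous (at (cl t) within I) ?f" using C[OF clI, of t] by (simp add: continuous_within)
  then have "(%k. ?f (cl (s k))) ----> ?f (cl t)"
   by (rule continuous_within_tendsto_compose'[OF _ clI]) (use s in "auto simp: cl_def intro!: tendsto_intros")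
  moreover have "?f (cl (s k)) = ennreal (4 * pi) * ns (%l. W (s k) l - W t l)" for k
  proof -
   have "Hdot_sq (1/2) (%l. W (s k) l - W t l) = ennreal (4 * pi) * ns (%l. W (s k) l - W t l)" by (rule Hdot_sq_borel) measurable
   then show ?thesis by (simp only: W_def Hdot_sq_cutp)
  qed
  ultimately have "(%k. ennreal (4 * pi) * ns (%l. W (s k) l - W t l)) ----> 0"
   using \<open>Hdot_sq (1/2) (%l. 0) = 0\<close> by simp
  then show "(%k. ns (%l. W (s k) l - W t l)) ----> 0" by (simp add: four_pi_mult_top)
 qed
 obtain B where B: "0 <= B" "!!t. \<bar>t\<bar> <= max (- a) b ==> ns (W t) <= ennreal B" using wl.wpath_bounded[OF pW, of "max (- a) b"] unfolding ns_wsq by blast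
 define R where "R = sqrt (B + 1)"
 have R: "0 < R" "ennreal B <= ennreal (R^2)" using B by (auto simp: R_def)
 have "ns (W t) <= ennreal (R^2)" for t
 proof -
  have "cl (cl t) = cl t" using ab by (intro clt) (auto simp: cl_def)
  then have "W t = W (cl t)" by (simp add: W_def)
  moreover have "\<bar>cl t\<bar> <= max (- a) b" using ab by (auto simp: cl_def)
  ultimately show ?thesis using B(2)[of "cl t"] R by (metis order_trans)
 qed
 then have cut: "cubic_force (W t) = cubic_force (radial_cut R (W t))" for t by (simp add: radial_cut_id)
 define N where "N t = cubic_force (W t)" for t
 have fN: "forcing N" using forcing_lip_map[OF lip_map_radial_cut[OF R(1)] pW] unfolding N_def cut .
 let ?u = "US (cutp w0) (cutp w1) N" and ?v = "WS (cutp w0) (cutp w1) N"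
 have F: "FD (%r. U ta r ^ 3) = N ta" if t: "ta \<in> {a..b}" for ta
 proof -
  have tI: "ta \<in> I" using t ab by auto
  have W: "W ta = cutp (w ta)" using clt[OF t] by (simp add: W_def)
  have "set_borel_measurable lborel {1..} (U ta)" using U[OF tI] by (simp add: represents_function_def)
  from phys_force(1)[OF this represents_function_profile[OF U[OF tI]]] show ?thesis using HW[of ta] by (simp add: N_def W)
 qed
 have eU: "AE l in hl. w t l = ?u t l" if t: "t \<in> {a..b}" for t
 proof -
  have i: "ta \<in> {a..b}" if "min 0 t < ta" "ta < max 0 t" for ta using that t ab by auto
  have "(LBINT ta=ereal 0..ereal t. sin ((t - ta) * l) / l * FD (%r. U ta r ^ 3) l) = (LBINT ta=ereal 0..ereal t. sin ((t - ta) * l) / l * N ta l)" for l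
   by (rule interval_cong(2)) (simp add: F[OF i])
  note e = this
  have "t \<in> I" using t ab by auto
  from du[OF this] show ?thesis unfolding AE_hl e US_Duhamel[OF fN] by eventually_elim simp
 qed
 have HU: "Hhalf (?u t)" "Hdual (?v t)" for t using path_Hhalf[OF US_paths(1)[OF H fN]] dpath_Hdual[OF US_paths(2)[OF H fN]] by auto
 note [measurable] = Hhalf_measurable[OF HU(1)] Hdual_measurable[OF HU(2)]
 have eV: "AE l in hl. wt t l = ?v t l" if t: "t \<in> {a..b}" for t
 proof -
  have tI: "t \<in> I" using t ab by auto
  \<comment> \<open>An end of the interval other than \<open>t\<close>: the sequence moves from
    \<open>z\<close> towards \<open>t\<close>, so the difference quotients use times in the interval
    even if \<open>t\<close> is an endpoint.\<close>
  define z where "z = (if t < b then b else a)"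
  have z: "z \<in> {a..b}" "z \<noteq> t" using ab t by (auto simp: z_def)
  define s where "s k = t + (z - t) * (1 / real (Suc k))" for k
  have st: "s k \<noteq> t" "s k \<in> {a..b}" for k
  proof -
   have "0 <= 1 / real (Suc k)" "1 / real (Suc k) <= 1" by auto
   then have "(1 - 1 / real (Suc k)) *\<^sub>R t + (1 / real (Suc k)) *\<^sub>R z \<in> {a..b}" using z(1) t by (intro convexD_alt convex_real_interval) auto
   then show "s k \<in> {a..b}" by (simp only: s_def) (simp add: algebra_simps diff_divide_distrib del: of_nat_Suc atLeastAtMost_iff)
   show "s k \<noteq> t" using z by (simp add: s_def)
  qed
  have sl: "s ----> t"
  proof -
   have "(%k. 1 / real (Suc k)) ----> 0" by real_asymp
   then have "(%k. t + (z - t) * (1 / real (Suc k))) ----> t + (z - t) * 0" by (intro tendsto_intros)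
   then show ?thesis by (simp add: s_def[abs_def])
  qed
  have "Hdual (cutp (wt t))" using D(2)[OF tI] by (simp add: Hdot_D_minus_half)
  note [measurable] = Hdual_measurable[OF this]
  have "(%k. Hdot_sq (- (1/2)) (%l. (w (s k) l - w t l) / (s k - t) - wt t l)) ----> 0"
   using Q[OF tI] unfolding tendsto_at_iff_sequentially comp_def using st sl ab(4) by blast
  moreover have "Hdot_sq (- (1/2)) (%l. (w (s k) l - w t l) / (s k - t) - wt t l) = ennreal (4 * pi) * nm (%l. (?u (s k) l - ?u t l) / (s k - t) - cutp (wt t) l)" for k
  proof -
   have "Hdot_sq (- (1/2)) (%l. (w (s k) l - w t l) / (s k - t) - wt t l) = Hdot_sq (- (1/2)) (%l. (?u (s k) l - ?u t l) / (s k - t) - cutp (wt t) l)"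
    by (rule Hdot_sq_AE) (use eU[OF st(2)[of k]] eU[OF t] cutp_AE[of "wt t"] in eventually_elim, simp)
   then show ?thesis by (simp add: Hdot_sq_borel)
  qed
  ultimately have 1: "(%k. nm (%l. (?u (s k) l - ?u t l) / (s k - t) - cutp (wt t) l)) ----> 0" by (simp add: four_pi_mult_top)
  have 2: "(%k. nm (%l. (?u (s k) l - ?u t l) / (s k - t) - ?v t l)) ----> 0" by (rule US_difference_quotient[OF H fN sl st(1)])
  have "nm (%l. cutp (wt t) l - ?v t l) <= 0"
  proof (rule LIMSEQ_le_const)
   show "(%k. 2 * (nm (%l. (?u (s k) l - ?u t l) / (s k - t) - ?v t l) + nm (%l. (?u (s k) l - ?u t l) / (s k - t) - cutp (wt t) l))) ----> 0"
    using ennreal_tendsto_cmult[OF _ tendsto_add[OF 2 1], of 2] by simp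
   have "nm (%l. ((?u (s k) l - ?u t l) / (s k - t) - ?v t l) - ((?u (s k) l - ?u t l) / (s k - t) - cutp (wt t) l))
     \<le> 2 * (nm (%l. (?u (s k) l - ?u t l) / (s k - t) - ?v t l) + nm (%l. (?u (s k) l - ?u t l) / (s k - t) - cutp (wt t) l))" for k
    by (rule nm_diff_le) measurable
   then show "\<exists>N. \<forall>k\<ge>N. nm (%l. cutp (wt t) l - ?v t l) <= 2 * (nm (%l. (?u (s k) l - ?u t l) / (s k - t) - ?v t l) + nm (%l. (?u (s k) l - ?u t l) / (s k - t) - cutp (wt t) l))"
    by simp
  qed
  then have "AE l in hl. cutp (wt t) l - ?v t l = 0" by (intro nm_eq_0_AE) auto
  with cutp_AE[of "wt t"] show ?thesis by eventually_elim simp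
 qed
 show ?thesis
 proof (rule that[of N])
  have "N t = cubic_force (?u t)" if t: "t \<in> {a..b}" for t
  proof -
   have Wt: "W t = cutp (w t)" using clt[OF t] by (simp add: W_def)
   have "AE l in hl. W t l = ?u t l" using eU[OF t] cutp_AE[of "w t"] unfolding Wt by eventually_elim simp
   from cubic_force_cong[OF HW this] have "cubic_force (W t) = cubic_force (?u t)" by measurable
   with N_def[of t] show ?thesis by (rule trans)
  qed
  then show "cube_sol {a..b} (cutp w0) (cutp w1) N" using H fN by (auto simp: cube_sol_def)
  show "AE l in hl. w t l = ?u t l \<and> wt t l = ?v t l" if "t \<in> {a..b}" for t using eU[OF that] eV[OF that] by eventually_elim simp
 qed
qed

section \<open>Stability, uniqueness and continuous dependence\<close>

definition stabK :: "real => real => real" where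
 "stabK L T = 4 + (8 * (L + 1) + 64 * T^2 * (L + 1)) * exp (2 * (8 * (L + 1)) * T^2)"

text \<open>The Lipschitz bound turns the energy estimate for the difference into the hypothesis of
  Gronwall's inequality with \<open>be = 8 * (L + 1)\<close>. In \<open>stabK\<close> the 4 is the
  contribution of the data, the summand \<open>8 * (L + 1)\<close> the bound on \<open>E\<close>
  itself, and \<open>64 * T^2 * (L + 1) = 8 * T^2 * be\<close> its time integral in the energy
  estimate for \<open>WS\<close>.\<close>

theorem stability:
 assumes F: "lip_map F L" and ab: "{a..b} \<subseteq> {- T..T}" "a <= 0" "0 <= b" and T: "0 < T"
  and H: "Hhalf c0" "Hdual c1" "Hhalf d0" "Hdual d1" and n: "forcing n" "forcing n'"
  and eq: "!!t. t \<in> {a..b} ==> n t = F (US c0 c1 n t)" "!!t. t \<in> {a..b} ==> n' t = F (US d0 d1 n' t)"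
  and e: "ns (%l. c0 l - d0 l) + nm (%l. c1 l - d1 l) = ennreal e" "0 <= e" and t: "t \<in> {a..b}"
 shows "ns (%l. US c0 c1 n t l - US d0 d1 n' t l) <= ennreal (stabK L T * e)" "nm (%l. WS c0 c1 n t l - WS d0 d1 n' t l) <= ennreal (stabK L T * e)"
proof -
 have L: "0 <= L" using F by (simp add: lip_map_def)
 note [measurable] = Hhalf_measurable[OF H(1)] Hhalf_measurable[OF H(3)] Hdual_measurable[OF H(2)] Hdual_measurable[OF H(4)]
 \<comment> \<open>Set to 0 off \<open>{a..b}\<close>, where the two equations are not assumed, so
   that Gronwall's inequality can run on the symmetric interval.\<close>
 define D where "D t = (if t \<in> {a..b} then ns (%l. US c0 c1 n t l - US d0 d1 n' t l) else 0)" for t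
 define E where "E t = ennreal (L + 1) * D t" for t
 have DE: "D t <= E t" for t
  using mult_right_mono[of 1 "ennreal (L + 1)" "D t"] L by (simp add: E_def)
 have B: "nm (%l. n ta l - n' ta l) <= E ta" if "min 0 t < ta" "ta < max 0 t" "t \<in> {a..b}" for t ta
 proof -
  have tau: "ta \<in> {a..b}" using that ab by auto
  have "nm (%l. n ta l - n' ta l) <= ennreal L * D ta"
   unfolding eq(1)[OF tau] eq(2)[OF tau]
   using F path_Hhalf[OF US_paths(1)[OF H(1,2) n(1)]] path_Hhalf[OF US_paths(1)[OF H(3,4) n(2)]] tau by (simp add: lip_map_def D_def)
  also have "... <= E ta" unfolding E_def using L by (intro mult_right_mono ennreal_leI) auto
  finally show ?thesis .
 qed
 note cmp = US_compare[OF _ _ _ _ n B, of c0 c1 d0 d1]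
 define be where "be = 8 * (L + 1)"
 define G where "G = exp (2 * be * T^2)"
 have b: "0 < be" using L by (simp add: be_def)
 have e4: "4 * ennreal e = ennreal (4 * e)" using e by (simp add: ennreal_mult)
 have Et: "E t <= ennreal (be * e * G)" if tT: "\<bar>t\<bar> <= T" for t
 proof -
  have "E t <= ennreal (2 * ((L + 1) * (4 * e)) * exp (2 * be * T * \<bar>t\<bar>))"
  proof (rule Gronwall[OF T b _ _ _ _ tT])
   fix t :: real assume tT: "\<bar>t\<bar> <= T"
   show "E t <= ennreal ((L + 1) * (4 * e)) + ennreal be * (ennreal \<bar>t\<bar> * (\<integral>\<^sup>+ta. E ta \<partial>seg 0 t))"
   proof (cases "t \<in> {a..b}")
    case True
    have "D t <= ennreal (4 * e) + 8 * (ennreal \<bar>t\<bar> * (\<integral>\<^sup>+ta. E ta \<partial>seg 0 t))"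
     using cmp(1)[OF _ _ _ _ _ _ True] True by (simp add: D_def e e4)
    then have "E t <= ennreal (L + 1) * (ennreal (4 * e) + 8 * (ennreal \<bar>t\<bar> * (\<integral>\<^sup>+ta. E ta \<partial>seg 0 t)))"
     unfolding E_def by (rule mult_left_mono) simp
    also have "... = ennreal ((L + 1) * (4 * e)) + (ennreal (L + 1) * 8) * (ennreal \<bar>t\<bar> * (\<integral>\<^sup>+ta. E ta \<partial>seg 0 t))"
    proof -
     have m: "ennreal ((L + 1) * (4 * e)) = ennreal (L + 1) * ennreal (4 * e)" using L e by (intro ennreal_mult) auto
     show ?thesis unfolding m by (simp only: distrib_left mult.assoc)
    qed
    also have "ennreal (L + 1) * 8 = ennreal be" using L by (simp add: be_def ennreal_mult mult.commute)
    finally show ?thesis .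
   next
    case False
    then have "E t = 0" by (simp add: E_def D_def del: atLeastAtMost_iff)
    then show ?thesis by simp
   qed
  next
   obtain C where C: "0 <= C" "!!t. \<bar>t\<bar> <= T ==> ns (US (%l. c0 l - d0 l) (%l. c1 l - d1 l) (%ta l. n ta l - n' ta l) t) <= ennreal C"
    using wl.wpath_bounded[OF US_paths(1)[OF Hhalf_diff[OF H(1,3)] Hdual_diff[OF H(2,4)] forcing_diff[OF n]], of T] unfolding ns_wsq by blast
   have Db: "D t <= ennreal C" if "\<bar>t\<bar> <= T" for t using C(2)[OF that] unfolding US_diff[OF n] by (simp add: D_def)
   \<comment> \<open>The a priori bound has to be a term that does not mention the \<open>C\<close>
     obtained inside this block; the choice operator names a bound with the same property.\<close>
   show "E t <= ennreal ((L + 1) * (SOME C. 0 <= C \<and> (\<forall>t. \<bar>t\<bar> <= T --> D t <= ennreal C)))" if "\<bar>t\<bar> <= T" for t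
    using someI[of "%C. 0 <= C \<and> (\<forall>t. \<bar>t\<bar> <= T --> D t <= ennreal C)" C] C Db that L unfolding E_def
    by (subst ennreal_mult) (auto intro!: mult_left_mono)
   show "0 <= (L + 1) * (SOME C. 0 <= C \<and> (\<forall>t. \<bar>t\<bar> <= T --> D t <= ennreal C))"
    using someI[of "%C. 0 <= C \<and> (\<forall>t. \<bar>t\<bar> <= T --> D t <= ennreal C)" C] C Db L by auto
  qed (use L e in auto)
  also have "... <= ennreal (be * e * G)"
  proof (rule ennreal_leI)
   have "T * \<bar>t\<bar> <= T * T" using tT T by (intro mult_left_mono) auto
   from mult_left_mono[OF this, of "2 * be"] have "2 * be * (T * \<bar>t\<bar>) <= 2 * be * T^2" unfolding power2_eq_square using b by simp
   then have "be * e * exp (2 * be * T * \<bar>t\<bar>) <= be * e * G" unfolding G_def using b e by (intro mult_left_mono) (auto simp: mult.assoc)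
   then show "2 * ((L + 1) * (4 * e)) * exp (2 * be * T * \<bar>t\<bar>) <= be * e * G" by (simp add: be_def mult_ac)
  qed
  finally show ?thesis .
 qed
 have tT: "\<bar>t\<bar> <= T" using t ab by auto
 have G: "1 <= G" "0 <= G" using b by (auto simp: G_def)
 have K: "stabK L T * e = 4 * e + be * e * G + 8 * (T * (be * e * G * T))" by (simp add: stabK_def be_def G_def power2_eq_square algebra_simps)
 have pos: "0 <= be * e * G" "0 <= 8 * (T * (be * e * G * T))" using b e G T by auto
 have "ns (%l. US c0 c1 n t l - US d0 d1 n' t l) <= ennreal (be * e * G)" using DE[of t] Et[OF tT] t by (simp add: D_def)
 also have "... <= ennreal (stabK L T * e)" unfolding K using pos e by (intro ennreal_leI) linarith
 finally show "ns (%l. US c0 c1 n t l - US d0 d1 n' t l) <= ennreal (stabK L T * e)" .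
 have "(\<integral>\<^sup>+ta. E ta \<partial>seg 0 t) <= (\<integral>\<^sup>+ta. ennreal (be * e * G) \<partial>seg 0 t)"
  by (intro nn_integral_mono_AE AE_seg Et) (use tT in auto)
 also have "... = ennreal (be * e * G * \<bar>t\<bar>)" using pos by (simp add: emeasure_seg ennreal_mult)
 also have "... <= ennreal (be * e * G * T)" by (intro ennreal_leI mult_left_mono tT pos)
 finally have S: "(\<integral>\<^sup>+ta. E ta \<partial>seg 0 t) <= ennreal (be * e * G * T)" .
 have "8 * (ennreal \<bar>t\<bar> * (\<integral>\<^sup>+ta. E ta \<partial>seg 0 t)) <= 8 * (ennreal T * ennreal (be * e * G * T))"
  by (intro mult_left_mono[OF mult_mono[OF ennreal_leI[OF tT] S]]) auto
 also have "... = ennreal (8 * (T * (be * e * G * T)))" using pos T by (simp add: ennreal_mult)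
 finally have "nm (%l. WS c0 c1 n t l - WS d0 d1 n' t l) <= ennreal (4 * e) + ennreal (8 * (T * (be * e * G * T)))"
  using cmp(2)[OF _ _ _ _ _ _ t] by (simp add: e e4) (meson add_left_mono order_trans)
 also have "... = ennreal (4 * e + 8 * (T * (be * e * G * T)))" using e pos by simp
 also have "... <= ennreal (stabK L T * e)" unfolding K using pos by (intro ennreal_leI) linarith
 finally show "nm (%l. WS c0 c1 n t l - WS d0 d1 n' t l) <= ennreal (stabK L T * e)" .
qed

lemma cube_sol_bounded:
 assumes s: "cube_sol I c0 c1 n" obtains B where "0 <= B" "!!t. \<bar>t\<bar> <= T ==> ns (US c0 c1 n t) <= ennreal B"
proof -
 have "hpath (US c0 c1 n)" using s by (auto simp: cube_sol_def intro: US_paths)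
 then show ?thesis using wl.wpath_bounded[of "US c0 c1 n" T] that unfolding ns_wsq by blast
qed

text \<open>With a radius that contains both solutions the cut is invisible, and
  \<open>stability\<close> with zero difference of the data gives equality.\<close>

theorem cube_sol_unique:
 assumes s: "cube_sol {a..b} c0 c1 n" and s': "cube_sol {a..b} c0 c1 n'" and ab: "a <= 0" "0 <= b" and t: "t \<in> {a..b}"
 shows "AE l in hl. US c0 c1 n t l = US c0 c1 n' t l \<and> WS c0 c1 n t l = WS c0 c1 n' t l"
proof -
 define T where "T = max (- a) b + 1"
 have T: "0 < T" "{a..b} \<subseteq> {- T..T}" using ab by (auto simp: T_def)
 obtain B B' where B: "0 <= B" "!!t. \<bar>t\<bar> <= T ==> ns (US c0 c1 n t) <= ennreal B" "0 <= B'" "!!t. \<bar>t\<bar> <= T ==> ns (US c0 c1 n' t) <= ennreal B'"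
  using cube_sol_bounded[OF s] cube_sol_bounded[OF s'] by metis
 define R where "R = sqrt (B + B' + 1)"
 have R: "0 < R" "ennreal B <= ennreal (R^2)" "ennreal B' <= ennreal (R^2)" using B(1,3) by (auto simp: R_def intro!: ennreal_leI)
 have c: "Hhalf c0" "Hdual c1" "forcing n" "forcing n'" using s s' by (auto simp: cube_sol_def)
 have eq: "n t = cubic_force (radial_cut R (US c0 c1 n t))" "n' t = cubic_force (radial_cut R (US c0 c1 n' t))" if t: "t \<in> {a..b}" for t
 proof -
  have "\<bar>t\<bar> <= T" using T t by auto
  then have "ns (US c0 c1 n t) <= ennreal (R^2)" "ns (US c0 c1 n' t) <= ennreal (R^2)" using B R by (meson order_trans)+
  then show "n t = cubic_force (radial_cut R (US c0 c1 n t))" "n' t = cubic_force (radial_cut R (US c0 c1 n' t))"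
   using s s' t by (simp_all add: cube_sol_def radial_cut_id)
 qed
 have H: "Hhalf (US c0 c1 n t)" "Hhalf (US c0 c1 n' t)" "Hdual (WS c0 c1 n t)" "Hdual (WS c0 c1 n' t)"
  using US_paths[OF c(1-3)] US_paths[OF c(1,2,4)] path_Hhalf dpath_Hdual by auto
 note [measurable] = Hhalf_measurable[OF H(1)] Hhalf_measurable[OF H(2)] Hdual_measurable[OF H(3)] Hdual_measurable[OF H(4)]
 have "ns (%l. c0 l - c0 l) + nm (%l. c1 l - c1 l) = ennreal 0" by simp
 from stability[OF lip_map_radial_cut[OF R(1)] T(2) ab T(1) c(1,2) c(1,2) c(3,4) eq this _ t]
 have z: "ns (%l. US c0 c1 n t l - US c0 c1 n' t l) = 0" "nm (%l. WS c0 c1 n t l - WS c0 c1 n' t l) = 0" by auto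
 have "AE l in hl. US c0 c1 n t l - US c0 c1 n' t l = 0" by (rule ns_eq_0_AE[OF _ z(1)]) measurable
 moreover have "AE l in hl. WS c0 c1 n t l - WS c0 c1 n' t l = 0" by (rule nm_eq_0_AE[OF _ z(2)]) measurable
 ultimately show ?thesis by eventually_elim simp
qed

lemma cube_sol_mono: "cube_sol I c0 c1 n ==> J \<subseteq> I ==> cube_sol J c0 c1 n" by (auto simp: cube_sol_def)

corollary nlw_unique:
 assumes s: "cube_sol {a<..<b} (cutp w0) (cutp w1) n" and w: "nlw_solution (1/2) {a<..<b} w0 w1 w wt" and ab: "a < 0" "0 < b" and t: "t \<in> {a<..<b}"
 shows "AE l in hl. w t l = US (cutp w0) (cutp w1) n t l \<and> wt t l = WS (cutp w0) (cutp w1) n t l"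
proof -
 \<comment> \<open>Midpoints between the ends and the smaller or larger of 0 and \<open>t\<close>: a
   compact interval inside the open one that contains both times.\<close>
 define a' b' where "a' = (a + min 0 t) / 2" and "b' = (b + max 0 t) / 2"
 have I: "a' <= 0" "0 <= b'" "a' < b'" "{a'..b'} \<subseteq> {a<..<b}" "t \<in> {a'..b'}" using ab t by (auto simp: a'_def b'_def)
 have H: "Hhalf (cutp w0)" "Hdual (cutp w1)" using s by (auto simp: cube_sol_def)
 obtain n' where n': "cube_sol {a'..b'} (cutp w0) (cutp w1) n'" "AE l in hl. w t l = US (cutp w0) (cutp w1) n' t l \<and> wt t l = WS (cutp w0) (cutp w1) n' t l"
  using nlw_cube_sol[OF w H I(1-4)] I(5) by metis
 from n'(2) cube_sol_unique[OF cube_sol_mono[OF s I(4)] n'(1) I(1,2,5)] show ?thesis by eventually_elim simp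
qed

lemma pair_norm_half:
 assumes "f \<in> BM" "g \<in> BM"
 shows "Hdot_pair_norm (1/2) f g = sqrt (4 * pi * enn2real (ns f)) + sqrt (4 * pi * enn2real (nm g))"
 using assms by (simp add: Hdot_pair_norm_def Hdot_norm_def Hdot_sq_borel enn2real_mult)

lemma Hdot_pair_norm_cong: "(!!sg. Hdot_sq sg f = Hdot_sq sg f') ==> (!!sg. Hdot_sq sg g = Hdot_sq sg g') ==> Hdot_pair_norm sg f g = Hdot_pair_norm sg f' g'"
 by (simp add: Hdot_pair_norm_def Hdot_norm_def)

text \<open>The cut equation with the new data has a global solution, close to the old one by
  \<open>stability\<close>. The radius \<open>R^2 = 2 * (1 + B)\<close> leaves room for a squared
  distance of 1, so the new solution stays in the ball on \<open>{a..b}\<close> and solves the uncut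
  equation.\<close>

theorem cube_sol_dependence:
 assumes s: "cube_sol {a..b} c0 c1 n" and ab: "a < 0" "0 < b" and \<epsilon>: "0 < \<epsilon>"
 shows "\<exists>\<delta>>0. \<forall>d0 d1. Hhalf d0 --> Hdual d1 --> Hdot_pair_norm (1/2) (%l. d0 l - c0 l) (%l. d1 l - c1 l) < \<delta> -->
  (\<exists>n'. cube_sol {a..b} d0 d1 n' \<and> (\<forall>t\<in>{a..b}. Hdot_pair_norm (1/2) (%l. US d0 d1 n' t l - US c0 c1 n t l) (%l. WS d0 d1 n' t l - WS c0 c1 n t l) < \<epsilon>))"
proof -
 define T where "T = max (- a) b"
 have T: "0 < T" "{a..b} \<subseteq> {- T..T}" using ab by (auto simp: T_def)
 obtain B where B: "0 <= B" "!!t. \<bar>t\<bar> <= T ==> ns (US c0 c1 n t) <= ennreal B" using cube_sol_bounded[OF s] by metis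
 define R where "R = sqrt (2 * (1 + B))"
 have R: "0 < R" "R^2 = 2 * (1 + B)" using B by (auto simp: R_def)
 note F = lip_map_radial_cut[OF R(1)]
 define K where "K = stabK (4 * cubeL R) T"
 have K: "0 <= K" using R by (auto simp: K_def stabK_def cubeL_def)
 \<comment> \<open>The first bound keeps the squared distance \<open>K * (p + q)\<close> at most 1,
   the second makes each of the two norms at most \<open>\<epsilon> / 4\<close>.\<close>
 define \<delta> where "\<delta> = min (1 / (K + 1)) (\<epsilon> / (16 * (K + 1)))"
 have d: "0 < \<delta>" "\<delta> <= 1 / (K + 1)" "\<delta> <= \<epsilon> / (16 * (K + 1))" using K \<epsilon> by (auto simp: \<delta>_def)
 have d': "(K + 1) * \<delta> <= 1" "16 * ((K + 1) * \<delta>) <= \<epsilon>" using d(2,3) K by (auto simp: field_simps)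
 have Kd: "(K + 1) * \<delta>^2 <= 1"
 proof -
  have "1 * \<delta> <= (K + 1) * \<delta>" using d K by (intro mult_right_mono) auto
  then have "\<delta> <= 1" using d'(1) by linarith
  then have "(K + 1) * \<delta> * \<delta> <= 1 * 1" using d d' K by (intro mult_mono) auto
  then show ?thesis by (simp add: power2_eq_square mult.assoc)
 qed
 have c: "Hhalf c0" "Hdual c1" "forcing n" using s by (auto simp: cube_sol_def)
 have cb: "ns (US c0 c1 n t) <= ennreal B" if "t \<in> {a..b}" for t using that T by (intro B) auto
 have neq: "n t = cubic_force (radial_cut R (US c0 c1 n t))" if t: "t \<in> {a..b}" for t
 proof -
  have "ennreal B <= ennreal (R^2)" using R B(1) by (intro ennreal_leI) simp
  then have "ns (US c0 c1 n t) <= ennreal (R^2)" by (rule order_trans[OF cb[OF t]])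
  then show ?thesis using s t by (simp add: cube_sol_def radial_cut_id)
 qed
 show ?thesis
 proof (intro exI[of _ \<delta>] conjI d allI impI)
  fix d0 d1 assume dd: "Hhalf d0" "Hdual d1" and small: "Hdot_pair_norm (1/2) (%l. d0 l - c0 l) (%l. d1 l - c1 l) < \<delta>"
  note [measurable] = Hhalf_measurable[OF dd(1)] Hdual_measurable[OF dd(2)] Hhalf_measurable[OF c(1)] Hdual_measurable[OF c(2)]
  obtain y where y: "hpath y" "!!t. y t = US d0 d1 (%ta. cubic_force (radial_cut R (y ta))) t"
   using mild_solution_exists[OF F dd] by blast
  define n' where "n' = (%ta. cubic_force (radial_cut R (y ta)))"
  have n': "forcing n'" unfolding n'_def by (rule forcing_lip_map[OF F y(1)])
  have yU: "y t = US d0 d1 n' t" for t unfolding n'_def by (rule y(2))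
  have eq': "n' t = cubic_force (radial_cut R (US d0 d1 n' t))" for t unfolding yU[symmetric] by (simp add: n'_def)
  define p q where "p = enn2real (ns (%l. d0 l - c0 l))" and "q = enn2real (nm (%l. d1 l - c1 l))"
  have fin: "ns (%l. d0 l - c0 l) = ennreal p" "nm (%l. d1 l - c1 l) = ennreal q" and pq: "0 <= p" "0 <= q"
   using Hhalf_diff[OF dd(1) c(1)] Hdual_diff[OF dd(2) c(2)] by (auto simp: p_def q_def Hhalf_def Hdual_def)
  have "sqrt (4 * pi * p) + sqrt (4 * pi * q) < \<delta>" using small by (subst (asm) pair_norm_half) (auto simp: p_def q_def)
  then have "sqrt (4 * pi * p) <= \<delta>" "sqrt (4 * pi * q) <= \<delta>" using pq by (smt (verit) real_sqrt_ge_zero mult_nonneg_nonneg pi_ge_zero)+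
  then have "4 * pi * p <= \<delta>^2" "4 * pi * q <= \<delta>^2" using d(1) by (metis real_sqrt_le_iff real_sqrt_unique less_imp_le)+
  moreover have "2 * p <= 4 * pi * p" "2 * q <= 4 * pi * q" using pi_ge_two pq by (intro mult_right_mono; simp)+
  ultimately have e: "p + q <= \<delta>^2" by linarith
  have "ns (%l. d0 l - c0 l) + nm (%l. d1 l - c1 l) = ennreal (p + q)" using fin pq by simp
  note st = stability[OF F T(2) less_imp_le[OF ab(1)] less_imp_le[OF ab(2)] T(1) dd c(1,2) n' c(3) eq' neq this _]
  have Ke: "K * (p + q) <= (K + 1) * \<delta>^2" "0 <= K * (p + q)" using e K pq by (auto intro!: mult_mono)
  have U: "Hhalf (US c0 c1 n t)" "Hhalf (US d0 d1 n' t)" "Hdual (WS c0 c1 n t)" "Hdual (WS d0 d1 n' t)" for t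
   using US_paths[OF c] US_paths[OF dd n'] path_Hhalf dpath_Hdual by auto
  note [measurable] = Hhalf_measurable[OF U(1)] Hhalf_measurable[OF U(2)] Hdual_measurable[OF U(3)] Hdual_measurable[OF U(4)]
  have st1: "ns (%l. US d0 d1 n' t l - US c0 c1 n t l) <= ennreal (K * (p + q))" "nm (%l. WS d0 d1 n' t l - WS c0 c1 n t l) <= ennreal (K * (p + q))" if "t \<in> {a..b}" for t
   using st that pq by (auto simp: K_def)
  show "\<exists>n'. cube_sol {a..b} d0 d1 n' \<and> (\<forall>t\<in>{a..b}. Hdot_pair_norm (1/2) (%l. US d0 d1 n' t l - US c0 c1 n t l) (%l. WS d0 d1 n' t l - WS c0 c1 n t l) < \<epsilon>)"
  proof (intro exI[of _ n'] conjI ballI)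
   have "n' t = cubic_force (US d0 d1 n' t)" if t: "t \<in> {a..b}" for t
   proof -
    have "ns (US d0 d1 n' t) <= 2 * (ns (%l. US d0 d1 n' t l - US c0 c1 n t l) + ns (US c0 c1 n t))"
     unfolding ns_wsq by (rule wl.wsq_split) auto
    also have "... <= 2 * (ennreal 1 + ennreal B)"
     using st1(1)[OF t] cb[OF t] Ke Kd by (intro mult_left_mono add_mono order_trans[OF st1(1)[OF t]] ennreal_leI) auto
    also have "... = ennreal (R^2)" using B(1) ennreal_mult[of 2 "1 + B"] unfolding R(2) by simp
    finally show ?thesis using eq' by (simp add: radial_cut_id)
   qed
   then show "cube_sol {a..b} d0 d1 n'" using dd n' by (simp add: cube_sol_def)
   fix t assume t: "t \<in> {a..b}"
   have b: "sqrt (4 * pi * enn2real x) <= 4 * ((K + 1) * \<delta>)" if "x <= ennreal (K * (p + q))" for x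
   proof (rule real_le_lsqrt)
    have "enn2real x <= K * (p + q)" using that Ke(2) by (simp add: enn2real_leI)
    then have "4 * pi * enn2real x <= 16 * ((K + 1) * \<delta>^2)" using Ke pi_less_4 by (intro order_trans[OF mult_mono[of "4 * pi" 16 _ "K * (p + q)"]]) auto
    also have "... <= 16 * ((K + 1) * ((K + 1) * \<delta>^2))" using K by (intro mult_left_mono) (auto intro!: mult_right_mono[of 1 "K + 1", simplified])
    also have "... = (4 * ((K + 1) * \<delta>))^2" by (simp add: power2_eq_square)
    finally show "4 * pi * enn2real x <= (4 * ((K + 1) * \<delta>))^2" .
   qed (use K d in auto)
   have "Hdot_pair_norm (1/2) (%l. US d0 d1 n' t l - US c0 c1 n t l) (%l. WS d0 d1 n' t l - WS c0 c1 n t l)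
     = sqrt (4 * pi * enn2real (ns (%l. US d0 d1 n' t l - US c0 c1 n t l))) + sqrt (4 * pi * enn2real (nm (%l. WS d0 d1 n' t l - WS c0 c1 n t l)))"
    by (rule pair_norm_half) measurable
   also have "... <= 4 * ((K + 1) * \<delta>) + 4 * ((K + 1) * \<delta>)" by (intro add_mono b st1 t)
   also have "... < \<epsilon>" using d'(2) d K by (smt (verit) mult_pos_pos)
   finally show "Hdot_pair_norm (1/2) (%l. US d0 d1 n' t l - US c0 c1 n t l) (%l. WS d0 d1 n' t l - WS c0 c1 n t l) < \<epsilon>" .
  qed
 qed
qed

text \<open>The data are replaced by their \<open>cutp\<close> throughout; norms, equation and
  almost everywhere equality do not distinguish a function from its cut.\<close>

theorem well_posed:
 assumes s: "cube_sol {- T<..<T} (cutp u0) (cutp u1) n" and T: "0 < T"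
 shows "well_posed_at (1/2) {- T<..<T} u0 u1"
proof -
 have e: "(1/2 - 1 :: real) = - (1/2)" by simp
 let ?u = "US (cutp u0) (cutp u1) n" and ?v = "WS (cutp u0) (cutp u1) n"
 have sol: "cube_sol {x<..<y} (cutp v0) (cutp v1) m ==> x < 0 ==> 0 < y ==>
   nlw_solution (1/2) {x<..<y} v0 v1 (US (cutp v0) (cutp v1) m) (WS (cutp v0) (cutp v1) m)" for x y v0 v1 m
  by (rule cube_sol_nlw) (auto simp: is_interval_1)
 show ?thesis
  unfolding well_posed_at_def e
 proof (rule exI[of _ ?u], rule exI[of _ ?v], intro conjI allI impI ballI)
  show "nlw_solution (1/2) {- T<..<T} u0 u1 ?u ?v" using sol[OF s] T by simp
  show "AE l in lborel. 0 < l --> w t l = ?u t l \<and> wt t l = ?v t l" if "nlw_solution (1/2) {- T<..<T} u0 u1 w wt" "t \<in> {- T<..<T}" for w wt t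
   unfolding AE_hl[symmetric] by (rule nlw_unique[OF s that(1) _ T that(2)]) (use T in simp)
  fix a b \<epsilon> :: real assume ab: "a < 0 \<and> 0 < b \<and> {a..b} \<subseteq> {- T<..<T}" and eps: "0 < \<epsilon>"
  obtain \<delta> where d: "0 < \<delta>" and D: "!!d0 d1. Hhalf d0 ==> Hdual d1 ==> Hdot_pair_norm (1/2) (%l. d0 l - cutp u0 l) (%l. d1 l - cutp u1 l) < \<delta> ==>
   (\<exists>n'. cube_sol {a..b} d0 d1 n' \<and> (\<forall>t\<in>{a..b}. Hdot_pair_norm (1/2) (%l. US d0 d1 n' t l - ?u t l) (%l. WS d0 d1 n' t l - ?v t l) < \<epsilon>))"
   using cube_sol_dependence[OF cube_sol_mono[OF s] _ _ eps, of a b] ab by blast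
  show "\<exists>\<delta>>0. \<forall>w0\<in>Hdot_D (1/2). \<forall>w1\<in>Hdot_D (- (1/2)). Hdot_pair_norm (1/2) (%l. w0 l - u0 l) (%l. w1 l - u1 l) < \<delta> -->
    (\<exists>w wt. nlw_solution (1/2) {a<..<b} w0 w1 w wt) \<and>
    (\<forall>w wt. nlw_solution (1/2) {a<..<b} w0 w1 w wt -->
     (\<forall>t\<in>{a<..<b}. Hdot_pair_norm (1/2) (%l. w t l - ?u t l) (%l. wt t l - ?v t l) < \<epsilon>))"
  proof (intro exI[of _ \<delta>] conjI d ballI impI)
   fix w0 w1 assume w: "w0 \<in> Hdot_D (1/2)" "w1 \<in> Hdot_D (- (1/2))" and small: "Hdot_pair_norm (1/2) (%l. w0 l - u0 l) (%l. w1 l - u1 l) < \<delta>"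
   have "Hdot_pair_norm (1/2) (%l. cutp w0 l - cutp u0 l) (%l. cutp w1 l - cutp u1 l) = Hdot_pair_norm (1/2) (%l. w0 l - u0 l) (%l. w1 l - u1 l)"
    by (rule Hdot_pair_norm_cong) (rule Hdot_sq_cutp)+
   then obtain n' where n': "cube_sol {a..b} (cutp w0) (cutp w1) n'"
    and close: "!!t. t \<in> {a..b} ==> Hdot_pair_norm (1/2) (%l. US (cutp w0) (cutp w1) n' t l - ?u t l) (%l. WS (cutp w0) (cutp w1) n' t l - ?v t l) < \<epsilon>"
    using D[of "cutp w0" "cutp w1"] w small by (auto simp: Hdot_D_half Hdot_D_minus_half)
   have s': "cube_sol {a<..<b} (cutp w0) (cutp w1) n'" by (rule cube_sol_mono[OF n']) auto
   show "\<exists>w wt. nlw_solution (1/2) {a<..<b} w0 w1 w wt" using sol[OF s'] ab by blast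
   show "\<forall>w wt. nlw_solution (1/2) {a<..<b} w0 w1 w wt --> (\<forall>t\<in>{a<..<b}. Hdot_pair_norm (1/2) (%l. w t l - ?u t l) (%l. wt t l - ?v t l) < \<epsilon>)"
   proof (intro allI impI ballI)
    fix w wt t assume w: "nlw_solution (1/2) {a<..<b} w0 w1 w wt" and t: "t \<in> {a<..<b}"
    have E: "AE l in hl. w t l = US (cutp w0) (cutp w1) n' t l \<and> wt t l = WS (cutp w0) (cutp w1) n' t l"
     using nlw_unique[OF s' w _ _ t] ab by blast
    have "Hdot_pair_norm (1/2) (%l. w t l - ?u t l) (%l. wt t l - ?v t l) = Hdot_pair_norm (1/2) (%l. US (cutp w0) (cutp w1) n' t l - ?u t l) (%l. WS (cutp w0) (cutp w1) n' t l - ?v t l)"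
     by (rule Hdot_pair_norm_cong) (rule Hdot_sq_AE, use E in eventually_elim, simp)+
    then show "Hdot_pair_norm (1/2) (%l. w t l - ?u t l) (%l. wt t l - ?v t l) < \<epsilon>" using close[of t] t by simp
   qed
  qed
 qed
qed

section \<open>Pointwise bounds for the Duhamel term\<close>

lemma AE_hl_pos: "AE x in hl. 0 < x" by (rule AE_hlI)

lemma integral_hl_interval:
 fixes f :: "real => real"
 assumes c: "0 <= c" and [measurable]: "f \<in> BM"
 shows "(LI x. indicator {c<..<d} x * f x) = (\<integral>x. indicator {c..d} x *\<^sub>R f x \<partial>lborel)"
proof -
 have "(LI x. indicator {c<..<d} x * f x) = (\<integral>x. indicator {0<..} x *\<^sub>R (indicator {c<..<d} x * f x) \<partial>lborel)"
  by (subst integral_hl) (auto simp: set_lebesgue_integral_def)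
 also have "... = (\<integral>x. indicator {c..d} x *\<^sub>R f x \<partial>lborel)"
 proof (rule integral_cong_AE)
  show "AE x in lborel. indicator {0<..} x *\<^sub>R (indicator {c<..<d} x * f x) = indicator {c..d} x *\<^sub>R f x"
   using AE_lborel_singleton[of c] AE_lborel_singleton[of d] by eventually_elim (use c in "auto simp: indicator_def")
 qed measurable
 finally show ?thesis .
qed

text \<open>Half the integral of the odd extension from \<open>x - sg\<close> to
  \<open>x + sg\<close>; for \<open>x < sg\<close> the reflected piece cancels the part up to
  \<open>sg - x\<close>, and the interval starting at \<open>\<bar>x - sg\<bar>\<close>
  remains.\<close>

definition dal :: "real => (real => real) => real => real" where
 "dal sg N x = (LI z. (if \<bar>x - sg\<bar> < z \<and> z < x + sg then N z else 0)) / 2"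

text \<open>D'Alembert's formula for the odd extension of \<open>N\<close>.\<close>

theorem dal_rep:
 assumes N: "integrable hl N" and sg: "0 <= sg" and fin: "nm (sine_tr N) < \<infinity>"
 shows "profile_rep (dal sg N) (%l. sin (sg * l) / l * sine_tr N l)"
proof -
 have [measurable]: "N \<in> BM" using borel_measurable_integrable[OF N] by simp
 define K where "K x z = (if \<bar>x - sg\<bar> < z \<and> z < x + sg then N z else 0)" for x z
 have Kb: "\<bar>K x z\<bar> <= \<bar>N z\<bar>" for x z by (simp add: K_def)
 have Km[measurable]: "(%p. K (fst p) (snd p)) \<in> borel_measurable (borel \<Otimes>\<^sub>M borel)" unfolding K_def by measurable
 have [measurable]: "(%p. K (snd p) (fst p)) \<in> borel_measurable (borel \<Otimes>\<^sub>M borel)" unfolding K_def by measurable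
 have [measurable]: "K x \<in> BM" "(%x. K x z) \<in> BM" for x z unfolding K_def by measurable
 have IK: "integrable hl (K x)" for x by (rule integrable_hl_bound[OF N]) (use Kb in auto)
 have dK: "dal sg N = (%x. (LI z. K x z) / 2)" by (simp add: fun_eq_iff dal_def K_def)
 have dm[measurable]: "dal sg N \<in> BM" unfolding dK by measurable
 have db: "\<bar>dal sg N x\<bar> <= (LI z. \<bar>N z\<bar>)" for x
 proof -
  have "\<bar>\<integral>z. K x z \<partial>hl\<bar> <= (LI z. \<bar>N z\<bar>)"
   by (rule order_trans[OF integral_abs_bound integral_hl_mono[OF integrable_abs[OF IK] integrable_abs[OF N] Kb]])
  then show ?thesis by (simp add: dK)
 qed
 have "isCont (dal sg N) x" for x
  unfolding continuous_at_sequentially comp_def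
 proof (intro allI impI)
  fix s assume s: "s ----> x"
  have l1: "(%k. \<bar>s k - sg\<bar>) ----> \<bar>x - sg\<bar>" and l2: "(%k. s k + sg) ----> x + sg" by (intro tendsto_intros s)+
  have "(%k. LI z. K (s k) z) ----> (LI z. K x z)"
  proof (rule integral_dominated_convergence[where w="%z. \<bar>N z\<bar>"])
   have "AE z in hl. z \<noteq> \<bar>x - sg\<bar>" "AE z in hl. z \<noteq> x + sg" unfolding AE_hl using AE_lborel_singleton[of "\<bar>x - sg\<bar>"] AE_lborel_singleton[of "x + sg"] by (auto elim: eventually_mono)
   then show "AE z in hl. (%k. K (s k) z) ----> K x z"
   proof eventually_elim
    case (elim z)
    then consider "\<bar>x - sg\<bar> < z \<and> z < x + sg" | "z < \<bar>x - sg\<bar>" | "x + sg < z" by linarith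
    then have "\<forall>\<^sub>F k in sequentially. K (s k) z = K x z"
    proof cases
     case 1
     then have "\<forall>\<^sub>F k in sequentially. \<bar>s k - sg\<bar> < z" "\<forall>\<^sub>F k in sequentially. z < s k + sg" using order_tendstoD(2)[OF l1] order_tendstoD(1)[OF l2] by auto
     then show ?thesis by eventually_elim (use 1 in "auto simp: K_def")
    next
     case 2 from order_tendstoD(1)[OF l1 this] show ?thesis by eventually_elim (use 2 in "auto simp: K_def")
    next
     case 3 from order_tendstoD(2)[OF l2 this] show ?thesis by eventually_elim (use 3 in "auto simp: K_def")
    qed
    then show ?case by (rule tendsto_eventually)
   qed
  qed (use N Kb in auto)
  then show "(%k. dal sg N (s k)) ----> dal sg N x" unfolding dK by (intro tendsto_divide tendsto_const) auto
 qed
 then have dc: "continuous_on {0..} (dal sg N)" by (intro continuous_at_imp_continuous_on) auto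
 have d0: "dal sg N 0 = 0"
 proof -
  have "K 0 = (%z. 0)" using sg by (auto simp: K_def fun_eq_iff)
  then show ?thesis by (simp add: dK)
 qed
 have J: "integrable (hl \<Otimes>\<^sub>M hl) (%p. b (fst p) * K (fst p) (snd p))" if b: "!!x. \<bar>b x\<bar> <= 1" and [measurable]: "b \<in> BM" for b
 proof (rule integrableI_bounded)
  show "(%p. b (fst p) * K (fst p) (snd p)) \<in> borel_measurable (hl \<Otimes>\<^sub>M hl)" by measurable
  have "(\<integral>\<^sup>+p. ennreal (norm (b (fst p) * K (fst p) (snd p))) \<partial>(hl \<Otimes>\<^sub>M hl)) <= (\<integral>\<^sup>+p. ennreal \<bar>K (fst p) (snd p)\<bar> \<partial>(hl \<Otimes>\<^sub>M hl))"
   using b by (intro nn_integral_mono ennreal_leI) (auto simp: abs_mult intro!: mult_left_le_one_le)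
  also have "... = (NN z. NN x. ennreal \<bar>K x z\<bar>)" by (subst hl2.nn_integral_snd[symmetric]) auto
  also have "... <= (NN z. ennreal (2 * sg * \<bar>N z\<bar>))"
  proof (rule nn_integral_mono)
   fix z
   have "(NN x. ennreal \<bar>K x z\<bar>) = (\<integral>\<^sup>+x\<in>{0<..}. ennreal \<bar>K x z\<bar> \<partial>lborel)" by (rule nn_integral_hl) measurable
   also have "... <= (\<integral>\<^sup>+x. ennreal \<bar>N z\<bar> * indicator {z - sg..z + sg} x \<partial>lborel)"
    by (intro nn_integral_mono) (auto simp: K_def indicator_def)
   also have "... = ennreal (2 * sg * \<bar>N z\<bar>)" using sg by (simp add: nn_integral_cmult_indicator ennreal_mult[symmetric] mult.commute)
   finally show "(NN x. ennreal \<bar>K x z\<bar>) <= ennreal (2 * sg * \<bar>N z\<bar>)" .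
  qed
  also have "... < \<infinity>" using N sg by (subst nn_integral_eq_integral) auto
  finally show "(\<integral>\<^sup>+p. ennreal (norm (b (fst p) * K (fst p) (snd p))) \<partial>(hl \<Otimes>\<^sub>M hl)) < \<infinity>" .
 qed
 have "integrable hl (%x. LI z. K x z)" using hl2.integrable_fst'[OF J[of "%_. 1"]] by simp
 then have di: "integrable hl (dal sg N)" unfolding dK by simp
 have tr: "sine_tr (dal sg N) l = sin (sg * l) / l * sine_tr N l" for l
 proof (cases "l = 0")
  case False
  have "(LI x. sin (x * l) * dal sg N x) = (LI x. (LI z. sin (x * l) * K x z)) / 2"
   by (simp add: dK)
  also have "(LI x. (LI z. sin (x * l) * K x z)) = (LI z. (LI x. sin (x * l) * K x z))"
   by (rule hl2.Fubini_integral[symmetric]) (use J[of "%x. sin (x * l)"] in "simp add: case_prod_beta'")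
  also have "... = (LI z. 2 * sin (sg * l) / l * (sin (z * l) * N z))"
  proof (rule integral_hl_cong)
   fix z :: real assume z: "0 < z"
   \<comment> \<open>The region is symmetric:
     \<open>\<bar>x - sg\<bar> < z \<and> z < x + sg\<close> says the same as
     \<open>\<bar>z - sg\<bar> < x \<and> x < z + sg\<close>, so after Fubini \<open>x\<close> runs
     over an explicit interval.\<close>
   have "(LI x. sin (x * l) * K x z) = (LI x. N z * (indicator {\<bar>z - sg\<bar><..<z + sg} x * sin (x * l)))"
    by (rule integral_hl_cong) (auto simp: K_def indicator_def)
   also have "... = N z * (\<integral>x. indicator {\<bar>z - sg\<bar>..z + sg} x *\<^sub>R sin (x * l) \<partial>lborel)"
    by (simp only: integral_mult_right_zero) (subst integral_hl_interval, auto)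
   also have "(\<integral>x. indicator {\<bar>z - sg\<bar>..z + sg} x *\<^sub>R sin (x * l) \<partial>lborel) = - cos ((z + sg) * l) / l - (- cos (\<bar>z - sg\<bar> * l) / l)"
   proof (rule integral_FTC_Icc)
    show "((%x. - cos (x * l) / l) has_vector_derivative sin (x * l)) (at x within {\<bar>z - sg\<bar>..z + sg})" for x
     unfolding has_real_derivative_iff_has_vector_derivative[symmetric] using False by (auto intro!: derivative_eq_intros)
   qed (use z sg in "auto intro!: continuous_intros")
   also have "cos (\<bar>z - sg\<bar> * l) = cos ((z - sg) * l)" by (cases "0 <= z - sg") (auto simp: abs_if minus_mult_left[symmetric] cos_minus simp del: minus_diff_eq)
   also have "- cos ((z + sg) * l) / l - (- cos ((z - sg) * l) / l) = 2 * sin (sg * l) / l * sin (z * l)"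
    by (simp add: distrib_right left_diff_distrib cos_add cos_diff diff_divide_distrib add_divide_distrib)
   finally show "(LI x. sin (x * l) * K x z) = 2 * sin (sg * l) / l * (sin (z * l) * N z)" by simp
  qed measurable
  finally show ?thesis by (simp add: sine_tr_def)
 qed (simp add: sine_tr_def)
 have "ns (sine_tr (dal sg N)) = nm (%l. sin (sg * l) * sine_tr N l)"
  using ns_divide[of "%l. sin (sg * l) * sine_tr N l"] by (simp add: tr[abs_def])
 also have "... <= ennreal (1^2) * nm (sine_tr N)" by (rule nm_trig) auto
 finally have f: "ns (sine_tr (dal sg N)) < \<infinity>" using fin by (simp add: le_less_trans)
 from profile_rep_inversion[OF dc d0 dm db di f] show ?thesis unfolding tr[abs_def] .
qed

text \<open>The interval has length \<open>2 * min x sg\<close> and the integrand is at most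
  \<open>\<kappa> * (x + sg) powr a\<close>. For \<open>sg <= x\<close> the power is comparable to
  \<open>x powr a\<close>; for \<open>x < sg\<close> the exponent \<open>a <= 1\<close> allows the
  trade \<open>x * sg powr a <= sg * x powr a\<close>.\<close>

lemma dal_bound:
 assumes N: "N \<in> BM" "!!z. 0 < z ==> \<bar>N z\<bar> <= \<kappa> * z powr a" and a: "0 < a" "a <= 1" and k: "0 <= \<kappa>" and sg: "0 <= sg" and x: "0 < x"
 shows "\<bar>dal sg N x\<bar> <= 2 * sg * \<kappa> * x powr a"
proof -
 have [measurable]: "N \<in> BM" by (rule N)
 let ?K = "%z. if \<bar>x - sg\<bar> < z \<and> z < x + sg then N z else 0"
 let ?I = "%z. indicator {\<bar>x - sg\<bar><..<x + sg} z * (\<kappa> * (x + sg) powr a)"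
 have I: "integrable hl ?I" using integrable_indicator_hl[of "{\<bar>x - sg\<bar><..<x + sg}"] by simp
 have le: "\<bar>?K z\<bar> <= ?I z" if "0 < z" for z
 proof (cases "\<bar>x - sg\<bar> < z \<and> z < x + sg")
  case True
  then have "z powr a <= (x + sg) powr a" using that a by (intro powr_mono2) auto
  then have "\<kappa> * z powr a <= \<kappa> * (x + sg) powr a" using k by (intro mult_left_mono)
  then show ?thesis using N(2)[OF that] True by simp
 qed auto
 have IK: "integrable hl ?K" by (rule integrable_hl_bound[OF I]) (use le in "auto simp: abs_of_nonneg k")
 have "\<bar>\<integral>z. ?K z \<partial>hl\<bar> <= (LI z. \<bar>?K z\<bar>)" using integral_abs_bound .
 also have "... <= (LI z. ?I z)" by (rule integral_hl_mono[OF integrable_abs[OF IK] I le])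
 also have "... = \<kappa> * (x + sg) powr a * (x + sg - \<bar>x - sg\<bar>)"
  by (subst integral_hl_interval) (use x sg in auto)
 also have "x + sg - \<bar>x - sg\<bar> = 2 * min x sg" by auto
 finally have 1: "\<bar>dal sg N x\<bar> <= \<kappa> * ((x + sg) powr a * min x sg)" by (simp add: dal_def)
 have p2: "(2 * y) powr a <= 2 * y powr a" if "0 <= y" for y :: real
 proof -
  have "2 powr a <= (2::real) powr 1" using a by (intro powr_mono) auto
  then show ?thesis using that by (simp add: powr_mult mult_right_mono)
 qed
 have "(x + sg) powr a * min x sg <= 2 * sg * x powr a"
 proof (cases "sg <= x")
  case True
  have "(x + sg) powr a <= (2 * x) powr a" using True x sg a by (intro powr_mono2) auto
  then have "(x + sg) powr a <= 2 * x powr a" using p2[of x] x by linarith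
  then have "(x + sg) powr a * sg <= 2 * x powr a * sg" using sg by (rule mult_right_mono)
  then show ?thesis using True by (simp add: min_absorb2 mult_ac)
 next
  case False
  have "(x + sg) powr a <= (2 * sg) powr a" using False x sg a by (intro powr_mono2) auto
  then have "(x + sg) powr a <= 2 * sg powr a" using p2[of sg] sg by linarith
  then have "(x + sg) powr a * x <= 2 * sg powr a * x" using x by (intro mult_right_mono) auto
  also have "... = 2 * sg powr a * (x powr a * x powr (1 - a))" using x by (simp flip: powr_add)
  also have "... <= 2 * sg powr a * (x powr a * sg powr (1 - a))" using False x a by (intro mult_left_mono powr_mono2) auto
  also have "... = 2 * (sg powr a * sg powr (1 - a)) * x powr a" by simp
  also have "sg powr a * sg powr (1 - a) = sg" using False x by (simp flip: powr_add)
  finally show ?thesis using False by (simp add: min_def)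
 qed
 from mult_left_mono[OF this k] 1 show ?thesis by (simp add: mult_ac)
qed

lemma forcing_sin:
 assumes n: "forcing n" shows "forcing (%ta l. sin ((t - ta) * l) * n ta l)"
proof -
 have d: "dpath n" and c: "continuous_on UNIV (%p. n (fst p) (snd p))" using n by (auto simp: forcing_def)
 have H: "Hdual (n ta)" for ta by (rule dpath_Hdual[OF d])
 note [measurable] = Hdual_measurable[OF H]
 have "dpath (%ta l. sin ((t - ta) * l) * n ta l)"
  unfolding wpath_def nm_wsq[symmetric]
 proof (intro conjI allI impI)
  fix ta
  show "(%l. sin ((t - ta) * l) * n ta l) \<in> BM" by measurable
  have "nm (%l. sin ((t - ta) * l) * n ta l) <= ennreal (1^2) * nm (n ta)" by (rule nm_trig) auto
  then show "nm (%l. sin ((t - ta) * l) * n ta l) < \<infinity>" using H[of ta] by (simp add: Hdual_def le_less_trans)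
  fix s assume s: "s ----> ta"
  let ?z = "%k l. (sin ((t - s k) * l) - sin ((t - ta) * l)) * n ta l"
  have "(%k. wsq inverse (?z k)) ----> 0"
  proof (rule wi.wsq_tendsto_0_dominated[where g="%l. 2 * n ta l"])
   show "wsq inverse (%l. 2 * n ta l) < \<infinity>" using H[of ta] nm_cmult[of "n ta" 2] by (simp add: nm_wsq Hdual_def ennreal_mult_less_top)
   show "\<bar>?z k l\<bar> <= \<bar>2 * n ta l\<bar>" for k l
   proof -
    have "\<bar>sin ((t - s k) * l) - sin ((t - ta) * l)\<bar> <= 2"
     using abs_triangle_ineq4[of "sin ((t - s k) * l)" "sin ((t - ta) * l)"] abs_sin_le_one[of "(t - s k) * l"] abs_sin_le_one[of "(t - ta) * l"] by linarith
    then show ?thesis unfolding abs_mult by (intro mult_right_mono) auto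
   qed
   have "(%k. ?z k l) ----> (sin ((t - ta) * l) - sin ((t - ta) * l)) * n ta l" for l by (intro tendsto_intros s)
   then show "(%k. ?z k l) ----> 0" for l by simp
  qed measurable
  then have z: "(%k. nm (?z k)) ----> 0" by (simp add: nm_wsq)
  show "(%k. nm (%l. sin ((t - s k) * l) * n (s k) l - sin ((t - ta) * l) * n ta l)) ----> 0"
  proof (rule ennreal_tendsto_0_squeeze[where c=2])
   show "(%k. nm (%l. n (s k) l - n ta l) + nm (?z k)) ----> 0" using tendsto_add[OF dpath_tendsto[OF d s] z] by simp
   fix k
   have "nm (%l. sin ((t - s k) * l) * n (s k) l - sin ((t - ta) * l) * n ta l) = nm (%l. sin ((t - s k) * l) * (n (s k) l - n ta l) + ?z k l)"
    by (rule arg_cong[where f=nm]) (auto simp: algebra_simps)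
   also have "... <= 2 * (nm (%l. sin ((t - s k) * l) * (n (s k) l - n ta l)) + nm (?z k))" by (rule nm_add_le) measurable
   also have "... <= 2 * (nm (%l. n (s k) l - n ta l) + nm (?z k))"
    using nm_trig[of "%l. n (s k) l - n ta l" "%l. sin ((t - s k) * l)" 1] by (intro mult_left_mono add_mono) auto
   finally show "nm (%l. sin ((t - s k) * l) * n (s k) l - sin ((t - ta) * l) * n ta l) <= 2 * (nm (%l. n (s k) l - n ta l) + nm (?z k))" .
  qed simp
 qed
 moreover have "continuous_on UNIV (%p. sin ((t - fst p) * snd p) * n (fst p) (snd p))" by (intro continuous_intros c)
 ultimately show ?thesis by (simp add: forcing_def)
qed

lemma forcing_const: assumes "forcing n" shows "forcing (%ta. n ta0)"
proof -
 have c: "continuous_on UNIV (%p. n (fst p) (snd p))" using assms by (simp add: forcing_def)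
 have "continuous_on UNIV ((%p. n (fst p) (snd p)) \<circ> (%p :: real \<times> real. (ta0, snd p)))"
  by (rule continuous_on_compose) (auto intro!: continuous_intros continuous_on_subset[OF c])
 then have "continuous_on UNIV (%p :: real \<times> real. n ta0 (snd p))" by (simp add: comp_def)
 then show ?thesis using assms by (simp add: forcing_def wpath_def)
qed

lemma profile_rep_add:
 assumes "profile_rep v g" "profile_rep v' g'" shows "profile_rep (%x. v x + v' x) (%l. g l + g' l)"
 using profile_rep_diff[OF assms(1) profile_rep_diff[OF profile_rep_zero assms(2)]] by simp

lemma profile_rep_cmult:
 assumes "profile_rep v g" shows "profile_rep (%x. c * v x) (%l. c * g l)"
proof -
 obtain gk where gk: "!!k :: nat. sine_class (gk k)" "(%k. ns (%l. gk k l - g l)) ----> 0" "(%k. E4 (%x. sine_tr (gk k) x - v x)) ----> 0"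
  and g: "Hhalf g" and [measurable]: "v \<in> BM" using assms unfolding profile_rep_def by blast
 note [measurable] = Hhalf_measurable[OF g] sine_class_measurable[OF gk(1)]
 have "ns (%l. c * gk k l - c * g l) = ennreal (c^2) * ns (%l. gk k l - g l)" for k
  unfolding right_diff_distrib[symmetric] by (rule ns_cmult) measurable
 then have 1: "(%k. ns (%l. c * gk k l - c * g l)) ----> 0" using ennreal_tendsto_cmult[OF _ gk(2), of "ennreal (c^2)"] by simp
 have "sine_tr (%l. c * gk k l) x = c * sine_tr (gk k) x" for k x by (simp add: sine_tr_def mult.left_commute)
 then have "E4 (%x. sine_tr (%l. c * gk k l) x - c * v x) = ennreal (c ^ 4) * E4 (%x. sine_tr (gk k) x - v x)" for k
  unfolding E4_def by (subst nn_integral_cmult[symmetric]) (auto simp: right_diff_distrib[symmetric] power_mult_distrib ennreal_mult'[symmetric] intro!: nn_integral_cong)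
 then have 2: "(%k. E4 (%x. sine_tr (%l. c * gk k l) x - c * v x)) ----> 0" using ennreal_tendsto_cmult[OF _ gk(3), of "ennreal (c ^ 4)"] by simp
 have "sine_class (%l. c * gk k l)" for k using gk(1)[of k] by (auto simp: sine_class_def mult.left_commute)
 then show ?thesis using 1 2 Hhalf_cmult[OF g] unfolding profile_rep_def by (intro conjI exI[of _ "%k l. c * gk k l"]) auto
qed

text \<open>Convexity of the fourth power with weights proportional to \<open>\<alpha>\<close> and
  \<open>be\<close>. The scaling is such that bounds \<open>\<epsilon> * \<alpha> ^ 4\<close> and
  \<open>\<epsilon> * be ^ 4\<close> combine to \<open>\<epsilon> * (\<alpha> + be) ^ 4\<close>, so
  nothing is lost when intervals are joined.\<close>

lemma fourth_power_convex:
 fixes f g \<alpha> be :: real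
 assumes "0 < \<alpha>" "0 < be" shows "(f + g) ^ 4 <= (\<alpha> + be) ^ 3 * (f ^ 4 / \<alpha> ^ 3 + g ^ 4 / be ^ 3)"
proof -
 have sq: "(F + G)^2 <= (\<alpha> + be) * (F^2 / \<alpha> + G^2 / be)" for F G
 proof -
  have "(\<alpha> + be) * (F^2 / \<alpha> + G^2 / be) - (F + G)\<^sup>2 = (F * be - G * \<alpha>)^2 / (\<alpha> * be)"
   using assms by (simp add: field_simps power2_eq_square)
  moreover have "0 <= (F * be - G * \<alpha>)^2 / (\<alpha> * be)" using assms by simp
  ultimately show ?thesis by linarith
 qed
 have "(f + g) ^ 4 = ((f + g)^2)^2" by simp
 also have "... <= ((\<alpha> + be) * (f^2 / \<alpha> + g^2 / be))^2" by (rule power_mono[OF sq]) simp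
 also have "... = (\<alpha> + be)^2 * (f^2 / \<alpha> + g^2 / be)^2" by (simp add: power_mult_distrib)
 also have "... <= (\<alpha> + be)^2 * ((\<alpha> + be) * ((f^2 / \<alpha>)^2 / \<alpha> + (g^2 / be)^2 / be))" by (intro mult_left_mono sq) simp
 also have "... = (\<alpha> + be) ^ 3 * (f ^ 4 / \<alpha> ^ 3 + g ^ 4 / be ^ 3)"
  using assms by (simp add: power_divide power2_eq_square power3_eq_cube power4_eq_xxxx mult.assoc)
 finally show ?thesis .
qed

text \<open>A profile is only determined up to null sets for each time, so it cannot be integrated in time pointwise.
  Instead the bound is propagated to time integrals by bisection: the fourth power of the excess over the
  bound is convex, and it is small on short intervals.\<close>

definition excess :: "(real => real) => real => (real => real) => ennreal" where
 "excess \<mu> c v = (NN x. ennreal ((max 0 (\<bar>v x\<bar> - c * \<mu> x)) ^ 4 / x))"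

theorem integral_profile_bound:
 assumes n: "forcing n" and [measurable]: "\<mu> \<in> BM" and st: "s <= t"
  and D: "!!ta. s <= ta ==> ta <= t ==> \<exists>d. profile_rep d (%l. n ta l / l) \<and> (AE x in hl. \<bar>d x\<bar> <= \<mu> x)"
  and v: "profile_rep v (%l. duh (%_. 1) n s t l / l)"
 shows "AE x in hl. \<bar>v x\<bar> <= (t - s) * \<mu> x"
proof -
 have k1: "isCont (%_. 1 :: real) x" "\<bar>1 :: real\<bar> <= 1" for x :: real by auto
 let ?S = "%s r l. duh (%_. 1) n s r l / l"
 have dn: "dpath n" using n by (simp add: forcing_def)
 note dm[measurable] = duh_measurable[OF k1 n]
 have HS: "Hhalf (?S s r)" for s r
 proof -
  obtain C where C: "0 <= C" "!!ta. \<bar>ta\<bar> <= max \<bar>s\<bar> \<bar>r\<bar> ==> nm (n ta) <= ennreal C" using wi.wpath_bounded[OF dn, of "max \<bar>s\<bar> \<bar>r\<bar>"] unfolding nm_wsq by blast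
  have "nm (duh (%_. 1) n s r) <= ennreal (C * (r - s)^2)" by (rule duh_nm_bound[OF k1 n C(2) C(1)]) auto
  then show ?thesis unfolding Hhalf_def ns_divide by (auto intro: le_less_trans)
 qed
 have main: "excess \<mu> (t - s) v <= ennreal (\<epsilon> * (t - s) ^ 4)" if e: "0 < \<epsilon>" for \<epsilon>
 proof -
  define P where "P s r \<longleftrightarrow> (\<forall>v. profile_rep v (?S s r) --> excess \<mu> (r - s) v <= ennreal (\<epsilon> * (r - s) ^ 4))" for s r
  have "P s t" using st
  proof (rule Bolzano)
   fix a b c assume ab: "P a b" and bc: "P b c" and le: "a <= b" "b <= c"
   show "P a c"
   proof (cases "a = b \<or> b = c")
    case False
    define \<alpha> be where "\<alpha> = b - a" and "be = c - b"
    have pos: "0 < \<alpha>" "0 < be" and sum: "c - a = \<alpha> + be" using le False by (auto simp: \<alpha>_def be_def)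
    define p q where "p = prof (?S a b)" and "q = prof (?S b c)"
    have pr: "profile_rep p (?S a b)" "profile_rep q (?S b c)" unfolding p_def q_def by (intro prof_rep HS)+
    note [measurable] = profile_rep_measurable[OF pr(1)] profile_rep_measurable[OF pr(2)]
    let ?f = "%x. max 0 (\<bar>p x\<bar> - \<alpha> * \<mu> x)" and ?g = "%x. max 0 (\<bar>q x\<bar> - be * \<mu> x)"
    have f: "(NN x. ennreal (?f x ^ 4 / x)) <= ennreal (\<epsilon> * \<alpha> ^ 4)" "(NN x. ennreal (?g x ^ 4 / x)) <= ennreal (\<epsilon> * be ^ 4)"
     using ab bc pr by (auto simp: P_def excess_def \<alpha>_def be_def)
    show ?thesis unfolding P_def
    proof (intro allI impI)
     fix v assume v: "profile_rep v (?S a c)"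
     have AEv: "AE x in hl. v x = p x + q x"
      by (rule profile_rep_unique[OF v profile_rep_add[OF pr]]) (simp add: duh_sum[OF k1 n] add_divide_distrib[symmetric])
     have gen: "ennreal (A * F + B * G) = ennreal A * ennreal F + ennreal B * ennreal G" if "0 <= A" "0 <= B" "0 <= F" "0 <= G" for A B F G :: real
      using that by (simp add: ennreal_mult)
     have "excess \<mu> (c - a) v <= (NN x. ennreal ((\<alpha> + be) ^ 3 / \<alpha> ^ 3) * ennreal (?f x ^ 4 / x) + ennreal ((\<alpha> + be) ^ 3 / be ^ 3) * ennreal (?g x ^ 4 / x))"
      unfolding excess_def
     proof (intro nn_integral_mono_AE, use AEv AE_hl_pos in eventually_elim)
      case (elim x)
      have x: "0 < x" using elim by simp
      have "max 0 (\<bar>v x\<bar> - (c - a) * \<mu> x) <= ?f x + ?g x" using elim unfolding sum distrib_right by linarith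
      then have "(max 0 (\<bar>v x\<bar> - (c - a) * \<mu> x)) ^ 4 <= (?f x + ?g x) ^ 4" by (intro power_mono) auto
      also have "... <= (\<alpha> + be) ^ 3 * (?f x ^ 4 / \<alpha> ^ 3 + ?g x ^ 4 / be ^ 3)" by (rule fourth_power_convex[OF pos])
      finally have "(max 0 (\<bar>v x\<bar> - (c - a) * \<mu> x)) ^ 4 / x <= (\<alpha> + be) ^ 3 * (?f x ^ 4 / \<alpha> ^ 3 + ?g x ^ 4 / be ^ 3) / x"
       using x by (intro divide_right_mono) auto
      also have "... = (\<alpha> + be) ^ 3 / \<alpha> ^ 3 * (?f x ^ 4 / x) + (\<alpha> + be) ^ 3 / be ^ 3 * (?g x ^ 4 / x)"
       by (simp add: distrib_left add_divide_distrib)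
      finally have fin: "(max 0 (\<bar>v x\<bar> - (c - a) * \<mu> x)) ^ 4 / x <= (\<alpha> + be) ^ 3 / \<alpha> ^ 3 * (?f x ^ 4 / x) + (\<alpha> + be) ^ 3 / be ^ 3 * (?g x ^ 4 / x)" .
      have nn: "0 <= (\<alpha> + be) ^ 3 / \<alpha> ^ 3" "0 <= (\<alpha> + be) ^ 3 / be ^ 3" "0 <= ?f x ^ 4 / x" "0 <= ?g x ^ 4 / x" using pos x by auto
      show ?case unfolding gen[OF nn, symmetric] by (rule ennreal_leI[OF fin])
     qed
     also have "... = ennreal ((\<alpha> + be) ^ 3 / \<alpha> ^ 3) * (NN x. ennreal (?f x ^ 4 / x)) + ennreal ((\<alpha> + be) ^ 3 / be ^ 3) * (NN x. ennreal (?g x ^ 4 / x))"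
      by (simp add: nn_integral_add nn_integral_cmult)
     also have "... <= ennreal ((\<alpha> + be) ^ 3 / \<alpha> ^ 3) * ennreal (\<epsilon> * \<alpha> ^ 4) + ennreal ((\<alpha> + be) ^ 3 / be ^ 3) * ennreal (\<epsilon> * be ^ 4)"
      by (intro add_mono mult_left_mono f) auto
     also have "... = ennreal ((\<alpha> + be) ^ 3 / \<alpha> ^ 3 * (\<epsilon> * \<alpha> ^ 4) + (\<alpha> + be) ^ 3 / be ^ 3 * (\<epsilon> * be ^ 4))"
      using pos e by (simp add: ennreal_mult[symmetric] ennreal_plus[symmetric] del: ennreal_plus)
     also have "(\<alpha> + be) ^ 3 / \<alpha> ^ 3 * (\<epsilon> * \<alpha> ^ 4) + (\<alpha> + be) ^ 3 / be ^ 3 * (\<epsilon> * be ^ 4) = \<epsilon> * (c - a) ^ 4"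
      unfolding sum using pos by (simp add: power3_eq_cube power4_eq_xxxx) (simp add: algebra_simps)
     finally show "excess \<mu> (c - a) v <= ennreal (\<epsilon> * (c - a) ^ 4)" .
    qed
   qed (use ab bc in auto)
  next
   fix ta0 assume tau: "s <= ta0" "ta0 <= t"
   obtain d where d: "profile_rep d (%l. n ta0 l / l)" "AE x in hl. \<bar>d x\<bar> <= \<mu> x" using D[OF tau] by blast
   \<comment> \<open>The 128 is that of \<open>profile_rep_E4\<close>. On an interval shorter than
     \<open>\<delta>\<close> the time integral differs from length times \<open>n ta0\<close> by at
     most \<open>\<eta>\<close> times the squared length in \<open>ns\<close>, hence the excess is
     at most \<open>\<epsilon>\<close> times the fourth power of the length.\<close>
   define \<eta> where "\<eta> = sqrt (\<epsilon> / 128)"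
   have eta: "0 < \<eta>" "128 * \<eta>^2 = \<epsilon>" using e by (auto simp: \<eta>_def)
   obtain \<delta> where dl: "0 < \<delta>" "!!ta. \<bar>ta - ta0\<bar> < \<delta> ==> nm (%l. n ta l - n ta0 l) < ennreal \<eta>"
    using wi.wpath_eps[OF dn, of "ennreal \<eta>" ta0] eta unfolding nm_wsq by auto
   have "P a b" if ab: "a <= ta0" "ta0 <= b" "b - a < \<delta>" for a b
    unfolding P_def
   proof (intro allI impI)
    fix v assume v: "profile_rep v (?S a b)"
    note r = profile_rep_diff[OF v profile_rep_cmult[OF d(1), of "b - a"]]
    have "nm (duh (%_. 1) (%ta l. n ta l - n ta0 l) a b) <= ennreal (\<eta> * (b - a)^2)"
     by (rule duh_nm_bound[OF k1 forcing_diff[OF n forcing_const[OF n]]]) (use dl(2) ab eta in "auto intro!: less_imp_le")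
    moreover have "duh (%_. 1) (%ta l. n ta l - n ta0 l) a b = (%l. duh (%_. 1) n a b l - (b - a) * n ta0 l)"
     by (rule ext) (simp add: duh_diff[OF k1 n forcing_const[OF n]], simp add: duh_def)
    ultimately have nsb: "ns (%l. ?S a b l - (b - a) * (n ta0 l / l)) <= ennreal (\<eta> * (b - a)^2)"
     using ns_divide[of "%l. duh (%_. 1) n a b l - (b - a) * n ta0 l"] by (simp add: diff_divide_distrib)
    have "excess \<mu> (b - a) v <= E4 (%x. v x - (b - a) * d x)"
     unfolding excess_def E4_def
    proof (intro nn_integral_mono_AE, use d(2) AE_hl_pos in eventually_elim)
     case (elim x)
     have "(b - a) * \<bar>d x\<bar> <= (b - a) * \<mu> x" using elim ab by (intro mult_left_mono) auto
     then have "\<bar>(b - a) * d x\<bar> <= (b - a) * \<mu> x" using ab by (simp add: abs_mult)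
     then have "max 0 (\<bar>v x\<bar> - (b - a) * \<mu> x) <= \<bar>v x - (b - a) * d x\<bar>" by linarith
     then have "(max 0 (\<bar>v x\<bar> - (b - a) * \<mu> x)) ^ 4 <= \<bar>v x - (b - a) * d x\<bar> ^ 4" by (intro power_mono) auto
     then show ?case using elim by (intro ennreal_leI divide_right_mono) auto
    qed
    also have "... <= 128 * (ns (%l. ?S a b l - (b - a) * (n ta0 l / l)))^2" by (rule profile_rep_E4[OF r])
    also have "... <= 128 * (ennreal (\<eta> * (b - a)^2))^2" by (intro mult_left_mono power_mono nsb) auto
    also have "... = ennreal (128 * (\<eta> * (b - a)^2)^2)"
    proof -
     have "128 * (ennreal y)^2 = ennreal (128 * y^2)" if "0 <= y" for y using that by (simp add: ennreal_power ennreal_mult)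
     then show ?thesis using eta(1) by simp
    qed
    also have "128 * (\<eta> * (b - a)^2)^2 = 128 * \<eta>^2 * (b - a) ^ 4" by (simp add: power_mult_distrib)
    finally show "excess \<mu> (b - a) v <= ennreal (\<epsilon> * (b - a) ^ 4)" unfolding eta(2) .
   qed
   then show "\<exists>d>0. \<forall>a b. a <= ta0 \<and> ta0 <= b \<and> b - a < d --> P a b" using dl(1) by blast
  qed
  then show ?thesis using v by (simp add: P_def)
 qed
 have [measurable]: "v \<in> BM" using v by measurable
 have "excess \<mu> (t - s) v <= 0"
 proof (rule ennreal_le_epsilon)
  fix e :: real assume e: "0 < e"
  have X: "0 < (t - s) ^ 4 + 1" by (simp add: add_nonneg_pos)
  have "e * (t - s) ^ 4 <= e * ((t - s) ^ 4 + 1)" using e by (intro mult_left_mono) auto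
  then have "e / ((t - s) ^ 4 + 1) * (t - s) ^ 4 <= e" using X by (simp add: pos_divide_le_eq)
  moreover have "0 < e / ((t - s) ^ 4 + 1)" using e X by simp
  ultimately show "excess \<mu> (t - s) v <= 0 + ennreal e" using main[of "e / ((t - s) ^ 4 + 1)"] by (auto intro: order_trans ennreal_leI)
 qed
 then have "E4 (%x. max 0 (\<bar>v x\<bar> - (t - s) * \<mu> x)) = 0" by (simp add: excess_def E4_def)
 then have "AE x in hl. max 0 (\<bar>v x\<bar> - (t - s) * \<mu> x) = 0" by (intro E4_eq_0_AE) auto
 then show ?thesis by eventually_elim linarith
qed

text \<open>For a fixed time \<open>ta\<close> the integrand is, up to sign, the transform of
  d'Alembert's integral over the time \<open>\<bar>t - ta\<bar>\<close>, bounded by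
  \<open>dal_bound\<close>. \<open>integral_profile_bound\<close> integrates this in time; negative
  \<open>t\<close> is treated by reversing the segment.\<close>

theorem Duhamel_bound:
 assumes n: "forcing n" and nN: "!!ta. n ta = sine_tr (N ta)" and N: "!!ta. integrable hl (N ta)"
  and b: "!!ta z. 0 < z ==> \<bar>N ta z\<bar> <= \<kappa> * z powr a" and a: "0 < a" "a <= 1" "0 <= \<kappa>"
  and v: "profile_rep v (%l. LBINT ta=ereal 0..ereal t. sin ((t - ta) * l) / l * n ta l)"
 shows "AE x in hl. \<bar>v x\<bar> <= \<bar>t\<bar> * (2 * \<bar>t\<bar> * \<kappa> * x powr a)"
proof -
 have k1: "isCont (%_. 1 :: real) x" "\<bar>1 :: real\<bar> <= 1" for x :: real by auto
 \<comment> \<open>With the sine put into the forcing, the Duhamel term is a plain time integral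
   divided by \<open>l\<close>.\<close>
 define m where "m ta l = sin ((t - ta) * l) * n ta l" for ta l
 have m: "forcing m" unfolding m_def by (rule forcing_sin[OF n])
 have S: "(LBINT ta=ereal 0..ereal t. sin ((t - ta) * l) / l * n ta l) = duh (%_. 1) m 0 t l / l" for l
  unfolding duh_def m_def by (simp flip: interval_lebesgue_integral_divide)
 have D: "\<exists>d. profile_rep d (%l. m ta l / l) \<and> (AE x in hl. \<bar>d x\<bar> <= 2 * \<bar>t\<bar> * \<kappa> * x powr a)" if tau: "min 0 t <= ta" "ta <= max 0 t" for ta
 proof -
  define sg where "sg = \<bar>t - ta\<bar>"
  have sg: "0 <= sg" "sg <= \<bar>t\<bar>" using tau by (auto simp: sg_def)
  have "nm (sine_tr (N ta)) < \<infinity>" using dpath_Hdual[of n ta] n unfolding nN[symmetric] by (simp add: forcing_def Hdual_def)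
  from dal_rep[OF N sg(1) this] have r: "profile_rep (dal sg (N ta)) (%l. sin (sg * l) / l * sine_tr (N ta) l)" .
  have bd: "\<bar>dal sg (N ta) x\<bar> <= 2 * \<bar>t\<bar> * \<kappa> * x powr a" if x: "0 < x" for x
  proof -
   have "\<bar>dal sg (N ta) x\<bar> <= 2 * sg * \<kappa> * x powr a" by (rule dal_bound[OF _ b a sg(1) x]) (use borel_measurable_integrable[OF N] in auto)
   also have "... <= 2 * \<bar>t\<bar> * \<kappa> * x powr a" using sg a by (intro mult_right_mono mult_left_mono) auto
   finally show ?thesis .
  qed
  show ?thesis
  proof (cases "ta <= t")
   case True
   then have "(%l. sin (sg * l) / l * sine_tr (N ta) l) = (%l. m ta l / l)" by (simp add: m_def sg_def nN)
   then show ?thesis using r bd by (intro exI[of _ "dal sg (N ta)"] conjI AE_hlI) auto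
  next
   case False
   have "(%l. (- 1) * (sin (sg * l) / l * sine_tr (N ta) l)) = (%l. m ta l / l)"
   proof
    fix l
    have "(t - ta) * l = - (sg * l)" using False by (simp add: sg_def algebra_simps)
    then have "sin ((t - ta) * l) = - sin (sg * l)" by simp
    then show "(- 1) * (sin (sg * l) / l * sine_tr (N ta) l) = m ta l / l" by (simp add: m_def nN)
   qed
   then show ?thesis using profile_rep_cmult[OF r, of "- 1"] bd by (intro exI[of _ "%x. (- 1) * dal sg (N ta) x"] conjI AE_hlI) auto
  qed
 qed
 have [measurable]: "(%x. 2 * \<bar>t\<bar> * \<kappa> * x powr a) \<in> BM" by measurable
 show ?thesis
 proof (cases "0 <= t")
  case True
  from integral_profile_bound[OF m _ True _ v[unfolded S], of "%x. 2 * \<bar>t\<bar> * \<kappa> * x powr a"] D show ?thesis using True by (simp add: min_def max_def)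
 next
  case False
  have "duh (%_. 1) m 0 t l + duh (%_. 1) m t 0 l = 0" for l using duh_sum[OF k1 m, of 0 t l 0] by simp
  then have "(- 1) * (duh (%_. 1) m 0 t l / l) = duh (%_. 1) m t 0 l / l" for l by (simp add: add_eq_0_iff)
  then have "profile_rep (%x. (- 1) * v x) (%l. duh (%_. 1) m t 0 l / l)" using profile_rep_cmult[OF v[unfolded S], of "- 1"] by simp
  from integral_profile_bound[OF m _ _ _ this, of "%x. 2 * \<bar>t\<bar> * \<kappa> * x powr a"] D False show ?thesis by (simp add: min_def max_def)
 qed
qed

section \<open>The lifespan\<close>

text \<open>The square of \<open>sin (l * x) / l powr (a + 1/2)\<close> is integrated by splitting
  at \<open>l = 1 / x\<close>, with \<open>\<bar>sin (l * x)\<bar>\<close> at most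
  \<open>l * x\<close> below and 1 above. The summands are the two pieces; their integrals converge
  for \<open>0 < a < 1\<close>, which is the range \<open>1/2 < s < 3/2\<close>.\<close>

definition linC :: "real => real" where "linC a = 1 / (2 - 2 * a) + 1 / (2 * a)"

lemma sine_kernel_norm:
 assumes a: "0 < a" "a < 1" and x: "0 < x"
 shows "(NN l. ennreal ((sin (l * x) / l powr (a + 1/2))^2)) <= ennreal ((sqrt (linC a) * x powr a)^2)"
proof -
 let ?h = "%l. x^2 * l powr (1 - 2 * a)" and ?t = "%l. l powr (- 2 * a - 1)"
 have pw: "((1 / x) powr (- 2 * a)) = x powr (2 * a)" using x by (simp add: powr_divide powr_minus_divide)
 have "(NN l. ennreal ((sin (l * x) / l powr (a + 1/2))^2)) = (\<integral>\<^sup>+l\<in>{0<..}. ennreal ((sin (l * x) / l powr (a + 1/2))^2) \<partial>lborel)"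
  by (rule nn_integral_hl) measurable
 also have "... <= (\<integral>\<^sup>+l. ennreal (?h l) * indicator {0..1 / x} l + ennreal (?t l) * indicator {1 / x..} l \<partial>lborel)"
 proof (rule nn_integral_mono)
  fix l :: real
  show "ennreal ((sin (l * x) / l powr (a + 1/2))^2) * indicator {0<..} l <= ennreal (?h l) * indicator {0..1 / x} l + ennreal (?t l) * indicator {1 / x..} l"
  proof (cases "0 < l")
   case l: True
   have sq: "(l powr (a + 1/2))^2 = l powr (2 * a + 1)" using l by (simp add: powr_power algebra_simps)
   have e: "(sin (l * x) / l powr (a + 1/2))^2 = (sin (l * x))^2 * ?t l"         using powr_minus[of l "2 * a + 1"] unfolding power_divide sq by (simp add: divide_inverse)
   show ?thesis
   proof (cases "l <= 1 / x")
    case True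
    have "\<bar>sin (l * x)\<bar> <= \<bar>l * x\<bar>" by (rule abs_sin_x_le_abs_x)
    then have "(sin (l * x))^2 <= (l * x)^2" by (simp add: abs_le_square_iff)
    then have "(sin (l * x))^2 * ?t l <= (l * x)^2 * ?t l" by (intro mult_right_mono) auto
    also have "... = x^2 * (l powr 2 * ?t l)" using l by (simp add: power_mult_distrib)
    also have "l powr 2 * ?t l = l powr (1 - 2 * a)" unfolding powr_add[symmetric] by simp
    finally have "ennreal ((sin (l * x))^2 * ?t l) <= ennreal (?h l)" by (rule ennreal_leI)
    then show ?thesis using True l e by (simp add: add_increasing2)
   next
    case False
    have "(sin (l * x))^2 * ?t l <= 1 * ?t l" by (intro mult_right_mono) (auto simp: abs_square_le_1)
    then have "ennreal ((sin (l * x))^2 * ?t l) <= ennreal (?t l)" by (intro ennreal_leI) simp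
    then show ?thesis using False l e by simp
   qed
  qed simp
 qed
 also have "... = (\<integral>\<^sup>+l. ennreal (?h l) * indicator {0..1 / x} l \<partial>lborel) + (\<integral>\<^sup>+l. ennreal (?t l) * indicator {1 / x..} l \<partial>lborel)"
  by (rule nn_integral_add) measurable
 also have "(\<integral>\<^sup>+l. ennreal (?h l) * indicator {0..1 / x} l \<partial>lborel) = ennreal (x^2 * ((1 / x) powr (1 - 2 * a + 1) / (1 - 2 * a + 1)))"
  by (rule nn_integral_has_integral_lebesgue'[OF _ has_integral_mult_right[OF has_integral_powr_from_0]]) (use a x in auto)
 also have "(\<integral>\<^sup>+l. ennreal (?t l) * indicator {1 / x..} l \<partial>lborel) = ennreal (- ((1 / x) powr (- 2 * a - 1 + 1)) / (- 2 * a - 1 + 1))"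
  by (rule nn_integral_has_integral_lebesgue'[OF _ has_integral_powr_to_inf]) (use a x in auto)
 also have "x^2 * ((1 / x) powr (1 - 2 * a + 1) / (1 - 2 * a + 1)) = x powr (2 * a) / (2 - 2 * a)"
 proof -
  have "(1 / x) powr (1 - 2 * a + 1) = (1 / x) powr 2 * (1 / x) powr (- 2 * a)" by (simp flip: powr_add)
  then have "x^2 * (1 / x) powr (1 - 2 * a + 1) = (x^2 * (1 / x) powr 2) * x powr (2 * a)" unfolding pw by simp
  also have "x^2 * (1 / x) powr 2 = 1" using x by (simp add: power_divide)
  finally show ?thesis by simp
 qed
 also have "- ((1 / x) powr (- 2 * a - 1 + 1)) / (- 2 * a - 1 + 1) = x powr (2 * a) / (2 * a)" using pw by simp
 also have "ennreal (x powr (2 * a) / (2 - 2 * a)) + ennreal (x powr (2 * a) / (2 * a)) = ennreal ((sqrt (linC a) * x powr a)^2)"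
 proof -
  have "(x powr a)^2 = x powr (2 * a)" using x by (simp add: powr_power)
  moreover have "0 <= linC a" using a by (simp add: linC_def)
  ultimately have "(sqrt (linC a) * x powr a)^2 = x powr (2 * a) / (2 - 2 * a) + x powr (2 * a) / (2 * a)"
   by (simp add: power_mult_distrib linC_def distrib_right)
  then show ?thesis using a by (simp add: ennreal_plus[symmetric] del: ennreal_plus)
 qed
 finally show ?thesis .
qed

text \<open>With \<open>a = s - 1/2\<close> the exponents are \<open>s\<close> and
  \<open>s - 1\<close>, the orders of the two data norms in the statement.\<close>

definition data_bound :: "real => (real => real) => (real => real) => real => bool" where
 "data_bound a c0 c1 \<rho> \<longleftrightarrow> 0 <= \<rho> \<and> (NN l. ennreal ((l powr (a + 1/2) * c0 l)^2)) <= ennreal (\<rho>^2) \<and>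
   (NN l. ennreal ((l powr (a - 1/2) * c1 l)^2)) <= ennreal (\<rho>^2)"

text \<open>Cauchy-Schwarz in frequency against \<open>sine_kernel_norm\<close>, once for each
  datum. The bound holds for all cutoffs alike, as \<open>profile_rep_bound\<close> requires, and
  for all \<open>t\<close>, since the sine and cosine of \<open>t * l\<close> are at most 1 in
  size.\<close>

theorem linear_bound:
 assumes a: "0 < a" "a < 1" and d: "data_bound a c0 c1 \<rho>" and m[measurable]: "c0 \<in> BM" "c1 \<in> BM"
  and p: "profile_rep p (%l. cos (t * l) * c0 l + sin (t * l) / l * c1 l)"
 shows "AE x in hl. \<bar>p x\<bar> <= 2 * \<rho> * sqrt (linC a) * x powr a"
proof (rule profile_rep_bound[OF p])
 show "(%x. 2 * \<rho> * sqrt (linC a) * x powr a) \<in> BM" by measurable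
 fix k :: nat and x :: real assume x: "0 < x"
 let ?g = "%l. indicator {..<real k} l * (cos (t * l) * c0 l + sin (t * l) / l * c1 l)"
 let ?A = "%l. sin (l * x) / l powr (a + 1/2)"
 have rho: "0 <= \<rho>" using d by (simp add: data_bound_def)
 have C: "0 <= sqrt (linC a) * x powr a" using a by (simp add: linC_def)
 have I: "integrable hl (%l. sin (l * x) * ?g l)"
  by (rule sine_class_integrable[OF Hhalf_cutoff(1)[OF profile_rep_Hhalf[OF p]] x])
 have "ennreal \<bar>\<integral>l. sin (l * x) * ?g l \<partial>hl\<bar> <= (NN l. ennreal \<bar>sin (l * x) * ?g l\<bar>)"
  using integral_norm_bound_ennreal[OF I] by simp
 also have "... <= (NN l. ennreal \<bar>?A l * (l powr (a + 1/2) * c0 l)\<bar> + ennreal \<bar>?A l * (l powr (a - 1/2) * c1 l)\<bar>)"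
 proof (rule nn_integral_hl_mono)
  fix l :: real assume l: "0 < l"
  have "\<bar>?g l\<bar> <= \<bar>cos (t * l) * c0 l + sin (t * l) / l * c1 l\<bar>" by (simp add: indicator_def)
  also have "... <= \<bar>cos (t * l)\<bar> * \<bar>c0 l\<bar> + \<bar>sin (t * l)\<bar> * (\<bar>c1 l\<bar> / l)" using l by (intro order_trans[OF abs_triangle_ineq]) (simp add: abs_mult)
  also have "... <= 1 * \<bar>c0 l\<bar> + 1 * (\<bar>c1 l\<bar> / l)" using l by (intro add_mono mult_right_mono) auto
  finally have "\<bar>sin (l * x)\<bar> * \<bar>?g l\<bar> <= \<bar>sin (l * x)\<bar> * (\<bar>c0 l\<bar> + \<bar>c1 l\<bar> / l)" by (intro mult_left_mono) auto
  also have "... = \<bar>?A l * (l powr (a + 1/2) * c0 l)\<bar> + \<bar>?A l * (l powr (a - 1/2) * c1 l)\<bar>"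
  proof -
   have "l powr (a - 1/2) * l = l powr (a + 1/2)" using l powr_add[of l "a - 1/2" 1] by (simp add: add.commute)
   then have "l powr (a - 1/2) / l powr (a + 1/2) = 1 / l" using l by (simp add: frac_eq_eq)
   then have "\<bar>sin (l * x)\<bar> * (\<bar>c1 l\<bar> / l) = \<bar>sin (l * x)\<bar> * \<bar>c1 l\<bar> * (l powr (a - 1/2) / l powr (a + 1/2))" by simp
   then show ?thesis using l by (simp add: abs_mult distrib_left)
  qed
  finally have "\<bar>sin (l * x) * ?g l\<bar> <= \<bar>?A l * (l powr (a + 1/2) * c0 l)\<bar> + \<bar>?A l * (l powr (a - 1/2) * c1 l)\<bar>" by (simp only: abs_mult)
  then show "ennreal \<bar>sin (l * x) * ?g l\<bar> <= ennreal \<bar>?A l * (l powr (a + 1/2) * c0 l)\<bar> + ennreal \<bar>?A l * (l powr (a - 1/2) * c1 l)\<bar>"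
   by (subst ennreal_plus[symmetric]) (simp_all only: abs_ge_zero ennreal_leI)
 qed
 also have "... = (NN l. ennreal \<bar>?A l * (l powr (a + 1/2) * c0 l)\<bar>) + (NN l. ennreal \<bar>?A l * (l powr (a - 1/2) * c1 l)\<bar>)"
  by (rule nn_integral_add) measurable
 also have "... <= ennreal (sqrt (linC a) * x powr a * \<rho>) + ennreal (sqrt (linC a) * x powr a * \<rho>)"
  by (intro add_mono Cauchy_Schwarz_hl sine_kernel_norm a x C rho) (use d in "auto simp: data_bound_def")
 also have "... = ennreal (2 * \<rho> * sqrt (linC a) * x powr a)"
  using C rho by (subst ennreal_plus[symmetric]) (auto intro!: mult_nonneg_nonneg simp: mult_ac)
 finally have b: "\<bar>\<integral>l. sin (l * x) * ?g l \<partial>hl\<bar> <= 2 * \<rho> * sqrt (linC a) * x powr a" using rho a by (subst (asm) ennreal_le_iff) (auto simp: linC_def)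
 have "\<bar>sine_tr ?g x\<bar> <= 1 * \<bar>\<integral>l. sin (l * x) * ?g l \<partial>hl\<bar>"
  unfolding sine_tr_def abs_mult using cS_le_1 cS_pos by (intro mult_right_mono) auto
 then show "\<bar>sine_tr ?g x\<bar> <= 2 * \<rho> * sqrt (linC a) * x powr a" using b by linarith
qed

text \<open>Since \<open>(l powr b)^2 <= 1 + (l powr a)^2\<close>, the norm of lower order is
  controlled by the critical one and the given one. \<open>r\<close> stays an unspecified number: it
  depends on the critical norm and must not enter the lifespan.\<close>

lemma data_bound_interpolate:
 assumes b: "0 < b" "b <= a" and d: "data_bound a c0 c1 \<rho>" and c: "Hhalf c0" "Hdual c1" shows "\<exists>r. data_bound b c0 c1 r"
proof -
 note [measurable] = Hhalf_measurable[OF c(1)] Hdual_measurable[OF c(2)]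
 have pw: "(l powr (e + s) * y)^2 = (l powr e)^2 * (l powr (2 * s) * y^2)" if "0 < l" for l e s y :: real
 proof -
  have "(l powr s)^2 = l powr (2 * s)" using that by (simp add: powr_power)
  then show ?thesis by (simp add: powr_add power_mult_distrib mult.assoc)
 qed
 have le: "(l powr b)^2 <= 1 + (l powr a)^2" if l: "0 < l" for l :: real
 proof (cases "l <= 1")
  case True
  then have "l powr b <= 1" using l b by (simp add: powr_le1)
  then have "(l powr b)^2 <= 1" by (simp add: power_le_one)
  then show ?thesis by (simp add: add_increasing2)
 next
  case False
  then have "l powr b <= l powr a" using b by (intro powr_mono) auto
  then have "(l powr b)^2 <= (l powr a)^2" by (intro power_mono) auto
  then show ?thesis by linarith
 qed
 have gen: "(NN l. ennreal ((l powr (b + s) * y l)^2)) <= (NN l. ennreal (l powr (2 * s) * (y l)^2)) + (NN l. ennreal ((l powr (a + s) * y l)^2))"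
  if [measurable]: "y \<in> BM" for s y
 proof -
  have "(NN l. ennreal ((l powr (b + s) * y l)^2)) <= (NN l. ennreal (l powr (2 * s) * (y l)^2) + ennreal ((l powr (a + s) * y l)^2))"
  proof (rule nn_integral_hl_mono)
   fix l :: real assume l: "0 < l"
   have "(l powr b)^2 * (l powr (2 * s) * (y l)^2) <= (1 + (l powr a)^2) * (l powr (2 * s) * (y l)^2)" by (intro mult_right_mono le l) auto
   then have "(l powr (b + s) * y l)^2 <= l powr (2 * s) * (y l)^2 + (l powr (a + s) * y l)^2" unfolding pw[OF l] by (simp add: distrib_right)
   then show "ennreal ((l powr (b + s) * y l)^2) <= ennreal (l powr (2 * s) * (y l)^2) + ennreal ((l powr (a + s) * y l)^2)"
    by (subst ennreal_plus[symmetric]) (auto intro: ennreal_leI simp del: ennreal_plus)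
  qed
  then show ?thesis by (subst (asm) nn_integral_add) auto
 qed
 have fin: "(NN l. ennreal ((l powr (b + s) * y l)^2)) < \<infinity>"
  if "y \<in> BM" "(NN l. ennreal (l powr (2 * s) * (y l)^2)) < \<infinity>" "(NN l. ennreal ((l powr (a + s) * y l)^2)) <= ennreal (\<rho>^2)" for s y
 proof -
  have "(NN l. ennreal ((l powr (a + s) * y l)^2)) < \<infinity>" using that(3) by (rule le_less_trans) simp
  then show ?thesis using that(2) by (intro le_less_trans[OF gen[OF that(1)]]) simp
 qed
 have "(NN l. ennreal (l powr (2 * (1/2)) * (c0 l)^2)) = ns c0" "(NN l. ennreal (l powr (2 * (- (1/2))) * (c1 l)^2)) = nm c1"
  unfolding ns_def nm_def by (auto intro!: nn_integral_hl_cong simp: powr_minus_divide)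
 then have f: "(NN l. ennreal ((l powr (b + 1/2) * c0 l)^2)) < \<infinity>" "(NN l. ennreal ((l powr (b - 1/2) * c1 l)^2)) < \<infinity>"
  using fin[of c0 "1/2"] fin[of c1 "- (1/2)"] c d by (auto simp: Hhalf_def Hdual_def data_bound_def)
 define A B where "A = enn2real (NN l. ennreal ((l powr (b + 1/2) * c0 l)^2))" and "B = enn2real (NN l. ennreal ((l powr (b - 1/2) * c1 l)^2))"
 have "0 <= A" "0 <= B" "(NN l. ennreal ((l powr (b + 1/2) * c0 l)^2)) = ennreal A" "(NN l. ennreal ((l powr (b - 1/2) * c1 l)^2)) = ennreal B"
  using f by (auto simp: A_def B_def less_top)
 then have "data_bound b c0 c1 (sqrt (A + B))" by (auto simp: data_bound_def intro!: ennreal_leI)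
 then show ?thesis by blast
qed

text \<open>This is \<open>1 / (4 * M^2)\<close> where \<open>M\<close> is twice the constant of the
  linear bound, plus 1. The 1 gives \<open>M >= 1\<close> and so a time of at most 1; hence
  \<open>t^2\<close> is at most the lifespan, and the Duhamel bound \<open>2 * t^2 * M^2 * M\<close>
  is at most \<open>M / 2\<close>.\<close>

definition lifespan :: "real => real => real" where "lifespan a \<rho> = 1 / (4 * (4 * \<rho> * sqrt (linC a) + 1)^2)"

text \<open>The nonlinearity is clamped at the profile \<open>m\<close>. The linear evolution stays below \<open>m / 2\<close>, and so does the Duhamel
  term of the clamped equation for a time that depends only on \<open>M\<close>; hence the clamp is inactive. The second bound, with
  the small exponent \<open>b\<close>, makes the clamped nonlinearity Lipschitz; the data-dependent constant \<open>K\<close> cancels.\<close>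

theorem cube_sol_lifespan:
 assumes a: "0 < a" "a < 1" and c: "Hhalf c0" "Hdual c1" and d: "data_bound a c0 c1 \<rho>"
 shows "\<exists>n. cube_sol {- lifespan a \<rho><..<lifespan a \<rho>} c0 c1 n"
proof -
 note [measurable] = Hhalf_measurable[OF c(1)] Hdual_measurable[OF c(2)]
 \<comment> \<open>With \<open>b <= 1/8\<close> the fourth power of \<open>K * x powr b\<close>
   grows at most like a square root for large \<open>x\<close>, so its quotient by
   \<open>(1 + x)^2\<close> is integrable, as the clamp requires.\<close>
 define b where "b = min a (1/8)"
 have b: "0 < b" "b <= a" "b <= 1/8" using a by (auto simp: b_def)
 obtain r where r: "data_bound b c0 c1 r" using data_bound_interpolate[OF b(1,2) d c] by blast
 define M K where "M = 4 * \<rho> * sqrt (linC a) + 1" and "K = 4 * r * sqrt (linC b) + 1"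
 have rho: "0 <= \<rho>" "0 <= r" using d r by (auto simp: data_bound_def)
 have C: "0 <= linC a" "0 <= linC b" using a b by (auto simp: linC_def)
 have M: "1 <= M" "2 * \<rho> * sqrt (linC a) <= M / 2" and K: "1 <= K" "2 * r * sqrt (linC b) <= K / 2" using rho C by (auto simp: M_def K_def)
 define T where "T = 1 / (4 * M^2)"
 have "1 <= M^2" using M by simp
 then have "1 <= 4 * M^2" by linarith
 then have T: "0 < T" "T <= 1" "4 * T * M^2 = 1" using M(1) by (auto simp: T_def field_simps)
 define m where "m x = min (M * x powr a) (K * x powr b)" for x
 have m0: "0 <= m x" and mM: "m x <= M * x powr a" and mK: "m x <= K * x powr b" for x using M K by (auto simp: m_def)
 have [measurable]: "m \<in> BM" unfolding m_def[abs_def] by measurable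
 have "(NN x. ennreal (9 * (m x) ^ 4 / (1 + x)^2)) <= (\<integral>\<^sup>+x\<in>{0..}. ennreal (9 * K ^ 4 * (1 + x) powr (- 3/2)) \<partial>lborel)"
 proof (subst nn_integral_hl, measurable, rule nn_integral_mono)
  fix x :: real
  show "ennreal (9 * (m x) ^ 4 / (1 + x)^2) * indicator {0<..} x <= ennreal (9 * K ^ 4 * (1 + x) powr (- 3/2)) * indicator {0..} x"
  proof (cases "0 < x")
   case x: True
   have "(m x) ^ 4 <= (K * x powr b) ^ 4" by (intro power_mono mK m0)
   also have "... = K ^ 4 * x powr (4 * b)" using x by (simp add: power_mult_distrib powr_power mult.commute)
   also have "... <= K ^ 4 * (1 + x) powr (4 * b)" using x b K by (intro mult_left_mono powr_mono2) auto
   also have "... <= K ^ 4 * (1 + x) powr (1/2)" using x b K by (intro mult_left_mono powr_mono) auto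
   finally have "9 * (m x) ^ 4 / (1 + x)^2 <= 9 * (K ^ 4 * (1 + x) powr (1/2)) / (1 + x)^2" by (intro divide_right_mono) auto
   also have "... = 9 * K ^ 4 * ((1 + x) powr (1/2) / (1 + x) powr 2)" using x by simp
   also have "(1 + x) powr (1/2) / (1 + x) powr 2 = (1 + x) powr (- 3/2)" unfolding powr_diff[symmetric] by simp
   finally show ?thesis using x by (simp add: ennreal_leI)
  qed simp
 qed
 also have "... = ennreal (0 - 9 * K ^ 4 * (- 2 * (1 + 0) powr (- 1/2)))"
 proof (rule nn_integral_FTC_atLeast[where F="%x. 9 * K ^ 4 * (- 2 * (1 + x) powr (- 1/2))"])
  show "DERIV (%x. 9 * K ^ 4 * (- 2 * (1 + x) powr (- 1/2))) x :> 9 * K ^ 4 * (1 + x) powr (- 3/2)" if "0 <= x" for x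
   using that by (auto intro!: derivative_eq_intros)
  have "((%x :: real. - 2 * (1 + x) powr (- 1/2)) \<longlongrightarrow> 0) at_top" by real_asymp
  from tendsto_mult_right_zero[OF this] show "((%x. 9 * K ^ 4 * (- 2 * (1 + x) powr (- 1/2))) \<longlongrightarrow> 0) at_top" .
 qed (use K in auto)
 finally have "(NN x. ennreal (9 * (m x) ^ 4 / (1 + x)^2)) <= ennreal ((sqrt (18 * K ^ 4))^2)" using K by simp
 note lc = lip_map_clamp[OF _ m0 this]
 define F where "F g = sine_tr (clamp_cubic m (prof g))" for g
 have F: "lip_map F (32 * (sqrt (18 * K ^ 4))^2)" unfolding F_def by (rule lc(1)) auto
 obtain u where u: "hpath u" "!!t. u t = US c0 c1 (%ta. F (u ta)) t" using mild_solution_exists[OF F c] by blast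
 define n where "n ta = F (u ta)" for ta
 define N where "N ta = clamp_cubic m (prof (u ta))" for ta
 have n: "forcing n" unfolding n_def by (rule forcing_lip_map[OF F u(1)])
 have uU: "u t = US c0 c1 n t" for t using u(2)[of t] by (simp only: n_def[abs_def])
 have Hu: "Hhalf (u t)" for t by (rule path_Hhalf[OF u(1)])
 have NI: "integrable hl (N ta)" for ta unfolding N_def by (rule lc(2)[OF _ _ prof_rep[OF Hu]]) auto
 have nN: "n ta = sine_tr (N ta)" for ta by (simp add: n_def N_def F_def)
 have Nm: "\<bar>N ta z\<bar> <= (m z * (m z * m z)) / (1 + z)^2" for ta z
 proof -
  have "\<bar>max (- m z) (min (m z) y)\<bar> <= m z" for y using m0[of z] by auto
  then have "\<bar>max (- m z) (min (m z) y)\<bar> ^ 3 <= m z ^ 3" for y by (intro power_mono) auto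
  then have "\<bar>(max (- m z) (min (m z) (prof (u ta) z))) ^ 3\<bar> / (1 + z)^2 <= m z ^ 3 / (1 + z)^2" by (intro divide_right_mono) (simp_all only: power_abs zero_le_power2)
  then show ?thesis by (simp only: N_def clamp_cubic_def cubic_def abs_divide abs_power2 power3_eq_cube[of "m z"] mult.assoc)
 qed
 have sq: "(M * z powr a * (M * z powr a)) / (1 + z)^2 <= M^2" if z: "0 < z" for z
 proof -
  have "z powr a <= (1 + z) powr a" using z a by (intro powr_mono2) auto
  also have "... <= (1 + z) powr 1" using z a by (intro powr_mono) auto
  finally have "(z powr a)^2 <= (1 + z)^2" using z by (intro power_mono) auto
  then have "M^2 * (z powr a)^2 <= M^2 * (1 + z)^2" by (intro mult_left_mono) auto
  then show ?thesis using z by (simp add: pos_divide_le_eq power2_eq_square mult_ac)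
 qed
 \<comment> \<open>Two of the three factors of the cube are bounded by \<open>M * z powr a\<close>,
   whose product is absorbed by \<open>(1 + z)^2\<close>; the third keeps the bound with
   \<open>L\<close>. The result is linear in \<open>L\<close>, so the same time serves
   \<open>L = M\<close> and \<open>L = K\<close>.\<close>
 have Nb: "\<bar>N ta z\<bar> <= M^2 * L * z powr e" if z: "0 < z" and L: "m z <= L * z powr e" "1 <= L" for ta z L e
 proof -
  have "(m z * (m z * m z)) / (1 + z)^2 = m z * ((m z * m z) / (1 + z)^2)" by simp
  also have "... <= (L * z powr e) * ((M * z powr a * (M * z powr a)) / (1 + z)^2)"
   using L m0[of z] mM[of z] M by (intro mult_mono divide_right_mono) auto
  also have "... <= (L * z powr e) * M^2" using L by (intro mult_left_mono sq z) auto
  finally show ?thesis using Nm[of ta z] by (simp add: mult_ac)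
 qed
 have eq: "n t = cubic_force (US c0 c1 n t)" if t: "\<bar>t\<bar> < T" for t
 proof -
  let ?S = "%l. LBINT ta=ereal 0..ereal t. sin ((t - ta) * l) / l * n ta l"
  let ?L = "%l. cos (t * l) * c0 l + sin (t * l) / l * c1 l"
  have uD: "u t l = ?L l - ?S l" for l unfolding uU US_Duhamel[OF n] ..
  \<comment> \<open>The linear part is the solution with zero forcing, which is how it is seen to
    lie in the critical space.\<close>
  have z: "forcing (%ta l. 0)" using forcing_diff[OF n n] by simp
  have "US c0 c1 (%ta l. 0) t = ?L" by (rule ext) (simp add: US_Duhamel[OF z])
  then have "Hhalf ?L" using path_Hhalf[OF US_paths(1)[OF c z], of t] by simp
  note p = prof_rep[OF this] and v = prof_rep[OF Hu[of t]]
  have q: "profile_rep (%x. prof ?L x - prof (u t) x) ?S" using profile_rep_diff[OF p v] by (simp add: uD)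
  have half: "\<bar>t\<bar> * (2 * \<bar>t\<bar> * (M^2 * L)) <= L / 2" if "1 <= L" for L
  proof -
   have "\<bar>t\<bar> * \<bar>t\<bar> <= T * 1" using t T by (intro mult_mono) auto
   then have "(\<bar>t\<bar> * \<bar>t\<bar>) * (2 * M^2 * L) <= T * 1 * (2 * M^2 * L)" using that by (intro mult_right_mono) auto
   also have "... = (4 * T * M^2) * L / 2" by simp
   finally show ?thesis unfolding T(3) by (simp add: mult_ac)
  qed
  have bnd: "AE x in hl. \<bar>prof (u t) x\<bar> <= L * x powr e"
   if e: "0 < e" "e < 1" and L: "1 <= L" "!!z. m z <= L * z powr e" and db: "data_bound e c0 c1 \<rho>'" "2 * \<rho>' * sqrt (linC e) <= L / 2" for L e \<rho>'
  proof -
   have "AE x in hl. \<bar>prof ?L x\<bar> <= 2 * \<rho>' * sqrt (linC e) * x powr e" by (rule linear_bound[OF e db(1) _ _ p]) auto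
   moreover have "AE x in hl. \<bar>prof ?L x - prof (u t) x\<bar> <= \<bar>t\<bar> * (2 * \<bar>t\<bar> * (M^2 * L) * x powr e)"
    by (rule Duhamel_bound[OF n nN NI Nb _ _ _ q]) (use L e in auto)
   ultimately show ?thesis
   proof eventually_elim
    case (elim x)
    have "2 * \<rho>' * sqrt (linC e) * x powr e <= L / 2 * x powr e" by (intro mult_right_mono db(2)) simp
    moreover have "\<bar>t\<bar> * (2 * \<bar>t\<bar> * (M^2 * L)) * x powr e <= L / 2 * x powr e" by (intro mult_right_mono half L(1)) simp
    ultimately show ?case using elim by (simp only: mult.assoc)
   qed
  qed
  have "AE x in hl. \<bar>prof (u t) x\<bar> <= M * x powr a" by (rule bnd[OF a M(1) mM d M(2)])
  moreover have "AE x in hl. \<bar>prof (u t) x\<bar> <= K * x powr b" by (rule bnd[OF b(1) _ K(1) mK r K(2)]) (use b in auto)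
  ultimately have "AE x in hl. N t x = cubic (prof (u t)) x"
  proof eventually_elim
   case (elim x)
   then have "max (- m x) (min (m x) (prof (u t) x)) = prof (u t) x" by (auto simp: m_def)
   then show ?case by (simp add: N_def clamp_cubic_def cubic_def)
  qed
  then have "sine_tr (N t) = sine_tr (cubic (prof (u t)))"
   by (rule sine_tr_cong_AE) (use borel_measurable_integrable[OF NI] profile_rep_measurable[OF v] in auto)
  then show ?thesis by (simp add: nN cubic_force_def flip: uU)
 qed
 have "cube_sol {- T<..<T} c0 c1 n" unfolding cube_sol_def using c n eq by auto
 then show ?thesis by (auto simp: lifespan_def T_def M_def)
qed

text \<open>The solution of the cut equation is continuous in the critical norm and starts with
  squared norm \<open>A^2\<close>. While its squared distance from the start is below 1, it stays in
  the ball with \<open>R^2 = 2 * (1 + A^2)\<close> and the cut is inactive.\<close>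

theorem cube_sol_exists:
 assumes c: "Hhalf c0" "Hdual c1" shows "\<exists>T>0. \<exists>n. cube_sol {- T<..<T} c0 c1 n"
proof -
 obtain A where A: "0 <= A" "ns c0 = ennreal (A^2)" using Hhalf_real[OF c(1)] by blast
 define R where "R = sqrt (2 * (1 + A^2))"
 have R: "0 < R" "R^2 = 2 * (1 + A^2)" by (auto simp: R_def add_pos_nonneg)
 note F = lip_map_radial_cut[OF R(1)]
 obtain u where u: "hpath u" "!!t. u t = US c0 c1 (%ta. cubic_force (radial_cut R (u ta))) t" using mild_solution_exists[OF F c] by blast
 define n where "n = (%ta. cubic_force (radial_cut R (u ta)))"
 have n: "forcing n" unfolding n_def by (rule forcing_lip_map[OF F u(1)])
 have uU: "u t = US c0 c1 n t" for t unfolding n_def by (rule u(2))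
 have u0: "u 0 = c0" unfolding uU by (rule ext) (simp add: US_def duh_def)
 note [measurable] = Hhalf_measurable[OF path_Hhalf[OF u(1)]]
 obtain T where T: "0 < T" "!!t. \<bar>t - 0\<bar> < T ==> ns (%l. u t l - u 0 l) < ennreal 1"
  using wl.wpath_eps[OF u(1), of "ennreal 1" 0] unfolding ns_wsq by auto
 have "n t = cubic_force (US c0 c1 n t)" if t: "\<bar>t\<bar> < T" for t
 proof -
  have "ns (u t) <= 2 * (ns (%l. u t l - u 0 l) + ns (u 0))" unfolding ns_wsq by (rule wl.wsq_split) measurable
  also have "... <= 2 * (ennreal 1 + ennreal (A^2))"
   unfolding u0 A(2) by (intro mult_left_mono add_mono order_refl less_imp_le[OF T(2)[unfolded u0]]) (use t in auto)
  also have "... = ennreal (R^2)" unfolding R(2) using ennreal_mult[of 2 "1 + A^2"] by simp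
  finally have "radial_cut R (u t) = u t" by (rule radial_cut_id)
  then show ?thesis unfolding uU[symmetric] by (simp add: n_def)
 qed
 then have "cube_sol {- T<..<T} c0 c1 n" using c n by (auto simp: cube_sol_def)
 then show ?thesis using T(1) by blast
qed

lemma Hdot_norm_bound:
 assumes [measurable]: "cutp g \<in> BM" and fin: "Hdot_sq sg g < \<infinity>" and le: "Hdot_norm sg g <= \<rho>"
 shows "(NN l. ennreal ((l powr sg * cutp g l)^2)) <= ennreal (\<rho>^2)"
proof -
 let ?I = "NN l. ennreal ((l powr sg * cutp g l)^2)"
 have "?I = (\<integral>\<^sup>+l\<in>{0<..}. ennreal ((l powr sg * cutp g l)^2) \<partial>lborel)" by (rule nn_integral_hl) measurable
 then have "Hdot_sq sg (cutp g) = ennreal (4 * pi) * ?I" unfolding Hdot_sq_def by simp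
 then have H: "Hdot_sq sg g = ennreal (4 * pi) * ?I" by (simp only: Hdot_sq_cutp)
 have "1 * ?I <= ennreal (4 * pi) * ?I" using pi_ge_two by (intro mult_right_mono) auto
 also have "... = ennreal ((Hdot_norm sg g)^2)" using fin unfolding H[symmetric] by (simp add: Hdot_norm_def)
 also have "... <= ennreal (\<rho>^2)" by (intro ennreal_leI power_mono le) (simp add: Hdot_norm_def)
 finally show ?thesis by simp
qed

theorem theorem1p2:
  shows "(\<forall>u0 \<in> Hdot_D (1/2). \<forall>u1 \<in> Hdot_D (-1/2).
            \<exists>T>0. well_posed_at (1/2) {-T<..<T} u0 u1) \<and>
         (\<forall>s::real. 1/2 < s \<and> s < 3/2 \<longrightarrow>
            (\<exists>T :: real \<Rightarrow> real. (\<forall>\<rho>. T \<rho> > 0) \<and>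
               (\<forall>u0 \<in> Hdot_D (1/2) \<inter> Hdot_D s. \<forall>u1 \<in> Hdot_D (-1/2) \<inter> Hdot_D (s - 1).
                  well_posed_at (1/2)
                    {- T (Hdot_pair_norm s u0 u1) <..< T (Hdot_pair_norm s u0 u1)} u0 u1)))"
proof (intro conjI ballI allI impI)
 have e: "(-1/2 :: real) = - (1/2)" by simp
 fix u0 u1 assume "u0 \<in> Hdot_D (1/2)" "u1 \<in> Hdot_D (-1/2)"
 then have "Hhalf (cutp u0)" "Hdual (cutp u1)" unfolding e by (auto simp: Hdot_D_half Hdot_D_minus_half)
 from cube_sol_exists[OF this] show "\<exists>T>0. well_posed_at (1/2) {-T<..<T} u0 u1" using well_posed by blast
next
 have e: "(-1/2 :: real) = - (1/2)" by simp
 fix s :: real assume s: "1/2 < s \<and> s < 3/2"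
 define a where "a = s - 1/2"
 have a: "0 < a" "a < 1" "s = a + 1/2" "s - 1 = a - 1/2" using s by (auto simp: a_def)
 have C: "0 <= linC a" using a by (simp add: linC_def)
 have pos: "0 < lifespan a \<bar>\<rho>\<bar>" for \<rho>
 proof -
  have "0 < 4 * \<bar>\<rho>\<bar> * sqrt (linC a) + 1" by (intro add_nonneg_pos) (use C in auto)
  then show ?thesis by (simp add: lifespan_def)
 qed
 show "\<exists>T :: real => real. (\<forall>\<rho>. T \<rho> > 0) \<and>
        (\<forall>u0 \<in> Hdot_D (1/2) \<inter> Hdot_D s. \<forall>u1 \<in> Hdot_D (-1/2) \<inter> Hdot_D (s - 1).
         well_posed_at (1/2) {- T (Hdot_pair_norm s u0 u1) <..< T (Hdot_pair_norm s u0 u1)} u0 u1)"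
 \<comment> \<open>The absolute value makes the lifespan positive for every real argument; on norms
   it changes nothing.\<close>
 proof (intro exI[of _ "%\<rho>. lifespan a \<bar>\<rho>\<bar>"] conjI allI ballI pos)
  fix u0 u1 assume u: "u0 \<in> Hdot_D (1/2) \<inter> Hdot_D s" "u1 \<in> Hdot_D (-1/2) \<inter> Hdot_D (s - 1)"
  have c: "Hhalf (cutp u0)" "Hdual (cutp u1)" using u unfolding e by (auto simp: Hdot_D_half Hdot_D_minus_half)
  define \<rho> where "\<rho> = Hdot_pair_norm s u0 u1"
  have nn: "0 <= Hdot_norm sg g" for sg g by (simp add: Hdot_norm_def)
  have r: "0 <= \<rho>" "Hdot_norm s u0 <= \<rho>" "Hdot_norm (s - 1) u1 <= \<rho>" using nn by (auto simp: \<rho>_def Hdot_pair_norm_def)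
  have "Hdot_sq s u0 < \<infinity>" "Hdot_sq (s - 1) u1 < \<infinity>" using u by (auto simp: Hdot_D_def)
  from Hdot_norm_bound[OF Hhalf_measurable[OF c(1)] this(1) r(2)] Hdot_norm_bound[OF Hdual_measurable[OF c(2)] this(2) r(3)]
  have "data_bound a (cutp u0) (cutp u1) \<rho>" unfolding a(4) unfolding a(3) using r(1) by (simp add: data_bound_def)
  from cube_sol_lifespan[OF a(1,2) c this] obtain n where "cube_sol {- lifespan a \<rho><..<lifespan a \<rho>} (cutp u0) (cutp u1) n" by blast
  then have "well_posed_at (1/2) {- lifespan a \<rho><..<lifespan a \<rho>} u0 u1" by (rule well_posed) (use pos[of \<rho>] r(1) in simp)
  then show "well_posed_at (1/2) {- lifespan a \<bar>Hdot_pair_norm s u0 u1\<bar><..<lifespan a \<bar>Hdot_pair_norm s u0 u1\<bar>} u0 u1"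
   using r(1) by (simp add: \<rho>_def)
 qed
qed

end
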